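(* Let $p \ge 2$ be an integer. Unless the Exponential Time Hypothesis is false, $p$-Split Min Cut is not FPT-approximable within a factor of $p-\varepsilon$ for any $\varepsilon>0$.
   Context: An instance of $p$-Split Min Cut consists of a graph $G$ with two special vertices $s,t$ such that $G-\{s,t\}$ is the disjoint union of $p$ graphs $G_1,\dots,G_p$; a set $\mathcal{B}$ of pairwise disjoint edge sets (bundles), each of size $1$ or $p$ and each containing at most one edge from each $G_i$; and an integer $k$ (the parameter). The question is whether there is an $st$-cut (a set of edges whose removal disconnects $s$ from $t$) that is the union of $k$ bundles of $\mathcal{B}$; the cost of an $st$-cut is the number of bundles it intersects. FPT-approximable within factor $c$ means there is an algorithm running in time $f(k)\cdot|I|^{O(1)}$ that accepts if $(I,k)$ is a yes-instance and rejects if $(I,c\cdot k)$ is a no-instance. *)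

theory Defs
  imports Complex_Main
begin

section \<open>Deterministic multi-tape Turing machines\<close>

datatype move = Left | Stay | Right

text \<open>
  Tape symbols are the naturals below \<open>n_symbols\<close> and states the naturals below \<open>n_states\<close>.
  Symbol 0 is the blank, symbols 1 to 4 are the input alphabet used by \<open>enc\<close> below.
  State 0 is initial, state 1 accepts, state 2 rejects.
\<close>

record tm =
  n_tapes :: nat
  n_symbols :: nat
  n_states :: nat
  trans_fun :: "nat \<Rightarrow> nat list \<Rightarrow> nat \<times> (nat \<times> move) list"

definition wf_tm :: "tm \<Rightarrow> bool" where
  "wf_tm M \<longleftrightarrow> n_tapes M \<ge> 1 \<and> n_symbols M \<ge> 5 \<and> n_states M \<ge> 3 \<and>
     (\<forall>q < n_states M. \<forall>as. length as = n_tapes M \<and> (\<forall>a \<in> set as. a < n_symbols M) \<longrightarrow>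
        (case trans_fun M q as of (q', ws) \<Rightarrow>
           q' < n_states M \<and> length ws = n_tapes M \<and> (\<forall>(a, m) \<in> set ws. a < n_symbols M)))"

text \<open>A tape is two-way infinite and is given by its contents together with its head position.\<close>

type_synonym tape = "(int \<Rightarrow> nat) \<times> int"
type_synonym config = "nat \<times> tape list"

fun read_tape :: "tape \<Rightarrow> nat" where
  "read_tape (c, h) = c h"

fun move_head :: "move \<Rightarrow> int \<Rightarrow> int" where
  "move_head Left h = h - 1"
| "move_head Stay h = h"
| "move_head Right h = h + 1"

fun write_tape :: "tape \<Rightarrow> nat \<times> move \<Rightarrow> tape" where
  "write_tape (c, h) (a, m) = (c(h := a), move_head m h)"

fun tm_step :: "tm \<Rightarrow> config \<Rightarrow> config" where
  "tm_step M (q, ts) =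
     (if q = 1 \<or> q = 2 then (q, ts)
      else case trans_fun M q (map read_tape ts) of (q', ws) \<Rightarrow> (q', map2 write_tape ts ws))"

definition input_tape :: "nat list \<Rightarrow> tape" where
  "input_tape x = (\<lambda>i. if 0 \<le> i \<and> i < int (length x) then x ! nat i else 0, 0)"

definition init_config :: "tm \<Rightarrow> nat list \<Rightarrow> config" where
  "init_config M x = (0, input_tape x # replicate (n_tapes M - 1) (input_tape []))"

definition accepts_within :: "tm \<Rightarrow> nat list \<Rightarrow> real \<Rightarrow> bool" where
  "accepts_within M x T \<longleftrightarrow> (\<exists>n. real n \<le> T \<and> fst ((tm_step M ^^ n) (init_config M x)) = 1)"

definition rejects_within :: "tm \<Rightarrow> nat list \<Rightarrow> real \<Rightarrow> bool" where
  "rejects_within M x T \<longleftrightarrow> (\<exists>n. real n \<le> T \<and> fst ((tm_step M ^^ n) (init_config M x)) = 2)"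


section \<open>Encoding of inputs\<close>

datatype data = Num nat | Node "data list"

text \<open>Symbols 1 and 2 are the binary digits 0 and 1; symbols 3 and 4 are brackets.\<close>

fun binary :: "nat \<Rightarrow> nat list" where
  "binary n = (if n < 2 then [n + 1] else binary (n div 2) @ [n mod 2 + 1])"

fun enc :: "data \<Rightarrow> nat list" where
  "enc (Num n) = [3] @ binary n @ [4]"
| "enc (Node ds) = [3] @ concat (map enc ds) @ [4]"

text \<open>
  Sets are presented as lists in an arbitrary order without repetitions, so an object
  may have several codes. An algorithm has to be correct on all of them.
\<close>

definition codes_set :: "('a \<Rightarrow> data \<Rightarrow> bool) \<Rightarrow> 'a set \<Rightarrow> data \<Rightarrow> bool" where
  "codes_set R A d \<longleftrightarrow>
     (\<exists>xs ds. distinct xs \<and> set xs = A \<and> list_all2 R xs ds \<and> d = Node ds)"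

definition codes_nat :: "nat \<Rightarrow> data \<Rightarrow> bool" where
  "codes_nat n d \<longleftrightarrow> d = Num n"


section \<open>The Exponential Time Hypothesis\<close>

type_synonym literal = "nat \<times> bool"
type_synonym cnf = "literal list list"

definition is_3cnf :: "cnf \<Rightarrow> bool" where
  "is_3cnf \<phi> \<longleftrightarrow> (\<forall>C \<in> set \<phi>. length C \<le> 3)"

definition vars :: "cnf \<Rightarrow> nat set" where
  "vars \<phi> = (\<Union>C \<in> set \<phi>. fst ` set C)"

definition satisfiable :: "cnf \<Rightarrow> bool" where
  "satisfiable \<phi> \<longleftrightarrow> (\<exists>\<alpha> :: nat \<Rightarrow> bool. \<forall>C \<in> set \<phi>. \<exists>(v, b) \<in> set C. \<alpha> v = b)"

definition enc_cnf :: "cnf \<Rightarrow> nat list" where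
  "enc_cnf \<phi> =
     enc (Node (map (\<lambda>C. Node (map (\<lambda>(v, b). Node [Num v, Num (if b then 1 else 0)]) C)) \<phi>))"

text \<open>
  The hypothesis is that the infimum of the \<open>\<delta>\<close> for which 3-SAT with \<open>n\<close> variables is solvable
  in time \<open>2 powr (\<delta> * n)\<close>, up to a factor polynomial in the input length, is positive.
\<close>

definition three_sat_solvable :: "real \<Rightarrow> bool" where
  "three_sat_solvable \<delta> \<longleftrightarrow>
     (\<exists>M (c::real) (d::nat). wf_tm M \<and>
        (\<forall>\<phi>. is_3cnf \<phi> \<longrightarrow>
           (let T = c * 2 powr (\<delta> * real (card (vars \<phi>))) * real (length (enc_cnf \<phi>)) ^ d in
             (satisfiable \<phi> \<longrightarrow> accepts_within M (enc_cnf \<phi>) T) \<and>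
             (\<not> satisfiable \<phi> \<longrightarrow> rejects_within M (enc_cnf \<phi>) T))))"

definition ETH :: bool where
  "ETH \<longleftrightarrow> (\<exists>\<delta> > 0. \<not> three_sat_solvable \<delta>)"


section \<open>Fixed-parameter approximability\<close>

text \<open>
  \<open>inst\<close> are the legal instances, \<open>code I k x\<close> says that the string \<open>x\<close> encodes \<open>(I, k)\<close>, and
  \<open>yes I r\<close> says that \<open>(I, r)\<close> is a yes-instance. The budget \<open>r\<close> is real because \<open>c \<cdot> k\<close> need
  not be an integer.
\<close>

definition fpt_approximable ::
  "('i \<Rightarrow> bool) \<Rightarrow> ('i \<Rightarrow> nat \<Rightarrow> nat list \<Rightarrow> bool) \<Rightarrow> ('i \<Rightarrow> real \<Rightarrow> bool) \<Rightarrow> real \<Rightarrow> bool"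
where
  "fpt_approximable inst code yes c \<longleftrightarrow>
     (\<exists>M (f :: nat \<Rightarrow> nat) (d :: nat). wf_tm M \<and>
        (\<forall>I k x. inst I \<and> code I k x \<longrightarrow>
           (let T = real (f k) * real (length x) ^ d in
             (accepts_within M x T \<or> rejects_within M x T) \<and>
             (yes I (real k) \<longrightarrow> accepts_within M x T) \<and>
             (\<not> yes I (c * real k) \<longrightarrow> rejects_within M x T))))"


section \<open>Split Min Cut\<close>

type_synonym edge = "nat set"

record graph =
  verts :: "nat set"
  edges :: "edge set"

definition is_graph :: "graph \<Rightarrow> bool" where
  "is_graph G \<longleftrightarrow> finite (verts G) \<and>
     (\<forall>e \<in> edges G. \<exists>u \<in> verts G. \<exists>v \<in> verts G. u \<noteq> v \<and> e = {u, v})"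

definition del_verts :: "graph \<Rightarrow> nat set \<Rightarrow> graph" where
  "del_verts G S = \<lparr>verts = verts G - S, edges = {e \<in> edges G. e \<inter> S = {}}\<rparr>"

definition is_disjoint_union :: "graph \<Rightarrow> graph list \<Rightarrow> bool" where
  "is_disjoint_union G Gs \<longleftrightarrow>
     (\<forall>H \<in> set Gs. is_graph H) \<and>
     (\<forall>i < length Gs. \<forall>j < length Gs. i \<noteq> j \<longrightarrow> verts (Gs ! i) \<inter> verts (Gs ! j) = {}) \<and>
     verts G = (\<Union>H \<in> set Gs. verts H) \<and> edges G = (\<Union>H \<in> set Gs. edges H)"

record split_instance =
  the_graph :: graph
  source :: nat
  sink :: nat
  pieces :: "graph list"
  bundles :: "edge set set"

definition is_split_instance :: "nat \<Rightarrow> split_instance \<Rightarrow> bool" where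
  "is_split_instance p I \<longleftrightarrow>
     is_graph (the_graph I) \<and>
     source I \<in> verts (the_graph I) \<and> sink I \<in> verts (the_graph I) \<and> source I \<noteq> sink I \<and>
     length (pieces I) = p \<and>
     is_disjoint_union (del_verts (the_graph I) {source I, sink I}) (pieces I) \<and>
     pairwise disjnt (bundles I) \<and>
     (\<forall>b \<in> bundles I. b \<subseteq> edges (the_graph I) \<and> card b \<in> {1, p} \<and>
        (\<forall>H \<in> set (pieces I). card (b \<inter> edges H) \<le> 1))"

definition is_st_cut :: "graph \<Rightarrow> nat \<Rightarrow> nat \<Rightarrow> edge set \<Rightarrow> bool" where
  "is_st_cut G s t Z \<longleftrightarrow> Z \<subseteq> edges G \<and> (s, t) \<notin> {(u, v). {u, v} \<in> edges G - Z}\<^sup>*"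

text \<open>
  ``The union of \<open>k\<close> bundles'' means the union of at most \<open>k\<close> bundles, which also makes sense for a
  real budget. The lemma \<open>split_yes_iff_exactly\<close> below compares this with exactly \<open>k\<close> bundles.
\<close>

definition split_yes :: "split_instance \<Rightarrow> real \<Rightarrow> bool" where
  "split_yes I r \<longleftrightarrow>
     (\<exists>X \<subseteq> bundles I. real (card X) \<le> r \<and>
        is_st_cut (the_graph I) (source I) (sink I) (\<Union>X))"

definition cut_cost :: "split_instance \<Rightarrow> edge set \<Rightarrow> nat" where
  "cut_cost I Z = card {b \<in> bundles I. b \<inter> Z \<noteq> {}}"

definition codes_edge :: "edge \<Rightarrow> data \<Rightarrow> bool" where
  "codes_edge e d \<longleftrightarrow> (\<exists>u v. e = {u, v} \<and> d = Node [Num u, Num v])"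

definition codes_graph :: "graph \<Rightarrow> data \<Rightarrow> bool" where
  "codes_graph G d \<longleftrightarrow>
     (\<exists>dV dE. codes_set codes_nat (verts G) dV \<and> codes_set codes_edge (edges G) dE \<and>
        d = Node [dV, dE])"

definition split_code :: "split_instance \<Rightarrow> nat \<Rightarrow> nat list \<Rightarrow> bool" where
  "split_code I k x \<longleftrightarrow>
     (\<exists>dG dHs dB. codes_graph (the_graph I) dG \<and>
        list_all2 codes_graph (pieces I) dHs \<and>
        codes_set (codes_set codes_edge) (bundles I) dB \<and>
        x = enc (Node [dG, Num (source I), Num (sink I), Node dHs, dB, Num k]))"

definition split_min_cut_fpt_approximable :: "nat \<Rightarrow> real \<Rightarrow> bool" where
  "split_min_cut_fpt_approximable p c \<longleftrightarrow>
     fpt_approximable (is_split_instance p) split_code split_yes c"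


subsection \<open>Sanity checks\<close>

lemma finite_edges: "is_graph G \<Longrightarrow> finite (edges G)"
  unfolding is_graph_def
  by (rule finite_subset[of _ "Pow (verts G)"]) auto

lemma finite_bundles: "is_split_instance p I \<Longrightarrow> finite (bundles I)"
  using finite_edges[of "the_graph I"] unfolding is_split_instance_def
  by (intro finite_subset[of "bundles I" "Pow (edges (the_graph I))"]) auto

lemma cut_cost_Union:
  assumes I: "is_split_instance p I" and "p \<ge> 2" and X: "X \<subseteq> bundles I"
  shows "cut_cost I (\<Union>X) = card X"
proof -
  have ne: "b \<noteq> {}" if "b \<in> bundles I" for b
    using I that \<open>p \<ge> 2\<close> unfolding is_split_instance_def by force
  have dis: "b \<inter> b' = {}" if "b \<in> bundles I" "b' \<in> bundles I" "b \<noteq> b'" for b b'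
    using I that unfolding is_split_instance_def pairwise_def disjnt_def by blast
  have "{b \<in> bundles I. b \<inter> \<Union>X \<noteq> {}} = X"
  proof
    show "{b \<in> bundles I. b \<inter> \<Union>X \<noteq> {}} \<subseteq> X" using dis X by blast
    show "X \<subseteq> {b \<in> bundles I. b \<inter> \<Union>X \<noteq> {}}" using ne X by blast
  qed
  then show ?thesis by (simp add: cut_cost_def)
qed

lemma is_st_cut_mono:
  assumes "is_st_cut G s t Z" "Z \<subseteq> Z'" "Z' \<subseteq> edges G"
  shows "is_st_cut G s t Z'"
proof -
  have "{(u, v). {u, v} \<in> edges G - Z'}\<^sup>* \<subseteq> {(u, v). {u, v} \<in> edges G - Z}\<^sup>*"
    using assms(2) by (intro rtrancl_mono) auto
  then show ?thesis using assms unfolding is_st_cut_def by blast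
qed

lemma split_yes_iff_exactly:
  assumes I: "is_split_instance p I" and k: "k \<le> card (bundles I)"
  shows "split_yes I (real k) \<longleftrightarrow>
    (\<exists>X \<subseteq> bundles I. card X = k \<and> is_st_cut (the_graph I) (source I) (sink I) (\<Union>X))"
proof
  assume "split_yes I (real k)"
  then obtain X where X: "X \<subseteq> bundles I" "card X \<le> k"
    "is_st_cut (the_graph I) (source I) (sink I) (\<Union>X)"
    unfolding split_yes_def by auto
  obtain Y where Y: "X \<subseteq> Y" "Y \<subseteq> bundles I" "card Y = k"
    using exists_subset_between[OF X(2) k X(1) finite_bundles[OF I]] by blast
  have "\<Union>Y \<subseteq> edges (the_graph I)"
    using I Y(2) unfolding is_split_instance_def by blast
  then have "is_st_cut (the_graph I) (source I) (sink I) (\<Union>Y)"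
    using is_st_cut_mono[OF X(3)] Y(1) by (simp add: Union_mono)
  with Y show "\<exists>X \<subseteq> bundles I. card X = k \<and>
      is_st_cut (the_graph I) (source I) (sink I) (\<Union>X)"
    by blast
qed (auto simp: split_yes_def)

end

theory Submission
  imports Defs 
begin

text \<open>
  Suppose that Split Min Cut is approximable within \<open>p - \<epsilon>\<close>. We solve 3-SAT in time \<open>2 powr (\<delta> * n)\<close> for every
  \<open>\<delta> > 0\<close>. Cut the variables into \<open>k\<close> blocks. With a linearity test over the subsets of the blocks, a formula
  becomes a probabilistically checkable proof whose number of positions depends on \<open>k\<close> only, while the alphabet
  consists of words of length \<open>O(n / k)\<close>; the verifier reads eight positions and errs with probability bounded
  away from 1. In the derived game with \<open>p\<close> players, each player is asked for the whole view or for one position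
  of it, so that for unsatisfiable formulas two players rarely agree on an accepted view.

  Repeating the game \<open>r\<close> times sequentially, player \<open>i\<close> becomes the \<open>i\<close>-th series-parallel network: questions are
  composed in parallel, answers in series, and the edges at the leaves are transcripts of accepted views. The
  bundle of a transcript contains its \<open>p\<close> copies. A strategy of all the players is a cut with one bundle for
  each sequence of coins. If a cut is cheaper than \<open>p - \<epsilon>\<close> times that number, then some coins have few bundles
  and two players are served by the same one, which is too likely once \<open>r\<close> is large. Here \<open>r\<close> depends on \<open>p\<close> and
  \<open>\<epsilon>\<close>, and so does the exponent \<open>D\<close> in the running time \<open>2 powr (D * n / k)\<close>, up to polynomial factors, of the
  reduction; hence \<open>k\<close> can be chosen last.
\<close>

section \<open>While-programs on tapes, with upper bounds on the number of steps\<close>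

section \<open>Structured programs for Turing machines\<close>

text \<open>The repetition is sequential because a player then answers round \<open>t\<close> from
  the questions up to \<open>t\<close> only, and success probabilities multiply by a plain
  induction; parallel repetition would need a far deeper theorem. The price is a deep game tree,
  which a series-parallel network absorbs: to cut all branches of a parallel node and one part of a
  series node is to choose an answer to every question.

  The parameter of the instance is the number of coin sequences. It depends on \<open>p\<close>,
  \<open>k\<close> and \<open>r\<close> but not on the formula, so the arbitrary function
  \<open>f\<close> of the approximation algorithm is a constant factor. Hence the randomness of the
  verifier must not depend on the formula, which enters only through the alphabet and the accepted
  views; the clauses on a triple of blocks, however many, are condensed into a trilinear map with
  values of \<open>O(n / k)\<close> bits.

  The gap is \<open>1 / 24300 = 1 / (300 * 81)\<close>: a proof of a false statement is rejected
  with probability at least \<open>1 / 300\<close>, and two players receive a given pair of the nine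
  kinds of question with probability \<open>1 / 81\<close>.\<close>

datatype prog =
    Put nat nat move
  | Mov nat move
  | Seq prog prog (infixr ";;" 60)
  | If nat "nat set" prog prog
  | While nat "nat set" prog

abbreviation "rd ts i \<equiv> read_tape (ts i)"

text \<open>The rule \<open>weaken\<close> turns the step count into an upper bound, so costs of
  subprograms can be estimated crudely and still be added up.\<close>

inductive ex :: "prog \<Rightarrow> (nat \<Rightarrow> tape) \<Rightarrow> nat \<Rightarrow> (nat \<Rightarrow> tape) \<Rightarrow> bool" where
  Put: "ex (Put i a m) ts 1 (ts(i := write_tape (ts i) (a, m)))"
| Mov: "ex (Mov i m) ts 1 (ts(i := write_tape (ts i) (rd ts i, m)))"
| Seq: "ex c ts n ts' \<Longrightarrow> ex d ts' n' ts'' \<Longrightarrow> ex (c ;; d) ts (n + n') ts''"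
| IfT: "rd ts i \<in> A \<Longrightarrow> ex c ts n ts' \<Longrightarrow> ex (If i A c d) ts (n + 1) ts'"
| IfF: "rd ts i \<notin> A \<Longrightarrow> ex d ts n ts' \<Longrightarrow> ex (If i A c d) ts (n + 1) ts'"
| WhileT: "rd ts i \<in> A \<Longrightarrow> ex c ts n ts' \<Longrightarrow> ex (While i A c) ts' n' ts'' \<Longrightarrow>
    ex (While i A c) ts (n + n' + 1) ts''"
| WhileF: "rd ts i \<notin> A \<Longrightarrow> ex (While i A c) ts 1 ts"
| weaken: "ex c ts n ts' \<Longrightarrow> n \<le> n' \<Longrightarrow> ex c ts n' ts'"

fun psize :: "prog \<Rightarrow> nat" where
  "psize (Put i a m) = 1"
| "psize (Mov i m) = 1"
| "psize (c ;; d) = psize c + psize d"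
| "psize (If i A c d) = 1 + psize c + psize d"
| "psize (While i A c) = 1 + psize c"

fun wf_prog :: "nat \<Rightarrow> nat \<Rightarrow> prog \<Rightarrow> bool" where
  "wf_prog N S (Put i a m) \<longleftrightarrow> i < N \<and> a < S"
| "wf_prog N S (Mov i m) \<longleftrightarrow> i < N"
| "wf_prog N S (c ;; d) \<longleftrightarrow> wf_prog N S c \<and> wf_prog N S d"
| "wf_prog N S (If i A c d) \<longleftrightarrow> i < N \<and> wf_prog N S c \<and> wf_prog N S d"
| "wf_prog N S (While i A c) \<longleftrightarrow> i < N \<and> wf_prog N S c"

lemma wf_prog_mono: "wf_prog N S c \<Longrightarrow> N \<le> N' \<Longrightarrow> S \<le> S' \<Longrightarrow> wf_prog N' S' c"
  by (induction c) auto

section \<open>Translation of programs into transition tables\<close>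

abbreviation "stay as \<equiv> map (\<lambda>a. (a, Stay)) as"

text \<open>The control states of \<^term>\<open>c\<close> are those below \<^term>\<open>psize c\<close>; the state \<^term>\<open>psize c\<close> is the exit.\<close>

fun ptrans :: "prog \<Rightarrow> nat \<Rightarrow> nat list \<Rightarrow> nat \<times> (nat \<times> move) list" where
  "ptrans (Put i a m) q as = (1, (stay as)[i := (a, m)])"
| "ptrans (Mov i m) q as = (1, (stay as)[i := (as ! i, m)])"
| "ptrans (c ;; d) q as =
     (if q < psize c then ptrans c q as
      else apfst (\<lambda>q. q + psize c) (ptrans d (q - psize c) as))"
| "ptrans (If i A c d) q as =
     (if q = 0 then (if as ! i \<in> A then 1 else 1 + psize c, stay as)
      else if q \<le> psize c then
        apfst (\<lambda>q. if q = psize c then 1 + psize c + psize d else q + 1) (ptrans c (q - 1) as)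
      else apfst (\<lambda>q. q + 1 + psize c) (ptrans d (q - 1 - psize c) as))"
| "ptrans (While i A c) q as =
     (if q = 0 then (if as ! i \<in> A then 1 else 1 + psize c, stay as)
      else apfst (\<lambda>q. if q = psize c then 0 else q + 1) (ptrans c (q - 1) as))"

lemma psize_pos: "psize c > 0"
  by (induction c) auto

lemma ptrans_wf:
  assumes "wf_prog N S c" "q < psize c" "length as = N" "\<forall>a \<in> set as. a < S"
    "ptrans c q as = (q', ws)"
  shows "q' \<le> psize c \<and> length ws = N \<and> (\<forall>(a, m) \<in> set ws. a < S)"
  using assms
proof (induction c arbitrary: q q')
  case (Put i a m)
  then show ?case by (auto dest!: subsetD[OF set_update_subset_insert])
next
  case (Mov i m)
  then show ?case by (auto dest!: subsetD[OF set_update_subset_insert])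
next
  case (Seq c d)
  show ?case
  proof (cases "q < psize c")
    case True
    then show ?thesis using Seq by fastforce
  next
    case False
    then obtain q1 where "ptrans d (q - psize c) as = (q1, ws)" "q' = q1 + psize c"
      using Seq.prems by (auto simp: apfst_def map_prod_def split: prod.splits)
    then show ?thesis using Seq.IH(2)[of "q - psize c" q1] Seq.prems False by auto
  qed
next
  case (If i A c d)
  consider "q = 0" | "0 < q" "q \<le> psize c" | "q > psize c" by linarith
  then show ?case
  proof cases
    case 1
    then show ?thesis using If.prems psize_pos[of d] by (auto split: if_splits)
  next
    case 2
    then obtain q1 where "ptrans c (q - 1) as = (q1, ws)"
      "q' = (if q1 = psize c then 1 + psize c + psize d else q1 + 1)"
      using If.prems by (auto simp: apfst_def map_prod_def split: prod.splits)
    moreover have "q - 1 < psize c" using 2 by simp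
    ultimately show ?thesis using If.IH(1)[of "q - 1" q1] If.prems 2 by auto
  next
    case 3
    then obtain q1 where "ptrans d (q - 1 - psize c) as = (q1, ws)" "q' = q1 + 1 + psize c"
      using If.prems by (auto simp: apfst_def map_prod_def split: prod.splits)
    then show ?thesis using If.IH(2)[of "q - 1 - psize c" q1] If.prems 3 by auto
  qed
next
  case (While i A c)
  show ?case
  proof (cases "q = 0")
    case True
    then show ?thesis using While.prems by (auto split: if_splits)
  next
    case False
    then obtain q1 where "ptrans c (q - 1) as = (q1, ws)" "q' = (if q1 = psize c then 0 else q1 + 1)"
      using While.prems by (auto simp: apfst_def map_prod_def split: prod.splits)
    then show ?thesis using While.IH[of "q - 1" q1] While.prems False by auto
  qed
qed

definition pstep :: "prog \<Rightarrow> config \<Rightarrow> config" where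
  "pstep c = (\<lambda>(q, ts). case ptrans c q (map read_tape ts) of (q', ws) \<Rightarrow> (q', map2 write_tape ts ws))"

inductive path :: "prog \<Rightarrow> nat \<Rightarrow> config \<Rightarrow> config \<Rightarrow> bool" for c where
  path0: "path c 0 x x"
| pathS: "q < psize c \<Longrightarrow> path c n (pstep c (q, ts)) x \<Longrightarrow> path c (Suc n) (q, ts) x"

lemma path_trans: "path c n x y \<Longrightarrow> path c m y z \<Longrightarrow> path c (n + m) x z"
  by (induction rule: path.induct) (auto intro: path.intros)

text \<open>Every compound program contains the tables of its parts under a renaming
  \<open>g\<close> of control states. The exit of a part is renamed to the entry of whatever follows
  it: the next program, the end of the conditional or the test of the loop.\<close>

lemma path_embed:
  assumes "path c n x y"
    and "\<And>q as. q < psize c \<Longrightarrow> ptrans d (g q) as = apfst g (ptrans c q as)"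
    and "\<And>q. q < psize c \<Longrightarrow> g q < psize d"
  shows "path d n (apfst g x) (apfst g y)"
  using assms(1)
proof (induction rule: path.induct)
  case (path0 x)
  show ?case by (rule path.path0)
next
  case (pathS q n ts x)
  have "pstep d (g q, ts) = apfst g (pstep c (q, ts))"
    using assms(2)[OF pathS(1)] by (auto simp: pstep_def split: prod.splits)
  then show ?case using pathS assms(3) by (auto intro!: path.pathS)
qed

abbreviation "tapes N f \<equiv> map f [0..<N]"

lemma map2_stay: "map2 write_tape ts (stay (map read_tape ts)) = ts"
  by (induction ts) (auto intro!: ext)

lemma map2_stay_upd:
  assumes "i < N"
  shows "map2 write_tape (tapes N f) ((stay (map read_tape (tapes N f)))[i := (a, m)]) =
    tapes N (f(i := write_tape (f i) (a, m)))"
proof (rule nth_equalityI)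
  fix j assume "j < length (map2 write_tape (tapes N f) ((stay (map read_tape (tapes N f)))[i := (a, m)]))"
  then have j: "j < N" by simp
  have "write_tape (f j) (rd f j, Stay) = f j" by (cases "f j") auto
  then show "map2 write_tape (tapes N f) ((stay (map read_tape (tapes N f)))[i := (a, m)]) ! j =
      tapes N (f(i := write_tape (f i) (a, m))) ! j"
    using j assms by (cases "i = j") auto
qed simp

lemma ex_path:
  assumes "ex c f n f'" "wf_prog N S c"
  shows "\<exists>k \<le> n. path c k (0, tapes N f) (psize c, tapes N f')"
  using assms
proof (induction rule: ex.induct)
  case (Put i a m ts)
  have "pstep (Put i a m) (0, tapes N ts) = (1, tapes N (ts(i := write_tape (ts i) (a, m))))"
    using map2_stay_upd[of i N ts a m] Put by (simp add: pstep_def del: map_map)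
  then have "path (Put i a m) (Suc 0) (0, tapes N ts) (1, tapes N (ts(i := write_tape (ts i) (a, m))))"
    by (intro pathS) (auto intro: path0)
  then show ?case unfolding psize.simps One_nat_def by blast
next
  case (Mov i m ts)
  have "pstep (Mov i m) (0, tapes N ts) = (1, tapes N (ts(i := write_tape (ts i) (rd ts i, m))))"
    using map2_stay_upd[of i N ts "rd ts i" m] Mov by (simp add: pstep_def del: map_map)
  then have "path (Mov i m) (Suc 0) (0, tapes N ts) (1, tapes N (ts(i := write_tape (ts i) (rd ts i, m))))"
    by (intro pathS) (auto intro: path0)
  then show ?case unfolding psize.simps One_nat_def by blast
next
  case (Seq c ts n ts' d n' ts'')
  then obtain k k' where k: "k \<le> n" "path c k (0, tapes N ts) (psize c, tapes N ts')"
    and k': "k' \<le> n'" "path d k' (0, tapes N ts') (psize d, tapes N ts'')" by auto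
  have "path (c ;; d) k (apfst id (0, tapes N ts)) (apfst id (psize c, tapes N ts'))"
    by (rule path_embed[OF k(2)]) auto
  moreover have "path (c ;; d) k' (apfst (\<lambda>q. q + psize c) (0, tapes N ts'))
      (apfst (\<lambda>q. q + psize c) (psize d, tapes N ts''))"
    by (rule path_embed[OF k'(2)]) auto
  ultimately have "path (c ;; d) (k + k') (0, tapes N ts) (psize (c ;; d), tapes N ts'')"
    using path_trans by (fastforce simp: add.commute[of "psize d"])
  then show ?case using k k' by (intro exI[of _ "k + k'"]) auto
next
  case (IfT ts i A c n ts' d)
  then obtain k where k: "k \<le> n" "path c k (0, tapes N ts) (psize c, tapes N ts')" by auto
  let ?g = "\<lambda>q. if q = psize c then 1 + psize c + psize d else q + 1"
  have 1: "path (If i A c d) k (apfst ?g (0, tapes N ts)) (apfst ?g (psize c, tapes N ts'))"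
    by (rule path_embed[OF k(2)]) auto
  have "pstep (If i A c d) (0, tapes N ts) = (1, tapes N ts)"
    using map2_stay[of "tapes N ts"] IfT by (auto simp add: pstep_def comp_def)
  then have "path (If i A c d) (Suc k) (0, tapes N ts) (psize (If i A c d), tapes N ts')"
    using 1 psize_pos[of c] by (intro pathS) auto
  then show ?case using k by (intro exI[of _ "Suc k"]) auto
next
  case (IfF ts i A d n ts' c)
  then obtain k where k: "k \<le> n" "path d k (0, tapes N ts) (psize d, tapes N ts')" by auto
  let ?g = "\<lambda>q. q + 1 + psize c"
  have 1: "path (If i A c d) k (apfst ?g (0, tapes N ts)) (apfst ?g (psize d, tapes N ts'))"
    by (rule path_embed[OF k(2)]) auto
  have "pstep (If i A c d) (0, tapes N ts) = (1 + psize c, tapes N ts)"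
    using map2_stay[of "tapes N ts"] IfF by (auto simp add: pstep_def comp_def)
  then have "path (If i A c d) (Suc k) (0, tapes N ts) (psize (If i A c d), tapes N ts')"
    using 1 by (intro pathS) (auto simp: add.commute)
  then show ?case using k by (intro exI[of _ "Suc k"]) auto
next
  case (WhileT ts i A c n ts' n' ts'')
  then obtain k k' where k: "k \<le> n" "path c k (0, tapes N ts) (psize c, tapes N ts')"
    and k': "k' \<le> n'" "path (While i A c) k' (0, tapes N ts') (psize (While i A c), tapes N ts'')" by auto
  let ?g = "\<lambda>q. if q = psize c then 0 else q + 1"
  have 1: "path (While i A c) k (apfst ?g (0, tapes N ts)) (apfst ?g (psize c, tapes N ts'))"
    by (rule path_embed[OF k(2)]) auto
  have "pstep (While i A c) (0, tapes N ts) = (1, tapes N ts)"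
    using map2_stay[of "tapes N ts"] WhileT by (auto simp add: pstep_def comp_def)
  then have "path (While i A c) (Suc k) (0, tapes N ts) (0, tapes N ts')"
    using 1 psize_pos[of c] by (intro pathS) auto
  from path_trans[OF this k'(2)] show ?case using k k' by (intro exI[of _ "Suc k + k'"]) auto
next
  case (WhileF ts i A c)
  have "pstep (While i A c) (0, tapes N ts) = (1 + psize c, tapes N ts)"
    using map2_stay[of "tapes N ts"] WhileF by (auto simp add: pstep_def comp_def)
  then have "path (While i A c) (Suc 0) (0, tapes N ts) (psize (While i A c), tapes N ts)"
    by (intro pathS) (auto intro: path0)
  then show ?case by (intro exI[of _ 1]) auto
next
  case (weaken c ts n ts' n')
  then show ?case by (meson le_trans)
qed

declare One_nat_def [simp del]

section \<open>Registers that hold binary trees, and how to copy, erase, join and split them\<close>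

section \<open>Trees on tapes\<close>

datatype tree = Lf | Br tree tree

text \<open>Preorder, one symbol per node. The code is prefix-free, so two codes can be written side
  by side without a separator and be taken apart again.\<close>

fun code :: "tree \<Rightarrow> nat list" where
  "code Lf = [1]"
| "code (Br a b) = 2 # code a @ code b"

abbreviation tsize :: "tree \<Rightarrow> nat" where
  "tsize t \<equiv> length (code t)"

lemma code_set: "set (code t) \<subseteq> {1, 2}"
  by (induction t) auto

lemma tsize_pos: "tsize t \<ge> 1"
  by (cases t) auto

text \<open>The cells left of the head, read leftwards, and the cells from the head on, read rightwards;
  the leftmost cell listed has position 0.\<close>

definition zt :: "nat list \<Rightarrow> nat list \<Rightarrow> tape" where
  "zt l r = (\<lambda>i. if 0 \<le> i \<and> nat i < length l + length r then (rev l @ r) ! nat i else 0, int (length l))"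

lemma read_zt [simp]: "read_tape (zt l (a # r)) = a" "read_tape (zt l []) = 0"
  by (auto simp: zt_def nth_append)

text \<open>Cells beyond the list are blank anyway. An exhausted list and a list with one more blank
  are the same tape, which is what lets a head at the end of the content write there.\<close>

lemma zt_0: "zt l (r @ [0]) = zt l r"
  by (auto simp: zt_def nth_append fun_eq_iff)

lemma zt_00 [simp]: "zt l [0] = zt l []" "zt l [a, 0] = zt l [a]"
  using zt_0[of l "[]"] zt_0[of l "[a]"] by auto

lemma zt_upd: "(fst (zt l (b # r)))(int (length l) := a) = fst (zt l (a # r))"
  by (auto simp: zt_def fun_eq_iff nth_append nth_Cons')

lemma zt_move: "fst (zt (a # l) r) = fst (zt l (a # r))"
  by (auto simp: zt_def)

lemma write_zt:
  "write_tape (zt l (b # r)) (a, m) = (fst (zt l (a # r)), move_head m (int (length l)))"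
proof -
  have "zt l (b # r) = (fst (zt l (b # r)), int (length l))" by (simp add: zt_def)
  then show ?thesis using zt_upd[of l b r a] by (metis write_tape.simps)
qed

lemma write_zt_simps [simp]:
  "write_tape (zt l (b # r)) (a, Right) = zt (a # l) r"
  "write_tape (zt l (b # r)) (a, Stay) = zt l (a # r)"
  "write_tape (zt (c # l) (b # r)) (a, Left) = zt l (c # a # r)"
  unfolding write_zt using zt_move[of a l r] zt_move[of c l "a # r"] by (simp_all add: zt_def)

lemma write_zt_Nil [simp]:
  "write_tape (zt l []) (a, Right) = zt (a # l) []"
  "write_tape (zt l []) (a, Stay) = zt l [a]"
  "write_tape (zt (c # l) []) (a, Left) = zt l [c, a]"
  using write_zt_simps[where r="[]" and b=0 and a=a and l=l]
    write_zt_simps(3)[where r="[]" and b=0 and a=a and l=l and c=c] by simp_all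

text \<open>The symbol 3 is a left end marker at which \<open>rewind\<close> turns around; the head
  rests on the first symbol of the code.\<close>

definition R :: "tree \<Rightarrow> tape" where
  "R t = zt [3] (code t)"

lemma read_R: "read_tape (R t) = (case t of Lf \<Rightarrow> 1 | Br a b \<Rightarrow> 2)"
  by (cases t) (auto simp: R_def)

lemma ex_eq: "ex c ts n ts' \<Longrightarrow> n \<le> m \<Longrightarrow> ts' = ts'' \<Longrightarrow> ex c ts m ts''"
  by (auto intro: ex.weaken)

lemma ex_Seq: "ex c ts n ts' \<Longrightarrow> ex d ts' n' ts'' \<Longrightarrow> n + n' \<le> m \<Longrightarrow> ex (c ;; d) ts m ts''"
  by (meson ex.Seq ex.weaken)

lemma ex_IfT: "rd ts i \<in> A \<Longrightarrow> ex c ts n ts' \<Longrightarrow> n + 1 \<le> m \<Longrightarrow> ex (If i A c d) ts m ts'"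
  by (meson ex.IfT ex.weaken)

lemma ex_IfF: "rd ts i \<notin> A \<Longrightarrow> ex d ts n ts' \<Longrightarrow> n + 1 \<le> m \<Longrightarrow> ex (If i A c d) ts m ts'"
  by (meson ex.IfF ex.weaken)

lemma ex_WhileT: "rd ts i \<in> A \<Longrightarrow> ex c ts n ts' \<Longrightarrow> ex (While i A c) ts' n' ts'' \<Longrightarrow> n + n' + 1 \<le> m \<Longrightarrow>
    ex (While i A c) ts m ts''"
  by (meson ex.WhileT ex.weaken)

lemma ex_Put: "ts' = ts(i := write_tape (ts i) (a, m)) \<Longrightarrow> ex (Put i a m) ts 1 ts'"
  using ex.Put by auto

lemma ex_Mov: "ts' = ts(i := write_tape (ts i) (rd ts i, m)) \<Longrightarrow> ex (Mov i m) ts 1 ts'"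
  using ex.Mov by auto

lemma ex_fwd:
  "set w \<subseteq> {1, 2} \<Longrightarrow> ts i = zt l w \<Longrightarrow>
    ex (While i {1, 2} (Mov i Right)) ts (2 * length w + 1) (ts(i := zt (rev w @ l) []))"
proof (induction w arbitrary: l ts)
  case Nil
  then show ?case using ex.WhileF[of ts i "{1, 2}"] by (simp add: fun_upd_idem)
next
  case (Cons a w)
  have "ex (Mov i Right) ts 1 (ts(i := zt (a # l) w))"
    using Cons by (intro ex_Mov) simp
  moreover have "ex (While i {1, 2} (Mov i Right)) (ts(i := zt (a # l) w)) (2 * length w + 1)
      (ts(i := zt (rev (a # w) @ l) []))"
    by (rule ex_eq[OF Cons.IH[of "ts(i := zt (a # l) w)" "a # l"]]) (use Cons.prems in auto)
  ultimately show ?case by (rule ex_WhileT[rotated]) (use Cons.prems in auto)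
qed

lemma mov_left: "write_tape (zt (c # l) r) (read_tape (zt (c # l) r), Left) = zt l (c # r)"
  by (cases r) auto

definition rewind :: "nat \<Rightarrow> prog" where
  "rewind i = (While i {0, 1, 2} (Mov i Left) ;; Mov i Right)"

lemma ex_back:
  "set w \<subseteq> {0, 1, 2} \<Longrightarrow> r = [] \<or> hd r \<in> {0, 1, 2} \<Longrightarrow> ts i = zt (w @ [3]) r \<Longrightarrow>
    ex (While i {0, 1, 2} (Mov i Left)) ts (2 * length w + 3) (ts(i := zt [] (3 # rev w @ r)))"
proof (induction w arbitrary: r ts)
  case Nil
  have 1: "ex (Mov i Left) ts 1 (ts(i := zt [] (3 # r)))"
    using Nil mov_left[of 3 "[]" r] by (intro ex_Mov) simp
  have 2: "ex (While i {0, 1, 2} (Mov i Left)) (ts(i := zt [] (3 # r))) 1 (ts(i := zt [] (3 # r)))"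
    by (rule ex.WhileF) simp
  have "rd ts i \<in> {0, 1, 2}" using Nil by (cases r) auto
  then show ?case by (intro ex_eq[OF ex.WhileT[OF _ 1 2]]) (simp_all add: fun_eq_iff)
next
  case (Cons a w)
  have 1: "ex (Mov i Left) ts 1 (ts(i := zt (w @ [3]) (a # r)))"
    using Cons mov_left[of a "w @ [3]" r] by (intro ex_Mov) simp
  have 2: "ex (While i {0, 1, 2} (Mov i Left)) (ts(i := zt (w @ [3]) (a # r))) (2 * length w + 3)
      (ts(i := zt [] (3 # rev (a # w) @ r)))"
    by (rule ex_eq[OF Cons.IH[of "a # r" "ts(i := zt (w @ [3]) (a # r))"]]) (use Cons.prems in auto)
  have "rd ts i \<in> {0, 1, 2}" using Cons by (cases r) auto
  then show ?case by (intro ex_WhileT[OF _ 1 2]) simp_all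
qed

lemma ex_rewind:
  assumes "set w \<subseteq> {0, 1, 2}" "r = [] \<or> hd r \<in> {0, 1, 2}" "ts i = zt (w @ [3]) r"
  shows "ex (rewind i) ts (2 * length w + 4) (ts(i := zt [3] (rev w @ r)))"
  unfolding rewind_def
proof (rule ex_Seq)
  show "ex (While i {0, 1, 2} (Mov i Left)) ts (2 * length w + 3) (ts(i := zt [] (3 # rev w @ r)))"
    using assms by (rule ex_back)
  show "ex (Mov i Right) (ts(i := zt [] (3 # rev w @ r))) 1 (ts(i := zt [3] (rev w @ r)))"
    by (intro ex_Mov) simp
qed simp

definition append_copy :: "nat \<Rightarrow> nat \<Rightarrow> prog" where
  "append_copy i j = While j {1, 2} (If j {1} (Put i 1 Right) (Put i 2 Right) ;; Mov j Right)"

lemma ex_append_copy: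
  "i \<noteq> j \<Longrightarrow> set w \<subseteq> {1, 2} \<Longrightarrow> ts j = zt l w \<Longrightarrow> ts i = zt li [] \<Longrightarrow>
    ex (append_copy i j) ts (4 * length w + 1) (ts(j := zt (rev w @ l) [], i := zt (rev w @ li) []))"
proof (induction w arbitrary: l li ts)
  case Nil
  then show ?case using ex.WhileF[of ts j "{1, 2}"] by (simp add: fun_upd_idem append_copy_def)
next
  case (Cons a w)
  let ?t = "ts(i := zt (a # li) [])"
  have "ex (If j {1} (Put i 1 Right) (Put i 2 Right)) ts 2 ?t"
  proof (cases "a = 1")
    case True
    then show ?thesis using Cons by (intro ex_IfT[where n=1] ex_Put) auto
  next
    case False
    then show ?thesis using Cons by (intro ex_IfF[where n=1] ex_Put) auto
  qed
  moreover have "ex (Mov j Right) ?t 1 (?t(j := zt (a # l) w))"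
    using Cons by (intro ex_Mov) simp
  ultimately have 1: "ex (If j {1} (Put i 1 Right) (Put i 2 Right) ;; Mov j Right) ts 3 (?t(j := zt (a # l) w))"
    by (intro ex_Seq) auto
  have 2: "ex (append_copy i j) (?t(j := zt (a # l) w)) (4 * length w + 1)
      (ts(j := zt (rev (a # w) @ l) [], i := zt (rev (a # w) @ li) []))"
    by (rule ex_eq[OF Cons.IH[of "?t(j := zt (a # l) w)" "a # l" "a # li"]])
       (use Cons.prems in \<open>auto simp: fun_eq_iff\<close>)
  show ?case unfolding append_copy_def
    by (rule ex_WhileT[OF _ 1 2[unfolded append_copy_def]]) (use Cons.prems in auto)
qed

text \<open>An empty register is not blank but holds the one-symbol code of \<open>Lf\<close>. That
  symbol is deleted first; \<open>mk\<close> below instead overwrites it by the root symbol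
  2.\<close>

definition copy :: "nat \<Rightarrow> nat \<Rightarrow> prog" where
  "copy i j = (Put i 0 Stay ;; append_copy i j ;; rewind i ;; rewind j)"

lemma rewind_code: "i \<noteq> j \<Longrightarrow> ts i = zt (rev (code t) @ [3]) [] \<Longrightarrow>
    ex (rewind i) ts (2 * tsize t + 4) (ts(i := R t))"
  using ex_rewind[of "rev (code t)" "[]" ts i] code_set[of t] by (auto simp: R_def)

lemma ex_copy:
  assumes "i \<noteq> j" "ts j = R t" "ts i = R Lf"
  shows "ex (copy i j) ts (8 * tsize t + 10) (ts(i := R t))"
proof -
  let ?w = "code t"
  let ?t1 = "ts(i := zt [3] [])"
  let ?t2 = "ts(j := zt (rev ?w @ [3]) [], i := zt (rev ?w @ [3]) [])"
  let ?t3 = "ts(j := zt (rev ?w @ [3]) [], i := R t)"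
  have 1: "ex (Put i 0 Stay) ts 1 ?t1"
    using assms by (intro ex_Put) (simp add: R_def)
  have 2: "ex (append_copy i j) ?t1 (4 * tsize t + 1) ?t2"
    using ex_append_copy[of i j ?w ?t1 "[3]" "[3]"] assms code_set[of t]
    by (auto simp: R_def fun_upd_twist[of i j] elim!: ex_eq)
  have 3: "ex (rewind i) ?t2 (2 * tsize t + 4) ?t3"
    using rewind_code[of i j ?t2 t] assms by (auto elim!: ex_eq)
  have 4: "ex (rewind j) ?t3 (2 * tsize t + 4) (ts(i := R t))"
    using rewind_code[of j i ?t3 t] assms by (auto elim!: ex_eq simp: fun_eq_iff)
  show ?thesis unfolding copy_def
    by (intro ex_Seq[OF 1] ex_Seq[OF 2] ex_Seq[OF 3 4]) auto
qed

definition erase :: "nat \<Rightarrow> prog" where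
  "erase i = (While i {1, 2} (Mov i Right) ;; Mov i Left ;; While i {1, 2} (Put i 0 Left) ;;
     Mov i Right ;; Put i 1 Stay)"

lemma ex_erase_back:
  "set w \<subseteq> {1, 2} \<Longrightarrow> a \<in> {1, 2} \<Longrightarrow> ts i = zt (w @ [3]) [a] \<Longrightarrow>
    ex (While i {1, 2} (Put i 0 Left)) ts (2 * length w + 3) (ts(i := zt [] [3]))"
proof (induction w arbitrary: a ts)
  case Nil
  have 1: "ex (Put i 0 Left) ts 1 (ts(i := zt [] [3]))"
    using Nil by (intro ex_Put) simp
  have 2: "ex (While i {1, 2} (Put i 0 Left)) (ts(i := zt [] [3])) 1 (ts(i := zt [] [3]))"
    by (rule ex.WhileF) simp
  show ?case by (rule ex_WhileT[OF _ 1 2]) (use Nil in auto)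
next
  case (Cons b w)
  have 1: "ex (Put i 0 Left) ts 1 (ts(i := zt (w @ [3]) [b]))"
    using Cons by (intro ex_Put) simp
  have 2: "ex (While i {1, 2} (Put i 0 Left)) (ts(i := zt (w @ [3]) [b])) (2 * length w + 3)
      (ts(i := zt [] [3]))"
    by (rule ex_eq[OF Cons.IH[of b "ts(i := zt (w @ [3]) [b])"]]) (use Cons.prems in auto)
  show ?case by (rule ex_WhileT[OF _ 1 2]) (use Cons.prems in auto)
qed

lemma ex_erase:
  assumes "ts i = R t"
  shows "ex (erase i) ts (4 * tsize t + 10) (ts(i := R Lf))"
proof -
  have ne: "rev (code t) \<noteq> []" using tsize_pos[of t] by auto
  then obtain a w where aw: "rev (code t) = a # w" by (meson list.exhaust)
  have s: "set (a # w) \<subseteq> {1, 2}" using code_set[of t] aw by (metis set_rev)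
  have l: "tsize t = length w + 1" using aw by (metis length_Cons length_rev Suc_eq_plus1)
  have 1: "ex (While i {1, 2} (Mov i Right)) ts (2 * tsize t + 1) (ts(i := zt (a # w @ [3]) []))"
    using ex_fwd[of "code t" ts i "[3]"] assms code_set[of t] aw by (simp add: R_def)
  have 2: "ex (Mov i Left) (ts(i := zt (a # w @ [3]) [])) 1 (ts(i := zt (w @ [3]) [a]))"
    by (intro ex_Mov) simp
  have 3: "ex (While i {1, 2} (Put i 0 Left)) (ts(i := zt (w @ [3]) [a])) (2 * length w + 3) (ts(i := zt [] [3]))"
    using ex_erase_back[of w a "ts(i := zt (w @ [3]) [a])" i] s by auto
  have 4: "ex (Mov i Right) (ts(i := zt [] [3])) 1 (ts(i := zt [3] []))"
    by (intro ex_Mov) simp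
  have 5: "ex (Put i 1 Stay) (ts(i := zt [3] [])) 1 (ts(i := R Lf))"
    by (intro ex_Put) (simp add: R_def)
  show ?thesis unfolding erase_def
    by (intro ex_Seq[OF 1] ex_Seq[OF 2] ex_Seq[OF 3] ex_Seq[OF 4 5]) (auto simp: l)
qed

definition mk :: "nat \<Rightarrow> nat \<Rightarrow> nat \<Rightarrow> prog" where
  "mk i j k = (Put i 2 Right ;; append_copy i j ;; append_copy i k ;; rewind i ;; rewind j ;; rewind k)"

lemma ex_mk:
  assumes "i \<noteq> j" "i \<noteq> k" "j \<noteq> k" "ts j = R a" "ts k = R b" "ts i = R Lf"
  shows "ex (mk i j k) ts (8 * tsize a + 8 * tsize b + 20) (ts(i := R (Br a b)))"
proof -
  let ?a = "rev (code a) @ [3]" and ?b = "rev (code b) @ [3]"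
  let ?t1 = "ts(i := zt [2, 3] [])"
  let ?t2 = "ts(j := zt ?a [], i := zt (rev (code a) @ [2, 3]) [])"
  let ?t3 = "ts(j := zt ?a [], k := zt ?b [], i := zt (rev (code (Br a b)) @ [3]) [])"
  let ?t4 = "ts(j := zt ?a [], k := zt ?b [], i := R (Br a b))"
  let ?t5 = "ts(k := zt ?b [], i := R (Br a b))"
  have 1: "ex (Put i 2 Right) ts 1 ?t1"
    using assms by (intro ex_Put) (simp add: R_def)
  have 2: "ex (append_copy i j) ?t1 (4 * tsize a + 1) ?t2"
    using ex_append_copy[of i j "code a" ?t1 "[3]" "[2, 3]"] assms code_set[of a]
    by (auto simp: R_def fun_upd_twist[of i j] elim!: ex_eq)
  have 3: "ex (append_copy i k) ?t2 (4 * tsize b + 1) ?t3"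
    using ex_append_copy[of i k "code b" ?t2 "[3]" "rev (code a) @ [2, 3]"] assms code_set[of b]
    by (auto simp: R_def fun_eq_iff elim!: ex_eq)
  have 4: "ex (rewind i) ?t3 (2 * tsize (Br a b) + 4) ?t4"
    using rewind_code[of i j ?t3 "Br a b"] assms by (auto elim!: ex_eq)
  have 5: "ex (rewind j) ?t4 (2 * tsize a + 4) ?t5"
    using rewind_code[of j i ?t4 a] assms by (auto elim!: ex_eq simp: fun_eq_iff)
  have 6: "ex (rewind k) ?t5 (2 * tsize b + 4) (ts(i := R (Br a b)))"
    using rewind_code[of k i ?t5 b] assms by (auto elim!: ex_eq simp: fun_eq_iff)
  show ?thesis unfolding mk_def
    by (intro ex_Seq[OF 1] ex_Seq[OF 2] ex_Seq[OF 3] ex_Seq[OF 4] ex_Seq[OF 5 6]) auto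
qed

text \<open>To find the end of the left subtree of tape \<open>j\<close>, the number of subtrees still to be read is
  kept in the head position of tape \<open>c\<close>, relative to its left marker.\<close>

definition take_subtree :: "nat \<Rightarrow> nat \<Rightarrow> nat \<Rightarrow> prog" where
  "take_subtree j i c = While c {0, 1}
     (If j {1} (Put i 1 Right ;; Mov c Left) (Put i 2 Right ;; Mov c Right) ;; Mov j Right)"

definition split :: "nat \<Rightarrow> nat \<Rightarrow> nat \<Rightarrow> nat \<Rightarrow> prog" where
  "split j i k c = (Mov j Right ;; Put i 0 Stay ;; take_subtree j i c ;; Mov c Right ;;
     Put k 0 Stay ;; append_copy k j ;; rewind i ;; rewind j ;; rewind k)"

text \<open>The content is that of an empty register; only the head position counts. So an empty
  register already is the counter 1, and after counting down to 0, where the head sees the marker 3,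
  one move restores it.\<close>

definition ctr :: "nat \<Rightarrow> tape" where
  "ctr p = (\<lambda>i. if i = 0 then 3 else if i = 1 then 1 else 0, int p)"

lemma ctr_1: "ctr 1 = R Lf"
  by (auto simp: ctr_def R_def zt_def fun_eq_iff nth_Cons')

lemma read_ctr: "read_tape (ctr 0) = 3" "read_tape (ctr (Suc n)) \<in> {0, 1}"
  by (auto simp: ctr_def)

lemma move_ctr:
  "write_tape (ctr (Suc n)) (read_tape (ctr (Suc n)), Left) = ctr n"
  "write_tape (ctr n) (read_tape (ctr n), Right) = ctr (Suc n)"
  by (auto simp: ctr_def)

text \<open>The claim is generalised from one subtree to a list \<open>us\<close> of pending ones. A
  leaf symbol removes the first of them, a branch symbol replaces it by its two children, so the
  counter is always the length of the list.\<close>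

lemma ex_take_subtree:
  assumes "i \<noteq> j" "i \<noteq> c" "j \<noteq> c"
    and "ts j = zt l (concat (map code us) @ w)" "ts i = zt li []" "ts c = ctr (length us)"
  shows "ex (take_subtree j i c) ts (5 * length (concat (map code us)) + 1)
    (ts(j := zt (rev (concat (map code us)) @ l) w, i := zt (rev (concat (map code us)) @ li) [], c := ctr 0))"
  using assms(4-)
proof (induction "length (concat (map code us))" arbitrary: us l li ts rule: less_induct)
  case less
  show ?case
  proof (cases us)
    case Nil
    then show ?thesis using less.prems ex.WhileF[of ts c "{0, 1}"] read_ctr(1)
      by (simp add: take_subtree_def fun_upd_idem)
  next
    case (Cons u us')
    obtain a vs where av: "(a = 1 \<and> vs = us') \<or> (a = 2 \<and> length vs = length us' + 2)"
      "concat (map code us) = a # concat (map code vs)"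
    proof (cases u)
      case Lf
      then show ?thesis using that[of 1 us'] Cons by simp
    next
      case (Br x y)
      then show ?thesis using that[of 2 "x # y # us'"] Cons by simp
    qed
    let ?t1 = "ts(i := zt (a # li) [], c := ctr (length vs))"
    let ?t2 = "?t1(j := zt (a # l) (concat (map code vs) @ w))"
    have "ex (If j {1} (Put i 1 Right ;; Mov c Left) (Put i 2 Right ;; Mov c Right)) ts 3 ?t1"
    proof (cases "a = 1")
      case True
      then have v: "vs = us'" using av by auto
      have "ex (Put i 1 Right) ts 1 (ts(i := zt (a # li) []))"
        using less.prems True by (intro ex_Put) simp
      moreover have "ex (Mov c Left) (ts(i := zt (a # li) [])) 1 ?t1"
        using less.prems assms v Cons move_ctr(1)[of "length us'"] by (intro ex_Mov) simp
      ultimately show ?thesis using less.prems av True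
        by (intro ex_IfT[where n=2] ex_Seq[where n=1 and n'=1]) auto
    next
      case False
      then have v: "a = 2" "length vs = Suc (length us)" using av Cons by auto
      have "ex (Put i 2 Right) ts 1 (ts(i := zt (a # li) []))"
        using less.prems v by (intro ex_Put) simp
      moreover have "ex (Mov c Right) (ts(i := zt (a # li) [])) 1 ?t1"
        using less.prems assms v move_ctr(2)[of "length us"] by (intro ex_Mov) simp
      ultimately show ?thesis using less.prems av v
        by (intro ex_IfF[where n=2] ex_Seq[where n=1 and n'=1]) auto
    qed
    moreover have "ex (Mov j Right) ?t1 1 ?t2"
      using less.prems av assms by (intro ex_Mov) simp
    ultimately have 1: "ex (If j {1} (Put i 1 Right ;; Mov c Left) (Put i 2 Right ;; Mov c Right) ;; Mov j Right) ts 4 ?t2"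
      by (intro ex_Seq) auto
    have 2: "ex (take_subtree j i c) ?t2 (5 * length (concat (map code vs)) + 1)
      (ts(j := zt (rev (concat (map code us)) @ l) w, i := zt (rev (concat (map code us)) @ li) [], c := ctr 0))"
      by (rule ex_eq[OF less.hyps[of vs ?t2 "a # l" "a # li"]])
         (use less.prems av assms in \<open>auto simp: fun_eq_iff\<close>)
    have "rd ts c \<in> {0, 1}" using less.prems Cons read_ctr(2) by simp
    then show ?thesis using av unfolding take_subtree_def
      by (intro ex_WhileT[OF _ 1 2[unfolded take_subtree_def]]) auto
  qed
qed

lemma ex_split:
  assumes "distinct [i, j, k, c]" "ts j = R (Br a b)" "ts i = R Lf" "ts k = R Lf" "ts c = R Lf"
  shows "ex (split j i k c) ts (20 * tsize (Br a b) + 20) (ts(i := R a, k := R b))"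
proof -
  let ?a = "rev (code a)" and ?b = "rev (code b)"
  let ?t1 = "ts(j := zt [2, 3] (code a @ code b))"
  let ?t2 = "?t1(i := zt [3] [])"
  let ?t3 = "ts(j := zt (?a @ [2, 3]) (code b), i := zt (?a @ [3]) [], c := ctr 0)"
  let ?t4 = "ts(j := zt (?a @ [2, 3]) (code b), i := zt (?a @ [3]) [])"
  let ?t5 = "?t4(k := zt [3] [])"
  let ?t6 = "ts(j := zt (?b @ ?a @ [2, 3]) [], i := zt (?a @ [3]) [], k := zt (?b @ [3]) [])"
  let ?t7 = "ts(j := zt (?b @ ?a @ [2, 3]) [], i := R a, k := zt (?b @ [3]) [])"
  let ?t8 = "ts(i := R a, k := zt (?b @ [3]) [])"
  have 1: "ex (Mov j Right) ts 1 ?t1"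
    using assms by (intro ex_Mov) (simp add: R_def)
  have 2: "ex (Put i 0 Stay) ?t1 1 ?t2"
    using assms by (intro ex_Put) (simp add: R_def)
  have 3: "ex (take_subtree j i c) ?t2 (5 * tsize a + 1) ?t3"
    using ex_take_subtree[of i j c ?t2 "[2, 3]" "[a]" "code b" "[3]"] assms ctr_1 ctr_1[unfolded One_nat_def]
    by (auto simp: fun_eq_iff elim!: ex_eq)
  have 4: "ex (Mov c Right) ?t3 1 ?t4"
    using assms move_ctr(2)[of 0] ctr_1[unfolded One_nat_def] by (intro ex_Mov) (auto simp: fun_eq_iff)
  have 5: "ex (Put k 0 Stay) ?t4 1 ?t5"
    using assms by (intro ex_Put) (simp add: R_def)
  have 6: "ex (append_copy k j) ?t5 (4 * tsize b + 1) ?t6"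
    using ex_append_copy[of k j "code b" ?t5 "?a @ [2, 3]" "[3]"] assms code_set[of b]
    by (auto simp: R_def fun_eq_iff elim!: ex_eq)
  have 7: "ex (rewind i) ?t6 (2 * tsize a + 4) ?t7"
    using rewind_code[of i j ?t6 a] assms by (auto elim!: ex_eq simp: fun_eq_iff)
  have 8: "ex (rewind j) ?t7 (2 * tsize (Br a b) + 4) ?t8"
    using rewind_code[of j i ?t7 "Br a b"] assms by (auto elim!: ex_eq simp: fun_eq_iff)
  have 9: "ex (rewind k) ?t8 (2 * tsize b + 4) (ts(i := R a, k := R b))"
    using rewind_code[of k i ?t8 b] assms by (auto elim!: ex_eq simp: fun_eq_iff)
  show ?thesis unfolding split_def
    by (intro ex_Seq[OF 1] ex_Seq[OF 2] ex_Seq[OF 3] ex_Seq[OF 4] ex_Seq[OF 5] ex_Seq[OF 6]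
        ex_Seq[OF 7] ex_Seq[OF 8 9]) auto
qed

definition move_reg :: "nat \<Rightarrow> nat \<Rightarrow> prog" where
  "move_reg i j = (erase i ;; copy i j ;; erase j)"

lemma ex_move_reg:
  assumes "i \<noteq> j" "ts i = R u" "ts j = R t"
  shows "ex (move_reg i j) ts (4 * tsize u + 12 * tsize t + 30) (ts(i := R t, j := R Lf))"
proof -
  have 1: "ex (erase i) ts (4 * tsize u + 10) (ts(i := R Lf))"
    by (rule ex_erase) (rule assms)
  have 2: "ex (copy i j) (ts(i := R Lf)) (8 * tsize t + 10) (ts(i := R t))"
    using ex_copy[of i j "ts(i := R Lf)" t] assms by simp
  have 3: "ex (erase j) (ts(i := R t)) (4 * tsize t + 10) (ts(i := R t, j := R Lf))"
    using ex_erase[of "ts(i := R t)" j t] assms by simp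
  show ?thesis unfolding move_reg_def by (intro ex_Seq[OF 1] ex_Seq[OF 2 3]) auto
qed

section \<open>Polynomial-time computability\<close>

text \<open>The base \<open>n + 2\<close> is at least 2, so that constants, sums and compositions
  are absorbed into the exponent even at \<open>n = 0\<close>.\<close>

definition pb :: "(nat \<Rightarrow> nat) \<Rightarrow> bool" where
  "pb B \<longleftrightarrow> mono B \<and> (\<exists>d. \<forall>n. B n \<le> (n + 2) ^ d)"

lemma pb_mono: "pb B \<Longrightarrow> m \<le> n \<Longrightarrow> B m \<le> B n"
  by (auto simp: pb_def mono_def)

lemma pb_id: "pb (\<lambda>n. n)"
  unfolding pb_def by (auto simp: mono_def intro!: exI[of _ 1])

lemma pb_const: "pb (\<lambda>n. c)"
proof -
  have "c \<le> (n + 2) ^ c" for n :: nat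
  proof -
    have "c \<le> 2 ^ c" by (simp add: less_imp_le)
    also have "\<dots> \<le> (n + 2) ^ c" by (intro power_mono) auto
    finally show ?thesis .
  qed
  then show ?thesis unfolding pb_def mono_def by blast
qed

lemma pb_mult: "pb A \<Longrightarrow> pb B \<Longrightarrow> pb (\<lambda>n. A n * B n)"
proof -
  assume a: "pb A" "pb B"
  then obtain c d where "\<And>n. A n \<le> (n + 2) ^ c" "\<And>n. B n \<le> (n + 2) ^ d" unfolding pb_def by blast
  then have "A n * B n \<le> (n + 2) ^ (c + d)" for n by (simp only: power_add mult_le_mono)
  moreover have "mono (\<lambda>n. A n * B n)" using a unfolding pb_def mono_def by (simp add: mult_le_mono)
  ultimately show ?thesis unfolding pb_def by blast
qed

lemma pb_add: "pb A \<Longrightarrow> pb B \<Longrightarrow> pb (\<lambda>n. A n + B n)"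
proof -
  assume a: "pb A" "pb B"
  then obtain c d where cd: "\<And>n. A n \<le> (n + 2) ^ c" "\<And>n. B n \<le> (n + 2) ^ d" unfolding pb_def by blast
  have "A n + B n \<le> (n + 2) ^ (c + d + 1)" for n
  proof -
    have "A n \<le> (n + 2) ^ (c + d)" by (rule le_trans[OF cd(1)]) (rule power_increasing; simp)
    moreover have "B n \<le> (n + 2) ^ (c + d)" by (rule le_trans[OF cd(2)]) (rule power_increasing; simp)
    ultimately have "A n + B n \<le> 2 * (n + 2) ^ (c + d)" by simp
    also have "\<dots> \<le> (n + 2) * (n + 2) ^ (c + d)" by (rule mult_le_mono1) simp
    finally show ?thesis by (simp only: power_add power_one_right mult.commute)
  qed
  moreover have "mono (\<lambda>n. A n + B n)" using a unfolding pb_def mono_def by (simp add: add_mono)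
  ultimately show ?thesis unfolding pb_def by blast
qed

lemma pb_comp: "pb A \<Longrightarrow> pb B \<Longrightarrow> pb (\<lambda>n. A (B n))"
proof -
  assume a: "pb A" "pb B"
  then obtain c d where cd: "\<And>n. A n \<le> (n + 2) ^ c" "\<And>n. B n \<le> (n + 2) ^ d" unfolding pb_def by blast
  have "A (B n) \<le> (n + 2) ^ ((d + 2) * c)" for n
  proof -
    have "B n + 2 \<le> (n + 2) ^ d + 2" using cd(2)[of n] by simp
    also have "\<dots> \<le> (n + 2) ^ d * 3" using one_le_power[of "n + 2" d] by simp
    also have "\<dots> \<le> (n + 2) ^ d * (n + 2) ^ 2"
      by (rule mult_le_mono2) (simp add: power2_eq_square)
    finally have "B n + 2 \<le> (n + 2) ^ (d + 2)" by (simp only: power_add)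
    then have "(B n + 2) ^ c \<le> ((n + 2) ^ (d + 2)) ^ c" by (rule power_mono) simp
    with cd(1)[of "B n"] show ?thesis unfolding power_mult by linarith
  qed
  moreover have "mono (\<lambda>n. A (B n))" using a unfolding pb_def mono_def by simp
  ultimately show ?thesis unfolding pb_def by blast
qed

lemmas pb_intros = pb_id pb_const pb_mult pb_add

section \<open>Representation of data by trees\<close>

class rep =
  fixes rep :: "'a \<Rightarrow> tree"
  assumes rep_inj: "rep x = rep y \<Longrightarrow> x = y"

abbreviation rsize :: "'a::rep \<Rightarrow> nat" where
  "rsize x \<equiv> tsize (rep x)"

instantiation tree :: rep begin
definition "rep_tree (t::tree) = t"
instance by standard (auto simp: rep_tree_def)
end

instantiation unit :: rep begin
definition "rep_unit (u::unit) = Lf"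
instance by standard auto
end

instantiation bool :: rep begin
definition "rep_bool b = (if b then Br Lf Lf else Lf)"
instance by standard (auto simp: rep_bool_def split: if_splits)
end

text \<open>Unary notation is affordable since numbers serve as indices, lengths and tape symbols
  only. Large numbers never become values of the program: variables are kept as digit lists, vertex
  names are printed digit by digit, and the budget is a ready-made string.\<close>

instantiation nat :: rep begin
primrec rep_nat where
  "rep_nat 0 = Lf"
| "rep_nat (Suc n) = Br Lf (rep_nat n)"
instance
proof
  fix x y :: nat assume "rep x = rep y" then show "x = y"
    by (induction x arbitrary: y) (metis old.nat.exhaust rep_nat.simps tree.distinct(1),
      metis not0_implies_Suc rep_nat.simps tree.inject tree.distinct(2))
qed
end

instantiation prod :: (rep, rep) rep begin
definition "rep_prod p = Br (rep (fst p)) (rep (snd p))"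
instance by standard (auto simp: rep_prod_def prod_eq_iff dest: rep_inj)
end

instantiation list :: (rep) rep begin
primrec rep_list where
  "rep_list [] = Lf"
| "rep_list (x # xs) = Br (rep x) (rep_list xs)"
instance
proof
  fix x y :: "'a list" assume "rep x = rep y" then show "x = y"
  proof (induction x arbitrary: y)
    case Nil then show ?case by (cases y) auto
  next
    case (Cons a x) then show ?case by (cases y) (auto dest: rep_inj)
  qed
qed
end

lemma rsize_simps [simp]:
  "rsize (a, b) = 1 + rsize a + rsize b"
  "rsize (x # xs) = 1 + rsize x + rsize xs"
  "rsize [] = 1" "rsize () = 1" "rsize (0::nat) = 1" "rsize (Suc n) = 2 + rsize n"
  by (auto simp: rep_prod_def rep_unit_def)

lemma rsize_nat: "rsize (n::nat) = 2 * n + 1"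
  by (induction n) auto

lemma rsize_bool: "rsize (b::bool) \<le> 3"
  by (auto simp: rep_bool_def)

lemma rsize_pos: "rsize x \<ge> 1"
  by (rule tsize_pos)

lemma rsize_append: "rsize (xs @ ys) + 1 = rsize xs + rsize ys"
  by (induction xs) auto

lemma length_le_rsize: "length xs + 1 \<le> rsize xs"
  by (induction xs) auto

lemma rsize_le_append: "rsize xs \<le> rsize (xs @ ys)" "rsize ys \<le> rsize (xs @ ys)"
  using rsize_append[of xs ys] rsize_pos[of ys] rsize_pos[of xs] by linarith+

lemma rsize_member: "x \<in> set xs \<Longrightarrow> rsize x \<le> rsize xs"
  by (induction xs) auto

section \<open>Functions computed by register programs, and their closure properties\<close>

text \<open>Programs on the registers \<open>b, \<dots>, b + m - 1\<close>: register \<open>b\<close> holds the argument and receives the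
  result, the others are empty before and after.\<close>

definition computes :: "prog \<Rightarrow> nat \<Rightarrow> nat \<Rightarrow> tree \<Rightarrow> tree \<Rightarrow> nat \<Rightarrow> bool" where
  "computes P b m x y n \<longleftrightarrow>
    (\<forall>ts. ts b = R x \<and> (\<forall>i. b < i \<and> i < b + m \<longrightarrow> ts i = R Lf) \<longrightarrow> ex P ts n (ts(b := R y)))"

text \<open>The measure \<open>\<mu>\<close> is added to the input size before the polynomial is
  applied; this isolates the one exponential quantity of the reduction. The number \<open>m\<close>
  of registers and the bound \<open>B\<close> do not depend on the base register \<open>b\<close>,
  so a program can be placed above registers that are in use.\<close>

definition tc :: "('a::rep \<Rightarrow> nat) \<Rightarrow> ('a \<Rightarrow> 'b::rep) \<Rightarrow> bool" where
  "tc \<mu> f \<longleftrightarrow> (\<exists>m B. pb B \<and> (\<forall>x. rsize (f x) \<le> B (\<mu> x + rsize x)) \<and>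
     (\<forall>b. \<exists>P. wf_prog (b + m) 4 P \<and>
       (\<forall>x. computes P b m (rep x) (rep (f x)) (B (\<mu> x + rsize x)))))"

abbreviation fp :: "('a::rep \<Rightarrow> 'b::rep) \<Rightarrow> bool" where
  "fp \<equiv> tc (\<lambda>_. 0)"

lemma computes_mono:
  "computes P b m x y n \<Longrightarrow> m \<le> m' \<Longrightarrow> n \<le> n' \<Longrightarrow> computes P b m' x y n'"
  unfolding computes_def by (meson ex.weaken le_trans less_le_trans add_left_mono)

lemma computesD:
  "computes P b m x y n \<Longrightarrow> ts b = R x \<Longrightarrow> (\<And>i. b < i \<Longrightarrow> i < b + m \<Longrightarrow> ts i = R Lf) \<Longrightarrow>
    ts' = ts(b := R y) \<Longrightarrow> ex P ts n ts'"
  unfolding computes_def by blast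

lemma tcI:
  assumes "pb B" "\<And>x. rsize (f x) \<le> B (\<mu> x + rsize x)"
    "\<And>b. \<exists>P. wf_prog (b + m) 4 P \<and> (\<forall>x. computes P b m (rep x) (rep (f x)) (B (\<mu> x + rsize x)))"
  shows "tc \<mu> f"
  using assms unfolding tc_def by blast

text \<open>A change of type that leaves the tree alone costs one idle step. In this way a pair of
  head and tail becomes a nonempty list, and a unary number a list of units.\<close>

lemma tc_rep_eq:
  assumes "\<And>x. rep (f x) = rep x"
  shows "tc \<mu> f"
proof (rule tcI[where B="\<lambda>n. n" and m=1])
  show "\<exists>P. wf_prog (b + 1) 4 P \<and> (\<forall>x. computes P b 1 (rep x) (rep (f x)) (\<mu> x + rsize x))" for b
  proof (intro exI[of _ "Mov b Stay"] conjI allI)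
    have "ex (Mov b Stay) ts (\<mu> x + rsize x) (ts(b := R (rep x)))" if "ts b = R (rep x)" for ts x
    proof -
      have "ex (Mov b Stay) ts 1 (ts(b := R (rep x)))"
        using that by (intro ex_Mov) (cases "R (rep x)", simp)
      then show ?thesis using rsize_pos[of x] by (auto elim: ex.weaken)
    qed
    then show "computes (Mov b Stay) b 1 (rep x) (rep (f x)) (\<mu> x + rsize x)" for x
      by (simp add: assms computes_def)
  qed simp
qed (auto simp: assms intro: pb_id)

lemma tc_id: "tc \<mu> (\<lambda>x. x)"
  by (rule tc_rep_eq) simp

lemma tc_Lf:
  assumes "rep c = Lf"
  shows "tc \<mu> (\<lambda>x. c)"
proof (rule tcI[where B="\<lambda>n. 4 * n + 10" and m=1])
  show "pb (\<lambda>n. 4 * n + 10)" by (intro pb_intros)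
  show "\<exists>P. wf_prog (b + 1) 4 P \<and> (\<forall>x. computes P b 1 (rep x) (rep c) (4 * (\<mu> x + rsize x) + 10))" for b
  proof (intro exI[of _ "erase b"] conjI allI)
    show "computes (erase b) b 1 (rep x) (rep c) (4 * (\<mu> x + rsize x) + 10)" for x
      unfolding computes_def assms by (blast intro: ex_eq[OF ex_erase] add_le_mono mult_le_mono le_add2 le_refl)
  qed (simp add: erase_def)
qed (auto simp: assms)

lemma tc_comp:
  assumes g: "tc \<mu> g" and f: "tc \<nu> f" and Q: "pb Q" "\<And>x. \<nu> (g x) \<le> Q (\<mu> x + rsize x)"
  shows "tc \<mu> (\<lambda>x. f (g x))"
proof -
  obtain m B where B: "pb B" "\<And>x. rsize (g x) \<le> B (\<mu> x + rsize x)"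
    and P: "\<And>b. \<exists>P. wf_prog (b + m) 4 P \<and> (\<forall>x. computes P b m (rep x) (rep (g x)) (B (\<mu> x + rsize x)))"
    using g unfolding tc_def by blast
  obtain m' B' where B': "pb B'" "\<And>x. rsize (f x) \<le> B' (\<nu> x + rsize x)"
    and P': "\<And>b. \<exists>P. wf_prog (b + m') 4 P \<and> (\<forall>x. computes P b m' (rep x) (rep (f x)) (B' (\<nu> x + rsize x)))"
    using f unfolding tc_def by blast
  let ?B = "\<lambda>n. B n + B' (Q n + B n)"
  have le: "B' (\<nu> (g x) + rsize (g x)) \<le> B' (Q (\<mu> x + rsize x) + B (\<mu> x + rsize x))" for x
    by (rule pb_mono[OF B'(1) add_mono[OF Q(2) B(2)]])
  show ?thesis
  proof (rule tcI[where B="?B" and m="max m m'"])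
    show "pb ?B" by (rule pb_add[OF B(1) pb_comp[OF B'(1) pb_add[OF Q(1) B(1)]]])
    show "rsize (f (g x)) \<le> ?B (\<mu> x + rsize x)" for x
      using le[of x] B'(2)[of "g x"] by linarith
    fix b
    obtain c where c: "wf_prog (b + m) 4 c" "\<And>x. computes c b m (rep x) (rep (g x)) (B (\<mu> x + rsize x))"
      using P[of b] by blast
    obtain d where d: "wf_prog (b + m') 4 d" "\<And>x. computes d b m' (rep x) (rep (f x)) (B' (\<nu> x + rsize x))"
      using P'[of b] by blast
    show "\<exists>P. wf_prog (b + max m m') 4 P \<and> (\<forall>x. computes P b (max m m') (rep x) (rep (f (g x))) (?B (\<mu> x + rsize x)))"
    proof (intro exI[of _ "c ;; d"] conjI allI)
      show "wf_prog (b + max m m') 4 (c ;; d)" using c(1) d(1) by (auto elim: wf_prog_mono)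
      fix x
      show "computes (c ;; d) b (max m m') (rep x) (rep (f (g x))) (?B (\<mu> x + rsize x))"
        unfolding computes_def
      proof (intro allI impI)
        fix ts assume ts: "ts b = R (rep x) \<and> (\<forall>i. b < i \<and> i < b + max m m' \<longrightarrow> ts i = R Lf)"
        have 1: "ex c ts (B (\<mu> x + rsize x)) (ts(b := R (rep (g x))))"
          by (rule computesD[OF c(2)]) (use ts in auto)
        have 2: "ex d (ts(b := R (rep (g x)))) (B' (\<nu> (g x) + rsize (g x))) (ts(b := R (rep (f (g x)))))"
          by (rule computesD[OF d(2)]) (use ts in auto)
        show "ex (c ;; d) ts (?B (\<mu> x + rsize x)) (ts(b := R (rep (f (g x)))))"
          by (rule ex_Seq[OF 1 2]) (use le[of x] in linarith)
      qed
    qed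
  qed
qed

lemma fp_comp: "fp f \<Longrightarrow> tc \<mu> g \<Longrightarrow> tc \<mu> (\<lambda>x. f (g x))"
  by (rule tc_comp[where Q="\<lambda>_. 0"]) (auto intro: pb_const)

lemma tc_pair:
  assumes f: "tc \<mu> f" and g: "tc \<mu> g"
  shows "tc \<mu> (\<lambda>x. (f x, g x))"
proof -
  obtain m B where B: "pb B" "\<And>x. rsize (f x) \<le> B (\<mu> x + rsize x)"
    and P: "\<And>b. \<exists>P. wf_prog (b + m) 4 P \<and> (\<forall>x. computes P b m (rep x) (rep (f x)) (B (\<mu> x + rsize x)))"
    using f unfolding tc_def by blast
  obtain m' B' where B': "pb B'" "\<And>x. rsize (g x) \<le> B' (\<mu> x + rsize x)"
    and P': "\<And>b. \<exists>P. wf_prog (b + m') 4 P \<and> (\<forall>x. computes P b m' (rep x) (rep (g x)) (B' (\<mu> x + rsize x)))"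
    using g unfolding tc_def by blast
  let ?m = "2 + (2 + max m m')"
  let ?B = "\<lambda>n. 100 * (n + B n + B' n) + 100"
  show ?thesis
  proof (rule tcI[where B="?B" and m="?m"])
    show "pb ?B" using B B' by (intro pb_intros) auto
    show "rsize (f x, g x) \<le> ?B (\<mu> x + rsize x)" for x
      using B(2)[of x] B'(2)[of x] by simp
    fix b
    obtain c where c: "wf_prog (b + 1 + m) 4 c" "\<And>x. computes c (b + 1) m (rep x) (rep (f x)) (B (\<mu> x + rsize x))"
      using P[of "b + 1"] by blast
    obtain d where d: "wf_prog (b + 2 + m') 4 d" "\<And>x. computes d (b + 2) m' (rep x) (rep (g x)) (B' (\<mu> x + rsize x))"
      using P'[of "b + 2"] by blast
    let ?P = "copy (b + 1) b ;; c ;; copy (b + 2) b ;; d ;; erase b ;; mk b (b + 1) (b + 2) ;; erase (b + 1) ;; erase (b + 2)"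
    show "\<exists>P. wf_prog (b + ?m) 4 P \<and> (\<forall>x. computes P b ?m (rep x) (rep (f x, g x)) (?B (\<mu> x + rsize x)))"
    proof (intro exI[of _ ?P] conjI allI)
      show "wf_prog (b + ?m) 4 ?P" using c(1) d(1)
        by (auto elim!: wf_prog_mono simp: copy_def erase_def mk_def append_copy_def rewind_def)
      fix x
      let ?n = "\<mu> x + rsize x"
      show "computes ?P b ?m (rep x) (rep (f x, g x)) (?B (\<mu> x + rsize x))"
        unfolding computes_def
      proof (intro allI impI)
        fix ts assume ts: "ts b = R (rep x) \<and> (\<forall>i. b < i \<and> i < b + ?m \<longrightarrow> ts i = R Lf)"
        then have ts1: "ts (b + 1) = R Lf" "ts (b + 2) = R Lf" by auto
        have 1: "ex (copy (b + 1) b) ts (8 * rsize x + 10) (ts(b + 1 := R (rep x)))"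
          using ts ts1 by (intro ex_copy) auto
        have 2: "ex c (ts(b + 1 := R (rep x))) (B ?n) (ts(b + 1 := R (rep (f x))))"
          by (rule computesD[OF c(2)]) (use ts in auto)
        have 3: "ex (copy (b + 2) b) (ts(b + 1 := R (rep (f x)))) (8 * rsize x + 10)
            (ts(b + 1 := R (rep (f x)), b + 2 := R (rep x)))"
          using ts ts1 by (intro ex_copy) auto
        have 4: "ex d (ts(b + 1 := R (rep (f x)), b + 2 := R (rep x))) (B' ?n)
            (ts(b + 1 := R (rep (f x)), b + 2 := R (rep (g x))))"
          by (rule computesD[OF d(2)]) (use ts in auto)
        have 5: "ex (erase b) (ts(b + 1 := R (rep (f x)), b + 2 := R (rep (g x)))) (4 * rsize x + 10)
            (ts(b + 1 := R (rep (f x)), b + 2 := R (rep (g x)), b := R Lf))"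
          using ts by (intro ex_erase) auto
        have 6: "ex (mk b (b + 1) (b + 2)) (ts(b + 1 := R (rep (f x)), b + 2 := R (rep (g x)), b := R Lf))
           (8 * rsize (f x) + 8 * rsize (g x) + 20)
            (ts(b + 1 := R (rep (f x)), b + 2 := R (rep (g x)), b := R (rep (f x, g x))))"
          by (rule ex_eq[OF ex_mk[of _ _ _ _ "rep (f x)" "rep (g x)"]]) (auto simp: rep_prod_def)
        have 7: "ex (erase (b + 1)) (ts(b + 1 := R (rep (f x)), b + 2 := R (rep (g x)), b := R (rep (f x, g x))))
           (4 * rsize (f x) + 10) (ts(b + 2 := R (rep (g x)), b := R (rep (f x, g x))))"
          by (rule ex_eq[OF ex_erase[of _ _ "rep (f x)"]]) (use ts1 in \<open>auto simp: fun_eq_iff\<close>)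
        have 8: "ex (erase (b + 2)) (ts(b + 2 := R (rep (g x)), b := R (rep (f x, g x))))
           (4 * rsize (g x) + 10) (ts(b := R (rep (f x, g x))))"
          by (rule ex_eq[OF ex_erase[of _ _ "rep (g x)"]]) (use ts1 in \<open>auto simp: fun_eq_iff\<close>)
        show "ex ?P ts (?B (\<mu> x + rsize x)) (ts(b := R (rep (f x, g x))))"
          by (rule ex_eq[OF ex.Seq[OF 1 ex.Seq[OF 2 ex.Seq[OF 3 ex.Seq[OF 4 ex.Seq[OF 5 ex.Seq[OF 6 ex.Seq[OF 7 8]]]]]]]])
            (use B(2)[of x] B'(2)[of x] in simp_all)
      qed
    qed
  qed
qed

fun thd :: "tree \<Rightarrow> tree" where "thd Lf = Lf" | "thd (Br a b) = a"
fun ttl :: "tree \<Rightarrow> tree" where "ttl Lf = Lf" | "ttl (Br a b) = b"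

lemmas prog_defs = copy_def erase_def mk_def append_copy_def rewind_def split_def take_subtree_def
  move_reg_def

lemma fp_thd_ttl: "fp thd" "fp ttl"
proof -
  have "fp (if h then thd else ttl)" for h
  proof (rule tcI[where B="\<lambda>n. 100 * n + 200" and m=4])
    show "pb (\<lambda>n. 100 * n + 200)" by (intro pb_intros)
    have "tsize ((if h then thd else ttl) x) \<le> tsize x" for x by (cases x; cases h; simp)
    then have "tsize ((if h then thd else ttl) x) \<le> 100 * (0 + tsize x) + 200" for x
      by (rule le_trans) simp
    then show "rsize ((if h then thd else ttl) x) \<le> 100 * (0 + rsize x) + 200" for x
      unfolding rep_tree_def .
    fix b :: nat
    let ?P = "If b {2} (split b (b + 1) (b + 2) (b + 3) ;; move_reg b (if h then b + 1 else b + 2) ;;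
      erase (if h then b + 2 else b + 1)) (Mov b Stay)"
    show "\<exists>P. wf_prog (b + 4) 4 P \<and> (\<forall>x. computes P b 4 (rep x) (rep ((if h then thd else ttl) x)) (100 * (0 + rsize x) + 200))"
    proof (intro exI[of _ ?P] conjI allI)
      show "wf_prog (b + 4) 4 ?P" by (auto simp: prog_defs)
      fix x :: tree
      show "computes ?P b 4 (rep x) (rep ((if h then thd else ttl) x)) (100 * (0 + rsize x) + 200)"
        unfolding computes_def
      proof (intro allI impI)
        fix ts assume ts: "ts b = R (rep x) \<and> (\<forall>i. b < i \<and> i < b + 4 \<longrightarrow> ts i = R Lf)"
        have ts1: "ts b = R x" "ts (b + 1) = R Lf" "ts (b + 2) = R Lf" "ts (b + 3) = R Lf"
          using ts by (auto simp: rep_tree_def)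
        show "ex ?P ts (100 * (0 + rsize x) + 200) (ts(b := R (rep ((if h then thd else ttl) x))))"
        proof (cases x)
          case Lf
          have "ex (Mov b Stay) ts 1 (ts(b := R Lf))"
            using ts1 Lf by (intro ex_Mov) (cases "R Lf", simp)
          then show ?thesis using ts1 Lf by (intro ex_IfF) (auto simp: read_R rep_tree_def)
        next
          case (Br u v)
          have 1: "ex (split b (b + 1) (b + 2) (b + 3)) ts (20 * tsize x + 20) (ts(b + 1 := R u, b + 2 := R v))"
            using ex_split[of "b + 1" b "b + 2" "b + 3" ts u v] ts1 Br by simp
          have 2: "ex (move_reg b (if h then b + 1 else b + 2)) (ts(b + 1 := R u, b + 2 := R v)) (16 * tsize x + 30)
            (ts(b + 1 := R u, b + 2 := R v, b := R (if h then u else v), (if h then b + 1 else b + 2) := R Lf))"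
            by (rule ex_eq[OF ex_move_reg[of _ _ _ x "if h then u else v"]]) (use ts1 Br in auto)
          have 3: "ex (erase (if h then b + 2 else b + 1)) (ts(b + 1 := R u, b + 2 := R v, b := R (if h then u else v), (if h then b + 1 else b + 2) := R Lf))
            (4 * tsize x + 10) (ts(b := R (if h then u else v)))"
            by (rule ex_eq[OF ex_erase[of _ _ "if h then v else u"]]) (use ts1 Br in \<open>auto simp: fun_eq_iff\<close>)
          show ?thesis
            by (intro ex_IfT[OF _ ex_eq[OF ex.Seq[OF 1 ex.Seq[OF 2 3]] le_refl]])
              (use ts1 Br in \<open>auto simp: read_R rep_tree_def\<close>)
        qed
      qed
    qed
  qed
  from this[of True] this[of False] show "fp thd" "fp ttl" by auto
qed

lemma tc_via:
  assumes "fp F" "\<And>x. rep (f x) = F (rep x)"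
  shows "tc \<mu> f"
proof -
  obtain m B where B: "pb B" "\<And>x. rsize (F x) \<le> B (rsize x)"
    and P: "\<And>b. \<exists>P. wf_prog (b + m) 4 P \<and> (\<forall>x. computes P b m (rep x) (rep (F x)) (B (rsize x)))"
    using assms(1) unfolding tc_def by auto
  have le: "B (rsize x) \<le> B (\<mu> x + rsize x)" for x by (rule pb_mono[OF B(1)]) simp
  show ?thesis
  proof (rule tcI[where B=B and m=m])
    show "rsize (f x) \<le> B (\<mu> x + rsize x)" for x
      using B(2)[of "rep x"] le[of x] assms(2) by (simp add: rep_tree_def)
    show "\<exists>P. wf_prog (b + m) 4 P \<and> (\<forall>x. computes P b m (rep x) (rep (f x)) (B (\<mu> x + rsize x)))" for b
    proof -
      obtain P where P: "wf_prog (b + m) 4 P" "\<And>x. computes P b m (rep x) (rep (F x)) (B (rsize x))"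
        using P[of b] by blast
      have "computes P b m (rep x) (rep (f x)) (B (\<mu> x + rsize x))" for x
        using computes_mono[OF P(2)[of "rep x"] le_refl] le[of x] assms(2)[of x] by (simp add: rep_tree_def)
      then show ?thesis using P(1) by blast
    qed
  qed (rule B(1))
qed

lemma tc_fst: "tc \<mu> f \<Longrightarrow> tc \<mu> (\<lambda>x. fst (f x))"
  by (rule fp_comp[OF tc_via[OF fp_thd_ttl(1)]]) (auto simp: rep_prod_def)

lemma tc_snd: "tc \<mu> f \<Longrightarrow> tc \<mu> (\<lambda>x. snd (f x))"
  by (rule fp_comp[OF tc_via[OF fp_thd_ttl(2)]]) (auto simp: rep_prod_def)

lemma tc_Cons: "tc \<mu> f \<Longrightarrow> tc \<mu> g \<Longrightarrow> tc \<mu> (\<lambda>x. f x # g x)"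
  by (rule fp_comp[OF tc_rep_eq[where f="\<lambda>p. fst p # snd p"] tc_pair, simplified]) (auto simp: rep_prod_def)

lemma fp_Br: "tc \<mu> f \<Longrightarrow> tc \<mu> g \<Longrightarrow> tc \<mu> (\<lambda>x. Br (f x) (g x))"
  by (rule fp_comp[OF tc_rep_eq[where f="\<lambda>p. Br (fst p) (snd p)"] tc_pair, simplified])
    (auto simp: rep_prod_def rep_tree_def)

lemma fp_const_tree: "tc \<mu> (\<lambda>x. t :: tree)"
  by (induction t) (auto intro: fp_Br tc_Lf simp: rep_tree_def)

lemma tc_const: "tc \<mu> (\<lambda>x. c)"
  by (rule tc_via[OF fp_const_tree[of _ "rep c"]]) (simp add: rep_tree_def)

lemma tc_if:
  assumes c: "tc \<mu> c" and f: "tc \<mu> f" and g: "tc \<mu> g"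
  shows "tc \<mu> (\<lambda>x. if c x then f x else g x)"
proof -
  obtain m B where B: "pb B"
    and P: "\<And>b. \<exists>P. wf_prog (b + m) 4 P \<and> (\<forall>x. computes P b m (rep x) (rep (c x)) (B (\<mu> x + rsize x)))"
    using c unfolding tc_def by blast
  obtain m' B' where B': "pb B'" "\<And>x. rsize (f x) \<le> B' (\<mu> x + rsize x)"
    and P': "\<And>b. \<exists>P. wf_prog (b + m') 4 P \<and> (\<forall>x. computes P b m' (rep x) (rep (f x)) (B' (\<mu> x + rsize x)))"
    using f unfolding tc_def by blast
  obtain m'' B'' where B'': "pb B''" "\<And>x. rsize (g x) \<le> B'' (\<mu> x + rsize x)"
    and P'': "\<And>b. \<exists>P. wf_prog (b + m'') 4 P \<and> (\<forall>x. computes P b m'' (rep x) (rep (g x)) (B'' (\<mu> x + rsize x)))"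
    using g unfolding tc_def by blast
  let ?m = "2 + m + m' + m''"
  let ?B = "\<lambda>n. 100 * (n + B n + B' n + B'' n) + 100"
  show ?thesis
  proof (rule tcI[where B="?B" and m="?m"])
    show "pb ?B" using B B' B'' by (intro pb_intros) auto
    show "rsize (if c x then f x else g x) \<le> ?B (\<mu> x + rsize x)" for x
      using B'(2)[of x] B''(2)[of x] by simp
    fix b
    obtain C where C: "wf_prog (b + 1 + m) 4 C" "\<And>x. computes C (b + 1) m (rep x) (rep (c x)) (B (\<mu> x + rsize x))"
      using P[of "b + 1"] by blast
    obtain F where F: "wf_prog (b + m') 4 F" "\<And>x. computes F b m' (rep x) (rep (f x)) (B' (\<mu> x + rsize x))"
      using P'[of b] by blast
    obtain G where G: "wf_prog (b + m'') 4 G" "\<And>x. computes G b m'' (rep x) (rep (g x)) (B'' (\<mu> x + rsize x))"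
      using P''[of b] by blast
    let ?P = "copy (b + 1) b ;; C ;; If (b + 1) {2} (erase (b + 1) ;; F) (erase (b + 1) ;; G)"
    show "\<exists>P. wf_prog (b + ?m) 4 P \<and> (\<forall>x. computes P b ?m (rep x) (rep (if c x then f x else g x)) (?B (\<mu> x + rsize x)))"
    proof (intro exI[of _ ?P] conjI allI)
      show "wf_prog (b + ?m) 4 ?P" using C(1) F(1) G(1)
        by (auto elim!: wf_prog_mono simp: prog_defs)
      fix x
      let ?n = "\<mu> x + rsize x"
      show "computes ?P b ?m (rep x) (rep (if c x then f x else g x)) (?B ?n)"
        unfolding computes_def
      proof (intro allI impI)
        fix ts assume ts: "ts b = R (rep x) \<and> (\<forall>i. b < i \<and> i < b + ?m \<longrightarrow> ts i = R Lf)"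
        then have ts1: "ts b = R (rep x)" "ts (b + 1) = R Lf" by auto
        have 1: "ex (copy (b + 1) b) ts (8 * rsize x + 10) (ts(b + 1 := R (rep x)))"
          using ts1 by (intro ex_copy) auto
        have 2: "ex C (ts(b + 1 := R (rep x))) (B ?n) (ts(b + 1 := R (rep (c x))))"
          by (rule computesD[OF C(2)]) (use ts in auto)
        have 3: "ex (erase (b + 1)) (ts(b + 1 := R (rep (c x)))) 22 ts"
          by (rule ex_eq[OF ex_erase[of _ _ "rep (c x)"]]) (use ts1 rsize_bool[of "c x"] in \<open>auto simp: fun_eq_iff\<close>)
        have 4: "ex (If (b + 1) {2} (erase (b + 1) ;; F) (erase (b + 1) ;; G)) (ts(b + 1 := R (rep (c x))))
          (23 + B' ?n + B'' ?n) (ts(b := R (rep (if c x then f x else g x))))"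
        proof (cases "c x")
          case True
          have "ex F ts (B' ?n) (ts(b := R (rep (f x))))"
            by (rule computesD[OF F(2)]) (use ts in auto)
          from ex.Seq[OF 3 this] show ?thesis using True
            by (intro ex_IfT[OF _ ]) (auto simp: read_R rep_bool_def)
        next
          case False
          have "ex G ts (B'' ?n) (ts(b := R (rep (g x))))"
            by (rule computesD[OF G(2)]) (use ts in auto)
          from ex.Seq[OF 3 this] show ?thesis using False
            by (intro ex_IfF[OF _ ]) (auto simp: read_R rep_bool_def)
        qed
        show "ex ?P ts (?B ?n) (ts(b := R (rep (if c x then f x else g x))))"
          by (rule ex_eq[OF ex.Seq[OF 1 ex.Seq[OF 2 4]]]) simp_all
      qed
    qed
  qed
qed

text \<open>Folds are the only form of iteration. A step function that is polynomial on its own may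
  still double the accumulator in every round, so a bound \<open>Q\<close> on all partial results
  has to be supplied.\<close>

lemma tc_foldl:
  fixes l :: "'a::rep \<Rightarrow> 'c::rep list" and i :: "'a \<Rightarrow> 'b::rep"
  assumes l: "tc \<mu> l" and i: "tc \<mu> i" and h: "fp (\<lambda>z. h (fst z) (fst (snd z)) (snd (snd z)))"
    and Q: "pb Q" "\<And>x k. rsize (foldl (h x) (i x) (take k (l x))) \<le> Q (\<mu> x + rsize x)"
  shows "tc \<mu> (\<lambda>x. foldl (h x) (i x) (l x))"
proof -
  obtain m B where B: "pb B" "\<And>x. rsize (l x) \<le> B (\<mu> x + rsize x)"
    and P: "\<And>b. \<exists>P. wf_prog (b + m) 4 P \<and> (\<forall>x. computes P b m (rep x) (rep (l x)) (B (\<mu> x + rsize x)))"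
    using l unfolding tc_def by blast
  obtain m' B' where B': "pb B'"
    and P': "\<And>b. \<exists>P. wf_prog (b + m') 4 P \<and> (\<forall>x. computes P b m' (rep x) (rep (i x)) (B' (\<mu> x + rsize x)))"
    using i unfolding tc_def by blast
  obtain m'' B'' where B'': "pb B''"
    and P'': "\<And>b. \<exists>P. wf_prog (b + m'') 4 P \<and> (\<forall>z. computes P b m'' (rep z) (rep (h (fst z) (fst (snd z)) (snd (snd z)))) (B'' (rsize z)))"
    using h unfolding tc_def by auto
  let ?m = "10 + m + m' + m''"
  \<comment> \<open>Time of one round: register operations linear in the data, plus a call of
    \<open>h\<close> on the triple of input, accumulator and list entry.\<close>
  define K where "K = (\<lambda>n. 100 * (n + Q n + B n) + 300 + B'' (n + Q n + B n + 2))"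
  let ?B = "\<lambda>n. 100 * (n + Q n + B n + B' n) + 100 + (B n + 1) * (K n + 1)"
  have pbK: "pb K" unfolding K_def
  proof (rule pb_add)
    show "pb (\<lambda>n. B'' (n + Q n + B n + 2))" using B B' B'' Q by (intro pb_comp[OF B''] pb_intros)
  qed (use B Q in \<open>intro pb_intros\<close>)
  show ?thesis
  proof (rule tcI[where B="?B" and m="?m"])
    show "pb ?B" using B B' Q pbK by (intro pb_intros)
    show "rsize (foldl (h x) (i x) (l x)) \<le> ?B (\<mu> x + rsize x)" for x
      using Q(2)[of x "length (l x)"] by simp
    fix b
    obtain L where L: "wf_prog (b + 1 + m) 4 L" "\<And>x. computes L (b + 1) m (rep x) (rep (l x)) (B (\<mu> x + rsize x))"
      using P[of "b + 1"] by blast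
    obtain I where I: "wf_prog (b + 2 + m') 4 I" "\<And>x. computes I (b + 2) m' (rep x) (rep (i x)) (B' (\<mu> x + rsize x))"
      using P'[of "b + 2"] by blast
    obtain H where H: "wf_prog (b + 6 + m'') 4 H" "\<And>z. computes H (b + 6) m'' (rep z) (rep (h (fst z) (fst (snd z)) (snd (snd z)))) (B'' (rsize z))"
      using P''[of "b + 6"] by blast
    \<comment> \<open>Register \<open>b\<close> keeps the input, \<open>b + 1\<close> the rest of
      the list, \<open>b + 2\<close> the accumulator; \<open>b + 3\<close> and \<open>b + 4\<close>
      receive head and tail, \<open>b + 5\<close> is first the counter of \<open>split\<close> and
      then holds an inner pair, and \<open>b + 6\<close> is the argument and result of
      \<open>H\<close>.\<close>
    let ?body = "split (b + 1) (b + 3) (b + 4) (b + 5) ;; mk (b + 5) (b + 2) (b + 3) ;; mk (b + 6) b (b + 5) ;;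
      erase (b + 5) ;; erase (b + 3) ;; H ;; move_reg (b + 2) (b + 6) ;; move_reg (b + 1) (b + 4)"
    let ?P = "copy (b + 1) b ;; L ;; copy (b + 2) b ;; I ;; While (b + 1) {2} ?body ;; move_reg b (b + 2)"
    show "\<exists>P. wf_prog (b + ?m) 4 P \<and> (\<forall>x. computes P b ?m (rep x) (rep (foldl (h x) (i x) (l x))) (?B (\<mu> x + rsize x)))"
    proof (intro exI[of _ ?P] conjI allI)
      show "wf_prog (b + ?m) 4 ?P" using L(1) I(1) H(1)
        by (auto elim!: wf_prog_mono simp: prog_defs)
      fix x
      let ?n = "\<mu> x + rsize x"
      show "computes ?P b ?m (rep x) (rep (foldl (h x) (i x) (l x))) (?B ?n)"
        unfolding computes_def
      proof (intro allI impI)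
        fix ts assume ts: "ts b = R (rep x) \<and> (\<forall>i. b < i \<and> i < b + ?m \<longrightarrow> ts i = R Lf)"
        then have ts1: "ts b = R (rep x)" "ts (b + 1) = R Lf" "ts (b + 2) = R Lf" "ts (b + 3) = R Lf"
          "ts (b + 4) = R Lf" "ts (b + 5) = R Lf" "ts (b + 6) = R Lf" by auto
        define S where "S = (\<lambda>(acc::'b) (rest::'c list). ts(b + 1 := R (rep rest), b + 2 := R (rep acc)))"
        have body: "ex ?body (S acc (y # rest)) (K ?n) (S (h x acc y) rest)"
          if le: "rsize acc \<le> Q ?n" "rsize (h x acc y) \<le> Q ?n" "rsize (y # rest) \<le> B ?n" for acc y rest
        proof -
          let ?z = "(x, acc, y)"
          let ?t1 = "(S acc (y # rest))(b + 3 := R (rep y), b + 4 := R (rep rest))"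
          let ?t2 = "?t1(b + 5 := R (rep (acc, y)))"
          let ?t3 = "?t2(b + 6 := R (rep ?z))"
          let ?t4 = "?t1(b + 6 := R (rep ?z))"
          let ?t5 = "(S acc (y # rest))(b + 4 := R (rep rest), b + 6 := R (rep ?z))"
          let ?t6 = "(S acc (y # rest))(b + 4 := R (rep rest), b + 6 := R (rep (h x acc y)))"
          let ?t7 = "(S (h x acc y) (y # rest))(b + 4 := R (rep rest))"
          have 1: "ex (split (b + 1) (b + 3) (b + 4) (b + 5)) (S acc (y # rest)) (20 * rsize (y # rest) + 20) ?t1"
            by (rule ex_eq[OF ex_split[of _ _ _ _ _ "rep y" "rep rest"]]) (use ts1 in \<open>auto simp: S_def\<close>)
          have 2: "ex (mk (b + 5) (b + 2) (b + 3)) ?t1 (8 * rsize acc + 8 * rsize y + 20) ?t2"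
            by (rule ex_eq[OF ex_mk[of _ _ _ _ "rep acc" "rep y"]]) (use ts1 in \<open>auto simp: S_def rep_prod_def\<close>)
          have 3: "ex (mk (b + 6) b (b + 5)) ?t2 (8 * rsize x + 8 * rsize (acc, y) + 20) ?t3"
            by (rule ex_eq[OF ex_mk[of _ _ _ _ "rep x" "rep (acc, y)"]]) (use ts1 in \<open>auto simp: S_def rep_prod_def\<close>)
          have 4: "ex (erase (b + 5)) ?t3 (4 * rsize (acc, y) + 10) ?t4"
            by (rule ex_eq[OF ex_erase[of _ _ "rep (acc, y)"]]) (use ts1 in \<open>auto simp: S_def fun_eq_iff\<close>)
          have 5: "ex (erase (b + 3)) ?t4 (4 * rsize y + 10) ?t5"
            by (rule ex_eq[OF ex_erase[of _ _ "rep y"]]) (use ts1 in \<open>auto simp: S_def fun_eq_iff\<close>)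
          have 6: "ex H ?t5 (B'' (rsize ?z)) ?t6"
            by (rule computesD[OF H(2)[of ?z]]) (use ts in \<open>auto simp: S_def\<close>)
          have 7: "ex (move_reg (b + 2) (b + 6)) ?t6 (4 * rsize acc + 12 * rsize (h x acc y) + 30) ?t7"
            by (rule ex_eq[OF ex_move_reg[of _ _ _ "rep acc" "rep (h x acc y)"]]) (use ts1 in \<open>auto simp: S_def fun_eq_iff\<close>)
          have 8: "ex (move_reg (b + 1) (b + 4)) ?t7 (4 * rsize (y # rest) + 12 * rsize rest + 30) (S (h x acc y) rest)"
            by (rule ex_eq[OF ex_move_reg[of _ _ _ "rep (y # rest)" "rep rest"]]) (use ts1 in \<open>auto simp: S_def fun_eq_iff\<close>)
          have "rsize ?z \<le> ?n + Q ?n + B ?n + 2" using le by simp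
          then have "B'' (rsize ?z) \<le> B'' (?n + Q ?n + B ?n + 2)" by (rule pb_mono[OF B''])
          then show ?thesis unfolding K_def
            by (intro ex_eq[OF ex.Seq[OF 1 ex.Seq[OF 2 ex.Seq[OF 3 ex.Seq[OF 4 ex.Seq[OF 5 ex.Seq[OF 6 ex.Seq[OF 7 8]]]]]]]])
              (use le in simp_all)
        qed
        have loop: "ex (While (b + 1) {2} ?body) (S (foldl (h x) (i x) p) r) (length r * (K ?n + 1) + 1) (S (foldl (h x) (i x) (l x)) [])"
          if "l x = p @ r" for p r
          using that
        proof (induction r arbitrary: p)
          case Nil
          have "rd (S (foldl (h x) (i x) p) []) (b + 1) \<notin> {2}" by (simp add: S_def read_R)
          then show ?case using Nil ex.WhileF by simp
        next
          case (Cons y r)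
          have rd: "rd (S (foldl (h x) (i x) p) (y # r)) (b + 1) \<in> {2}" by (simp add: S_def read_R)
          have "rsize (y # r) \<le> rsize (l x)" unfolding Cons.prems by (rule rsize_le_append(2))
          then have le3: "rsize (y # r) \<le> B ?n" using B(2)[of x] by linarith
          have le1: "rsize (foldl (h x) (i x) p) \<le> Q ?n"
            using Q(2)[of x "length p"] Cons.prems by simp
          have le2: "rsize (h x (foldl (h x) (i x) p) y) \<le> Q ?n"
            using Q(2)[of x "Suc (length p)"] Cons.prems by simp
          have IH: "ex (While (b + 1) {2} ?body) (S (h x (foldl (h x) (i x) p) y) r) (length r * (K ?n + 1) + 1) (S (foldl (h x) (i x) (l x)) [])"
            using Cons.IH[of "p @ [y]"] Cons.prems by simp
          show ?case by (rule ex_WhileT[OF rd body[OF le1 le2 le3] IH]) simp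
        qed
        have 1: "ex (copy (b + 1) b) ts (8 * rsize x + 10) (ts(b + 1 := R (rep x)))"
          using ts1 by (intro ex_copy) auto
        have 2: "ex L (ts(b + 1 := R (rep x))) (B ?n) (ts(b + 1 := R (rep (l x))))"
          by (rule computesD[OF L(2)]) (use ts in auto)
        have 3: "ex (copy (b + 2) b) (ts(b + 1 := R (rep (l x)))) (8 * rsize x + 10) (ts(b + 1 := R (rep (l x)), b + 2 := R (rep x)))"
          using ts1 by (intro ex_copy) auto
        have 4: "ex I (ts(b + 1 := R (rep (l x)), b + 2 := R (rep x))) (B' ?n) (S (i x) (l x))"
          by (rule computesD[OF I(2)]) (use ts in \<open>auto simp: S_def\<close>)
        have "(length (l x)) * (K ?n + 1) + 1 \<le> (B ?n + 1) * (K ?n + 1)"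
        proof -
          have "length (l x) \<le> B ?n" using length_le_rsize[of "l x"] B(2)[of x] by linarith
          then have "length (l x) * (K ?n + 1) \<le> B ?n * (K ?n + 1)" by (rule mult_le_mono1)
          then show ?thesis unfolding add_mult_distrib[of "B ?n" 1] mult_1 by (rule add_le_mono) simp
        qed
        then have 5: "ex (While (b + 1) {2} ?body) (S (i x) (l x)) ((B ?n + 1) * (K ?n + 1)) (S (foldl (h x) (i x) (l x)) [])"
          using loop[of "[]" "l x"] by (auto intro: ex.weaken)
        let ?r = "foldl (h x) (i x) (l x)"
        have 6: "ex (move_reg b (b + 2)) (S ?r []) (4 * rsize x + 12 * rsize ?r + 30) (ts(b := R (rep ?r)))"
          by (rule ex_eq[OF ex_move_reg[of _ _ _ "rep x" "rep ?r"]]) (use ts1 in \<open>auto simp: S_def fun_eq_iff\<close>)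
        show "ex ?P ts (?B ?n) (ts(b := R (rep ?r)))"
          by (rule ex_eq[OF ex.Seq[OF 1 ex.Seq[OF 2 ex.Seq[OF 3 ex.Seq[OF 4 ex.Seq[OF 5 6]]]]]])
            (use Q(2)[of x "length (l x)"] in simp_all)
      qed
    qed
  qed
qed

text \<open>Trees cannot be compared by a fold, but lists of truth values can: \<open>flat\<close>
  makes the symbols of a code available as data, and equality of all represented types is reduced to
  it.\<close>

definition flat :: "tree \<Rightarrow> bool list" where
  "flat t = map (\<lambda>s. s = 2) (code t)"

definition flatten_loop :: "nat \<Rightarrow> nat \<Rightarrow> prog" where
  "flatten_loop i j = While j {1, 2} (If j {1} (Put i 2 Right ;; Put i 1 Right)
     (Put i 2 Right ;; Put i 2 Right ;; Put i 1 Right ;; Put i 1 Right) ;; Mov j Right)"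

lemma ex_flatten_loop:
  "i \<noteq> j \<Longrightarrow> set w \<subseteq> {1, 2} \<Longrightarrow> ts j = zt l w \<Longrightarrow> ts i = zt li [] \<Longrightarrow>
    ex (flatten_loop i j) ts (7 * length w + 1) (ts(j := zt (rev w @ l) [],
      i := zt (rev (concat (map (\<lambda>s. 2 # code (rep (s = 2))) w)) @ li) []))"
proof (induction w arbitrary: l li ts)
  case Nil
  then show ?case using ex.WhileF[of ts j "{1, 2}"] by (simp add: fun_upd_idem flatten_loop_def)
next
  case (Cons a w)
  let ?c = "2 # code (rep (a = 2))"
  let ?t = "ts(i := zt (rev ?c @ li) [])"
  let ?b = "If j {1} (Put i 2 Right ;; Put i 1 Right) (Put i 2 Right ;; Put i 2 Right ;; Put i 1 Right ;; Put i 1 Right)"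
  have P: "ex (Put i s Right) (ts(i := zt q [])) 1 (ts(i := zt (s # q) []))" for s q
    by (intro ex_Put) simp
  have P0: "ex (Put i s Right) ts 1 (ts(i := zt (s # li) []))" for s
    using Cons.prems by (intro ex_Put) simp
  have "ex ?b ts 5 ?t"
  proof (cases "a = 1")
    case True
    have "ex (Put i 2 Right ;; Put i 1 Right) ts (1 + 1) (ts(i := zt (1 # 2 # li) []))"
      by (rule ex.Seq[OF P0 P])
    then show ?thesis using Cons.prems True by (intro ex_IfT) (auto simp: rep_bool_def)
  next
    case False
    then have a: "a = 2" using Cons.prems by auto
    have "ex (Put i 2 Right ;; Put i 2 Right ;; Put i 1 Right ;; Put i 1 Right) ts (1 + (1 + (1 + 1)))
        (ts(i := zt (1 # 1 # 2 # 2 # li) []))"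
      by (rule ex.Seq[OF P0 ex.Seq[OF P ex.Seq[OF P P]]])
    then show ?thesis using Cons.prems a by (intro ex_IfF) (auto simp: rep_bool_def)
  qed
  moreover have "ex (Mov j Right) ?t 1 (?t(j := zt (a # l) w))"
    using Cons.prems by (intro ex_Mov) simp
  ultimately have 1: "ex (?b ;; Mov j Right) ts 6 (?t(j := zt (a # l) w))"
    by (intro ex_Seq) auto
  have 2: "ex (flatten_loop i j) (?t(j := zt (a # l) w)) (7 * length w + 1)
      (ts(j := zt (rev (a # w) @ l) [], i := zt (rev (concat (map (\<lambda>s. 2 # code (rep (s = 2))) (a # w))) @ li) []))"
    by (rule ex_eq[OF Cons.IH[of "?t(j := zt (a # l) w)" "a # l" "rev ?c @ li"]])
       (use Cons.prems in \<open>auto simp: fun_eq_iff\<close>)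
  show ?case unfolding flatten_loop_def
    by (rule ex_WhileT[OF _ 1 2[unfolded flatten_loop_def]]) (use Cons.prems in auto)
qed

lemma code_flat: "code (rep (flat t)) = concat (map (\<lambda>s. 2 # code (rep (s = 2))) (code t)) @ [1]"
proof -
  have "code (rep (map (\<lambda>s. s = 2) w)) = concat (map (\<lambda>s. 2 # code (rep (s = 2))) w) @ [1]" for w :: "nat list"
    by (induction w) auto
  then show ?thesis by (simp add: flat_def)
qed

lemma rsize_flat: "rsize (flat t) \<le> 4 * tsize t + 1"
proof -
  have "rsize (map (\<lambda>s. s = 2) w) \<le> 4 * length w + 1" for w :: "nat list"
    by (induction w) (auto simp: rep_bool_def)
  then show ?thesis by (simp add: flat_def)
qed

lemma fp_flat: "fp flat"
proof (rule tcI[where B="\<lambda>n. 200 * n + 200" and m=2])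
  show "pb (\<lambda>n. 200 * n + 200)" by (intro pb_intros)
  show "rsize (flat x) \<le> 200 * (0 + rsize x) + 200" for x
    using rsize_flat[of x] by (simp add: rep_tree_def)
  fix b :: nat
  let ?P = "Put (b + 1) 0 Stay ;; flatten_loop (b + 1) b ;; Put (b + 1) 1 Right ;;
    rewind (b + 1) ;; rewind b ;; move_reg b (b + 1)"
  show "\<exists>P. wf_prog (b + 2) 4 P \<and> (\<forall>x. computes P b 2 (rep x) (rep (flat x)) (200 * (0 + rsize x) + 200))"
  proof (intro exI[of _ ?P] conjI allI)
    show "wf_prog (b + 2) 4 ?P" by (auto simp: prog_defs flatten_loop_def)
    fix x :: tree
    show "computes ?P b 2 (rep x) (rep (flat x)) (200 * (0 + rsize x) + 200)"
      unfolding computes_def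
    proof (intro allI impI)
      fix ts assume ts: "ts b = R (rep x) \<and> (\<forall>i. b < i \<and> i < b + 2 \<longrightarrow> ts i = R Lf)"
      have ts1: "ts b = R x" "ts (b + 1) = R Lf" using ts by (auto simp: rep_tree_def)
      let ?w = "code x" and ?c = "concat (map (\<lambda>s. 2 # code (rep (s = 2))) (code x))"
      let ?t2 = "ts(b := zt (rev ?w @ [3]) [], b + 1 := zt (rev ?c @ [3]) [])"
      let ?t3 = "ts(b := zt (rev ?w @ [3]) [], b + 1 := zt (rev (code (rep (flat x))) @ [3]) [])"
      let ?t4 = "ts(b := zt (rev ?w @ [3]) [], b + 1 := R (rep (flat x)))"
      let ?t5 = "ts(b + 1 := R (rep (flat x)))"
      have 1: "ex (Put (b + 1) 0 Stay) ts 1 (ts(b + 1 := zt [3] []))"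
        using ts1 by (intro ex_Put) (simp add: R_def)
      have 2: "ex (flatten_loop (b + 1) b) (ts(b + 1 := zt [3] [])) (7 * tsize x + 1) ?t2"
        by (rule ex_eq[OF ex_flatten_loop[of _ _ ?w _ "[3]" "[3]"]])
          (use ts1 code_set[of x] in \<open>auto simp: R_def fun_eq_iff\<close>)
      have 3: "ex (Put (b + 1) 1 Right) ?t2 1 ?t3"
        by (intro ex_Put) (simp add: code_flat)
      have 4: "ex (rewind (b + 1)) ?t3 (2 * rsize (flat x) + 4) ?t4"
        by (rule ex_eq[OF rewind_code[of _ b _ "rep (flat x)"]]) auto
      have 5: "ex (rewind b) ?t4 (2 * tsize x + 4) ?t5"
        by (rule ex_eq[OF rewind_code[of _ "b + 1" _ x]]) (use ts1 in \<open>auto simp: fun_eq_iff\<close>)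
      have 6: "ex (move_reg b (b + 1)) ?t5 (4 * tsize x + 12 * rsize (flat x) + 30) (ts(b := R (rep (flat x))))"
        by (rule ex_eq[OF ex_move_reg[of _ _ _ x "rep (flat x)"]]) (use ts1 in \<open>auto simp: fun_eq_iff\<close>)
      show "ex ?P ts (200 * (0 + rsize x) + 200) (ts(b := R (rep (flat x))))"
        by (rule ex_eq[OF ex.Seq[OF 1 ex.Seq[OF 2 ex.Seq[OF 3 ex.Seq[OF 4 ex.Seq[OF 5 6]]]]]])
          (use rsize_flat[of x] in \<open>simp_all add: rep_tree_def\<close>)
    qed
  qed
qed

declare One_nat_def [simp]

subsection \<open>Lists and numbers\<close>

named_theorems fp_intros

declare tc_id [fp_intros] tc_const [fp_intros] tc_pair [fp_intros] tc_fst [fp_intros]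
  tc_snd [fp_intros] tc_Cons [fp_intros] tc_if [fp_intros]

lemma tc_comp2:
  assumes "fp (\<lambda>z. h (fst z) (snd z))" "tc \<mu> f" "tc \<mu> g"
  shows "tc \<mu> (\<lambda>x. h (f x) (g x))"
  using fp_comp[OF assms(1) tc_pair[OF assms(2,3)]] by simp

lemma tc_flat_rep [fp_intros]: "tc \<mu> f \<Longrightarrow> tc \<mu> (\<lambda>x. flat (rep (f x)))"
  by (rule fp_comp[OF fp_flat fp_comp[OF tc_rep_eq[where f=rep]]]) (simp_all add: rep_tree_def)

text \<open>The first symbol of a code tells a branch from a leaf, and \<open>flat\<close> delivers
  it as a truth value.\<close>

lemma rep_nonleaf: "rep (t \<noteq> Lf) = thd (rep (flat (rep t)))"
  by (cases t) (auto simp: flat_def rep_tree_def rep_bool_def)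

lemma fp_nonleaf: "fp (\<lambda>t. t \<noteq> Lf)"
proof (rule tc_via)
  show "fp (\<lambda>t. thd (rep (flat t)))"
    by (rule fp_comp[OF fp_thd_ttl(1) fp_comp[OF tc_rep_eq[where f=rep] fp_flat]]) (simp add: rep_tree_def)
  show "rep (t \<noteq> Lf) = thd (rep (flat (rep t)))" for t
    by (rule rep_nonleaf)
qed

text \<open>If every round adds at most a polynomial in the size of input and list entry, then the
  accumulator is bounded by its initial size plus the number of rounds times that increment.\<close>

lemma tc_foldl_add:
  fixes l :: "'a::rep \<Rightarrow> 'c::rep list" and i :: "'a \<Rightarrow> 'b::rep"
  assumes l: "tc \<mu> l" and i: "tc \<mu> i" and h: "fp (\<lambda>z. h (fst z) (fst (snd z)) (snd (snd z)))"
    and Q: "pb Q" "\<And>x a y. rsize (h x a y) \<le> rsize a + Q (rsize x + rsize y)"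
  shows "tc \<mu> (\<lambda>x. foldl (h x) (i x) (l x))"
proof -
  obtain B where B: "pb B" "\<And>x. rsize (l x) \<le> B (\<mu> x + rsize x)" using l unfolding tc_def by blast
  obtain B' where B': "pb B'" "\<And>x. rsize (i x) \<le> B' (\<mu> x + rsize x)" using i unfolding tc_def by blast
  show ?thesis
  proof (rule tc_foldl[OF l i h])
    show "pb (\<lambda>n. B' n + B n * Q (n + B n))"
      by (intro pb_add pb_mult B(1) B'(1) pb_comp[OF Q(1)] pb_id)
    fix x k
    let ?n = "\<mu> x + rsize x"
    have "rsize (foldl (h x) a ys) \<le> rsize a + length ys * Q (?n + B ?n)" if "set ys \<subseteq> set (l x)" for ys a
      using that
    proof (induction ys arbitrary: a)
      case (Cons y ys)
      have "rsize y \<le> B ?n" using rsize_member[of y "l x"] B(2)[of x] Cons.prems by (auto intro: le_trans)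
      then have "Q (rsize x + rsize y) \<le> Q (?n + B ?n)" by (intro pb_mono[OF Q(1)]) simp
      then show ?case using Cons.IH[of "h x a y"] Cons.prems Q(2)[of x a y] by simp
    qed simp
    from this[OF set_take_subset, of "i x" k]
    have "rsize (foldl (h x) (i x) (take k (l x))) \<le> rsize (i x) + length (take k (l x)) * Q (?n + B ?n)" .
    also have "\<dots> \<le> B' ?n + B ?n * Q (?n + B ?n)"
    proof (rule add_le_mono[OF B'(2) mult_le_mono1])
      have "length (take k (l x)) \<le> length (l x)" by simp
      then show "length (take k (l x)) \<le> B ?n"
        using length_le_rsize[of "l x"] B(2)[of x] by linarith
    qed
    finally show "rsize (foldl (h x) (i x) (take k (l x))) \<le> B' ?n + B ?n * Q (?n + B ?n)" .
  qed
qed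

lemma tc_cong: "tc \<mu> f \<Longrightarrow> (\<And>x. f x = g x) \<Longrightarrow> tc \<mu> g"
  by (metis ext)

lemma fp_tl: "fp (tl :: 'a::rep list \<Rightarrow> 'a list)"
proof (rule tc_via[OF fp_thd_ttl(2)])
  show "rep (tl xs) = ttl (rep xs)" for xs :: "'a list" by (cases xs) auto
qed

lemmas tc_tl [fp_intros] = fp_comp[OF fp_tl]

lemma fp_hd: "fp (hd :: 'a::rep list \<Rightarrow> 'a)"
\<comment> \<open>\<open>hd []\<close> is some fixed value, so it can be written down as a
  constant.\<close>
proof (rule tc_via[OF tc_if[OF fp_nonleaf fp_thd_ttl(1) fp_const_tree[of _ "rep (hd [] :: 'a)"]]])
  show "rep (hd xs) = (if rep xs \<noteq> Lf then thd (rep xs) else rep (hd [] :: 'a))" for xs :: "'a list"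
    by (cases xs) auto
qed

lemmas tc_hd [fp_intros] = fp_comp[OF fp_hd]

lemma fp_nonempty: "fp (\<lambda>xs :: 'a::rep list. xs \<noteq> [])"
proof (rule tc_via)
  show "fp (\<lambda>t. thd (rep (flat t)))"
    by (rule fp_comp[OF fp_thd_ttl(1) fp_comp[OF tc_rep_eq[where f=rep] fp_flat]]) (simp add: rep_tree_def)
  show "rep (xs \<noteq> []) = thd (rep (flat (rep xs)))" for xs :: "'a list"
    using rep_nonleaf[of "rep xs"] by (cases xs) (auto simp: rep_tree_def)
qed

lemmas tc_nonempty = fp_comp[OF fp_nonempty]

lemma tc_not [fp_intros]: "tc \<mu> f \<Longrightarrow> tc \<mu> (\<lambda>x. \<not> f x)"
  by (rule tc_cong[OF tc_if[of \<mu> f "\<lambda>_. False" "\<lambda>_. True"]]) (auto simp: tc_const)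

lemma tc_conj [fp_intros]: "tc \<mu> f \<Longrightarrow> tc \<mu> g \<Longrightarrow> tc \<mu> (\<lambda>x. f x \<and> g x)"
  by (rule tc_cong[OF tc_if[of \<mu> f g "\<lambda>_. False"]]) (auto simp: tc_const)

lemma tc_disj [fp_intros]: "tc \<mu> f \<Longrightarrow> tc \<mu> g \<Longrightarrow> tc \<mu> (\<lambda>x. f x \<or> g x)"
  by (rule tc_cong[OF tc_if[of \<mu> f "\<lambda>_. True" g]]) (auto simp: tc_const)

lemma tc_null: "tc \<mu> f \<Longrightarrow> tc \<mu> (\<lambda>x. f x = [])"
  using tc_not[OF tc_nonempty, of \<mu> f] by simp

lemma tc_beq: "tc \<mu> f \<Longrightarrow> tc \<mu> g \<Longrightarrow> tc \<mu> (\<lambda>x. f x = (g x :: bool))"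
  by (rule tc_cong[OF tc_if[of \<mu> f g "\<lambda>x. \<not> g x"]]) (auto simp: tc_not)

lemma fp_rev: "fp (rev :: 'a::rep list \<Rightarrow> 'a list)"
proof -
  have "fp (\<lambda>xs :: 'a list. foldl (\<lambda>a y. y # a) [] xs)"
    by (rule tc_foldl_add[where Q="\<lambda>n. n + 1"]) (intro fp_intros pb_intros | simp)+
  then show ?thesis by (rule tc_cong) (simp add: foldl_conv_fold fold_Cons_rev)
qed

lemmas tc_rev [fp_intros] = fp_comp[OF fp_rev]

lemma fp_append: "fp (\<lambda>z :: 'a::rep list \<times> 'a list. fst z @ snd z)"
proof -
  have "fp (\<lambda>z :: 'a list \<times> 'a list. foldl (\<lambda>a y. y # a) (snd z) (rev (fst z)))"
    by (rule tc_foldl_add[where Q="\<lambda>n. n + 1"]) (intro fp_intros pb_intros | simp)+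
  then show ?thesis by (rule tc_cong) (simp add: foldl_conv_fold fold_Cons_rev)
qed

lemmas tc_append [fp_intros] = tc_comp2[OF fp_append]

lemma rsize_snoc: "rsize (xs @ [y]) = rsize xs + rsize y + 1"
  using rsize_append[of xs "[y]"] by simp

lemma foldl_map_snoc: "foldl (\<lambda>a y. a @ [g y]) a ys = a @ map g ys"
  by (induction ys arbitrary: a) auto

lemma tc_map [fp_intros]:
  assumes "tc \<mu> f" "fp (\<lambda>z. g (fst z) (snd z))"
  shows "tc \<mu> (\<lambda>x. map (g x) (f x))"
proof -
  obtain B where B: "pb B" "\<And>z. rsize (g (fst z) (snd z)) \<le> B (rsize z)"
    using assms(2) unfolding tc_def by auto
  have *: "fp (\<lambda>z. g (fst z) (snd (snd z)))"
    using tc_comp2[OF assms(2), of _ fst "\<lambda>z. snd (snd z)"] by (simp add: fp_intros)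
  have "tc \<mu> (\<lambda>x. foldl (\<lambda>a y. a @ [g x y]) [] (f x))"
  proof (rule tc_foldl_add[OF assms(1), where Q="\<lambda>n. B (n + 1) + 1"])
    show "pb (\<lambda>n. B (n + 1) + 1)" by (intro pb_add pb_comp[OF B(1)] pb_intros)
    show "rsize (a @ [g x y]) \<le> rsize a + (B (rsize x + rsize y + 1) + 1)" for x a y
      using B(2)[of "(x, y)"] by (simp add: rsize_snoc)
  qed (intro fp_intros *)+
  then show ?thesis by (simp add: foldl_map_snoc)
qed

lemma tc_filter [fp_intros]:
  assumes "tc \<mu> f" "fp (\<lambda>z. g (fst z) (snd z))"
  shows "tc \<mu> (\<lambda>x. filter (g x) (f x))"
proof -
  have *: "fp (\<lambda>z. g (fst z) (snd (snd z)))"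
    using tc_comp2[OF assms(2), of _ fst "\<lambda>z. snd (snd z)"] by (simp add: fp_intros)
  have "tc \<mu> (\<lambda>x. foldl (\<lambda>a y. if g x y then a @ [y] else a) [] (f x))"
  proof (rule tc_foldl_add[OF assms(1), where Q="\<lambda>n. n + 1"])
    show "rsize (if g x y then a @ [y] else a) \<le> rsize a + (rsize x + rsize y + 1)" for x a y
      by (simp add: rsize_snoc)
  qed (intro fp_intros pb_intros *)+
  moreover have "foldl (\<lambda>a y. if g x y then a @ [y] else a) a ys = a @ filter (g x) ys" for x a ys
    by (induction ys arbitrary: a) auto
  ultimately show ?thesis by simp
qed

lemma tc_concat [fp_intros]:
  fixes f :: "'a::rep \<Rightarrow> 'b::rep list list"
  assumes "tc \<mu> f"
  shows "tc \<mu> (\<lambda>x. concat (f x))"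
proof -
  have "tc \<mu> (\<lambda>x. foldl (@) [] (f x))"
  proof (rule tc_foldl_add[OF assms, where Q="\<lambda>n. n"])
    show "rsize (a @ y) \<le> rsize a + (rsize x + rsize y)" for x :: 'a and a y :: "'b list"
      using rsize_append[of a y] by simp
  qed (intro fp_intros pb_intros)+
  moreover have "foldl (@) a ys = a @ concat ys" for a :: "'b list" and ys
    by (induction ys arbitrary: a) auto
  ultimately show ?thesis by simp
qed

lemma tc_list_ex [fp_intros]:
  assumes "tc \<mu> f" "fp (\<lambda>z. g (fst z) (snd z))"
  shows "tc \<mu> (\<lambda>x. list_ex (g x) (f x))"
  using tc_nonempty[OF tc_filter[OF assms(1), of "g"]] assms(2)
  by (simp add: filter_empty_conv list_ex_iff)

lemma fp_bool_list_eq: "fp (\<lambda>z. fst z = (snd z :: bool list))"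
proof -
  let ?h = "\<lambda>(p :: bool \<times> bool list) (y :: bool). (fst p \<and> snd p \<noteq> [] \<and> hd (snd p) = y, tl (snd p))"
  have "fp (\<lambda>z. foldl ?h (True, snd z) (fst z))"
  proof (rule tc_foldl_add[where Q="\<lambda>n. 3"])
    have tl: "rsize (tl xs) \<le> rsize xs" for xs :: "bool list" by (cases xs) auto
    have "rsize (?h a y) \<le> rsize a + 3" for a y
      using tl[of "snd a"] rsize_bool[of "fst (?h a y)"] by (cases a) simp
    then show "rsize (?h a y) \<le> rsize a + 3" for a y .
  qed (intro fp_intros pb_intros tc_nonempty tc_beq)+
  then have "fp (\<lambda>z. (\<lambda>p. fst p \<and> snd p = []) (foldl ?h (True, snd z) (fst z)))"
    by (intro fp_intros tc_null)
  moreover have "(fst (foldl ?h (b, ys) xs) \<and> snd (foldl ?h (b, ys) xs) = []) = (b \<and> xs = ys)" for b xs ys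
  proof (induction xs arbitrary: b ys)
    case (Cons x xs)
    then show ?case by (cases ys) auto
  qed auto
  ultimately show ?thesis by simp
qed

lemma code_inj: "code a @ r = code b @ s \<Longrightarrow> a = b \<and> r = s"
proof (induction a arbitrary: b r s)
  case Lf
  show ?case using Lf.prems by (cases b) simp_all
next
  case (Br a1 a2)
  obtain b1 b2 where b: "b = Br b1 b2" using Br.prems by (cases b) simp_all
  then have "code a1 @ (code a2 @ r) = code b1 @ (code b2 @ s)" using Br.prems by simp
  from Br.IH(1)[OF this] have "a1 = b1" "code a2 @ r = code b2 @ s" by auto
  then show ?case using Br.IH(2) b by blast
qed

lemma flat_inj: "flat a = flat b \<Longrightarrow> a = b"
proof -
  assume a: "flat a = flat b"
  have "code t = map (\<lambda>c. if c then 2 else 1) (flat t)" for t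
    using code_set[of t] unfolding flat_def by (auto intro!: map_idI[symmetric] simp: o_def)
  then have "code a = code b" using a by metis
  then show "a = b" using code_inj[of a "[]" b "[]"] by simp
qed

lemma tc_eq [fp_intros]:
  fixes f :: "'a::rep \<Rightarrow> 'b::rep"
  shows "tc \<mu> f \<Longrightarrow> tc \<mu> g \<Longrightarrow> tc \<mu> (\<lambda>x. f x = g x)"
proof -
  assume "tc \<mu> f" "tc \<mu> g"
  then have "tc \<mu> (\<lambda>x. flat (rep (f x)) = flat (rep (g x)))"
    by (intro tc_comp2[OF fp_bool_list_eq] fp_intros)
  moreover have "(flat (rep a) = flat (rep b)) = (a = b)" for a b :: 'b
    using flat_inj rep_inj by blast
  ultimately show ?thesis by simp
qed

lemma tc_member [fp_intros]:
  fixes f :: "'a::rep \<Rightarrow> 'b::rep"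
  shows "tc \<mu> f \<Longrightarrow> tc \<mu> g \<Longrightarrow> tc \<mu> (\<lambda>x. f x \<in> set (g x))"
proof -
  assume "tc \<mu> f" "tc \<mu> g"
  moreover have "fp (\<lambda>z :: 'b \<times> 'b list. list_ex (\<lambda>y. fst z = y) (snd z))" by (intro fp_intros)
  ultimately have "tc \<mu> (\<lambda>x. list_ex (\<lambda>y. f x = y) (g x))"
    using tc_comp2[where h="\<lambda>a. list_ex (\<lambda>y. a = y)"] by blast
  then show ?thesis by (simp add: list_ex_iff)
qed

lemma tc_remdups [fp_intros]:
  fixes f :: "'a::rep \<Rightarrow> 'b::rep list"
  assumes "tc \<mu> f"
  shows "tc \<mu> (\<lambda>x. remdups (f x))"
proof -
  let ?h = "\<lambda>a y. if y \<in> set a then a else y # a"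
  have "tc \<mu> (\<lambda>x. foldl ?h [] (rev (f x)))"
    by (rule tc_foldl_add[where Q="\<lambda>n. n + 1"]) (intro fp_intros pb_intros assms | simp)+
  moreover have "foldl ?h [] (rev xs) = remdups xs" for xs :: "'b list"
    by (induction xs) auto
  ultimately show ?thesis by simp
qed

lemma fp_zip: "fp (\<lambda>z :: 'b::rep list \<times> 'c::rep list. zip (fst z) (snd z))"
proof -
  let ?h = "\<lambda>(p :: ('b \<times> 'c) list \<times> 'c list) (y :: 'b).
    if snd p = [] then p else (fst p @ [(y, hd (snd p))], tl (snd p))"
  have "fp (\<lambda>z. foldl ?h ([], snd z) (fst z))"
  proof (rule tc_foldl_add[where Q="\<lambda>n. n + 2"])
    have "rsize (?h (p, q) y) \<le> rsize (p, q) + (n + rsize y + 2)" for p q y n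
      by (cases q) (auto simp: rsize_snoc)
    then show "rsize (?h a y) \<le> rsize a + (rsize x + rsize y + 2)" for x :: "'b list \<times> 'c list" and a y
      by (cases a) blast
  qed (intro fp_intros pb_intros)+
  then have "fp (\<lambda>z. fst (foldl ?h ([], snd z) (fst z)))" by (intro fp_intros)
  moreover have "fst (foldl ?h (acc, ys) xs) = acc @ zip xs ys" for acc xs ys
  proof (induction xs arbitrary: acc ys)
    case (Cons x xs) then show ?case by (cases ys) auto
  qed simp
  ultimately show ?thesis by simp
qed

lemmas tc_zip [fp_intros] = tc_comp2[OF fp_zip]

text \<open>Loops over a number become folds over a list of units, which is the same tree.\<close>

lemma fp_units: "fp (\<lambda>n. replicate n ())"
proof (rule tc_rep_eq)
  show "rep (replicate n ()) = rep n" for n by (induction n) (auto simp: rep_unit_def)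
qed

lemmas tc_units [fp_intros] = fp_comp[OF fp_units]

lemma tc_replicate [fp_intros]:
  fixes g :: "'a::rep \<Rightarrow> 'b::rep"
  assumes "tc \<mu> f" "tc \<mu> g"
  shows "tc \<mu> (\<lambda>x. replicate (f x) (g x))"
proof -
  have "fp (\<lambda>z :: nat \<times> 'b. map (\<lambda>_. snd z) (replicate (fst z) ()))" by (intro fp_intros)
  then have "fp (\<lambda>z :: nat \<times> 'b. replicate (fst z) (snd z))" by (simp add: map_replicate)
  then show ?thesis using tc_comp2 assms by blast
qed

lemma fp_Suc: "fp Suc"
proof -
  have "fp (\<lambda>p :: unit \<times> nat. Suc (snd p))"
    by (rule tc_rep_eq) (simp add: rep_prod_def rep_unit_def)
  from fp_comp[OF this, of "\<lambda>_. 0" "\<lambda>n. ((), n)"] show ?thesis by (simp add: fp_intros)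
qed

lemmas tc_Suc [fp_intros] = fp_comp[OF fp_Suc]

lemma tc_length [fp_intros]:
  fixes f :: "'a::rep \<Rightarrow> 'b::rep list"
  assumes "tc \<mu> f"
  shows "tc \<mu> (\<lambda>x. length (f x))"
proof -
  have "tc \<mu> (\<lambda>x. foldl (\<lambda>a _. Suc a) 0 (f x))"
    by (rule tc_foldl_add[where Q="\<lambda>n. 2"]) (intro fp_intros pb_intros assms | simp)+
  moreover have "foldl (\<lambda>a _. Suc a) n ys = n + length ys" for n and ys :: "'b list"
    by (induction ys arbitrary: n) auto
  ultimately show ?thesis by simp
qed

lemma tc_plus [fp_intros]:
  assumes "tc \<mu> f" "tc \<mu> g"
  shows "tc \<mu> (\<lambda>x. f x + g x :: nat)"
proof -
  have "tc \<mu> (\<lambda>x. length (replicate (f x) () @ replicate (g x) ()))" by (intro fp_intros assms)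
  then show ?thesis by simp
qed

lemma tc_drop [fp_intros]:
  fixes g :: "'a::rep \<Rightarrow> 'b::rep list"
  assumes "tc \<mu> f" "tc \<mu> g"
  shows "tc \<mu> (\<lambda>x. drop (f x) (g x))"
proof -
  have "tc \<mu> (\<lambda>x. foldl (\<lambda>a _. tl a) (g x) (replicate (f x) ()))"
  proof (rule tc_foldl_add[where Q="\<lambda>n. 0"])
    have "rsize (tl a) \<le> rsize a" for a :: "'b list" by (cases a) auto
    then show "rsize (tl a) \<le> rsize a + 0" for a :: "'b list" by simp
  qed (intro fp_intros pb_intros assms)+
  moreover have "foldl (\<lambda>a _. tl a) ys (replicate n ()) = drop n ys" for n and ys :: "'b list"
    by (induction n arbitrary: ys) (auto simp: drop_Suc)
  ultimately show ?thesis by simp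
qed

lemma tc_take [fp_intros]:
  fixes g :: "'a::rep \<Rightarrow> 'b::rep list"
  assumes "tc \<mu> f" "tc \<mu> g"
  shows "tc \<mu> (\<lambda>x. take (f x) (g x))"
proof -
  have "tc \<mu> (\<lambda>x. map snd (zip (replicate (f x) ()) (g x)))" by (intro fp_intros assms)
  moreover have "map snd (zip (replicate n ()) ys) = take n ys" for n and ys :: "'b list"
    by (simp add: map_snd_zip_take min_def)
  ultimately show ?thesis by simp
qed

lemma tc_less [fp_intros]:
  assumes "tc \<mu> f" "tc \<mu> g"
  shows "tc \<mu> (\<lambda>x. f x < (g x :: nat))"
proof -
  have "tc \<mu> (\<lambda>x. drop (f x) (replicate (g x) ()) \<noteq> [])" by (intro fp_intros tc_nonempty assms)
  then show ?thesis by (rule tc_cong) auto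
qed

text \<open>The entry appended in a round grows with the accumulator, so the partial results are
  bounded directly, by a quadratic polynomial.\<close>

lemma tc_upt [fp_intros]:
  assumes "tc \<mu> f"
  shows "tc \<mu> (\<lambda>x. [0..<f x])"
proof -
  obtain B where B: "pb B" "\<And>x. rsize (f x) \<le> B (\<mu> x + rsize x)" using assms unfolding tc_def by blast
  have "tc \<mu> (\<lambda>x. foldl (\<lambda>a _. a @ [length a]) [] (replicate (f x) ()))"
  proof (rule tc_foldl[where Q="\<lambda>n. B n * (2 * B n + 2) + 1"])
    show "pb (\<lambda>n. B n * (2 * B n + 2) + 1)" by (intro pb_intros B(1))
    fix x k
    have e: "foldl (\<lambda>a _. a @ [length a]) [] (replicate n ()) = [0..<n]" for n
      by (induction n) (simp_all add: replicate_append_same[symmetric])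
    have s: "rsize [0..<n] \<le> n * (2 * n + 2) + 1" for n
    proof (induction n)
      case (Suc n)
      then show ?case by (simp add: rsize_snoc rsize_nat)
    qed simp
    let ?n = "\<mu> x + rsize x"
    have m: "min k (f x) \<le> B ?n" using B(2)[of x] rsize_nat[of "f x"] by linarith
    have "rsize (foldl (\<lambda>a _. a @ [length a]) [] (take k (replicate (f x) ()))) \<le> min k (f x) * (2 * min k (f x) + 2) + 1"
      using s[of "min k (f x)"] by (simp add: e)
    also have "\<dots> \<le> B ?n * (2 * B ?n + 2) + 1" using m by (intro add_mono mult_le_mono) auto
    finally show "rsize (foldl (\<lambda>a _. a @ [length a]) [] (take k (replicate (f x) ()))) \<le> B ?n * (2 * B ?n + 2) + 1" .
  qed (intro fp_intros assms)+
  moreover have "foldl (\<lambda>a _. a @ [length a]) [] (replicate n ()) = [0..<n]" for n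
    by (induction n) (simp_all add: replicate_append_same[symmetric])
  ultimately show ?thesis by simp
qed

lemma tc_product [fp_intros]:
  fixes f :: "'a::rep \<Rightarrow> 'b::rep list" and g :: "'a \<Rightarrow> 'c::rep list"
  assumes "tc \<mu> f" "tc \<mu> g"
  shows "tc \<mu> (\<lambda>x. List.product (f x) (g x))"
proof -
  have "fp (\<lambda>z :: 'b list \<times> 'c list. concat (map (\<lambda>y. map (\<lambda>w. (y, w)) (snd z)) (fst z)))"
    by (intro fp_intros)
  then show ?thesis using tc_comp2[where h=List.product, OF _ assms] by (simp add: product_concat_map)
qed

section \<open>Linearity testing\<close>

definition sdiff :: "'a set \<Rightarrow> 'a set \<Rightarrow> 'a set" (infixl "\<triangle>" 65) where
  "A \<triangle> B = (A - B) \<union> (B - A)"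

lemma mem_sdiff: "x \<in> A \<triangle> B \<longleftrightarrow> (x \<in> A) \<noteq> (x \<in> B)"
  by (auto simp: sdiff_def)

lemma sdiff_simps [simp]:
  "A \<triangle> A = {}" "A \<triangle> {} = A" "{} \<triangle> A = A" "A \<triangle> (A \<triangle> B) = B"
  by (auto simp: sdiff_def)

lemma sdiff_assoc: "A \<triangle> B \<triangle> C = A \<triangle> (B \<triangle> C)"
  by (auto simp: sdiff_def)

lemma sdiff_commute: "A \<triangle> B = B \<triangle> A"
  by (auto simp: sdiff_def)

lemma sdiff_left_commute: "A \<triangle> (B \<triangle> C) = B \<triangle> (A \<triangle> C)"
  by (auto simp: sdiff_def)

lemmas sdiff_ac = sdiff_assoc sdiff_commute sdiff_left_commute

lemma sdiff_eq_empty: "A \<triangle> B = {} \<longleftrightarrow> A = B"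
  by (auto simp: sdiff_def)

lemma sdiff_subset: "A \<subseteq> J \<Longrightarrow> B \<subseteq> J \<Longrightarrow> A \<triangle> B \<subseteq> J"
  by (auto simp: sdiff_def)

lemma sdiff_subset_iff: "A \<subseteq> J \<Longrightarrow> A \<triangle> B \<subseteq> J \<longleftrightarrow> B \<subseteq> J"
  by (metis sdiff_simps(4) sdiff_subset)

lemma sdiff_left_cancel: "A \<triangle> B = A \<triangle> C \<longleftrightarrow> B = C"
  by (metis sdiff_simps(4))

lemma odd_card_sdiff:
  assumes "finite A" "finite B"
  shows "odd (card (A \<triangle> B)) \<longleftrightarrow> odd (card A) \<noteq> odd (card B)"
proof -
  have "card (A \<triangle> B) = card (A - B) + card (B - A)"
    unfolding sdiff_def using assms by (intro card_Un_disjoint) auto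
  moreover have "card A = card (A - B) + card (A \<inter> B)"
    using assms card_Int_Diff[of A B] by simp
  moreover have "card B = card (B - A) + card (A \<inter> B)"
    using assms card_Int_Diff[of B A] by (simp add: Int_commute)
  ultimately show ?thesis by presburger
qed

definition additive_on :: "'a set \<Rightarrow> ('a set \<Rightarrow> 'b set) \<Rightarrow> bool" where
  "additive_on J g \<longleftrightarrow> (\<forall>A B. A \<subseteq> J \<longrightarrow> B \<subseteq> J \<longrightarrow> g (A \<triangle> B) = g A \<triangle> g B)"

lemma additive_onD: "additive_on J g \<Longrightarrow> A \<subseteq> J \<Longrightarrow> B \<subseteq> J \<Longrightarrow> g (A \<triangle> B) = g A \<triangle> g B"
  by (auto simp: additive_on_def)

lemma card_shift:
  "A \<subseteq> J \<Longrightarrow> card {y \<in> Pow J. P (A \<triangle> y)} = card {y \<in> Pow J. P y}"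
proof (rule bij_betw_same_card)
  assume A: "A \<subseteq> J"
  show "bij_betw (\<lambda>y. A \<triangle> y) {y \<in> Pow J. P (A \<triangle> y)} {y \<in> Pow J. P y}"
    by (rule bij_betw_byWitness[where f'="\<lambda>y. A \<triangle> y"]) (use A sdiff_subset_iff[OF A] in auto)
qed

text \<open>The linearity test of Blum, Luby and Rubinfeld, for functions whose values are vectors
  too. Each \<open>y\<close> votes for the value \<open>f (x \<triangle> y) \<triangle> f y\<close>
  at \<open>x\<close>; nearly all votes agree, and their choice is \<open>g\<close>. With a failure
  rate of at most 1/7, three exceptional sets of twice that rate do not cover the space.\<close>

lemma blr:
  fixes f :: "'a set \<Rightarrow> 'b set"
  assumes J: "finite J"
    and few: "7 * card {(x, y) \<in> Pow J \<times> Pow J. f x \<triangle> f y \<noteq> f (x \<triangle> y)} \<le> card (Pow J) ^ 2"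
  shows "\<exists>g. additive_on J g \<and>
    card (Pow J) * card {x \<in> Pow J. f x \<noteq> g x} \<le> 2 * card {(x, y) \<in> Pow J \<times> Pow J. f x \<triangle> f y \<noteq> f (x \<triangle> y)}"
proof -
  let ?V = "Pow J"
  define B where "B = {(x, y) \<in> ?V \<times> ?V. f x \<triangle> f y \<noteq> f (x \<triangle> y)}"
  define N where "N = card ?V"
  have finV: "finite ?V" using J by simp
  have finB: "finite B" unfolding B_def using finV by (auto intro: finite_subset[of _ "?V \<times> ?V"])
  have N: "N > 0" unfolding N_def using J by (simp add: card_Pow)
  have few': "7 * card B \<le> N * N" using few unfolding B_def N_def by (simp add: power2_eq_square)
  \<comment> \<open>If the tests at \<open>(x \<triangle> y, z)\<close> and
    \<open>(x \<triangle> z, y)\<close> both succeed, then both sides equal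
    \<open>f (x \<triangle> y \<triangle> z)\<close> and the votes of \<open>y\<close> and
    \<open>z\<close> agree. So at most \<open>2 * card B\<close> pairs disagree, and some
    \<open>z\<close> disagrees with at most the average number of \<open>y\<close>.\<close>
  have vote: "\<exists>w. N * card {y \<in> ?V. f (x \<triangle> y) \<triangle> f y \<noteq> w} \<le> 2 * card B" if x: "x \<in> ?V" for x
  proof -
    let ?D = "{(y, z) \<in> ?V \<times> ?V. f (x \<triangle> y) \<triangle> f y \<noteq> f (x \<triangle> z) \<triangle> f z}"
    have finD: "finite ?D" using finV by (auto intro: finite_subset[of _ "?V \<times> ?V"])
    let ?D1 = "{(y, z) \<in> ?V \<times> ?V. (x \<triangle> y, z) \<in> B}"
    let ?D2 = "{(y, z) \<in> ?V \<times> ?V. (x \<triangle> z, y) \<in> B}"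
    have fin12: "finite ?D1" "finite ?D2" using finV by (auto intro: finite_subset[of _ "?V \<times> ?V"])
    have "?D \<subseteq> ?D1 \<union> ?D2"
    proof
      fix p assume "p \<in> ?D"
      then obtain y z where p: "p = (y, z)"
        and yz: "y \<subseteq> J" "z \<subseteq> J" "f (x \<triangle> y) \<triangle> f y \<noteq> f (x \<triangle> z) \<triangle> f z" by auto
      show "p \<in> ?D1 \<union> ?D2"
      proof (cases "(x \<triangle> z, y) \<in> B")
        case False
        then have "f (x \<triangle> z) \<triangle> f y = f (x \<triangle> y \<triangle> z)"
          using yz x by (auto simp: B_def sdiff_ac sdiff_subset_iff)
        then have "f (x \<triangle> y) \<triangle> f z \<noteq> f (x \<triangle> y \<triangle> z)"
          using yz(3) by (metis sdiff_assoc sdiff_commute sdiff_simps(1,2))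
        then show ?thesis using yz x p by (auto simp: B_def sdiff_subset_iff)
      qed (use yz p in auto)
    qed
    then have "card ?D \<le> card ?D1 + card ?D2"
      using fin12 by (meson card_Un_le card_mono finite_UnI le_trans)
    moreover have "card ?D1 \<le> card B"
      by (rule card_inj_on_le[of "\<lambda>(y, z). (x \<triangle> y, z)"]) (auto simp: inj_on_def sdiff_left_cancel finB)
    moreover have "card ?D2 \<le> card B"
      by (rule card_inj_on_le[of "\<lambda>(y, z). (x \<triangle> z, y)"]) (auto simp: inj_on_def sdiff_left_cancel finB)
    ultimately have D: "card ?D \<le> 2 * card B" by simp
    have cD: "card ?D = (\<Sum>z\<in>?V. card {y \<in> ?V. f (x \<triangle> y) \<triangle> f y \<noteq> f (x \<triangle> z) \<triangle> f z})"
    proof -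
      have "card ?D = card (SIGMA z:?V. {y \<in> ?V. f (x \<triangle> y) \<triangle> f y \<noteq> f (x \<triangle> z) \<triangle> f z})"
        by (rule bij_betw_same_card[of "\<lambda>(y, z). (z, y)"])
          (auto intro!: bij_betw_byWitness[where f'="\<lambda>(y, z). (z, y)"])
      then show ?thesis using finV by simp
    qed
    show ?thesis
    proof (rule ccontr)
      assume "\<not> ?thesis"
      then have "2 * card B < N * card {y \<in> ?V. f (x \<triangle> y) \<triangle> f y \<noteq> f (x \<triangle> z) \<triangle> f z}" for z
        by (meson not_le)
      then have "(\<Sum>z\<in>?V. 2 * card B) < (\<Sum>z\<in>?V. N * card {y \<in> ?V. f (x \<triangle> y) \<triangle> f y \<noteq> f (x \<triangle> z) \<triangle> f z})"
        using finV by (intro sum_strict_mono) auto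
      then have "N * (2 * card B) < N * card ?D"
        unfolding cD by (simp add: sum_distrib_left N_def)
      then show False using D by simp
    qed
  qed
  define g where "g x = (SOME w. N * card {y \<in> ?V. f (x \<triangle> y) \<triangle> f y \<noteq> w} \<le> 2 * card B)" for x
  have g: "N * card {y \<in> ?V. f (x \<triangle> y) \<triangle> f y \<noteq> g x} \<le> 2 * card B" if "x \<in> ?V" for x
    using someI_ex[OF vote[OF that]] unfolding g_def .
  have "additive_on J g" unfolding additive_on_def
  proof (intro allI impI)
    fix A B' assume AB: "A \<subseteq> J" "B' \<subseteq> J"
    \<comment> \<open>A vector \<open>y\<close> outside three sets of dissenters gives all three
      values of \<open>g\<close> by votes at the same points, and these votes telescope.\<close>
    let ?S = "\<lambda>x. {y \<in> ?V. f (x \<triangle> y) \<triangle> f y \<noteq> g x}"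
    let ?Y2 = "{y \<in> ?V. f (B' \<triangle> (A \<triangle> y)) \<triangle> f (A \<triangle> y) \<noteq> g B'}"
    have c2: "card ?Y2 = card (?S B')" by (rule card_shift[OF AB(1)])
    have "N * card (?S A \<union> ?Y2 \<union> ?S (A \<triangle> B')) \<le> N * (card (?S A) + card ?Y2 + card (?S (A \<triangle> B')))"
      by (intro mult_le_mono2) (meson card_Un_le le_trans add_le_mono1)
    also have "\<dots> \<le> 6 * card B"
      using g[of A] g[of B'] g[of "A \<triangle> B'"] AB sdiff_subset[of A J B'] c2 by (simp add: distrib_left)
    also have "\<dots> < N * N" using few' N by (cases "card B = 0") auto
    finally have "card (?S A \<union> ?Y2 \<union> ?S (A \<triangle> B')) < card ?V" by (simp add: N_def)
    moreover have "card ?V \<le> card (?S A \<union> ?Y2 \<union> ?S (A \<triangle> B'))" if "?V \<subseteq> ?S A \<union> ?Y2 \<union> ?S (A \<triangle> B')"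
      using that finV by (intro card_mono) simp_all
    ultimately have "\<not> ?V \<subseteq> ?S A \<union> ?Y2 \<union> ?S (A \<triangle> B')" by linarith
    then obtain y where y: "y \<in> ?V" "y \<notin> ?S A" "y \<notin> ?Y2" "y \<notin> ?S (A \<triangle> B')" by blast
    then have "f (A \<triangle> y) \<triangle> f y = g A" "f (B' \<triangle> (A \<triangle> y)) \<triangle> f (A \<triangle> y) = g B'"
      "f (A \<triangle> B' \<triangle> y) \<triangle> f y = g (A \<triangle> B')" by auto
    then show "g (A \<triangle> B') = g A \<triangle> g B'"
      by (metis (no_types, lifting) sdiff_assoc sdiff_commute sdiff_simps(4))
  qed
  moreover have "N * card {x \<in> ?V. f x \<noteq> g x} \<le> 2 * card B"
  proof -
    let ?D = "{x \<in> ?V. f x \<noteq> g x}"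
    \<comment> \<open>If \<open>f x\<close> differs from \<open>g x\<close>, the test at
      \<open>x\<close> fails for every \<open>y\<close> that votes for \<open>g x\<close>. These are
      at least half of all \<open>y\<close>, since the dissenters have density at most 2/7.\<close>
    have half: "N \<le> 2 * card {y \<in> ?V. (x, y) \<in> B}" if x: "x \<in> ?D" for x
    proof -
      have "?V \<subseteq> {y \<in> ?V. (x, y) \<in> B} \<union> {y \<in> ?V. f (x \<triangle> y) \<triangle> f y \<noteq> g x}"
      proof
        fix y assume y: "y \<in> ?V"
        have "f x \<triangle> f y \<noteq> f (x \<triangle> y)" if "f (x \<triangle> y) \<triangle> f y = g x"
        proof
          assume e: "f x \<triangle> f y = f (x \<triangle> y)"
          have "f (x \<triangle> y) \<triangle> f y = f x" unfolding e[symmetric] by (simp add: sdiff_assoc)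
          then show False using that x by simp
        qed
        then show "y \<in> {y \<in> ?V. (x, y) \<in> B} \<union> {y \<in> ?V. f (x \<triangle> y) \<triangle> f y \<noteq> g x}"
          using x y by (auto simp: B_def)
      qed
      then have "N \<le> card ({y \<in> ?V. (x, y) \<in> B} \<union> {y \<in> ?V. f (x \<triangle> y) \<triangle> f y \<noteq> g x})"
        unfolding N_def using finV by (intro card_mono) auto
      also have "\<dots> \<le> card {y \<in> ?V. (x, y) \<in> B} + card {y \<in> ?V. f (x \<triangle> y) \<triangle> f y \<noteq> g x}"
        by (rule card_Un_le)
      finally have 1: "N \<le> card {y \<in> ?V. (x, y) \<in> B} + card {y \<in> ?V. f (x \<triangle> y) \<triangle> f y \<noteq> g x}" .
      have "2 * (N * card {y \<in> ?V. f (x \<triangle> y) \<triangle> f y \<noteq> g x}) \<le> N * N"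
        using g[of x, OF CollectD[OF x, THEN conjunct1]] few' by linarith
      then have "2 * card {y \<in> ?V. f (x \<triangle> y) \<triangle> f y \<noteq> g x} \<le> N"
        using N unfolding mult.left_commute[of 2] mult_le_cancel1 by blast
      then show ?thesis using 1 by simp
    qed
    have "card ?D * N \<le> (\<Sum>x\<in>?D. 2 * card {y \<in> ?V. (x, y) \<in> B})"
      using sum_mono[of ?D "\<lambda>_. N", OF half] by simp
    also have "\<dots> = 2 * card (SIGMA x:?D. {y \<in> ?V. (x, y) \<in> B})"
      using finV by (simp add: sum_distrib_left)
    also have "\<dots> \<le> 2 * card B"
      by (intro mult_le_mono2 card_mono finB) auto
    finally show ?thesis by (simp add: mult.commute)
  qed
  ultimately show ?thesis unfolding B_def N_def by blast
qed

text \<open>Adding \<open>Z\<close> maps the kernel injectively into its complement.\<close>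

lemma half_nonzero:
  assumes X: "finite X" and h: "additive_on X h" and Z: "Z \<subseteq> X" "h Z \<noteq> {}"
  shows "card (Pow X) \<le> 2 * card {A \<in> Pow X. h A \<noteq> {}}"
proof -
  let ?K = "{A \<in> Pow X. h A = {}}" and ?N = "{A \<in> Pow X. h A \<noteq> {}}"
  have "card (Pow X) = card ?K + card ?N"
    using X by (subst card_Un_disjoint[symmetric]) (auto intro: arg_cong[where f=card])
  moreover have "card ?K \<le> card ?N"
    using X Z additive_onD[OF h Z(1)]
    by (intro card_inj_on_le[of "\<lambda>A. Z \<triangle> A"]) (auto simp: inj_on_def sdiff_left_cancel mem_sdiff)
  ultimately show ?thesis by simp
qed

text \<open>Each further random argument in which a map is additive costs a factor 2. Applied
  repeatedly, a multilinear map that is nonzero at one point is often nonzero at random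
  points.\<close>

lemma half_nonzero_prod:
  assumes X: "finite X" and S: "finite S"
    and h: "\<And>s. s \<in> S \<Longrightarrow> additive_on X (\<lambda>A. h A s)" and Z: "Z \<subseteq> X"
    and good: "card S \<le> c * card {s \<in> S. h Z s \<noteq> {}}"
  shows "card (Pow X \<times> S) \<le> 2 * c * card {(A, s) \<in> Pow X \<times> S. h A s \<noteq> {}}"
proof -
  let ?G = "{s \<in> S. h Z s \<noteq> {}}"
  have "card (Pow X) * card ?G = (\<Sum>s\<in>?G. card (Pow X))" by simp
  also have "\<dots> \<le> (\<Sum>s\<in>?G. 2 * card {A \<in> Pow X. h A s \<noteq> {}})"
    by (intro sum_mono half_nonzero[OF X h Z]) auto
  also have "\<dots> = 2 * card (SIGMA s:?G. {A \<in> Pow X. h A s \<noteq> {}})"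
    using S X by (simp add: sum_distrib_left)
  also have "card (SIGMA s:?G. {A \<in> Pow X. h A s \<noteq> {}}) \<le> card {(A, s) \<in> Pow X \<times> S. h A s \<noteq> {}}"
    using S X by (intro card_inj_on_le[of "\<lambda>(s, A). (A, s)"])
      (auto simp: inj_on_def intro: finite_subset[of _ "Pow X \<times> S"])
  finally have 1: "card (Pow X) * card ?G \<le> 2 * card {(A, s) \<in> Pow X \<times> S. h A s \<noteq> {}}" by simp
  have "card (Pow X \<times> S) \<le> card (Pow X) * (c * card ?G)"
    unfolding card_cartesian_product by (intro mult_le_mono2 good)
  also have "\<dots> = c * (card (Pow X) * card ?G)" by simp
  also have "\<dots> \<le> c * (2 * card {(A, s) \<in> Pow X \<times> S. h A s \<noteq> {}})"
    by (intro mult_le_mono2 1)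
  finally show ?thesis by simp
qed

section \<open>A probabilistically checkable proof over large alphabets\<close>

type_synonym tri = "nat \<times> nat \<times> nat"

text \<open>Basis of the proof: \<open>YI a\<close> is the word of block \<open>a\<close>, and
  \<open>QI e a b c\<close> the value of the map of the triple \<open>e\<close> at the words of
  blocks \<open>a\<close>, \<open>b\<close>, \<open>c\<close>. Only entries with
  \<open>e = (a, b, c)\<close> have to vanish, but the independent indices make the honest proof
  multilinear and so testable against products.\<close>

datatype idx = YI nat | QI tri nat nat nat

record test =
  tx :: "idx set"
  ty :: "idx set"
  tal :: "nat set"
  tal' :: "nat set"
  tal'' :: "nat set"
  tbe :: "tri set"

definition blocks3 :: "nat \<Rightarrow> tri set" where
  "blocks3 k = {..<k} \<times> {..<k} \<times> {..<k}"

definition idxs :: "nat \<Rightarrow> idx set" where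
  "idxs k = YI ` {..<k} \<union> (\<lambda>(e, a, b, c). QI e a b c) ` (blocks3 k \<times> blocks3 k)"

definition tests :: "nat \<Rightarrow> test set" where
  "tests k = {t. tx t \<subseteq> idxs k \<and> ty t \<subseteq> idxs k \<and> tal t \<subseteq> {..<k} \<and> tal' t \<subseteq> {..<k} \<and>
     tal'' t \<subseteq> {..<k} \<and> tbe t \<subseteq> blocks3 k}"

definition tensor :: "tri set \<Rightarrow> nat set \<Rightarrow> nat set \<Rightarrow> nat set \<Rightarrow> idx set" where
  "tensor E A B C = (\<lambda>(e, a, b, c). QI e a b c) ` (E \<times> A \<times> B \<times> C)"

definition diag :: "tri set \<Rightarrow> idx set" where
  "diag E = (\<lambda>(a, b, c). QI (a, b, c) a b c) ` E"

text \<open>All queries after the linearity test are shifted by \<open>tx t\<close>. Thus each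
  single position is uniformly distributed, and the difference to the answer at \<open>tx t\<close>
  is a self-corrected value at the shift.\<close>

definition positions :: "test \<Rightarrow> idx set list" where
  "positions t = [tx t, ty t, tx t \<triangle> ty t, tx t \<triangle> YI ` tal t, tx t \<triangle> YI ` tal' t,
     tx t \<triangle> YI ` tal'' t, tx t \<triangle> tensor (tbe t) (tal t) (tal' t) (tal'' t), tx t \<triangle> diag (tbe t)]"

definition Tsum :: "(tri \<Rightarrow> nat set \<Rightarrow> nat set \<Rightarrow> nat set \<Rightarrow> nat set) \<Rightarrow> tri set \<Rightarrow>
    nat set \<Rightarrow> nat set \<Rightarrow> nat set \<Rightarrow> nat set" where
  "Tsum T E u v w = {i. odd (card {e \<in> E. i \<in> T e u v w})}"

text \<open>The conditions are additivity, the product rule for random sums of words and maps,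
  vanishing of a random sum of diagonal entries, and the normalisation that coordinate 0 of every
  word is 1, which sums up to the parity of \<open>tal t\<close>.\<close>

definition acc :: "(tri \<Rightarrow> nat set \<Rightarrow> nat set \<Rightarrow> nat set \<Rightarrow> nat set) \<Rightarrow> test \<Rightarrow> nat set list \<Rightarrow> bool" where
  "acc T t v \<longleftrightarrow> v ! 0 \<triangle> v ! 1 = v ! 2 \<and>
     v ! 0 \<triangle> v ! 6 = Tsum T (tbe t) (v ! 0 \<triangle> v ! 3) (v ! 0 \<triangle> v ! 4) (v ! 0 \<triangle> v ! 5) \<and>
     v ! 0 = v ! 7 \<and> (0 \<in> v ! 0 \<triangle> v ! 3 \<longleftrightarrow> odd (card (tal t)))"

definition trilinear :: "(nat set \<Rightarrow> nat set \<Rightarrow> nat set \<Rightarrow> nat set) \<Rightarrow> bool" where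
  "trilinear f \<longleftrightarrow> (\<forall>u u' v w. f (u \<triangle> u') v w = f u v w \<triangle> f u' v w) \<and>
     (\<forall>u v v' w. f u (v \<triangle> v') w = f u v w \<triangle> f u v' w) \<and>
     (\<forall>u v w w'. f u v (w \<triangle> w') = f u v w \<triangle> f u v w')"

lemma finite_blocks3: "finite (blocks3 k)"
  by (simp add: blocks3_def)

lemma finite_idxs: "finite (idxs k)"
  by (simp add: idxs_def finite_blocks3)

lemma image_sdiff: "inj f \<Longrightarrow> f ` (A \<triangle> B) = f ` A \<triangle> f ` B"
  by (auto simp: sdiff_def inj_def image_iff)

lemma YI_sub: "A \<subseteq> {..<k} \<Longrightarrow> YI ` A \<subseteq> idxs k"
  by (auto simp: idxs_def)

lemma tensor_sub:
  "E \<subseteq> blocks3 k \<Longrightarrow> A \<subseteq> {..<k} \<Longrightarrow> B \<subseteq> {..<k} \<Longrightarrow> C \<subseteq> {..<k} \<Longrightarrow> tensor E A B C \<subseteq> idxs k"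
  unfolding tensor_def idxs_def blocks3_def by (rule subset_trans[OF image_mono Un_upper2]) blast

lemma diag_sub: "E \<subseteq> blocks3 k \<Longrightarrow> diag E \<subseteq> idxs k"
  by (force simp: diag_def idxs_def blocks3_def)

lemma tensor_sdiff:
  "tensor (E \<triangle> E') A B C = tensor E A B C \<triangle> tensor E' A B C"
  "tensor E (A \<triangle> A') B C = tensor E A B C \<triangle> tensor E A' B C"
  "tensor E A (B \<triangle> B') C = tensor E A B C \<triangle> tensor E A B' C"
  "tensor E A B (C \<triangle> C') = tensor E A B C \<triangle> tensor E A B C'"
proof -
  have t: "x \<in> tensor E A B C \<longleftrightarrow> (\<exists>e a b c. x = QI e a b c \<and> e \<in> E \<and> a \<in> A \<and> b \<in> B \<and> c \<in> C)" for x E A B C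
    unfolding tensor_def by (force simp: image_iff)
  show "tensor (E \<triangle> E') A B C = tensor E A B C \<triangle> tensor E' A B C"
    "tensor E (A \<triangle> A') B C = tensor E A B C \<triangle> tensor E A' B C"
    "tensor E A (B \<triangle> B') C = tensor E A B C \<triangle> tensor E A B' C"
    "tensor E A B (C \<triangle> C') = tensor E A B C \<triangle> tensor E A B C'"
    by (auto simp: set_eq_iff mem_sdiff t)
qed

lemma diag_sdiff: "diag (E \<triangle> E') = diag E \<triangle> diag E'"
  unfolding diag_def by (rule image_sdiff) (auto simp: inj_def)

lemma Tsum_add:
  assumes "\<And>e. trilinear (T e)" "finite E"
  shows "trilinear (Tsum T E)"
proof -
  have key: "Tsum T E u v w = Tsum T E u' v' w' \<triangle> Tsum T E u'' v'' w''"
    if "\<And>e. T e u v w = T e u' v' w' \<triangle> T e u'' v'' w''" for u v w u' v' w' u'' v'' w''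
  proof -
    have "{e \<in> E. i \<in> T e u v w} = {e \<in> E. i \<in> T e u' v' w'} \<triangle> {e \<in> E. i \<in> T e u'' v'' w''}" for i
      unfolding that by (auto simp: mem_sdiff)
    then show ?thesis using assms(2) unfolding Tsum_def by (auto simp: mem_sdiff odd_card_sdiff)
  qed
  show ?thesis unfolding trilinear_def
    by (intro conjI allI; rule key; use assms(1) in \<open>simp add: trilinear_def\<close>)
qed

lemma Tsum_sdiff:
  assumes "finite E" "finite E'"
  shows "Tsum T (E \<triangle> E') u v w = Tsum T E u v w \<triangle> Tsum T E' u v w"
proof -
  have "{e \<in> E \<triangle> E'. i \<in> T e u v w} = {e \<in> E. i \<in> T e u v w} \<triangle> {e \<in> E'. i \<in> T e u v w}" for i
    by (auto simp: sdiff_def)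
  then show ?thesis using assms unfolding Tsum_def by (auto simp: mem_sdiff odd_card_sdiff)
qed

lemma Tsum_single: "Tsum T {e} u v w = T e u v w"
proof -
  have "odd (card {e' \<in> {e}. i \<in> T e' u v w}) = (i \<in> T e u v w)" for i
    by (cases "i \<in> T e u v w") (auto simp: Collect_conv_if)
  then show ?thesis by (simp add: Tsum_def)
qed

lemma additive_cong_sub: "additive_on J g \<Longrightarrow> (\<And>A B. A \<subseteq> X \<Longrightarrow> B \<subseteq> X \<Longrightarrow> F (A \<triangle> B) = F A \<triangle> F B) \<Longrightarrow>
   (\<And>A. A \<subseteq> X \<Longrightarrow> F A \<subseteq> J) \<Longrightarrow> additive_on X (\<lambda>A. g (F A))"
  by (auto simp: additive_on_def)

lemma additive_on_sdiff: "additive_on X f \<Longrightarrow> additive_on X g \<Longrightarrow> additive_on X (\<lambda>A. f A \<triangle> g A)"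
  by (auto simp: additive_on_def sdiff_ac)

definition rests :: "nat \<Rightarrow> (nat set \<times> nat set \<times> nat set \<times> tri set) set" where
  "rests k = Pow {..<k} \<times> Pow {..<k} \<times> Pow {..<k} \<times> Pow (blocks3 k)"

lemma finite_rests: "finite (rests k)"
  by (simp add: rests_def finite_blocks3)

lemma Collect_mem_prod: "{(x, y). (x, y) \<in> S \<and> P x y} = {s \<in> S. P (fst s) (snd s)}"
  by auto

text \<open>An additive \<open>g\<close> that is not the proof of a solution breaks one of the rules
  already at basis elements. Each rule compares maps that are additive in every random argument, of
  which there are at most four, whence the factor \<open>16 = 2 ^ 4\<close>.\<close>

lemma rests_fail:
  assumes T: "\<And>e. trilinear (T e)" and g: "additive_on (idxs k) g"
    and bad: "\<not> ((\<forall>a<k. 0 \<in> g {YI a}) \<and>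
      (\<forall>(a, b, c) \<in> blocks3 k. T (a, b, c) (g {YI a}) (g {YI b}) (g {YI c}) = {}))"
  shows "card (rests k) \<le> 16 * card {(A, B, C, E) \<in> rests k. \<not>
     (g (tensor E A B C) = Tsum T E (g (YI ` A)) (g (YI ` B)) (g (YI ` C)) \<and> g (diag E) = {} \<and>
      (0 \<in> g (YI ` A) \<longleftrightarrow> odd (card A)))}" (is "_ \<le> 16 * card ?F")
proof -
  have finF: "finite ?F" using finite_rests by (rule finite_subset[rotated]) auto
  have gY: "additive_on {..<k} (\<lambda>A. g (YI ` A))"
    by (rule additive_cong_sub[OF g]) (auto simp: image_sdiff inj_def intro: YI_sub[THEN subsetD])
  have fE: "finite E" if "E \<subseteq> blocks3 k" for E using that finite_blocks3 finite_subset by blast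
  have one: "card S \<le> 1 * card S" for S :: "'z set" by simp
  \<comment> \<open>If the map of \<open>(a, b, c)\<close> does not vanish at the words of its
    blocks, then either \<open>g\<close> deviates from it at the entry
    \<open>QI (a, b, c) a b c\<close>, or that diagonal entry itself is nonzero.\<close>
  consider (tens) e a b c where "e \<in> blocks3 k" "a < k" "b < k" "c < k"
      "g {QI e a b c} \<noteq> T e (g {YI a}) (g {YI b}) (g {YI c})"
    | (diag) a b c where "(a, b, c) \<in> blocks3 k" "g {QI (a, b, c) a b c} \<noteq> {}"
    | (const) a where "a < k" "0 \<notin> g {YI a}"
    using bad by (fastforce simp: blocks3_def)
  then show ?thesis
  proof cases
    case tens
    \<comment> \<open>The defect of the product rule is additive in each of \<open>A\<close>,
      \<open>B\<close>, \<open>C\<close> and \<open>E\<close>. It is nonzero at a tuple of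
      singletons, which are then replaced by random sets one after the other.\<close>
    define \<Delta> where "\<Delta> A B C E = g (tensor E A B C) \<triangle> Tsum T E (g (YI ` A)) (g (YI ` B)) (g (YI ` C))" for A B C E
    note lin = Tsum_add[OF T fE, unfolded trilinear_def]
    have aE: "additive_on (blocks3 k) (\<Delta> A B C)" if "A \<subseteq> {..<k}" "B \<subseteq> {..<k}" "C \<subseteq> {..<k}" for A B C
      unfolding \<Delta>_def
      by (intro additive_on_sdiff additive_cong_sub[OF g])
        (use that tensor_sub in \<open>auto simp: tensor_sdiff additive_on_def Tsum_sdiff fE\<close>)
    have aC: "additive_on {..<k} (\<lambda>C. \<Delta> A B C E)" if "A \<subseteq> {..<k}" "B \<subseteq> {..<k}" "E \<subseteq> blocks3 k" for A B E
      unfolding \<Delta>_def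
      by (intro additive_on_sdiff additive_cong_sub[OF g])
        (use that tensor_sub lin[of E] gY in \<open>auto simp: tensor_sdiff additive_on_def\<close>)
    have aB: "additive_on {..<k} (\<lambda>B. \<Delta> A B C E)" if "A \<subseteq> {..<k}" "C \<subseteq> {..<k}" "E \<subseteq> blocks3 k" for A C E
      unfolding \<Delta>_def
      by (intro additive_on_sdiff additive_cong_sub[OF g])
        (use that tensor_sub lin[of E] gY in \<open>auto simp: tensor_sdiff additive_on_def\<close>)
    have aA: "additive_on {..<k} (\<lambda>A. \<Delta> A B C E)" if "B \<subseteq> {..<k}" "C \<subseteq> {..<k}" "E \<subseteq> blocks3 k" for B C E
      unfolding \<Delta>_def
      by (intro additive_on_sdiff additive_cong_sub[OF g])
        (use that tensor_sub lin[of E] gY in \<open>auto simp: tensor_sdiff additive_on_def\<close>)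
    have nz: "\<Delta> {a} {b} {c} {e} \<noteq> {}"
      using tens by (simp add: \<Delta>_def sdiff_eq_empty tensor_def Tsum_single)
    have s1: "card (Pow (blocks3 k)) \<le> 2 * card {E \<in> Pow (blocks3 k). \<Delta> {a} {b} {c} E \<noteq> {}}"
      by (rule half_nonzero[OF finite_blocks3 aE, where Z="{e}"]) (use tens nz in auto)
    have s2: "card (Pow {..<k} \<times> Pow (blocks3 k)) \<le> 2 * 2 * card {(C, E) \<in> Pow {..<k} \<times> Pow (blocks3 k). \<Delta> {a} {b} C E \<noteq> {}}"
      by (rule half_nonzero_prod[where Z="{c}"]) (use tens s1 aC in \<open>auto simp: finite_blocks3\<close>)
    have s3: "card (Pow {..<k} \<times> Pow {..<k} \<times> Pow (blocks3 k)) \<le> 2 * (2 * 2) *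
        card {(B, s) \<in> Pow {..<k} \<times> Pow {..<k} \<times> Pow (blocks3 k). \<Delta> {a} B (fst s) (snd s) \<noteq> {}}"
      by (rule half_nonzero_prod[where Z="{b}"]) (use tens s2[unfolded Collect_mem_prod] aB in \<open>auto simp: finite_blocks3\<close>)
    have s4: "card (Pow {..<k} \<times> Pow {..<k} \<times> Pow {..<k} \<times> Pow (blocks3 k)) \<le> 2 * (2 * (2 * 2)) *
        card {(A, s) \<in> Pow {..<k} \<times> Pow {..<k} \<times> Pow {..<k} \<times> Pow (blocks3 k). \<Delta> A (fst s) (fst (snd s)) (snd (snd s)) \<noteq> {}}"
      by (rule half_nonzero_prod[where Z="{a}"]) (use tens s3[unfolded Collect_mem_prod] aA in \<open>auto simp: finite_blocks3\<close>)
    also have "\<dots> \<le> 2 * (2 * (2 * 2)) * card ?F"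
      by (intro mult_le_mono2 card_mono finF) (auto simp: rests_def \<Delta>_def sdiff_eq_empty)
    finally show ?thesis by (simp add: rests_def)
  next
    case diag
    have a: "additive_on (blocks3 k) (\<lambda>E. g (diag E))"
      by (rule additive_cong_sub[OF g]) (auto simp: diag_sdiff intro: diag_sub[THEN subsetD])
    have s1: "card (Pow (blocks3 k)) \<le> 2 * card {E \<in> Pow (blocks3 k). g (Submission.diag E) \<noteq> {}}"
      by (rule half_nonzero[OF finite_blocks3 a, where Z="{(a, b, c)}"]) (use diag in \<open>auto simp: diag_def\<close>)
    have "card (rests k) = card (Pow {..<k} \<times> Pow {..<k} \<times> Pow {..<k}) * card (Pow (blocks3 k))"
      by (simp add: rests_def card_cartesian_product)
    also have "\<dots> \<le> card (Pow {..<k} \<times> Pow {..<k} \<times> Pow {..<k}) * (2 * card {E \<in> Pow (blocks3 k). g (Submission.diag E) \<noteq> {}})"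
      by (rule mult_le_mono2[OF s1])
    also have "\<dots> = 2 * card (Pow {..<k} \<times> Pow {..<k} \<times> Pow {..<k} \<times> {E \<in> Pow (blocks3 k). g (Submission.diag E) \<noteq> {}})"
      by (simp add: card_cartesian_product)
    also have "\<dots> \<le> 2 * card ?F"
      by (intro mult_le_mono2 card_mono finF) (auto simp: rests_def)
    finally show ?thesis by simp
  next
    case const
    \<comment> \<open>The defect of the normalisation as an additive map: coordinate 0 of the value
      plus the parity of \<open>A\<close>.\<close>
    define h where "h A = (g (YI ` A) \<inter> {0}) \<triangle> (if odd (card A) then {0} else {})" for A
    have a: "additive_on {..<k} h"
      unfolding additive_on_def
    proof (intro allI impI)
      fix A B assume AB: "A \<subseteq> {..<k}" "B \<subseteq> {..<k}"
      then have "odd (card (A \<triangle> B)) = (odd (card A) \<noteq> odd (card B))"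
        using finite_subset[OF _ finite_lessThan] by (intro odd_card_sdiff) auto
      then show "h (A \<triangle> B) = h A \<triangle> h B"
        using additive_onD[OF gY AB] unfolding h_def by (auto simp: mem_sdiff set_eq_iff)
    qed
    have nz: "h {a} \<noteq> {}" using const by (auto simp: h_def)
    have s1: "card (Pow {..<k}) \<le> 2 * card {A \<in> Pow {..<k}. h A \<noteq> {}}"
      by (rule half_nonzero[OF _ a, where Z="{a}"]) (use const nz in auto)
    have "card (rests k) = card (Pow {..<k}) * card (Pow {..<k} \<times> Pow {..<k} \<times> Pow (blocks3 k))"
      by (simp add: rests_def card_cartesian_product)
    also have "\<dots> \<le> (2 * card {A \<in> Pow {..<k}. h A \<noteq> {}}) * card (Pow {..<k} \<times> Pow {..<k} \<times> Pow (blocks3 k))"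
      by (rule mult_le_mono1[OF s1])
    also have "\<dots> = 2 * card ({A \<in> Pow {..<k}. h A \<noteq> {}} \<times> Pow {..<k} \<times> Pow {..<k} \<times> Pow (blocks3 k))"
      by (simp add: card_cartesian_product)
    also have "\<dots> \<le> 2 * card ?F"
      by (intro mult_le_mono2 card_mono finF) (auto simp: rests_def h_def mem_sdiff split: if_splits)
    finally show ?thesis by simp
  qed
qed

definition mkt :: "idx set \<times> idx set \<times> nat set \<times> nat set \<times> nat set \<times> tri set \<Rightarrow> test" where
  "mkt = (\<lambda>(x, y, A, B, C, E). \<lparr>tx = x, ty = y, tal = A, tal' = B, tal'' = C, tbe = E\<rparr>)"

lemma bij_mkt: "bij_betw mkt (Pow (idxs k) \<times> Pow (idxs k) \<times> rests k) (tests k)"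
  by (rule bij_betw_byWitness[where f'="\<lambda>t. (tx t, ty t, tal t, tal' t, tal'' t, tbe t)"])
    (auto simp: mkt_def tests_def rests_def)

lemma finite_tests: "finite (tests k)"
  using bij_betw_finite[OF bij_mkt] by (simp add: finite_idxs finite_rests)

lemma card_Collect_mkt:
  "card {t \<in> tests k. P t} = card {z \<in> Pow (idxs k) \<times> Pow (idxs k) \<times> rests k. P (mkt z)}"
proof -
  let ?S = "Pow (idxs k) \<times> Pow (idxs k) \<times> rests k"
  have "{t \<in> tests k. P t} = mkt ` {z \<in> ?S. P (mkt z)}"
    unfolding bij_betw_imp_surj_on[OF bij_mkt, symmetric] by blast
  moreover have "inj_on mkt {z \<in> ?S. P (mkt z)}"
    by (rule inj_on_subset[OF bij_betw_imp_inj_on[OF bij_mkt]]) blast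
  ultimately show ?thesis by (simp add: card_image)
qed

text \<open>The linearity test provides an additive \<open>g\<close> near \<open>F\<close>. A choice
  that \<open>g\<close> fails is rejected unless one of six shifted queries hits an error of
  \<open>F\<close>; the linearity test makes such a hit at most twice as likely as rejection. So
  \<open>1 + 6 * 2 = 13\<close> times the rejection rate is at least \<open>1 / 16\<close>, while
  \<open>13 * 16 = 208 < 300\<close>.\<close>

theorem pcp_sound:
  assumes T: "\<And>e. trilinear (T e)"
    and few: "300 * card {t \<in> tests k. \<not> acc T t (map F (positions t))} < card (tests k)"
  shows "\<exists>y. (\<forall>a<k. 0 \<in> y a) \<and> (\<forall>(a, b, c) \<in> blocks3 k. T (a, b, c) (y a) (y b) (y c) = {})"
proof (rule ccontr)
  assume none: "\<not> ?thesis"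
  let ?J = "idxs k" and ?V = "Pow (idxs k)" and ?M = "rests k"
  define N where "N = card ?V"
  define m where "m = card ?M"
  define Rj where "Rj = {z \<in> ?V \<times> ?V \<times> ?M. \<not> acc T (mkt z) (map F (positions (mkt z)))}"
  have fin: "finite ?V" "finite ?M" by (simp_all add: finite_idxs finite_rests)
  have finR: "finite Rj" unfolding Rj_def using fin by (intro finite_subset[OF _ finite_cartesian_product[OF fin(1) finite_cartesian_product[OF fin]]]) auto
  have ct: "card (tests k) = N * (N * m)"
    using bij_betw_same_card[OF bij_mkt, of k] by (simp add: N_def m_def card_cartesian_product)
  have few: "300 * card Rj < N * (N * m)" using few unfolding card_Collect_mkt ct Rj_def .
  have pos: "N > 0" "m > 0" by (rule gr0I, use few in simp)+
  define B where "B = {(x, y) \<in> ?V \<times> ?V. F x \<triangle> F y \<noteq> F (x \<triangle> y)}"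
  have finB: "finite B" unfolding B_def using fin by (auto intro: finite_subset[of _ "?V \<times> ?V"])
  have "card B * m = card (B \<times> ?M)" by (simp add: m_def card_cartesian_product)
  also have "\<dots> \<le> card Rj"
    by (rule card_inj_on_le[OF _ _ finR, of "\<lambda>((x, y), r). (x, y, r)"])
      (auto simp: inj_on_def B_def Rj_def acc_def positions_def mkt_def)
  finally have BR: "card B * m \<le> card Rj" .
  have "7 * card B \<le> N\<^sup>2"
  proof -
    have "7 * card B * m \<le> 300 * card Rj" using BR by simp
    also have "\<dots> \<le> (N * N) * m" using few by (simp add: mult.assoc)
    finally show ?thesis using pos by (simp add: power2_eq_square)
  qed
  then obtain g where g: "additive_on ?J g" and D: "N * card {x \<in> ?V. F x \<noteq> g x} \<le> 2 * card B"
    using blr[OF finite_idxs[of k], of F, folded B_def N_def] by blast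
  define D where "D = {x \<in> ?V. F x \<noteq> g x}"
  define Fl where "Fl = {(A, X, C, E) \<in> rests k. \<not>
     (g (tensor E A X C) = Tsum T E (g (YI ` A)) (g (YI ` X)) (g (YI ` C)) \<and> g (diag E) = {} \<and>
      (0 \<in> g (YI ` A) \<longleftrightarrow> odd (card A)))}"
  have Fl: "m \<le> 16 * card Fl"
    unfolding m_def Fl_def
    by (rule rests_fail[OF T g], rule notI, rule none[THEN notE], rule exI[of _ "\<lambda>a. g {YI a}"])
  \<comment> \<open>The empty shift stands for the query at \<open>x\<close> itself.\<close>
  define vs :: "nat set \<times> nat set \<times> nat set \<times> tri set \<Rightarrow> idx set list" where
    "vs = (\<lambda>(A, X, C, E). [{}, YI ` A, YI ` X, YI ` C, tensor E A X C, diag E])"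
  have vsub: "r \<in> ?M \<Longrightarrow> v \<in> set (vs r) \<Longrightarrow> v \<subseteq> ?J" for r v
  proof -
    assume r: "r \<in> ?M" and v: "v \<in> set (vs r)"
    obtain A X C E where rr: "r = (A, X, C, E)" by (metis prod_cases4)
    then have "v \<in> {{}, YI ` A, YI ` X, YI ` C, tensor E A X C, diag E}" using v by (simp add: vs_def)
    moreover have "A \<subseteq> {..<k}" "X \<subseteq> {..<k}" "C \<subseteq> {..<k}" "E \<subseteq> blocks3 k" using r rr by (simp_all add: rests_def)
    ultimately show "v \<subseteq> ?J" using YI_sub tensor_sub diag_sub by (elim insertE emptyE) simp_all
  qed
  define Bd where "Bd j = {(x, y, r) \<in> ?V \<times> ?V \<times> ?M. x \<triangle> vs r ! j \<in> D}" for j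
  have finBd: "finite (Bd j)" for j
    unfolding Bd_def using fin by (intro finite_subset[OF _ finite_cartesian_product[OF fin(1) finite_cartesian_product[OF fin]]]) auto
  \<comment> \<open>For a fixed rest \<open>r\<close> the shift permutes all positions, so a shifted
    query meets an error of \<open>F\<close> as rarely as a uniform one.\<close>
  have cBd: "card (Bd j) \<le> card D * (N * m)" if "j < 6" for j
  proof -
    have "card (Bd j) \<le> card (D \<times> (?V \<times> ?M))"
    proof (rule card_inj_on_le)
      show "inj_on (\<lambda>(x, y, r). (vs r ! j \<triangle> x, y, r)) (Bd j)"
        by (auto simp: inj_on_def sdiff_left_cancel)
      show "finite (D \<times> (?V \<times> ?M))" using fin by (auto simp: D_def)
    qed (auto simp: Bd_def sdiff_commute)
    then show ?thesis by (simp add: card_cartesian_product N_def m_def)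
  qed
  have "?V \<times> ?V \<times> Fl \<subseteq> Rj \<union> (\<Union>j<6. Bd j)"
  proof
    fix z assume z: "z \<in> ?V \<times> ?V \<times> Fl"
    then obtain x y A X C E where zz: "z = (x, y, A, X, C, E)" by (metis prod_cases6)
    let ?r = "(A, X, C, E)"
    have mem: "x \<subseteq> ?J" "y \<subseteq> ?J" "?r \<in> ?M" using z zz by (auto simp: Fl_def)
    show "z \<in> Rj \<union> (\<Union>j<6. Bd j)"
    proof (rule ccontr)
      assume n: "z \<notin> Rj \<union> (\<Union>j<6. Bd j)"
      have rd: "F (x \<triangle> vs ?r ! j) = g x \<triangle> g (vs ?r ! j)" if "j < 6" for j
      proof -
        have "vs ?r ! j \<in> set (vs ?r)" using that by (intro nth_mem) (simp add: vs_def)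
        then have s: "vs ?r ! j \<subseteq> ?J" using vsub mem by blast
        have "x \<triangle> vs ?r ! j \<notin> D" using n that mem zz by (auto simp: Bd_def)
        then show ?thesis using mem s sdiff_subset[OF mem(1) s] additive_onD[OF g mem(1) s] by (auto simp: D_def)
      qed
      have g0: "g {} = {}" using additive_onD[OF g, of "{}" "{}"] by simp
      have r: "F x = g x" "F (x \<triangle> YI ` A) = g x \<triangle> g (YI ` A)" "F (x \<triangle> YI ` X) = g x \<triangle> g (YI ` X)"
        "F (x \<triangle> YI ` C) = g x \<triangle> g (YI ` C)" "F (x \<triangle> tensor E A X C) = g x \<triangle> g (tensor E A X C)"
        "F (x \<triangle> diag E) = g x \<triangle> g (diag E)"
        using rd[of 0] rd[of 1] rd[of 2] rd[of 3] rd[of 4] rd[of 5] by (simp_all add: vs_def g0)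
      have "acc T (mkt z) (map F (positions (mkt z)))" using n mem zz by (auto simp: Rj_def)
      then have "g (tensor E A X C) = Tsum T E (g (YI ` A)) (g (YI ` X)) (g (YI ` C))"
        "g x = g x \<triangle> g (diag E)" "0 \<in> g (YI ` A) \<longleftrightarrow> odd (card A)"
        unfolding acc_def positions_def mkt_def zz by (simp_all add: r)
      moreover from this(2) have "g (diag E) = {}" by (metis sdiff_simps(1,4))
      ultimately show False using z zz by (auto simp: Fl_def)
    qed
  qed
  then have "card (?V \<times> ?V \<times> Fl) \<le> card (Rj \<union> (\<Union>j<6. Bd j))"
    using finR finBd by (intro card_mono) auto
  also have "\<dots> \<le> card Rj + card (\<Union>j<6. Bd j)" by (rule card_Un_le)
  also have "card (\<Union>j<6. Bd j) \<le> (\<Sum>j<6. card (Bd j))" by (rule card_UN_le) simp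
  also have "\<dots> \<le> (\<Sum>j<6::nat. card D * (N * m))" by (intro sum_mono cBd) simp
  also have "\<dots> = 6 * (N * card D) * m" by simp
  also have "\<dots> \<le> 6 * (2 * card B) * m"
    using D unfolding D_def by (intro mult_le_mono1 mult_le_mono2)
  also have "\<dots> \<le> 12 * card Rj" using BR by simp
  finally have "N * (N * card Fl) \<le> 13 * card Rj" by (simp add: card_cartesian_product N_def)
  moreover have "N * (N * m) \<le> N * (N * (16 * card Fl))" using Fl by (intro mult_le_mono2)
  moreover have "N * (N * (16 * card Fl)) = 16 * (N * (N * card Fl))" by simp
  ultimately show False using few by linarith
qed

section \<open>Completeness of the verifier\<close>

text \<open>The linear extension of the intended values on the basis, that is, the coordinatewise
  parity of those belonging to \<open>S\<close>.\<close>

definition honest :: "(tri \<Rightarrow> nat set \<Rightarrow> nat set \<Rightarrow> nat set \<Rightarrow> nat set) \<Rightarrow> (nat \<Rightarrow> nat set) \<Rightarrow> idx set \<Rightarrow> nat set" where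
  "honest T y S = {i. odd (card {j \<in> S. i \<in> (case j of YI a \<Rightarrow> y a | QI e a b c \<Rightarrow> T e (y a) (y b) (y c))})}"

lemma honest_additive: "additive_on (idxs k) (honest T y)"
  unfolding additive_on_def
proof (intro allI impI)
  fix A B assume AB: "A \<subseteq> idxs k" "B \<subseteq> idxs k"
  then have fin: "finite A" "finite B" using finite_idxs finite_subset by blast+
  have *: "{j \<in> A \<triangle> B. P j} = {j \<in> A. P j} \<triangle> {j \<in> B. P j}" for P :: "idx \<Rightarrow> bool" by (auto simp: sdiff_def)
  have "i \<in> honest T y (A \<triangle> B) \<longleftrightarrow> i \<in> honest T y A \<triangle> honest T y B" for i
    unfolding mem_sdiff unfolding honest_def mem_Collect_eq * using fin by (intro odd_card_sdiff) simp_all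
  then show "honest T y (A \<triangle> B) = honest T y A \<triangle> honest T y B" by blast
qed

lemma honest_single:
  "honest T y {YI a} = y a" "honest T y {QI e a b c} = T e (y a) (y b) (y c)"
proof -
  have *: "odd (card {j \<in> {j0}. P j}) = P j0" for P and j0 :: idx
    by (cases "P j0") (auto simp: Collect_conv_if)
  show "honest T y {YI a} = y a" "honest T y {QI e a b c} = T e (y a) (y b) (y c)"
    unfolding honest_def * by auto
qed

lemma honest_bounded:
  assumes "\<And>a. y a \<subseteq> {..<L}" "\<And>e u v w. T e u v w \<subseteq> {..<L}"
  shows "honest T y S \<subseteq> {..<L}"
proof
  fix i assume "i \<in> honest T y S"
  then have "card {j \<in> S. i \<in> (case j of YI a \<Rightarrow> y a | QI e a b c \<Rightarrow> T e (y a) (y b) (y c))} \<noteq> 0"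
    by (auto simp: honest_def elim: oddE)
  then obtain j where j: "i \<in> (case j of YI a \<Rightarrow> y a | QI e a b c \<Rightarrow> T e (y a) (y b) (y c))"
    by (metis (mono_tags, lifting) card.empty empty_Collect_eq)
  show "i \<in> {..<L}"
  proof (cases j)
    case (YI a)
    then show ?thesis using j assms(1)[of a] by auto
  next
    case (QI e a b c)
    then have "i \<in> T e (y a) (y b) (y c)" using j by simp
    then show ?thesis using assms(2)[of e "y a" "y b" "y c"] by blast
  qed
qed

text \<open>Linear maps that agree on a basis are equal.\<close>

lemma additive_eq_on_singletons:
  assumes "finite X" "\<And>x. x \<in> X \<Longrightarrow> f {x} = g {x}" "additive_on X f" "additive_on X g"
  shows "f X = g X"
proof -
  have "S \<subseteq> X \<Longrightarrow> f S = g S" if "finite S" for S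
    using that
  proof (induction S)
    case empty
    have "f ({} \<triangle> {}) = f {} \<triangle> f {}" "g ({} \<triangle> {}) = g {} \<triangle> g {}"
      by (rule additive_onD[OF assms(3)] additive_onD[OF assms(4)]; simp)+
    then show ?case by simp
  next
    case (insert x S)
    have e: "insert x S = {x} \<triangle> S" using insert by (auto simp: sdiff_def)
    have "x \<in> X" "{x} \<subseteq> X" "S \<subseteq> X" using insert.prems by auto
    then show ?case unfolding e
      using insert.IH additive_onD[OF assms(3), of "{x}" S] additive_onD[OF assms(4), of "{x}" S] assms(2)[of x]
      by simp
  qed
  then show ?thesis using assms(1) by blast
qed

lemma additive_on_subset: "additive_on X f \<Longrightarrow> S \<subseteq> X \<Longrightarrow> additive_on S f"
  by (auto simp: additive_on_def)

theorem pcp_complete: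
  assumes T: "\<And>e. trilinear (T e)" and t: "t \<in> tests k"
    and y: "\<And>a. a < k \<Longrightarrow> 0 \<in> y a" "\<And>a b c. (a, b, c) \<in> blocks3 k \<Longrightarrow> T (a, b, c) (y a) (y b) (y c) = {}"
  shows "acc T t (map (honest T y) (positions t))"
proof -
  define g where "g = honest T y"
  define A X C E where "A = tal t" and "X = tal' t" and "C = tal'' t" and "E = tbe t"
  have mem: "tx t \<subseteq> idxs k" "ty t \<subseteq> idxs k" "A \<subseteq> {..<k}" "X \<subseteq> {..<k}" "C \<subseteq> {..<k}" "E \<subseteq> blocks3 k"
    using t by (auto simp: tests_def A_def X_def C_def E_def)
  have fin: "finite A" "finite X" "finite C" "finite E"
    using mem finite_blocks3 by (auto intro: finite_subset)
  note g = honest_additive[of k T y, folded g_def]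
  have gx: "g (tx t \<triangle> S) = g (tx t) \<triangle> g S" if "S \<subseteq> idxs k" for S
    using additive_onD[OF g mem(1) that] .
  note lin = Tsum_add[of T, OF T, unfolded trilinear_def]
  have gY: "additive_on {..<k} (\<lambda>A. g (YI ` A))"
    by (rule additive_cong_sub[OF g]) (auto simp: image_sdiff inj_def intro: YI_sub[THEN subsetD])
  have d: "g (diag E) = {}"
    by (rule additive_eq_on_singletons[where f="\<lambda>E. g (diag E)" and g="\<lambda>E. {}", OF fin(4)])
      (use mem(6) y(2) additive_cong_sub[OF g diag_sdiff, of E] diag_sub in
        \<open>auto simp: g_def honest_single diag_def[of "{_}"] additive_on_def[of _ "\<lambda>_. {}"]\<close>)
  have fE: "finite S" if "S \<subseteq> E" for S using that fin(4) finite_subset by blast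
  have sub: "S \<subseteq> {..<k}" if "S \<subseteq> A \<or> S \<subseteq> X \<or> S \<subseteq> C" for S using that mem by auto
  have gadd: "g (S \<triangle> S') = g S \<triangle> g S'" if "S \<subseteq> idxs k" "S' \<subseteq> idxs k" for S S'
    using additive_onD[OF g that] .
  have t1: "g (tensor {e} {a} {b} {c}) = Tsum T {e} (g (YI ` {a})) (g (YI ` {b})) (g (YI ` {c}))" for e a b c
    by (simp add: g_def tensor_def honest_single Tsum_single)
  have aL: "additive_on S (\<lambda>S. g (F S))"
    if "\<And>S S'. F (S \<triangle> S') = F S \<triangle> F S'" "\<And>S'. S' \<subseteq> S \<Longrightarrow> F S' \<subseteq> idxs k" for F :: "'z set \<Rightarrow> idx set" and S
    by (rule additive_cong_sub[OF g that])
  have aR: "additive_on S (\<lambda>S. G (g (YI ` S)))"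
    if "S \<subseteq> {..<k}" "\<And>u u'. G (u \<triangle> u') = G u \<triangle> G u'" for S and G :: "nat set \<Rightarrow> nat set"
    using additive_on_subset[OF gY that(1)] that(2) by (auto simp: additive_on_def)
  \<comment> \<open>The product rule holds for singletons by definition of the honest proof. It is
    carried over to arbitrary sets one argument at a time, both sides being additive in that
    argument.\<close>
  have t2: "g (tensor {e} {a} {b} C) = Tsum T {e} (g (YI ` {a})) (g (YI ` {b})) (g (YI ` C))"
    if "e \<in> E" "a \<in> A" "b \<in> X" for e a b
  proof (rule additive_eq_on_singletons[where f="\<lambda>C. g (tensor {e} {a} {b} C)" and g="\<lambda>C. Tsum T {e} (g (YI ` {a})) (g (YI ` {b})) (g (YI ` C))", OF fin(3) t1])
    show "additive_on C (\<lambda>C. g (tensor {e} {a} {b} C))"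
      by (rule aL[of "\<lambda>C. tensor {e} {a} {b} C", OF tensor_sdiff(4) tensor_sub]) (use that mem in auto)
    show "additive_on C (\<lambda>C. Tsum T {e} (g (YI ` {a})) (g (YI ` {b})) (g (YI ` C)))"
      by (rule aR[OF mem(5)]) (use lin[of "{e}"] in blast)
  qed
  have t3: "g (tensor {e} {a} X C) = Tsum T {e} (g (YI ` {a})) (g (YI ` X)) (g (YI ` C))"
    if "e \<in> E" "a \<in> A" for e a
  proof (rule additive_eq_on_singletons[where f="\<lambda>X. g (tensor {e} {a} X C)" and g="\<lambda>X. Tsum T {e} (g (YI ` {a})) (g (YI ` X)) (g (YI ` C))", OF fin(2) t2])
    show "additive_on X (\<lambda>X. g (tensor {e} {a} X C))"
      by (rule aL[of "\<lambda>X. tensor {e} {a} X C", OF tensor_sdiff(3) tensor_sub]) (use that mem in auto)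
    show "additive_on X (\<lambda>X. Tsum T {e} (g (YI ` {a})) (g (YI ` X)) (g (YI ` C)))"
      by (rule aR[OF mem(4)]) (use lin[of "{e}"] in blast)
  qed (use that in auto)
  have t4: "g (tensor {e} A X C) = Tsum T {e} (g (YI ` A)) (g (YI ` X)) (g (YI ` C))"
    if "e \<in> E" for e
  proof (rule additive_eq_on_singletons[where f="\<lambda>A. g (tensor {e} A X C)" and g="\<lambda>A. Tsum T {e} (g (YI ` A)) (g (YI ` X)) (g (YI ` C))", OF fin(1) t3])
    show "additive_on A (\<lambda>A. g (tensor {e} A X C))"
      by (rule aL[of "\<lambda>A. tensor {e} A X C", OF tensor_sdiff(2) tensor_sub]) (use that mem in auto)
    show "additive_on A (\<lambda>A. Tsum T {e} (g (YI ` A)) (g (YI ` X)) (g (YI ` C)))"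
      by (rule aR[OF mem(3)]) (use lin[of "{e}"] in blast)
  qed (use that in auto)
  have t5: "g (tensor E A X C) = Tsum T E (g (YI ` A)) (g (YI ` X)) (g (YI ` C))"
  proof (rule additive_eq_on_singletons[where f="\<lambda>E. g (tensor E A X C)" and g="\<lambda>E. Tsum T E (g (YI ` A)) (g (YI ` X)) (g (YI ` C))", OF fin(4) t4])
    show "additive_on E (\<lambda>E. g (tensor E A X C))"
      by (rule aL[of "\<lambda>E. tensor E A X C", OF tensor_sdiff(1) tensor_sub]) (use mem in auto)
    show "additive_on E (\<lambda>E. Tsum T E (g (YI ` A)) (g (YI ` X)) (g (YI ` C)))"
      by (simp add: additive_on_def Tsum_sdiff fE)
  qed
  \<comment> \<open>Parity with values in subsets of \<open>{0}\<close>, so that the comparison on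
    singletons covers the normalisation as well.\<close>
  define par where "par S = (if odd (card S) then {0} else {} :: nat set)" for S :: "nat set"
  have c: "g (YI ` A) \<inter> {0} = par A"
  proof (rule additive_eq_on_singletons[where f="\<lambda>A. g (YI ` A) \<inter> {0}" and g=par, OF fin(1)])
    show "g (YI ` {a}) \<inter> {0} = par {a}" if "a \<in> A" for a
      using that mem y(1) by (auto simp: g_def honest_single par_def)
    show "additive_on A (\<lambda>A. g (YI ` A) \<inter> {0})"
      using additive_on_subset[OF gY mem(3)] by (auto simp: additive_on_def sdiff_def)
    show "additive_on A par"
      unfolding additive_on_def
    proof (intro allI impI)
      fix S S' assume "S \<subseteq> A" "S' \<subseteq> A"
      then have "finite S" "finite S'" using fin(1) finite_subset by blast+
      then show "par (S \<triangle> S') = par S \<triangle> par S'" by (auto simp: par_def odd_card_sdiff mem_sdiff)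
    qed
  qed
  have subs: "YI ` A \<subseteq> idxs k" "YI ` X \<subseteq> idxs k" "YI ` C \<subseteq> idxs k" "tensor E A X C \<subseteq> idxs k" "diag E \<subseteq> idxs k"
    using mem YI_sub tensor_sub diag_sub by simp_all
  have "0 \<in> g (YI ` A) \<longleftrightarrow> odd (card A)" using c by (auto simp: par_def split: if_splits)
  then show ?thesis
    unfolding acc_def positions_def A_def[symmetric] X_def[symmetric] C_def[symmetric] E_def[symmetric] g_def[symmetric]
    using t5 d gx[OF mem(2)] by (simp add: gx[OF subs(1)] gx[OF subs(2)] gx[OF subs(3)] gx[OF subs(4)] gx[OF subs(5)])
qed

declare split_paired_All [simp del] split_paired_Ex [simp del]

section \<open>Sequential repetition of a game\<close>

datatype 'b sp = Edge 'b | Ser "'b sp list" | Par "'b sp list"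

text \<open>Whether deleting the labels in \<open>X\<close> separates the two terminals of the
  network. Seen as a game, a cut answers every branch of a parallel node by one part of the series
  node below it.\<close>

fun cut :: "'b set \<Rightarrow> 'b sp \<Rightarrow> bool" where
  "cut X (Edge b) \<longleftrightarrow> b \<in> X"
| "cut X (Ser ts) \<longleftrightarrow> (\<exists>t \<in> set ts. cut X t)"
| "cut X (Par ts) \<longleftrightarrow> (\<forall>t \<in> set ts. cut X t)"

fun labels :: "'b sp \<Rightarrow> 'b list" where
  "labels (Edge b) = [b]"
| "labels (Ser ts) = concat (map labels ts)"
| "labels (Par ts) = concat (map labels ts)"

type_synonym view = "bool list list"

text \<open>An outcome of the verifier's coins: its number, the number of the question put to each player,
  the part of the view that answers the question, and the accepted views.\<close>

type_synonym omega = "nat \<times> nat list \<times> nat list list \<times> view list"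
type_synonym label = "(nat \<times> view) list"

definition ith :: "'a list \<Rightarrow> nat \<Rightarrow> 'a" where
  "ith xs i = hd (drop i xs)"

lemma ith_nth: "i < length xs \<Longrightarrow> ith xs i = xs ! i"
  by (simp add: ith_def hd_drop_conv_nth)

definition omq :: "nat \<Rightarrow> omega \<Rightarrow> nat" where
  "omq i w = ith (fst (snd w)) i"

definition omv :: "omega \<Rightarrow> view list" where
  "omv w = snd (snd (snd w))"

definition oma :: "nat \<Rightarrow> omega \<Rightarrow> view \<Rightarrow> view" where
  "oma i w v = map (\<lambda>m. ith v m) (ith (fst (snd (snd w))) i)"

definition questions :: "omega list \<Rightarrow> nat \<Rightarrow> nat list" where
  "questions Om i = remdups (map (omq i) Om)"

definition answers :: "omega list \<Rightarrow> nat \<Rightarrow> nat \<Rightarrow> view list" where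
  "answers Om i q = remdups (concat (map (\<lambda>w. map (oma i w) (omv w)) (filter (\<lambda>w. omq i w = q) Om)))"

text \<open>\<open>opts\<close> collects the partial transcripts of one fixed sequence of coins;
  those extensions by the coins \<open>w\<close> are kept whose view restricts to the answer
  \<open>a\<close>.\<close>

definition extend :: "nat \<Rightarrow> view \<Rightarrow> omega \<Rightarrow> label list \<Rightarrow> label list" where
  "extend i a w opts = concat (map (\<lambda>b. map (\<lambda>v. b @ [(fst w, v)]) (filter (\<lambda>v. oma i w v = a) (omv w))) opts)"

definition ext :: "omega list \<Rightarrow> nat \<Rightarrow> nat \<Rightarrow> view \<Rightarrow> label list list \<Rightarrow> label list list" where
  "ext Om i q a G = concat (map (\<lambda>opts. map (\<lambda>w. extend i a w opts) (filter (\<lambda>w. omq i w = q) Om)) G)"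

text \<open>\<open>G\<close> has one entry for each sequence of coins that is compatible with the
  questions put to player \<open>i\<close> so far, listing the transcripts compatible with the
  answers given. After the last round every such sequence must have one of its transcripts in the
  cut.\<close>

primrec spt :: "omega list \<Rightarrow> nat \<Rightarrow> nat \<Rightarrow> label list list \<Rightarrow> label sp" where
  "spt Om i 0 G = Par (map (\<lambda>opts. Ser (map Edge opts)) G)"
| "spt Om i (Suc n) G = Par (map (\<lambda>q. Ser (map (\<lambda>a. spt Om i n (ext Om i q a G)) (answers Om i q))) (questions Om i))"

lemma set_extend:
  "set (extend i a w opts) = {b @ [(fst w, v)] | b v. b \<in> set opts \<and> v \<in> set (omv w) \<and> oma i w v = a}"
  by (auto simp: extend_def)

definition seqs :: "omega list \<Rightarrow> nat \<Rightarrow> omega list set" where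
  "seqs Om n = {ws. length ws = n \<and> set ws \<subseteq> set Om}"

lemma seqs_Suc: "seqs Om (Suc n) = (\<lambda>(w, ws). w # ws) ` (set Om \<times> seqs Om n)"
  by (auto simp: seqs_def length_Suc_conv image_iff)

lemma seqs_0: "seqs Om 0 = {[]}"
  by (auto simp: seqs_def)

lemma finite_seqs: "finite (seqs Om n)"
  by (induction n) (auto simp: seqs_0 seqs_Suc)

lemma card_seqs: "card (seqs Om n) = card (set Om) ^ n"
proof (induction n)
  case (Suc n)
  have "card (seqs Om (Suc n)) = card (set Om \<times> seqs Om n)"
    unfolding seqs_Suc by (rule card_image) (auto simp: inj_on_def)
  then show ?case using Suc by (simp add: card_cartesian_product)
qed (simp add: seqs_0)

text \<open>The part chosen at a series node is the answer to the last question. It depends on the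
  branch taken so far, that is, on the earlier questions of the same player only, so the cut
  contains an online strategy together with a transcript for every sequence of coins.\<close>

lemma spt_strategy:
  "cut X (spt Om i n G) \<Longrightarrow> \<exists>\<sigma>. \<forall>opts \<in> set G. \<forall>ws \<in> seqs Om n. \<exists>b \<in> set opts. \<exists>vs. length vs = n \<and>
     (\<forall>t<n. vs ! t \<in> set (omv (ws ! t)) \<and> oma i (ws ! t) (vs ! t) = \<sigma> (map (omq i) (take (Suc t) ws))) \<and>
     b @ zip (map fst ws) vs \<in> X"
proof (induction n arbitrary: G)
  case 0
  then show ?case by (fastforce simp: seqs_0)
next
  case (Suc n)
  have "\<exists>a. a \<in> set (answers Om i q) \<and> cut X (spt Om i n (ext Om i q a G))" if "q \<in> set (questions Om i)" for q
    using Suc.prems that by auto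
  then obtain a where a: "\<And>q. q \<in> set (questions Om i) \<Longrightarrow> cut X (spt Om i n (ext Om i q (a q) G))"
    by metis
  have "\<exists>\<sigma>. q \<in> set (questions Om i) \<longrightarrow> (\<forall>opts \<in> set (ext Om i q (a q) G). \<forall>ws \<in> seqs Om n. \<exists>b \<in> set opts. \<exists>vs. length vs = n \<and>
     (\<forall>t<n. vs ! t \<in> set (omv (ws ! t)) \<and> oma i (ws ! t) (vs ! t) = \<sigma> (map (omq i) (take (Suc t) ws))) \<and>
     b @ zip (map fst ws) vs \<in> X)" for q
    using Suc.IH[OF a, of q] by blast
  then obtain \<tau> where \<tau>: "\<And>q opts ws. q \<in> set (questions Om i) \<Longrightarrow> opts \<in> set (ext Om i q (a q) G) \<Longrightarrow> ws \<in> seqs Om n \<Longrightarrow>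
     \<exists>b \<in> set opts. \<exists>vs. length vs = n \<and>
     (\<forall>t<n. vs ! t \<in> set (omv (ws ! t)) \<and> oma i (ws ! t) (vs ! t) = \<tau> q (map (omq i) (take (Suc t) ws))) \<and>
     b @ zip (map fst ws) vs \<in> X"
    by metis
  \<comment> \<open>A history of one question is answered by \<open>a\<close>; longer ones are
    passed on, without their first question, to the strategy found below the answer to it.\<close>
  define \<sigma> where "\<sigma> qs = (if tl qs = [] then a (hd qs) else \<tau> (hd qs) (tl qs))" for qs
  show ?case
  proof (intro exI[of _ \<sigma>] ballI)
    fix opts ws assume o: "opts \<in> set G" and ws: "ws \<in> seqs Om (Suc n)"
    obtain w ws' where w: "ws = w # ws'" "w \<in> set Om" "ws' \<in> seqs Om n" using ws by (auto simp: seqs_Suc)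
    have q: "omq i w \<in> set (questions Om i)" using w by (auto simp: questions_def)
    let ?a = "a (omq i w)"
    have "extend i ?a w opts \<in> set (ext Om i (omq i w) ?a G)" using o w by (auto simp: ext_def)
    from \<tau>[OF q this w(3)] obtain b vs where b: "b \<in> set (extend i ?a w opts)" "length vs = n"
      "\<And>t. t < n \<Longrightarrow> vs ! t \<in> set (omv (ws' ! t)) \<and> oma i (ws' ! t) (vs ! t) = \<tau> (omq i w) (map (omq i) (take (Suc t) ws'))"
      "b @ zip (map fst ws') vs \<in> X" by blast
    obtain b' v where b': "b = b' @ [(fst w, v)]" "b' \<in> set opts" "v \<in> set (omv w)" "oma i w v = ?a"
      using b(1) by (auto simp: set_extend)
    show "\<exists>b\<in>set opts. \<exists>vs. length vs = Suc n \<and>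
       (\<forall>t<Suc n. vs ! t \<in> set (omv (ws ! t)) \<and> oma i (ws ! t) (vs ! t) = \<sigma> (map (omq i) (take (Suc t) ws))) \<and>
       b @ zip (map fst ws) vs \<in> X"
    proof (intro bexI[of _ b'] exI[of _ "v # vs"] conjI allI impI)
      fix t assume t: "t < Suc n"
      show "(v # vs) ! t \<in> set (omv (ws ! t))" using t b b' w by (cases t) auto
      show "oma i (ws ! t) ((v # vs) ! t) = \<sigma> (map (omq i) (take (Suc t) ws))"
      proof (cases t)
        case 0
        then show ?thesis using b' w by (simp add: \<sigma>_def)
      next
        case (Suc t')
        then have "take (Suc t') ws' \<noteq> []" using t w by (auto simp: seqs_def)
        then show ?thesis using b(3)[of t'] t Suc w by (simp add: \<sigma>_def)
      qed
    qed (use b b' w in auto)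
  qed
qed

text \<open>If the answers that a choice \<open>V\<close> of accepted views gives to player
  \<open>i\<close> depend on the question alone, they form a strategy, and the transcripts with the
  views \<open>V\<close> cut the network. The same transcripts do so for all players, hence one
  bundle per sequence of coins.\<close>

lemma spt_complete:
  assumes V: "\<And>w. w \<in> set Om \<Longrightarrow> V w \<in> set (omv w)"
    and con: "\<And>w w'. w \<in> set Om \<Longrightarrow> w' \<in> set Om \<Longrightarrow> omq i w = omq i w' \<Longrightarrow> oma i w (V w) = oma i w' (V w')"
  shows "(\<And>opts. opts \<in> set G \<Longrightarrow> \<exists>b \<in> set opts. \<forall>ws \<in> seqs Om n. b @ zip (map fst ws) (map V ws) \<in> X) \<Longrightarrow>
    cut X (spt Om i n G)"
proof (induction n arbitrary: G)
  case 0
  then show ?case by (fastforce simp: seqs_0)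
next
  case (Suc n)
  have "\<exists>a \<in> set (answers Om i q). cut X (spt Om i n (ext Om i q a G))" if q: "q \<in> set (questions Om i)" for q
  proof -
    obtain w where w: "w \<in> set Om" "omq i w = q" using q by (auto simp: questions_def)
    \<comment> \<open>Any coins with this question may be used, since they all lead to the same
      answer.\<close>
    let ?a = "oma i w (V w)"
    show ?thesis
    proof (rule bexI)
      show "?a \<in> set (answers Om i q)" using w V[OF w(1)] by (auto simp: answers_def intro!: bexI[of _ w])
      show "cut X (spt Om i n (ext Om i q ?a G))"
      proof (rule Suc.IH)
        fix opts assume "opts \<in> set (ext Om i q ?a G)"
        then obtain o' w' where o': "opts = extend i ?a w' o'" "o' \<in> set G" "w' \<in> set Om" "omq i w' = q"
          by (auto simp: ext_def)
        obtain b where b: "b \<in> set o'" "\<And>ws. ws \<in> seqs Om (Suc n) \<Longrightarrow> b @ zip (map fst ws) (map V ws) \<in> X"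
          using Suc.prems[OF o'(2)] by blast
        have "b @ [(fst w', V w')] \<in> set opts"
          using o' b V con[OF o'(3) w(1)] w by (auto simp: set_extend)
        moreover have "(b @ [(fst w', V w')]) @ zip (map fst ws) (map V ws) \<in> X" if "ws \<in> seqs Om n" for ws
          using b(2)[of "w' # ws"] that o' by (auto simp: seqs_def)
        ultimately show "\<exists>b \<in> set opts. \<forall>ws \<in> seqs Om n. b @ zip (map fst ws) (map V ws) \<in> X" by blast
      qed
    qed
  qed
  then show ?case by auto
qed

section \<open>The transcripts, which are common to all players\<close>

definition bundle_labels :: "omega list \<Rightarrow> nat \<Rightarrow> label set" where
  "bundle_labels Om n = {zip (map fst ws) vs | ws vs. ws \<in> seqs Om n \<and> list_all2 (\<lambda>w v. v \<in> set (omv w)) ws vs}"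

lemma bundle_labels_Suc:
  "bundle_labels Om (Suc n) = {(fst w, v) # b | w v b. w \<in> set Om \<and> v \<in> set (omv w) \<and> b \<in> bundle_labels Om n}"
proof (intro set_eqI iffI)
  let ?P = "\<lambda>w v. v \<in> set (omv w)"
  fix x assume "x \<in> bundle_labels Om (Suc n)"
  then obtain ws vs where 1: "x = zip (map fst ws) vs" "ws \<in> seqs Om (Suc n)" "list_all2 ?P ws vs"
    unfolding bundle_labels_def by blast
  then obtain w ws' where 2: "ws = w # ws'" "w \<in> set Om" "ws' \<in> seqs Om n" by (auto simp: seqs_Suc)
  then obtain v vs' where 3: "vs = v # vs'" "v \<in> set (omv w)" "list_all2 ?P ws' vs'"
    using 1 by (auto simp: list_all2_Cons1)
  have "zip (map fst ws') vs' \<in> bundle_labels Om n" unfolding bundle_labels_def using 2 3 by blast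
  moreover have "x = (fst w, v) # zip (map fst ws') vs'" using 1 2 3 by simp
  ultimately show "x \<in> {(fst w, v) # b | w v b. w \<in> set Om \<and> v \<in> set (omv w) \<and> b \<in> bundle_labels Om n}"
    using 2 3 by blast
next
  let ?P = "\<lambda>w v. v \<in> set (omv w)"
  fix x assume "x \<in> {(fst w, v) # b | w v b. w \<in> set Om \<and> v \<in> set (omv w) \<and> b \<in> bundle_labels Om n}"
  then obtain w v ws vs where 1: "x = (fst w, v) # zip (map fst ws) vs" "w \<in> set Om" "v \<in> set (omv w)"
    "ws \<in> seqs Om n" "list_all2 ?P ws vs" unfolding bundle_labels_def by blast
  have "x = zip (map fst (w # ws)) (v # vs)" "w # ws \<in> seqs Om (Suc n)" "list_all2 ?P (w # ws) (v # vs)"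
    using 1 by (simp_all add: seqs_def)
  then show "x \<in> bundle_labels Om (Suc n)" unfolding bundle_labels_def by blast
qed

lemma set_concat_ext:
  "set (concat (ext Om i q a G)) = {b @ [(fst w, v)] | b w v.
     b \<in> set (concat G) \<and> w \<in> set Om \<and> omq i w = q \<and> v \<in> set (omv w) \<and> oma i w v = a}" (is "?L = ?R")
proof (intro set_eqI iffI)
  fix x assume "x \<in> ?L"
  then obtain opts w where "opts \<in> set G" "w \<in> set Om" "omq i w = q" "x \<in> set (extend i a w opts)"
    unfolding ext_def by auto
  then show "x \<in> ?R" unfolding set_extend by auto
next
  fix x assume "x \<in> ?R"
  then obtain b w v opts where "x = b @ [(fst w, v)]" "opts \<in> set G" "b \<in> set opts" "w \<in> set Om" "omq i w = q"
    "v \<in> set (omv w)" "oma i w v = a" by auto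
  then have "x \<in> set (extend i a w opts)" "extend i a w opts \<in> set (ext Om i q a G)"
    by (auto simp: set_extend ext_def)
  then show "x \<in> ?L" by auto
qed

lemma mem_questions: "w \<in> set Om \<Longrightarrow> omq i w \<in> set (questions Om i)"
  by (auto simp: questions_def)

lemma mem_answers: "w \<in> set Om \<Longrightarrow> v \<in> set (omv w) \<Longrightarrow> oma i w v \<in> set (answers Om i (omq i w))"
  by (auto simp: answers_def intro!: bexI[of _ w])

text \<open>Starting from the empty transcript, the set of labels is the same for every
  \<open>i\<close>. This gives each bundle an edge in every piece.\<close>

lemma set_labels_spt:
  "set (labels (spt Om i n G)) = {b @ c | b c. b \<in> set (concat G) \<and> c \<in> bundle_labels Om n}"
proof (induction n arbitrary: G)
  case 0
  have "bundle_labels Om 0 = {[]}" by (auto simp: bundle_labels_def seqs_0)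
  then show ?case by (auto simp: comp_def)
next
  case (Suc n)
  have e: "(\<Union>q \<in> set (questions Om i). \<Union>a \<in> set (answers Om i q). set (concat (ext Om i q a G))) =
      {b @ [(fst w, v)] | b w v. b \<in> set (concat G) \<and> w \<in> set Om \<and> v \<in> set (omv w)}" (is "?L = ?R")
  proof
    show "?L \<subseteq> ?R" unfolding set_concat_ext by blast
    show "?R \<subseteq> ?L"
    proof
      fix x assume "x \<in> ?R"
      then obtain b w v where x: "x = b @ [(fst w, v)]" "b \<in> set (concat G)" "w \<in> set Om" "v \<in> set (omv w)" by blast
      then have "x \<in> set (concat (ext Om i (omq i w) (oma i w v) G))" unfolding set_concat_ext by blast
      then show "x \<in> ?L" using mem_questions[OF x(3)] mem_answers[OF x(3,4)] by blast
    qed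
  qed
  have "set (labels (spt Om i (Suc n) G)) =
      (\<Union>q \<in> set (questions Om i). \<Union>a \<in> set (answers Om i q). {b @ c | b c. b \<in> set (concat (ext Om i q a G)) \<and> c \<in> bundle_labels Om n})"
    using Suc by (simp add: comp_def)
  also have "\<dots> = {b @ c | b c. b \<in> ?L \<and> c \<in> bundle_labels Om n}" by blast
  also have "\<dots> = {b @ c | b c. b \<in> set (concat G) \<and> c \<in> bundle_labels Om (Suc n)}"
  proof (intro set_eqI iffI)
    fix x assume "x \<in> {b @ c | b c. b \<in> ?L \<and> c \<in> bundle_labels Om n}"
    then obtain b w v c where x: "x = (b @ [(fst w, v)]) @ c" "b \<in> set (concat G)" "w \<in> set Om" "v \<in> set (omv w)" "c \<in> bundle_labels Om n"
      unfolding e by blast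
    have "(fst w, v) # c \<in> bundle_labels Om (Suc n)" unfolding bundle_labels_Suc using x by blast
    moreover have "x = b @ ((fst w, v) # c)" using x by simp
    ultimately show "x \<in> {b @ c | b c. b \<in> set (concat G) \<and> c \<in> bundle_labels Om (Suc n)}" using x by blast
  next
    fix x assume "x \<in> {b @ c | b c. b \<in> set (concat G) \<and> c \<in> bundle_labels Om (Suc n)}"
    then obtain b w v c where x: "x = b @ (fst w, v) # c" "b \<in> set (concat G)" "w \<in> set Om" "v \<in> set (omv w)" "c \<in> bundle_labels Om n"
      unfolding bundle_labels_Suc by blast
    have "b @ [(fst w, v)] \<in> ?L" unfolding e using x by blast
    moreover have "x = (b @ [(fst w, v)]) @ c" using x by simp
    ultimately show "x \<in> {b @ c | b c. b \<in> ?L \<and> c \<in> bundle_labels Om n}" using x by blast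
  qed
  finally show ?case .
qed

lemma distinct_concat_map:
  assumes "distinct xs" "\<And>x. x \<in> set xs \<Longrightarrow> distinct (f x)"
    "\<And>x y. x \<in> set xs \<Longrightarrow> y \<in> set xs \<Longrightarrow> x \<noteq> y \<Longrightarrow> set (f x) \<inter> set (f y) = {}"
  shows "distinct (concat (map f xs))"
  using assms by (induction xs) fastforce+

text \<open>A transcript determines the questions and answers of player \<open>i\<close> and hence
  its leaf, so no label occurs twice. The common length \<open>m\<close> tells which entry of a
  transcript belongs to the current round.\<close>

lemma distinct_labels_spt:
  assumes Om: "distinct (map fst Om)" "\<And>w. w \<in> set Om \<Longrightarrow> distinct (omv w)"
  shows "distinct (concat G) \<Longrightarrow> (\<And>b. b \<in> set (concat G) \<Longrightarrow> length b = m) \<Longrightarrow> distinct (labels (spt Om i n G))"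
proof (induction n arbitrary: G m)
  case 0
  have "labels (spt Om i 0 G) = concat G" by (simp add: comp_def)
  then show ?case using 0 by simp
next
  case (Suc n)
  have fst_inj: "w = w'" if "w \<in> set Om" "w' \<in> set Om" "fst w = fst w'" for w w'
    using Om(1) that by (metis distinct_map inj_onD)
  have ext_dist: "distinct (concat (ext Om i q a G))" for q a
  proof -
    have *: "distinct (concat (map (\<lambda>w. extend i a w opts) (filter (\<lambda>w. omq i w = q) Om)))" if "distinct opts" for opts
    proof (rule distinct_concat_map)
      show "distinct (filter (\<lambda>w. omq i w = q) Om)" using Om(1) by (simp add: distinct_map)
      show "distinct (extend i a w opts)" if "w \<in> set (filter (\<lambda>w. omq i w = q) Om)" for w
        unfolding extend_def using that Om(2) \<open>distinct opts\<close>
        by (intro distinct_concat_map) (auto simp: distinct_map inj_on_def)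
      show "set (extend i a w opts) \<inter> set (extend i a w' opts) = {}"
        if "w \<in> set (filter (\<lambda>w. omq i w = q) Om)" "w' \<in> set (filter (\<lambda>w. omq i w = q) Om)" "w \<noteq> w'" for w w'
        using that fst_inj[of w w'] by (auto simp: set_extend)
    qed
    have "distinct (concat (concat (map (\<lambda>opts. map (\<lambda>w. extend i a w opts) (filter (\<lambda>w. omq i w = q) Om)) G')))"
      if "distinct (concat G')" for G'
      using that
    proof (induction G')
      case (Cons opts G')
      then show ?case using *[of opts] by (auto simp: set_extend)
    qed simp
    then show ?thesis using Suc.prems(1) unfolding ext_def by blast
  qed
  have ext_len: "length b = Suc m" if "b \<in> set (concat (ext Om i q a G))" for b q a
  proof -
    obtain b' v and w :: omega where b: "b = b' @ [(fst w, v)]" "b' \<in> set (concat G)"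
      using \<open>b \<in> set (concat (ext Om i q a G))\<close> unfolding set_concat_ext by blast
    then show ?thesis using Suc.prems(2)[OF b(2)] by simp
  qed
  have form: "\<exists>b w v c. x = b @ (fst w, v) # c \<and> length b = m \<and> w \<in> set Om \<and> omq i w = q \<and> oma i w v = a"
    if "x \<in> set (labels (spt Om i n (ext Om i q a G)))" for x q a
  proof -
    have "\<exists>b' c. x = b' @ c \<and> b' \<in> set (concat (ext Om i q a G)) \<and> c \<in> bundle_labels Om n"
      using that unfolding set_labels_spt mem_Collect_eq .
    then obtain b' c where b': "x = b' @ c" "b' \<in> set (concat (ext Om i q a G))" by (elim exE conjE)
    have "\<exists>b w v. b' = b @ [(fst w, v)] \<and> b \<in> set (concat G) \<and> w \<in> set Om \<and> omq i w = q \<and> v \<in> set (omv w) \<and> oma i w v = a"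
      using b'(2) unfolding set_concat_ext mem_Collect_eq .
    then obtain b w v where b: "b' = b @ [(fst w, v)]" "b \<in> set (concat G)" "w \<in> set Om" "omq i w = q" "oma i w v = a"
      by (elim exE conjE)
    have "x = b @ (fst w, v) # c" using b b' by simp
    then show ?thesis using b(3-5) Suc.prems(2)[OF b(2)] by (intro exI conjI)
  qed
  \<comment> \<open>Entry \<open>m\<close> of \<open>x\<close> names the coins and the view of this
    round, and these fix the question and the answer.\<close>
  have disj: "q = q' \<and> a = a'" if x: "x \<in> set (labels (spt Om i n (ext Om i q a G)))" "x \<in> set (labels (spt Om i n (ext Om i q' a' G)))" for x q a q' a'
  proof -
    obtain b w v c where 1: "x = b @ (fst w, v) # c" "length b = m" "w \<in> set Om" "omq i w = q" "oma i w v = a"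
      using form[OF x(1)] by blast
    obtain b' w' v' c' where 2: "x = b' @ (fst w', v') # c'" "length b' = m" "w' \<in> set Om" "omq i w' = q'" "oma i w' v' = a'"
      using form[OF x(2)] by blast
    have "fst w = fst w' \<and> v = v'" using 1(1,2) 2(1,2) by simp
    then show ?thesis using fst_inj 1 2 by metis
  qed
  have "labels (spt Om i (Suc n) G) = concat (map (\<lambda>q. concat (map (\<lambda>a. labels (spt Om i n (ext Om i q a G))) (answers Om i q))) (questions Om i))"
    by (simp add: comp_def)
  moreover have "distinct \<dots>"
  proof (rule distinct_concat_map)
    show "distinct (questions Om i)" by (simp add: questions_def)
    show "distinct (concat (map (\<lambda>a. labels (spt Om i n (ext Om i q a G))) (answers Om i q)))" for q
    proof (rule distinct_concat_map)
      show "distinct (answers Om i q)" by (simp add: answers_def)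
      show "distinct (labels (spt Om i n (ext Om i q a G)))" for a
        by (rule Suc.IH[OF ext_dist ext_len])
    qed (use disj in blast)
  qed (use disj in fastforce)
  ultimately show ?case by metis
qed

section \<open>Value of the repeated game and the size of cuts\<close>

text \<open>The success of round one depends on its coins alone, because a strategy does not see
  later questions. Given those coins, the rest is the shorter game with other strategies. This
  induction is the whole of sequential repetition.\<close>

lemma online_bound:
  fixes lam :: real
  assumes base: "\<And>s s'. real (card {w \<in> set Om. \<exists>v \<in> set (omv w). oma i w v = s (omq i w) \<and> oma j w v = s' (omq j w)}) \<le> lam * card (set Om)"
    and lam: "lam \<ge> 0"
  shows "real (card {ws \<in> seqs Om n. \<forall>t<n. \<exists>v \<in> set (omv (ws ! t)).
      oma i (ws ! t) v = \<sigma> (map (omq i) (take (Suc t) ws)) \<and> oma j (ws ! t) v = \<tau> (map (omq j) (take (Suc t) ws))})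
    \<le> (lam * card (set Om)) ^ n"
proof (induction n arbitrary: \<sigma> \<tau>)
  case 0
  have "{ws. ws \<in> seqs Om 0} = {[]}" by (auto simp: seqs_0)
  then show ?case by simp
next
  case (Suc n)
  define B where "B = {w \<in> set Om. \<exists>v \<in> set (omv w). oma i w v = \<sigma> [omq i w] \<and> oma j w v = \<tau> [omq j w]}"
  \<comment> \<open>After the first coins \<open>w\<close> the players continue with strategies that
    have their first question built in. The induction hypothesis bounds this set by the same number
    for every \<open>w\<close>.\<close>
  define S where "S w = {ws \<in> seqs Om n. \<forall>t<n. \<exists>v \<in> set (omv (ws ! t)).
      oma i (ws ! t) v = \<sigma> (omq i w # map (omq i) (take (Suc t) ws)) \<and>
      oma j (ws ! t) v = \<tau> (omq j w # map (omq j) (take (Suc t) ws))}" for w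
  let ?L = "{ws \<in> seqs Om (Suc n). \<forall>t<Suc n. \<exists>v \<in> set (omv (ws ! t)).
      oma i (ws ! t) v = \<sigma> (map (omq i) (take (Suc t) ws)) \<and> oma j (ws ! t) v = \<tau> (map (omq j) (take (Suc t) ws))}"
  have finS: "finite (S w)" for w unfolding S_def using finite_seqs by simp
  have finB: "finite B" unfolding B_def by simp
  have "?L \<subseteq> (\<lambda>(w, ws). w # ws) ` (SIGMA w:B. S w)"
  proof
    fix ws assume L: "ws \<in> ?L"
    then obtain w ws' where w: "ws = w # ws'" "w \<in> set Om" "ws' \<in> seqs Om n" by (auto simp: seqs_Suc)
    have h: "\<exists>v \<in> set (omv (ws ! t)). oma i (ws ! t) v = \<sigma> (map (omq i) (take (Suc t) ws)) \<and> oma j (ws ! t) v = \<tau> (map (omq j) (take (Suc t) ws))"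
      if "t < Suc n" for t using L that by blast
    have "w \<in> B" using h[of 0] w by (auto simp: B_def)
    moreover have "ws' \<in> S w" using h[of "Suc _"] w by (simp add: S_def)
    ultimately show "ws \<in> (\<lambda>(w, ws). w # ws) ` (SIGMA w:B. S w)" using w by auto
  qed
  then have "card ?L \<le> card ((\<lambda>(w, ws). w # ws) ` (SIGMA w:B. S w))"
    using finB finS by (intro card_mono finite_imageI finite_SigmaI) auto
  also have "\<dots> \<le> card (SIGMA w:B. S w)" using finB finS by (intro card_image_le finite_SigmaI) auto
  also have "\<dots> = (\<Sum>w\<in>B. card (S w))" using finB finS by simp
  finally have "real (card ?L) \<le> real (\<Sum>w\<in>B. card (S w))" by (simp only: of_nat_le_iff)
  also have "\<dots> = (\<Sum>w\<in>B. real (card (S w)))" by simp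
  also have "\<dots> \<le> (\<Sum>w\<in>B. (lam * card (set Om)) ^ n)"
    unfolding S_def by (intro sum_mono) (rule Suc.IH)
  also have "\<dots> = real (card B) * (lam * card (set Om)) ^ n" by simp
  also have "\<dots> \<le> (lam * card (set Om)) * (lam * card (set Om)) ^ n"
    unfolding B_def using base[of "\<lambda>q. \<sigma> [q]" "\<lambda>q. \<tau> [q]"] lam by (intro mult_right_mono) auto
  finally show ?case by simp
qed

text \<open>Inclusion and exclusion up to pairs, with \<open>p ^ 2\<close> as a crude count of the
  pairs.\<close>

lemma card_UN_ge:
  fixes c M :: real
  assumes "\<And>i. i < p \<Longrightarrow> finite (Z i)" "\<And>i. i < p \<Longrightarrow> real (card (Z i)) = M"
    "\<And>i j. i < p \<Longrightarrow> j < p \<Longrightarrow> i \<noteq> j \<Longrightarrow> real (card (Z i \<inter> Z j)) \<le> c" "c \<ge> 0"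
  shows "real (card (\<Union>i<p. Z i)) \<ge> real p * M - real p ^ 2 * c"
  using assms
proof (induction p)
  case (Suc p)
  let ?U = "\<Union>i<p. Z i"
  have fin: "finite ?U" "finite (Z p)" using Suc.prems(1) by auto
  have "card (?U \<inter> Z p) \<le> (\<Sum>i<p. card (Z i \<inter> Z p))"
  proof -
    have "?U \<inter> Z p = (\<Union>i<p. Z i \<inter> Z p)" by auto
    then show ?thesis using card_UN_le[of "{..<p}" "\<lambda>i. Z i \<inter> Z p"] by simp
  qed
  then have "real (card (?U \<inter> Z p)) \<le> real (\<Sum>i<p. card (Z i \<inter> Z p))" by (simp only: of_nat_le_iff)
  also have "\<dots> = (\<Sum>i<p. real (card (Z i \<inter> Z p)))" by simp
  also have "\<dots> \<le> (\<Sum>i<p. c)" using Suc.prems(3) by (intro sum_mono) simp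
  finally have 1: "real (card (?U \<inter> Z p)) \<le> real p * c" by simp
  have "card ?U + card (Z p) = card (?U \<union> Z p) + card (?U \<inter> Z p)" by (rule card_Un_Int[OF fin])
  then have "real (card ?U) + real (card (Z p)) = real (card (?U \<union> Z p)) + real (card (?U \<inter> Z p))"
    by (metis of_nat_add)
  moreover have "real (card ?U) \<ge> real p * M - real p ^ 2 * c" using Suc.prems by (intro Suc.IH) auto
  moreover have "(\<Union>i<Suc p. Z i) = ?U \<union> Z p" by (auto simp: less_Suc_eq)
  moreover have "real (card (Z p)) = M" using Suc.prems(2) by simp
  moreover have "real (Suc p) ^ 2 * c \<ge> real p ^ 2 * c + real p * c"
    using Suc.prems(4) by (simp add: power2_eq_square algebra_simps)
  ultimately show ?case using 1 by (simp add: algebra_simps)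
qed simp

text \<open>Every player picks from \<open>X\<close> one transcript for each sequence of coins, and
  different sequences have different transcripts. Two players pick the same one only if their
  strategies agree with a common accepted view in all \<open>n\<close> rounds, so the
  \<open>p\<close> families hardly overlap.\<close>

lemma spt_sound:
  fixes lam :: real
  assumes base: "\<And>i j s s'. i < p \<Longrightarrow> j < p \<Longrightarrow> i \<noteq> j \<Longrightarrow>
      real (card {w \<in> set Om. \<exists>v \<in> set (omv w). oma i w v = s (omq i w) \<and> oma j w v = s' (omq j w)}) \<le> lam * card (set Om)"
    and lam: "lam \<ge> 0" and ids: "distinct (map fst Om)" and X: "finite X"
    and cut: "\<And>i. i < p \<Longrightarrow> cut X (spt Om i n [[[]]])"
  shows "real (card X) \<ge> (real p - real p ^ 2 * lam ^ n) * real (card (set Om)) ^ n"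
proof -
  have "\<exists>\<sigma> vs. i < p \<longrightarrow> (\<forall>ws \<in> seqs Om n. length (vs ws) = n \<and>
     (\<forall>t<n. vs ws ! t \<in> set (omv (ws ! t)) \<and> oma i (ws ! t) (vs ws ! t) = \<sigma> (map (omq i) (take (Suc t) ws))) \<and>
     zip (map fst ws) (vs ws) \<in> X)" for i
  proof (cases "i < p")
    case True
    from spt_strategy[OF cut[OF this]] obtain \<sigma> where "\<forall>ws \<in> seqs Om n. \<exists>vs. length vs = n \<and>
     (\<forall>t<n. vs ! t \<in> set (omv (ws ! t)) \<and> oma i (ws ! t) (vs ! t) = \<sigma> (map (omq i) (take (Suc t) ws))) \<and>
     zip (map fst ws) vs \<in> X" by auto
    then show ?thesis by metis
  qed auto
  then obtain \<sigma> vs where s: "\<And>i ws. i < p \<Longrightarrow> ws \<in> seqs Om n \<Longrightarrow> length (vs i ws) = n \<and>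
     (\<forall>t<n. vs i ws ! t \<in> set (omv (ws ! t)) \<and> oma i (ws ! t) (vs i ws ! t) = \<sigma> i (map (omq i) (take (Suc t) ws))) \<and>
     zip (map fst ws) (vs i ws) \<in> X" by metis
  \<comment> \<open>The transcript that player \<open>i\<close> uses for the coins
    \<open>ws\<close>; its first components give \<open>ws\<close> back since coins are numbered
    injectively.\<close>
  define z where "z i ws = zip (map fst ws) (vs i ws)" for i ws
  have fst_inj: "ws = ws'" if "ws \<in> seqs Om n" "ws' \<in> seqs Om n" "map fst ws = map fst ws'" for ws ws'
  proof (rule nth_equalityI)
    show len: "length ws = length ws'" using that by (simp add: seqs_def)
    fix t assume t: "t < length ws"
    then have "ws ! t \<in> set Om" "ws' ! t \<in> set Om" "fst (ws ! t) = fst (ws' ! t)"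
      using that len by (auto simp: seqs_def dest: nth_map[of t ws fst] nth_map[of t ws' fst]) (metis nth_map)
    then show "ws ! t = ws' ! t" using ids by (metis distinct_map inj_onD)
  qed
  have zfst: "map fst (z i ws) = map fst ws" "map snd (z i ws) = vs i ws" if "i < p" "ws \<in> seqs Om n" for i ws
    using s[OF that] that by (simp_all add: z_def seqs_def)
  have inj: "inj_on (z i) (seqs Om n)" if "i < p" for i
    by (rule inj_onI) (metis zfst(1)[OF that] fst_inj)
  have "real (card (\<Union>i<p. z i ` seqs Om n)) \<ge> real p * real (card (set Om)) ^ n - real p ^ 2 * (lam * card (set Om)) ^ n"
  proof (rule card_UN_ge)
    show "real (card (z i ` seqs Om n)) = real (card (set Om)) ^ n" if "i < p" for i
      using inj[OF that] by (simp add: card_image card_seqs)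
    fix i j assume ij: "i < p" "j < p" "i \<noteq> j"
    let ?C = "{ws \<in> seqs Om n. \<forall>t<n. \<exists>v \<in> set (omv (ws ! t)).
      oma i (ws ! t) v = \<sigma> i (map (omq i) (take (Suc t) ws)) \<and> oma j (ws ! t) v = \<sigma> j (map (omq j) (take (Suc t) ws))}"
    have "z i ` seqs Om n \<inter> z j ` seqs Om n \<subseteq> z i ` ?C"
    proof
      fix x assume "x \<in> z i ` seqs Om n \<inter> z j ` seqs Om n"
      then obtain ws ws' where ws: "ws \<in> seqs Om n" "ws' \<in> seqs Om n" "x = z i ws" "x = z j ws'" by auto
      then have "ws = ws'" using zfst(1) ij fst_inj by metis
      then have "vs i ws = vs j ws" using ws zfst(2) ij by metis
      then have "ws \<in> ?C" using s[OF ij(1) ws(1)] s[OF ij(2) ws(1)] ws(1) by auto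
      then show "x \<in> z i ` ?C" using ws by blast
    qed
    then have "card (z i ` seqs Om n \<inter> z j ` seqs Om n) \<le> card (z i ` ?C)"
      using finite_seqs by (intro card_mono) auto
    also have "\<dots> \<le> card ?C" using finite_seqs by (intro card_image_le) auto
    finally have "real (card (z i ` seqs Om n \<inter> z j ` seqs Om n)) \<le> real (card ?C)" by simp
    also have "\<dots> \<le> (lam * card (set Om)) ^ n" by (rule online_bound[OF base[OF ij] lam])
    finally show "real (card (z i ` seqs Om n \<inter> z j ` seqs Om n)) \<le> (lam * card (set Om)) ^ n" .
  qed (use finite_seqs lam in auto)
  also have "card (\<Union>i<p. z i ` seqs Om n) \<le> card X"
    using X s by (intro card_mono) (auto simp: z_def)
  finally show ?thesis by (simp add: algebra_simps power_mult_distrib)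
qed

section \<open>Series-parallel networks as split instances\<close>

type_synonym vpath = "nat list"

text \<open>An empty label marks an edge outside all bundles, which can never be cut. A leaf is
  subdivided by a vertex of its own, so parallel leaves stay distinct in a simple graph. The
  connecting edges at a series node also make an empty series uncuttable, in accordance with
  \<open>cut\<close>.\<close>

function sp_edges :: "vpath \<Rightarrow> vpath \<Rightarrow> vpath \<Rightarrow> 'b sp \<Rightarrow> ((vpath \<times> vpath) \<times> 'b list) list" where
  "sp_edges \<pi> u v (Edge b) = [((u, \<pi> @ [0]), []), ((\<pi> @ [0], v), [b])]"
| "sp_edges \<pi> u v (Par ts) =
     concat (map (\<lambda>z. sp_edges (\<pi> @ [Suc (fst z)]) u v (snd z)) (zip [0..<length ts] ts))"
| "sp_edges \<pi> u v (Ser ts) = [((u, \<pi> @ [Suc 0]), []), ((\<pi> @ [Suc (length ts)], v), [])] @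
     concat (map (\<lambda>z. sp_edges (\<pi> @ [Suc (fst z)]) (\<pi> @ [Suc (fst z)]) (\<pi> @ [Suc (Suc (fst z))]) (snd z))
       (zip [0..<length ts] ts))"
  by pat_completeness auto
termination
proof (relation "measure (\<lambda>(\<pi>, u, v, t). size t)", simp)
  fix ts :: "'b sp list" and \<pi> u v :: vpath and z assume "z \<in> set (zip [0..<length ts] ts)"
  then have "snd z \<in> set ts" by (metis prod.collapse set_zip_rightD)
  then have s: "size (snd z) \<le> size_list size ts" by (rule size_list_estimation') simp
  show "((\<pi> @ [Suc (fst z)], u, v, snd z), \<pi>, u, v, Par ts) \<in> measure (\<lambda>(\<pi>, u, v, t). size t)"
    "((\<pi> @ [Suc (fst z)], \<pi> @ [Suc (fst z)], \<pi> @ [Suc (Suc (fst z))], snd z), \<pi>, u, v, Ser ts) \<in> measure (\<lambda>(\<pi>, u, v, t). size t)"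
    using s by auto
qed

lemma set_enum: "set (zip [0..<length ts] ts) = {(j, ts ! j) | j. j < length ts}"
proof -
  have "(\<exists>i. x = ([0..<length ts] ! i, ts ! i) \<and> i < length ts) = (\<exists>j. x = (j, ts ! j) \<and> j < length ts)" for x
    by (metis add_0 nth_upt)
  then show ?thesis by (simp add: set_zip)
qed

lemma sp_induct [case_names Edge Par Ser]:
  assumes "\<And>b \<pi> u v. P \<pi> u v (Edge b)"
    "\<And>ts \<pi> u v. (\<And>j. j < length ts \<Longrightarrow> P (\<pi> @ [Suc j]) u v (ts ! j)) \<Longrightarrow> P \<pi> u v (Par ts)"
    "\<And>ts \<pi> u v. (\<And>j. j < length ts \<Longrightarrow> P (\<pi> @ [Suc j]) (\<pi> @ [Suc j]) (\<pi> @ [Suc (Suc j)]) (ts ! j)) \<Longrightarrow> P \<pi> u v (Ser ts)"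
  shows "P \<pi> u v t"
proof (induction \<pi> u v t rule: sp_edges.induct)
  case (2 \<pi> u v ts)
  show ?case
  proof (rule assms(2))
    fix j assume "j < length ts"
    then show "P (\<pi> @ [Suc j]) u v (ts ! j)" using 2[of "(j, ts ! j)"] set_enum by auto
  qed
next
  case (3 \<pi> u v ts)
  show ?case
  proof (rule assms(3))
    fix j assume "j < length ts"
    then show "P (\<pi> @ [Suc j]) (\<pi> @ [Suc j]) (\<pi> @ [Suc (Suc j)]) (ts ! j)" using 3[of "(j, ts ! j)"] set_enum by auto
  qed
qed (rule assms(1))

lemma set_sp_Par: "set (sp_edges \<pi> u v (Par ts)) = (\<Union>j<length ts. set (sp_edges (\<pi> @ [Suc j]) u v (ts ! j)))"
  by (auto simp: set_enum)

lemma set_sp_Ser: "set (sp_edges \<pi> u v (Ser ts)) = {((u, \<pi> @ [Suc 0]), []), ((\<pi> @ [Suc (length ts)], v), [])} \<union>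
   (\<Union>j<length ts. set (sp_edges (\<pi> @ [Suc j]) (\<pi> @ [Suc j]) (\<pi> @ [Suc (Suc j)]) (ts ! j)))"
  by (auto simp: set_enum)

text \<open>The names reserved for the interior of the network at \<open>\<pi>\<close>. Different
  children have disjoint interiors, and a terminal is never interior.\<close>

definition below :: "vpath \<Rightarrow> vpath set" where
  "below \<pi> = {\<pi> @ x # xs | x xs. True}"

lemma below_iff: "\<rho> \<in> below \<pi> \<longleftrightarrow> (\<exists>x xs. \<rho> = \<pi> @ x # xs)"
  by (auto simp: below_def)

lemma below_simps [simp]:
  "\<pi> @ [j] \<in> below \<pi>" "\<pi> \<notin> below \<pi>" "\<pi> @ [j] \<in> below (\<pi> @ [i]) \<longleftrightarrow> False" "below (\<pi> @ [j]) \<subseteq> below \<pi>"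
  by (auto simp: below_iff)

lemma below_disj: "\<rho> \<in> below (\<pi> @ [i]) \<Longrightarrow> \<rho> \<in> below (\<pi> @ [j]) \<Longrightarrow> i = j"
  by (auto simp: below_iff)

text \<open>The main point is that every edge has an interior end, by which the subnetwork it
  belongs to can be recognised.\<close>

lemma sp_edges_ends:
  "((a, c), l) \<in> set (sp_edges \<pi> u v t) \<Longrightarrow>
    a \<in> insert u (insert v (below \<pi>)) \<and> c \<in> insert u (insert v (below \<pi>)) \<and> (a \<in> below \<pi> \<or> c \<in> below \<pi>) \<and>
    (u \<noteq> v \<longrightarrow> u \<notin> below \<pi> \<longrightarrow> v \<notin> below \<pi> \<longrightarrow> a \<noteq> c) \<and> length l \<le> 1"
proof (induction \<pi> u v t arbitrary: a c l rule: sp_induct)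
  case (Edge b \<pi> u v)
  then show ?case by auto
next
  case (Par ts \<pi> u v)
  then obtain j where j: "j < length ts" "((a, c), l) \<in> set (sp_edges (\<pi> @ [Suc j]) u v (ts ! j))"
    unfolding set_sp_Par by blast
  then show ?case using Par.IH[OF j] subsetD[OF below_simps(4)[of \<pi> "Suc j"]] by blast
next
  case (Ser ts \<pi> u v)
  then consider "((a, c), l) \<in> {((u, \<pi> @ [Suc 0]), []), ((\<pi> @ [Suc (length ts)], v), [])}"
    | j where "j < length ts" "((a, c), l) \<in> set (sp_edges (\<pi> @ [Suc j]) (\<pi> @ [Suc j]) (\<pi> @ [Suc (Suc j)]) (ts ! j))"
    unfolding set_sp_Ser by blast
  then show ?case
  proof cases
    case 1
    then show ?thesis by auto
  next
    case 2
    have "\<pi> @ [Suc j] \<noteq> \<pi> @ [Suc (Suc j)]" by simp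
    then show ?thesis using Ser.IH[OF 2] subsetD[OF below_simps(4)[of \<pi> "Suc j"]] below_simps(1,2,3) by blast
  qed
qed

text \<open>The interior end of an edge determines its child network, so equal vertex pairs come
  from the same place of the tree and carry the same label.\<close>

lemma sp_edges_unique:
  assumes "u \<noteq> v" "u \<notin> below \<pi>" "v \<notin> below \<pi>" "((a, c), l) \<in> set (sp_edges \<pi> u v t)" "((a', c'), l') \<in> set (sp_edges \<pi> u v t)"
    "{a, c} = {a', c'}"
  shows "l = l'"
  using assms
proof (induction \<pi> u v t arbitrary: a c l a' c' l' rule: sp_induct)
  case (Edge b \<pi> u v)
  then show ?case by (auto simp: doubleton_eq_iff)
next
  case (Par ts \<pi> u v)
  obtain j where j: "j < length ts" "((a, c), l) \<in> set (sp_edges (\<pi> @ [Suc j]) u v (ts ! j))"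
    using Par.prems(4) unfolding set_sp_Par by blast
  obtain j' where j': "j' < length ts" "((a', c'), l') \<in> set (sp_edges (\<pi> @ [Suc j']) u v (ts ! j'))"
    using Par.prems(5) unfolding set_sp_Par by blast
  have low: "x \<in> below \<pi>" if "x \<in> below (\<pi> @ [j])" for x j using that subsetD[OF below_simps(4)] by blast
  obtain z where z: "z \<in> {a, c}" "z \<in> below (\<pi> @ [Suc j])" using sp_edges_ends[OF j(2)] by blast
  then have "z \<in> insert u (insert v (below (\<pi> @ [Suc j'])))"
    using sp_edges_ends[OF j'(2)] unfolding Par.prems(6) by blast
  moreover have "z \<noteq> u" "z \<noteq> v" using low[OF z(2)] Par.prems(2,3) by auto
  ultimately have "z \<in> below (\<pi> @ [Suc j'])" by blast
  from below_disj[OF z(2) this] have "j = j'" by simp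
  moreover have "u \<notin> below (\<pi> @ [Suc j])" "v \<notin> below (\<pi> @ [Suc j])"
    using Par.prems(2,3) subsetD[OF below_simps(4)[of \<pi> "Suc j"]] by blast+
  ultimately show ?case using Par.IH[OF j(1) Par.prems(1) _ _ j(2), of a' c' l'] j' Par.prems(6) by blast
next
  case (Ser ts \<pi> u v)
  let ?C = "{((u, \<pi> @ [Suc 0]), []), ((\<pi> @ [Suc (length ts)], v), [])} :: ((vpath \<times> vpath) \<times> 'a list) set"
  let ?S = "\<lambda>j. set (sp_edges (\<pi> @ [Suc j]) (\<pi> @ [Suc j]) (\<pi> @ [Suc (Suc j)]) (ts ! j))"
  have low: "x \<in> below \<pi>" if "x \<in> below (\<pi> @ [j])" for x j using that subsetD[OF below_simps(4)] by blast
  have conn: False if h: "((a, c), l) \<in> ?C" "j < length ts" "((a', c'), l') \<in> ?S j" "{a, c} = {a', c'}" for a c l a' c' l' j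
  proof -
    obtain z where z: "z \<in> {a', c'}" "z \<in> below (\<pi> @ [Suc j])" using sp_edges_ends[OF h(3)] by blast
    then have "z \<in> {a, c}" using h(4) by simp
    then have "z \<in> {u, v, \<pi> @ [Suc 0], \<pi> @ [Suc (length ts)]}" using h(1) by auto
    then show False using z(2) low[OF z(2)] Ser.prems(2,3) by auto
  qed
  consider (cc) "((a, c), l) \<in> ?C" "((a', c'), l') \<in> ?C"
    | (cj) j where "((a, c), l) \<in> ?C" "j < length ts" "((a', c'), l') \<in> ?S j"
    | (jc) j where "((a', c'), l') \<in> ?C" "j < length ts" "((a, c), l) \<in> ?S j"
    | (jj) j j' where "j < length ts" "((a, c), l) \<in> ?S j" "j' < length ts" "((a', c'), l') \<in> ?S j'"
    using Ser.prems(4,5) unfolding set_sp_Ser by blast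
  then show ?case
  proof cases
    case cc then show ?thesis by auto
  next
    case cj show ?thesis using conn[OF cj Ser.prems(6)] by simp
  next
    case jc show ?thesis using conn[OF jc Ser.prems(6)[symmetric]] by simp
  next
    case jj
    obtain z where z: "z \<in> {a, c}" "z \<in> below (\<pi> @ [Suc j])" using sp_edges_ends[OF jj(2)] by blast
    then have "z \<in> insert (\<pi> @ [Suc j']) (insert (\<pi> @ [Suc (Suc j')]) (below (\<pi> @ [Suc j'])))"
      using sp_edges_ends[OF jj(4)] unfolding Ser.prems(6) by blast
    then have "z \<in> below (\<pi> @ [Suc j'])" using z(2) by auto
    from below_disj[OF z(2) this] have e: "j' = j" by simp
    show ?thesis
      by (rule Ser.IH[OF jj(1) _ _ _ jj(2) jj(4)[unfolded e] Ser.prems(6)]) auto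
  qed
qed

lemma sp_edges_labels: "concat (map snd (sp_edges \<pi> u v t)) = labels t"
proof (induction \<pi> u v t rule: sp_induct)
  case (Par ts \<pi> u v)
  have "concat (map snd (concat (map (\<lambda>z. sp_edges (\<pi> @ [Suc (fst z)]) u v (snd z)) zs))) = concat (map (labels \<circ> snd) zs)"
    if "set zs \<subseteq> set (zip [0..<length ts] ts)" for zs
    using that by (induction zs) (auto simp: set_enum Par)
  from this[OF subset_refl] show ?case by (simp flip: map_map)
next
  case (Ser ts \<pi> u v)
  have "concat (map snd (concat (map (\<lambda>z. sp_edges (\<pi> @ [Suc (fst z)]) (\<pi> @ [Suc (fst z)]) (\<pi> @ [Suc (Suc (fst z))]) (snd z)) zs))) = concat (map (labels \<circ> snd) zs)"
    if "set zs \<subseteq> set (zip [0..<length ts] ts)" for zs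
    using that by (induction zs) (auto simp: set_enum Ser)
  from this[OF subset_refl] show ?case by (simp flip: map_map)
qed simp

section \<open>Cuts of a network as graph cuts\<close>

definition kept :: "'b set \<Rightarrow> 'b list \<Rightarrow> bool" where
  "kept X l \<longleftrightarrow> set l \<inter> X = {}"

definition fwd :: "'b set \<Rightarrow> ((vpath \<times> vpath) \<times> 'b list) set \<Rightarrow> (vpath \<times> vpath) set" where
  "fwd X E = {(a, c). \<exists>l. ((a, c), l) \<in> E \<and> kept X l}"

lemma fwd_mono: "E \<subseteq> E' \<Longrightarrow> (fwd X E)\<^sup>* \<subseteq> (fwd X E')\<^sup>*"
  by (rule rtrancl_mono) (auto simp: fwd_def)

lemma sp_not_cut: "\<not> cut X t \<Longrightarrow> (u, v) \<in> (fwd X (set (sp_edges \<pi> u v t)))\<^sup>*"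
proof (induction \<pi> u v t rule: sp_induct)
  case (Edge b \<pi> u v)
  have "(u, \<pi> @ [0]) \<in> fwd X (set (sp_edges \<pi> u v (Edge b)))" "(\<pi> @ [0], v) \<in> fwd X (set (sp_edges \<pi> u v (Edge b)))"
    using Edge by (auto simp: fwd_def kept_def)
  then show ?case by (rule converse_rtrancl_into_rtrancl[OF _ r_into_rtrancl])
next
  case (Par ts \<pi> u v)
  then obtain j where j: "j < length ts" "\<not> cut X (ts ! j)" by (auto simp: in_set_conv_nth)
  have "set (sp_edges (\<pi> @ [Suc j]) u v (ts ! j)) \<subseteq> set (sp_edges \<pi> u v (Par ts))"
    unfolding set_sp_Par using j by blast
  then show ?case using Par.IH[OF j] fwd_mono by blast
next
  case (Ser ts \<pi> u v)
  let ?R = "fwd X (set (sp_edges \<pi> u v (Ser ts)))"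
  have "(\<pi> @ [Suc 0], \<pi> @ [Suc j]) \<in> ?R\<^sup>*" if "j \<le> length ts" for j
    using that
  proof (induction j)
    case (Suc j)
    then have j: "j < length ts" "\<not> cut X (ts ! j)" using Ser.prems by auto
    have "set (sp_edges (\<pi> @ [Suc j]) (\<pi> @ [Suc j]) (\<pi> @ [Suc (Suc j)]) (ts ! j)) \<subseteq> set (sp_edges \<pi> u v (Ser ts))"
      unfolding set_sp_Ser using j by blast
    then have "(\<pi> @ [Suc j], \<pi> @ [Suc (Suc j)]) \<in> ?R\<^sup>*" using Ser.IH[OF j] fwd_mono by blast
    then show ?case using Suc by (meson Suc_leD rtrancl_trans)
  qed simp
  moreover have "(u, \<pi> @ [Suc 0]) \<in> ?R" "(\<pi> @ [Suc (length ts)], v) \<in> ?R"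
    by (auto simp: fwd_def kept_def)
  ultimately show ?case by (meson converse_rtrancl_into_rtrancl le_refl rtrancl_into_rtrancl)
qed

text \<open>The certificate is the source side: a set of interior vertices which, with
  \<open>u\<close> added, no kept edge leaves or enters, and which cannot contain
  \<open>v\<close>.\<close>

lemma sp_cut:
  "cut X t \<Longrightarrow> u \<noteq> v \<Longrightarrow> u \<notin> below \<pi> \<Longrightarrow> v \<notin> below \<pi> \<Longrightarrow> \<exists>S \<subseteq> below \<pi>. \<forall>a c l.
     ((a, c), l) \<in> set (sp_edges \<pi> u v t) \<longrightarrow> kept X l \<longrightarrow> (a \<in> insert u S \<longleftrightarrow> c \<in> insert u S)"
proof (induction \<pi> u v t rule: sp_induct)
  case (Edge b \<pi> u v)
  then show ?case by (intro exI[of _ "{\<pi> @ [0]}"]) (auto simp: kept_def)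
next
  case (Par ts \<pi> u v)
  have low: "x \<in> below \<pi>" if "x \<in> below (\<pi> @ [j])" for x j using that subsetD[OF below_simps(4)] by blast
  have "\<exists>S \<subseteq> below (\<pi> @ [Suc j]). \<forall>a c l.
     ((a, c), l) \<in> set (sp_edges (\<pi> @ [Suc j]) u v (ts ! j)) \<longrightarrow> kept X l \<longrightarrow> (a \<in> insert u S \<longleftrightarrow> c \<in> insert u S)"
    if "j < length ts" for j
    by (rule Par.IH[OF that]) (use that Par.prems low in auto)
  then obtain S where S: "\<And>j. j < length ts \<Longrightarrow> S j \<subseteq> below (\<pi> @ [Suc j])"
    "\<And>j a c l. j < length ts \<Longrightarrow> ((a, c), l) \<in> set (sp_edges (\<pi> @ [Suc j]) u v (ts ! j)) \<Longrightarrow> kept X l \<Longrightarrow> (a \<in> insert u (S j) \<longleftrightarrow> c \<in> insert u (S j))"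
    by metis
  let ?S = "\<Union>j<length ts. S j"
  \<comment> \<open>Membership in the union can be decided inside a single child, as the interiors
    of the children are disjoint and \<open>v\<close> is interior to none.\<close>
  have m: "(x \<in> insert u ?S) = (x \<in> insert u (S j))" if "j < length ts" "x \<in> insert u (insert v (below (\<pi> @ [Suc j])))" for x j
  proof -
    have "j' = j" if "j' < length ts" "x \<in> S j'" "x \<in> below (\<pi> @ [Suc j])" for j'
      using that S(1)[of j'] below_disj[of x \<pi> "Suc j'" "Suc j"] by auto
    moreover have "v \<notin> ?S" using S(1) low Par.prems(4) by blast
    ultimately show ?thesis using that by blast
  qed
  show ?case
  proof (intro exI[of _ ?S] conjI allI impI)
    show "?S \<subseteq> below \<pi>" using S(1) low by blast
    fix a c l assume "((a, c), l) \<in> set (sp_edges \<pi> u v (Par ts))" and k: "kept X l"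
    then obtain j where j: "j < length ts" "((a, c), l) \<in> set (sp_edges (\<pi> @ [Suc j]) u v (ts ! j))"
      unfolding set_sp_Par by blast
    then show "(a \<in> insert u ?S) = (c \<in> insert u ?S)"
      using S(2)[OF j k] m[OF j(1)] sp_edges_ends[OF j(2)] by simp
  qed
next
  case (Ser ts \<pi> u v)
  have low: "x \<in> below \<pi>" if "x \<in> below (\<pi> @ [j])" for x j using that subsetD[OF below_simps(4)] by blast
  obtain j where j: "j < length ts" "cut X (ts ! j)" using Ser.prems(1) by (auto simp: in_set_conv_nth)
  obtain S where S: "S \<subseteq> below (\<pi> @ [Suc j])"
    "\<And>a c l. ((a, c), l) \<in> set (sp_edges (\<pi> @ [Suc j]) (\<pi> @ [Suc j]) (\<pi> @ [Suc (Suc j)]) (ts ! j)) \<Longrightarrow> kept X l \<Longrightarrow>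
      (a \<in> insert (\<pi> @ [Suc j]) S \<longleftrightarrow> c \<in> insert (\<pi> @ [Suc j]) S)"
    using Ser.IH[OF j(1) j(2)] by auto
  \<comment> \<open>Everything up to the source of the cut component \<open>j\<close> lies on the
    source side, together with the source side \<open>S\<close> inside that component.\<close>
  define U where "U = (\<lambda>i. \<pi> @ [Suc i]) ` {..j} \<union> (\<Union>i<j. below (\<pi> @ [Suc i])) \<union> S"
  have Usub: "U \<subseteq> below \<pi>" unfolding U_def using S(1) low by auto
  have node: "\<pi> @ [Suc i] \<in> U \<longleftrightarrow> i \<le> j" for i unfolding U_def using S(1) by auto
  have deep: "x \<in> U \<longleftrightarrow> i < j \<or> (i = j \<and> x \<in> S)" if "x \<in> below (\<pi> @ [Suc i])" for x i
  proof -
    have "x \<notin> (\<lambda>i. \<pi> @ [Suc i]) ` {..j}" using that by auto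
    moreover have "i' = i" if "x \<in> below (\<pi> @ [Suc i'])" for i'
      using below_disj[OF that \<open>x \<in> below (\<pi> @ [Suc i])\<close>] by simp
    moreover have "i = j" if "x \<in> S" using that S(1) calculation(2) by blast
    ultimately show ?thesis unfolding U_def using that by blast
  qed
  show ?case
  proof (intro exI[of _ U] conjI allI impI)
    fix a c l assume E: "((a, c), l) \<in> set (sp_edges \<pi> u v (Ser ts))" and k: "kept X l"
    have uv: "u \<notin> U" "v \<notin> U" using Usub Ser.prems by auto
    from E consider "a = u" "c = \<pi> @ [Suc 0]" | "a = \<pi> @ [Suc (length ts)]" "c = v"
      | i where "i < length ts" "((a, c), l) \<in> set (sp_edges (\<pi> @ [Suc i]) (\<pi> @ [Suc i]) (\<pi> @ [Suc (Suc i)]) (ts ! i))"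
      unfolding set_sp_Ser by blast
    then show "(a \<in> insert u U) = (c \<in> insert u U)"
    proof cases
      case 1 then show ?thesis using node[of 0] by simp
    next
      case 2 then show ?thesis using node[of "length ts"] j uv Ser.prems by auto
    next
      case 3
      have ne: "x \<noteq> u" if "x \<in> insert (\<pi> @ [Suc i]) (insert (\<pi> @ [Suc (Suc i)]) (below (\<pi> @ [Suc i])))" for x
        using that Ser.prems(3) low below_simps(1) by blast
      have "x \<in> U \<longleftrightarrow> i < j \<or> (i = j \<and> x \<in> insert (\<pi> @ [Suc j]) S)"
        if "x \<in> insert (\<pi> @ [Suc i]) (insert (\<pi> @ [Suc (Suc i)]) (below (\<pi> @ [Suc i])))" for x
        using that node[of i] node[of "Suc i"] deep[of x i] S(1) by auto
      then show ?thesis using sp_edges_ends[OF 3(2)] ne S(2)[of a c l] 3(2) k by auto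
    qed
  qed (rule Usub)
qed

declare split_paired_All [simp] split_paired_Ex [simp]

lemma distinct_concat_unique:
  "distinct (concat (map f xs)) \<Longrightarrow> x \<in> set xs \<Longrightarrow> y \<in> set xs \<Longrightarrow> b \<in> set (f x) \<Longrightarrow> b \<in> set (f y) \<Longrightarrow> x = y"
  by (induction xs) auto

section \<open>The split instance made from \<open>p\<close> networks with the same labels\<close>

locale network =
  fixes p :: nat and t :: "nat \<Rightarrow> 'b sp" and nm :: "vpath \<Rightarrow> nat" and L :: "'b set"
  assumes nm: "inj nm" and p2: "p \<ge> 2"
    and lab: "\<And>i. i < p \<Longrightarrow> distinct (labels (t i))" "\<And>i. i < p \<Longrightarrow> set (labels (t i)) = L"
begin

text \<open>The paths \<open>[0]\<close> and \<open>[1]\<close> are the global terminals, their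
  extensions by \<open>Suc i\<close> the terminals of piece \<open>i\<close>, and its interior lies
  below \<open>[Suc (Suc i)]\<close>. Private terminals keep all labelled edges inside the pieces
  when source and sink are removed.\<close>

definition side :: "nat \<Rightarrow> ((vpath \<times> vpath) \<times> 'b list) list" where
  "side i = sp_edges [Suc (Suc i)] [0, Suc i] [1, Suc i] (t i)"

definition edg :: "vpath \<Rightarrow> vpath \<Rightarrow> nat set" where
  "edg a c = {nm a, nm c}"

definition vset :: "nat \<Rightarrow> vpath set" where
  "vset i = {[0, Suc i], [1, Suc i]} \<union> (\<Union>((a, c), l) \<in> set (side i). {a, c})"

definition piece :: "nat \<Rightarrow> graph" where
  "piece i = \<lparr>verts = nm ` vset i, edges = (\<lambda>((a, c), l). edg a c) ` set (side i)\<rparr>"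

definition conn :: "nat set set" where
  "conn = (\<Union>i<p. {edg [0] [0, Suc i], edg [1, Suc i] [1]})"

definition bnd :: "'b \<Rightarrow> nat set set" where
  "bnd b = {edg a c | i a c. i < p \<and> ((a, c), [b]) \<in> set (side i)}"

definition inst :: split_instance where
  "inst = \<lparr>the_graph = \<lparr>verts = {nm [0], nm [1]} \<union> (\<Union>i<p. nm ` vset i),
       edges = conn \<union> (\<Union>i<p. edges (piece i))\<rparr>,
     source = nm [0], sink = nm [1], pieces = map piece [0..<p], bundles = bnd ` L\<rparr>"

text \<open>All names that piece \<open>i\<close> may use. Regions are disjoint and avoid the global
  terminals, which yields the disjointness of the pieces.\<close>

definition region :: "nat \<Rightarrow> vpath set" where
  "region i = {[0, Suc i], [1, Suc i]} \<union> below [Suc (Suc i)]"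

lemma region_disj: "x \<in> region i \<Longrightarrow> x \<in> region j \<Longrightarrow> i = j"
  by (auto simp: region_def below_iff)

lemma region_st: "[0] \<notin> region i" "[1] \<notin> region i"
  by (auto simp: region_def below_iff)

lemma term_simps: "[0, Suc i] \<noteq> [1, Suc i]" "[0, Suc i] \<notin> below [Suc (Suc i)]" "[1, Suc i] \<notin> below [Suc (Suc i)]"
  by (auto simp: below_iff)

lemma side_ends:
  assumes "((a, c), l) \<in> set (side i)"
  shows "a \<in> region i" "c \<in> region i" "a \<noteq> c" "length l \<le> 1"
  using sp_edges_ends[OF assms[unfolded side_def]] term_simps by (auto simp: region_def)

lemma vset_region: "vset i \<subseteq> region i"
proof
  fix x assume "x \<in> vset i"
  then consider "x \<in> {[0, Suc i], [1, Suc i]}" | a c l where "((a, c), l) \<in> set (side i)" "x \<in> {a, c}"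
    unfolding vset_def by auto
  then show "x \<in> region i" by cases (auto simp: region_def dest: side_ends)
qed

lemma edg_eq: "edg a c = edg a' c' \<longleftrightarrow> {a, c} = {a', c'}"
proof -
  have "edg a c = nm ` {a, c}" for a c by (simp add: edg_def)
  then show ?thesis using inj_image_eq_iff[OF nm] by metis
qed

lemma mem_edg: "nm x \<in> edg a c \<longleftrightarrow> x = a \<or> x = c"
  using nm by (auto simp: edg_def inj_eq)

lemma label_unique:
  assumes "((a, c), l) \<in> set (side i)" "((a', c'), l') \<in> set (side j)" "edg a c = edg a' c'"
  shows "i = j \<and> l = l'"
proof -
  have e: "{a, c} = {a', c'}" using assms(3) edg_eq by blast
  then have "a \<in> {a', c'}" by auto
  then have ij: "i = j" using side_ends[OF assms(1)] side_ends[OF assms(2)] region_disj[of a] by auto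
  have "l = l'"
    by (rule sp_edges_unique[OF term_simps[of i] assms(1)[unfolded side_def] assms(2)[unfolded side_def ij[symmetric]] e])
  with ij show ?thesis by blast
qed

lemma label_item:
  assumes "i < p" "b \<in> L"
  obtains a c where "((a, c), [b]) \<in> set (side i)"
proof -
  have "b \<in> set (concat (map snd (side i)))"
    using assms lab(2) by (simp only: side_def sp_edges_labels)
  then obtain z where z: "z \<in> set (side i)" "b \<in> set (snd z)" by auto
  obtain a c l where zz: "z = ((a, c), l)" by (metis prod.collapse)
  have "l = [b]" using side_ends(4)[OF z(1)[unfolded zz]] z(2) zz by (cases l) auto
  then show ?thesis using that z zz by blast
qed

lemma label_item_unique:
  assumes "i < p" "((a, c), [b]) \<in> set (side i)" "((a', c'), [b]) \<in> set (side i)"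
  shows "a = a' \<and> c = c'"
proof -
  have "distinct (concat (map snd (side i)))" using lab(1)[OF assms(1)] by (simp only: side_def sp_edges_labels)
  from distinct_concat_unique[OF this assms(2,3), of b] show ?thesis by simp
qed

lemma finite_L: "finite L"
  using lab(2)[of 0] p2 by (metis List.finite_set less_le_trans pos2)

lemma bnd_edges: "bnd b \<subseteq> (\<Union>i<p. edges (piece i))"
  by (force simp: bnd_def piece_def)

lemma card_bnd:
  assumes "b \<in> L"
  shows "card (bnd b) = p"
proof -
  have "\<exists>f. \<forall>i<p. ((fst (f i), snd (f i)), [b]) \<in> set (side i)"
  proof -
    have "\<exists>z. i < p \<longrightarrow> ((fst z, snd z), [b]) \<in> set (side i)" for i
      using label_item[OF _ assms, of i] by (metis fst_conv snd_conv)
    then show ?thesis by metis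
  qed
  then obtain f where f: "\<And>i. i < p \<Longrightarrow> ((fst (f i), snd (f i)), [b]) \<in> set (side i)" by blast
  have "bnd b = (\<lambda>i. edg (fst (f i)) (snd (f i))) ` {..<p}"
  proof (intro set_eqI iffI)
    fix e assume "e \<in> bnd b"
    then obtain i a c where "e = edg a c" "i < p" "((a, c), [b]) \<in> set (side i)" by (auto simp: bnd_def)
    then show "e \<in> (\<lambda>i. edg (fst (f i)) (snd (f i))) ` {..<p}"
      using label_item_unique[OF _ f, of i a c] by (auto intro!: image_eqI[of _ _ i])
  next
    fix e assume "e \<in> (\<lambda>i. edg (fst (f i)) (snd (f i))) ` {..<p}"
    then show "e \<in> bnd b" unfolding bnd_def using f by blast
  qed
  moreover have "inj_on (\<lambda>i. edg (fst (f i)) (snd (f i))) {..<p}"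
    using label_unique[OF f f] by (auto intro!: inj_onI)
  ultimately show ?thesis by (simp add: card_image)
qed

lemma bnd_disjoint: "e \<in> bnd b \<Longrightarrow> e \<in> bnd b' \<Longrightarrow> b = b'"
  unfolding bnd_def using label_unique by blast

lemma bnd_inj: "inj_on bnd L"
proof (rule inj_onI)
  fix b b' assume b: "b \<in> L" "b' \<in> L" "bnd b = bnd b'"
  have "bnd b \<noteq> {}" using card_bnd[OF b(1)] p2 by auto
  then show "b = b'" using bnd_disjoint b(3) by blast
qed

lemma is_graph_piece: "is_graph (piece i)"
  unfolding is_graph_def
proof (intro conjI ballI)
  show "finite (verts (piece i))" by (auto simp: piece_def vset_def)
  fix e assume "e \<in> edges (piece i)"
  then obtain a c l where e: "((a, c), l) \<in> set (side i)" "e = edg a c" by (auto simp: piece_def)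
  have "a \<in> vset i" "c \<in> vset i" using e(1) unfolding vset_def by force+
  moreover have "nm a \<noteq> nm c" using side_ends(3)[OF e(1)] nm by (simp add: inj_eq)
  ultimately show "\<exists>u\<in>verts (piece i). \<exists>v\<in>verts (piece i). u \<noteq> v \<and> e = {u, v}"
    using e(2) by (auto simp: piece_def edg_def)
qed

lemma nm_vset: "nm x \<in> nm ` vset i \<Longrightarrow> x \<in> region i"
  using nm subsetD[OF vset_region] by (auto simp: inj_eq)

lemma is_split_instance_inst: "is_split_instance p inst"
proof -
  let ?G = "the_graph inst"
  have st: "nm [0] \<noteq> nm [1]" "nm [0] \<notin> nm ` vset i" "nm [1] \<notin> nm ` vset i" for i
    using nm nm_vset[of _ i] region_st[of i] by (auto simp: inj_eq)
  have T: "[0, Suc i] \<in> vset i" "[1, Suc i] \<in> vset i" for i by (auto simp: vset_def)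
  have G: "is_graph ?G" unfolding is_graph_def
  proof (intro conjI ballI)
    show "finite (verts ?G)" using is_graph_piece by (auto simp: inst_def is_graph_def piece_def)
    fix e assume "e \<in> edges ?G"
    then consider i where "i < p" "e \<in> edges (piece i)" | i where "i < p" "e = edg [0] [0, Suc i]" | i where "i < p" "e = edg [1, Suc i] [1]"
      by (auto simp: inst_def conn_def)
    then show "\<exists>u\<in>verts ?G. \<exists>v\<in>verts ?G. u \<noteq> v \<and> e = {u, v}"
    proof cases
      case 1
      then obtain u v where "u \<in> verts (piece i)" "v \<in> verts (piece i)" "u \<noteq> v" "e = {u, v}"
        using is_graph_piece[of i] unfolding is_graph_def by blast
      moreover have "verts (piece i) \<subseteq> verts ?G" using 1 by (auto simp: inst_def piece_def)
      ultimately show ?thesis by blast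
    next
      case 2
      have "nm [0] \<in> verts ?G" "nm [0, Suc i] \<in> verts ?G" "nm [0] \<noteq> nm [0, Suc i]" "e = {nm [0], nm [0, Suc i]}"
        using 2 T nm by (auto simp: inst_def edg_def inj_eq)
      then show ?thesis by blast
    next
      case 3
      have "nm [1, Suc i] \<in> verts ?G" "nm [1] \<in> verts ?G" "nm [1, Suc i] \<noteq> nm [1]" "e = {nm [1, Suc i], nm [1]}"
        using 3 T nm by (auto simp: inst_def edg_def inj_eq)
      then show ?thesis by blast
    qed
  qed
  have pe: "e \<inter> {nm [0], nm [1]} = {}" if h: "e \<in> edges (piece i)" for e i
  proof -
    obtain a c l where e: "((a, c), l) \<in> set (side i)" "e = edg a c" using h by (auto simp: piece_def)
    then show ?thesis using side_ends[OF e(1)] region_st[of i] nm by (auto simp: edg_def inj_eq)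
  qed
  have D: "is_disjoint_union (del_verts ?G {nm [0], nm [1]}) (map piece [0..<p])"
    unfolding is_disjoint_union_def
  proof (intro conjI ballI allI impI)
    show "is_graph H" if "H \<in> set (map piece [0..<p])" for H using that is_graph_piece by auto
    fix i j assume "i < length (map piece [0..<p])" "j < length (map piece [0..<p])" "i \<noteq> j"
    then show "verts (map piece [0..<p] ! i) \<inter> verts (map piece [0..<p] ! j) = {}"
      using nm_vset region_disj by (auto simp: piece_def) (metis image_eqI)
  next
    show "verts (del_verts ?G {nm [0], nm [1]}) = (\<Union>H\<in>set (map piece [0..<p]). verts H)"
      using st by (auto simp: del_verts_def inst_def piece_def)
    have "e \<inter> {nm [0], nm [1]} \<noteq> {}" if "e \<in> conn" for e using that by (auto simp: conn_def edg_def)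
    then show "edges (del_verts ?G {nm [0], nm [1]}) = (\<Union>H\<in>set (map piece [0..<p]). edges H)"
      using pe by (auto simp: del_verts_def inst_def)
  qed
  have one: "card (bnd b \<inter> edges (piece i)) \<le> 1" if h: "i < p" "b \<in> L" for b i
  proof -
    obtain a c where ac: "((a, c), [b]) \<in> set (side i)" using label_item[OF h] .
    have "bnd b \<inter> edges (piece i) \<subseteq> {edg a c}"
    proof
      fix e assume "e \<in> bnd b \<inter> edges (piece i)"
      then obtain j a1 c1 a2 c2 l where "e = edg a1 c1" "j < p" "((a1, c1), [b]) \<in> set (side j)" "e = edg a2 c2" "((a2, c2), l) \<in> set (side i)"
        by (auto simp: bnd_def piece_def)
      then show "e \<in> {edg a c}" using label_unique label_item_unique[OF h(1) ac] by blast
    qed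
    then show ?thesis using card_mono[of "{edg a c}"] by fastforce
  qed
  show ?thesis
    unfolding is_split_instance_def
  proof (intro conjI ballI)
    show "pairwise disjnt (bundles inst)"
      using bnd_disjoint by (auto simp: inst_def pairwise_def disjnt_def)
    fix b assume "b \<in> bundles inst"
    then obtain l where l: "l \<in> L" "b = bnd l" by (auto simp: inst_def)
    show "b \<subseteq> edges (the_graph inst)" using l bnd_edges by (auto simp: inst_def)
    show "card b \<in> {1, p}" using card_bnd l by simp
    fix H assume "H \<in> set (pieces inst)"
    then show "card (b \<inter> edges H) \<le> 1" using one l by (auto simp: inst_def)
  qed (use G D st in \<open>auto simp: inst_def\<close>)
qed

lemma edge_kept:
  assumes "i < p" "((a, c), l) \<in> set (side i)"
  shows "edg a c \<in> \<Union>(bnd ` X) \<longleftrightarrow> \<not> kept X l"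
proof
  assume "edg a c \<in> \<Union>(bnd ` X)"
  then obtain b j a' c' where "b \<in> X" "j < p" "((a', c'), [b]) \<in> set (side j)" "edg a c = edg a' c'" by (auto simp: bnd_def)
  then show "\<not> kept X l" using label_unique[OF assms(2)] by (force simp: kept_def)
next
  assume "\<not> kept X l"
  then obtain b where "b \<in> X" "b \<in> set l" by (auto simp: kept_def)
  then have "l = [b]" using side_ends(4)[OF assms(2)] by (cases l) auto
  then show "edg a c \<in> \<Union>(bnd ` X)" using assms \<open>b \<in> X\<close> by (auto simp: bnd_def)
qed

lemma conn_kept: "e \<in> conn \<Longrightarrow> e \<notin> \<Union>(bnd ` X)"
proof
  assume e: "e \<in> conn" "e \<in> \<Union>(bnd ` X)"
  then obtain b j a c where c: "((a, c), [b]) \<in> set (side j)" "e = edg a c" by (auto simp: bnd_def)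
  have "nm [0] \<in> e \<or> nm [1] \<in> e" using e(1) by (auto simp: conn_def edg_def)
  then show False using side_ends[OF c(1)] region_st[of j] c(2) mem_edg by auto
qed

text \<open>The pieces meet only in source and sink and are tied to them by edges in no bundle. So
  source and sink are separated exactly if this happens within every piece.\<close>

lemma st_cut_iff:
  "is_st_cut (the_graph inst) (nm [0]) (nm [1]) (\<Union>(bnd ` X)) \<longleftrightarrow> (\<forall>i<p. cut X (t i))"
proof
  let ?Z = "\<Union>(bnd ` X)"
  let ?R = "{(u, v). {u, v} \<in> edges (the_graph inst) - ?Z}"
  assume C: "is_st_cut (the_graph inst) (nm [0]) (nm [1]) ?Z"
  show "\<forall>i<p. cut X (t i)"
  proof (intro allI impI, rule ccontr)
    fix i assume i: "i < p" "\<not> cut X (t i)"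
    have fw: "(nm a, nm c) \<in> ?R" if h: "(a, c) \<in> fwd X (set (side i))" for a c
    proof -
      obtain l where l: "((a, c), l) \<in> set (side i)" "kept X l" using h by (auto simp: fwd_def)
      have "edg a c \<in> edges (the_graph inst)" using l(1) i(1) by (force simp: inst_def piece_def)
      then show ?thesis using edge_kept[OF i(1) l(1), of X] l(2) by (simp add: edg_def)
    qed
    have "(nm a, nm c) \<in> ?R\<^sup>*" if "(a, c) \<in> (fwd X (set (side i)))\<^sup>*" for a c
      using that
    proof (induction rule: rtrancl_induct)
      case (step y z)
      then show ?case using fw[of y z] by (meson rtrancl_into_rtrancl)
    qed simp
    then have 1: "(nm [0, Suc i], nm [1, Suc i]) \<in> ?R\<^sup>*"
      using sp_not_cut[OF i(2)] unfolding side_def by blast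
    have c: "edg [0] [0, Suc i] \<in> conn" "edg [1, Suc i] [1] \<in> conn" using i(1) by (auto simp: conn_def)
    have "edg [0] [0, Suc i] \<notin> ?Z" "edg [1, Suc i] [1] \<notin> ?Z" using conn_kept c by blast+
    then have "(nm [0], nm [0, Suc i]) \<in> ?R" "(nm [1, Suc i], nm [1]) \<in> ?R"
      using c by (simp_all add: inst_def edg_def)
    then have "(nm [0], nm [1]) \<in> ?R\<^sup>*" using 1 by (meson converse_rtrancl_into_rtrancl rtrancl_into_rtrancl)
    then show False using C by (simp add: is_st_cut_def)
  qed
next
  let ?Z = "\<Union>(bnd ` X)"
  let ?R = "{(u, v). {u, v} \<in> edges (the_graph inst) - ?Z}"
  assume C: "\<forall>i<p. cut X (t i)"
  have "\<exists>S \<subseteq> below [Suc (Suc i)]. \<forall>a c l. ((a, c), l) \<in> set (side i) \<longrightarrow> kept X l \<longrightarrow>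
      (a \<in> insert [0, Suc i] S \<longleftrightarrow> c \<in> insert [0, Suc i] S)" if "i < p" for i
    unfolding side_def using C that term_simps by (intro sp_cut) auto
  then obtain S where S: "\<And>i. i < p \<Longrightarrow> S i \<subseteq> below [Suc (Suc i)]"
    "\<And>i a c l. i < p \<Longrightarrow> ((a, c), l) \<in> set (side i) \<Longrightarrow> kept X l \<Longrightarrow>
      (a \<in> insert [0, Suc i] (S i) \<longleftrightarrow> c \<in> insert [0, Suc i] (S i))" by metis
  \<comment> \<open>The source side of the whole graph, glued from those of the pieces.\<close>
  define U where "U = insert [0] (\<Union>i<p. insert [0, Suc i] (S i))"
  have SR: "insert [0, Suc i] (S i) \<subseteq> region i" if "i < p" for i using S(1)[OF that] by (auto simp: region_def)
  have U: "x \<in> U \<longleftrightarrow> x \<in> insert [0, Suc i] (S i)" if "i < p" "x \<in> region i" for i x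
  proof
    assume "x \<in> U"
    then consider "x = [0]" | j where "j < p" "x \<in> insert [0, Suc j] (S j)" by (auto simp: U_def)
    then show "x \<in> insert [0, Suc i] (S i)"
    proof cases
      case 1 then show ?thesis using that region_st by auto
    next
      case 2
      then have "j = i" using region_disj that(2) SR by blast
      then show ?thesis using 2 by simp
    qed
  qed (use that in \<open>auto simp: U_def\<close>)
  have T: "[1, Suc i] \<notin> U" if "i < p" for i
    using U[OF that, of "[1, Suc i]"] S(1)[OF that] term_simps[of i] by (auto simp: region_def)
  have T1: "[1] \<notin> U" using SR region_st by (auto simp: U_def)
  have ed: "a \<in> U \<longleftrightarrow> c \<in> U" if "edg a c \<in> edges (the_graph inst) - ?Z" for a c
  proof -
    have sym: "a \<in> U \<longleftrightarrow> c \<in> U" if "edg a c = edg a' c'" "a' \<in> U \<longleftrightarrow> c' \<in> U" for a' c'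
      using that edg_eq by (auto simp: doubleton_eq_iff)
    from that consider i a' c' l where "i < p" "((a', c'), l) \<in> set (side i)" "edg a c = edg a' c'"
      | i where "i < p" "edg a c = edg [0] [0, Suc i]" | i where "i < p" "edg a c = edg [1, Suc i] [1]"
      by (auto simp: inst_def piece_def conn_def)
    then show ?thesis
    proof cases
      case 1
      then have "kept X l" using that edge_kept[OF 1(1,2), of X] by auto
      then have "a' \<in> U \<longleftrightarrow> c' \<in> U" using S(2)[OF 1(1,2)] U[OF 1(1)] side_ends[OF 1(2)] by blast
      then show ?thesis using sym 1(3) by blast
    next
      case 2
      have "[0] \<in> U" "[0, Suc i] \<in> U" using 2(1) by (auto simp: U_def)
      then show ?thesis using sym[OF 2(2)] by blast
    next
      case 3
      then show ?thesis using sym[OF 3(2)] T T1 by blast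
    qed
  qed
  have reach: "x \<in> nm ` U" if "(nm [0], x) \<in> ?R\<^sup>*" for x
    using that
  proof (induction rule: rtrancl_induct)
    case base then show ?case by (auto simp: U_def)
  next
    case (step y z)
    then obtain a where a: "a \<in> U" "y = nm a" by auto
    have yz: "{y, z} \<in> edges (the_graph inst) - ?Z" using step by auto
    then have "\<exists>c. z = nm c"
      using a by (auto simp: inst_def piece_def conn_def edg_def doubleton_eq_iff)
    then obtain c where "z = nm c" by blast
    then show ?case using ed[of a c] yz a by (auto simp: edg_def)
  qed
  have "(nm [0], nm [1]) \<notin> ?R\<^sup>*" using reach[of "nm [1]"] T1 inj_image_mem_iff[OF nm] by blast
  moreover have "?Z \<subseteq> edges (the_graph inst)" using bnd_edges by (fastforce simp: inst_def)
  ultimately show "is_st_cut (the_graph inst) (nm [0]) (nm [1]) ?Z" by (simp add: is_st_cut_def)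
qed

text \<open>Bundles correspond injectively to labels, so their numbers agree.\<close>

lemma split_yes_inst: "split_yes inst r \<longleftrightarrow> (\<exists>X \<subseteq> L. real (card X) \<le> r \<and> (\<forall>i<p. cut X (t i)))"
proof
  assume "split_yes inst r"
  then obtain Y where Y: "Y \<subseteq> bnd ` L" "real (card Y) \<le> r" "is_st_cut (the_graph inst) (nm [0]) (nm [1]) (\<Union>Y)"
    by (auto simp: split_yes_def inst_def)
  then obtain X where X: "X \<subseteq> L" "Y = bnd ` X" by (auto simp: subset_image_iff)
  have "card X = card Y" using X by (simp add: card_image inj_on_subset[OF bnd_inj])
  then show "\<exists>X \<subseteq> L. real (card X) \<le> r \<and> (\<forall>i<p. cut X (t i))" using X Y st_cut_iff[of X] by auto
next
  assume "\<exists>X \<subseteq> L. real (card X) \<le> r \<and> (\<forall>i<p. cut X (t i))"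
  then obtain X where X: "X \<subseteq> L" "real (card X) \<le> r" "\<forall>i<p. cut X (t i)" by blast
  have "real (card (bnd ` X)) \<le> r"
    using card_image_le[OF finite_subset[OF X(1) finite_L], of bnd] X(2) by linarith
  then show "split_yes inst r" unfolding split_yes_def
    using X st_cut_iff[of X] by (intro exI[of _ "bnd ` X"]) (auto simp: inst_def)
qed

end

section \<open>From formulas to games\<close>

fun words :: "nat \<Rightarrow> bool list list" where
  "words 0 = [[]]"
| "words (Suc n) = map ((#) True) (words n) @ map ((#) False) (words n)"

lemma set_words: "set (words n) = {w. length w = n}"
proof (induction n)
  case (Suc n)
  show ?case
  proof (intro set_eqI iffI)
    fix w assume "w \<in> {w :: bool list. length w = Suc n}"
    then obtain b w' where "w = b # w'" "length w' = n" by (auto simp: length_Suc_conv)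
    then show "w \<in> set (words (Suc n))" using Suc by (cases b) auto
  qed (use Suc in auto)
qed simp

lemma length_words: "length (words n) = 2 ^ n"
  by (induction n) auto

section \<open>Violated clauses as products of linear functionals\<close>

type_synonym lfun = "nat \<times> bool"
type_synonym triple = "bool list \<times> bool list \<times> bool list"

text \<open>A clause is a list of three pairs of a block and a linear functional on the word of that block;
  the functional is true if the literal is false, where coordinate 0 of a word is meant to be true.\<close>

type_synonym bclause = "(nat \<times> lfun) list"

text \<open>A literal with sign \<open>b\<close> is false if its coordinate plus \<open>b\<close> is
  1 over the two-element field. Multiplying the constant by coordinate 0, which is meant to be 1,
  makes this affine condition linear.\<close>

definition lf :: "lfun \<Rightarrow> bool list \<Rightarrow> bool" where
  "lf f u \<longleftrightarrow> ith u (fst f) \<noteq> (snd f \<and> ith u 0)"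

definition viol :: "bclause \<Rightarrow> triple \<Rightarrow> bool" where
  "viol c x \<longleftrightarrow> lf (snd (ith c 0)) (fst x) \<and> lf (snd (ith c 1)) (fst (snd x)) \<and> lf (snd (ith c 2)) (snd (snd x))"

definition parity :: "bool list \<Rightarrow> bool" where
  "parity bs = foldl (\<lambda>a b. a \<noteq> b) False bs"

lemma foldl_xor: "foldl (\<lambda>a b. a \<noteq> b) a bs = (a \<noteq> odd (length (filter id bs)))"
  by (induction bs arbitrary: a) auto

lemma parity_odd: "parity (map P xs) = odd (length (filter P xs))"
  unfolding parity_def foldl_xor by (simp add: filter_map comp_def)

definition rowval :: "bclause list \<Rightarrow> triple \<Rightarrow> bool" where
  "rowval row x = parity (map (\<lambda>c. viol c x) row)"

lemma rowval_snoc: "rowval (row @ [c]) x = (rowval row x \<noteq> viol c x)"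
  unfolding rowval_def parity_odd by auto

section \<open>Condensing the clauses of a block triple into few parities\<close>

text \<open>A random set of clauses has odd violation parity at half of the violating triples; this
  is the deterministic replacement by conditional choice. The triples in \<open>A\<close> violate
  \<open>c\<close> and none of the clauses \<open>cs\<close> still to come, so \<open>c\<close> is
  added if this makes more of them odd.\<close>

definition decide :: "triple list \<Rightarrow> bclause \<Rightarrow> bclause list \<Rightarrow> bclause list \<Rightarrow> bclause list" where
  "decide S c cs row = (let A = filter (\<lambda>x. viol c x \<and> \<not> list_ex (\<lambda>c. viol c x) cs) S; B = filter (rowval row) A in
     if length B + length B < length A then row @ [c] else row)"

fun pick :: "triple list \<Rightarrow> bclause list \<Rightarrow> bclause list \<Rightarrow> bclause list" where
  "pick S [] row = row"
| "pick S (c # cs) row = pick S cs (decide S c cs row)"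

text \<open>A triple is decided at the last clause that it violates: later choices do not change its parity.\<close>

lemma pick_half:
  "length (filter (\<lambda>x. list_ex (\<lambda>c. viol c x) cs) S) \<le>
     2 * length (filter (\<lambda>x. list_ex (\<lambda>c. viol c x) cs \<and> rowval (pick S cs row) x) S) \<and>
   (\<forall>x. \<not> list_ex (\<lambda>c. viol c x) cs \<longrightarrow> rowval (pick S cs row) x = rowval row x)"
proof (induction cs arbitrary: row)
  case (Cons c cs)
  let ?L = "\<lambda>x. list_ex (\<lambda>c. viol c x) cs"
  define row' where "row' = decide S c cs row"
  define F where "F = rowval (pick S cs row')"
  note IH = Cons.IH[of row', folded F_def]
  define A where "A = filter (\<lambda>x. viol c x \<and> \<not> ?L x) S"
  have A: "length A \<le> 2 * length (filter F A)"
  proof -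
    have "filter F A = filter (rowval row') A" using IH by (intro filter_cong) (auto simp: A_def)
    moreover have "length A \<le> 2 * length (filter (rowval row') A)"
    proof (cases "length (filter (rowval row) A) + length (filter (rowval row) A) < length A")
      case True
      then have r: "row' = row @ [c]" by (simp add: row'_def decide_def A_def Let_def)
      have "filter (rowval row') A = filter (\<lambda>x. \<not> rowval row x) A"
        unfolding r rowval_snoc by (intro filter_cong) (auto simp: A_def)
      moreover have "length A = length (filter (rowval row) A) + length (filter (\<lambda>x. \<not> rowval row x) A)"
        by (rule sum_length_filter_compl[symmetric])
      ultimately show ?thesis using True by simp
    next
      case False
      then have "row' = row" by (simp add: row'_def decide_def A_def Let_def)
      then show ?thesis using False by simp
    qed
    ultimately show ?thesis by simp
  qed
  have split: "length (filter (\<lambda>x. (viol c x \<or> ?L x) \<and> Q x) S) = length (filter (\<lambda>x. ?L x \<and> Q x) S) + length (filter Q A)" for Q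
    unfolding A_def by (induction S) auto
  have row': "rowval row' x = rowval row x" if "\<not> viol c x" for x
    using that by (auto simp: row'_def decide_def rowval_snoc Let_def)
  have "length (filter (\<lambda>x. viol c x \<or> ?L x) S) \<le> 2 * length (filter (\<lambda>x. (viol c x \<or> ?L x) \<and> F x) S)"
    using split[of "\<lambda>_. True"] split[of F] IH A by simp
  then show ?case using IH row' by (simp add: F_def row'_def)
qed simp

text \<open>Each row is chosen for the triples that all previous rows have missed. The number of
  rows, not that of clauses, becomes the bit length of the alphabet.\<close>

fun rows :: "nat \<Rightarrow> bclause list \<Rightarrow> triple list \<Rightarrow> bclause list list" where
  "rows 0 cs S = []"
| "rows (Suc n) cs S = (let r = pick S cs [] in r # rows n cs (filter (\<lambda>x. \<not> rowval r x) S))"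

lemma length_rows: "length (rows n cs S) = n"
  by (induction n arbitrary: S) (auto simp: Let_def)

lemma set_decide: "set (decide S c cs row) \<subseteq> insert c (set row)"
  by (auto simp: decide_def Let_def)

lemma set_pick: "set (pick S cs row) \<subseteq> set cs \<union> set row"
proof (induction cs arbitrary: row)
  case (Cons c cs)
  then show ?case using set_decide[of S c cs row] by fastforce
qed simp

lemma set_rows: "r \<in> set (rows n cs S) \<Longrightarrow> set r \<subseteq> set cs"
  by (induction n arbitrary: S) (use set_pick in \<open>fastforce simp: Let_def\<close>)+

text \<open>Every row catches at least half of the remaining violating triples, so fewer than
  \<open>2 ^ n\<close> of them are exhausted by \<open>n\<close> rows.\<close>

lemma rows_kill:
  "(\<forall>x \<in> set S. list_ex (\<lambda>c. viol c x) cs) \<Longrightarrow> length S < 2 ^ n \<Longrightarrow> x \<in> set S \<Longrightarrow>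
    \<exists>r \<in> set (rows n cs S). rowval r x"
proof (induction n arbitrary: S)
  case (Suc n)
  let ?r = "pick S cs []"
  let ?S = "filter (\<lambda>x. \<not> rowval ?r x) S"
  have "length S \<le> 2 * length (filter (rowval ?r) S)"
  proof -
    have "filter (\<lambda>x. list_ex (\<lambda>c. viol c x) cs) S = S" using Suc.prems(1) by (intro filter_True) auto
    moreover have "filter (\<lambda>x. list_ex (\<lambda>c. viol c x) cs \<and> rowval ?r x) S = filter (rowval ?r) S"
      using Suc.prems(1) by (intro filter_cong) auto
    ultimately show ?thesis using pick_half[of cs S "[]"] by simp
  qed
  moreover have "length S = length (filter (rowval ?r) S) + length ?S"
    by (rule sum_length_filter_compl[symmetric])
  ultimately have "length ?S < 2 ^ n" using Suc.prems(2) by simp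
  then show ?case using Suc.IH[of ?S] Suc.prems by (cases "rowval ?r x") (auto simp: Let_def)
qed simp

subsection \<open>The trilinear maps\<close>

definition setof :: "bool list \<Rightarrow> nat set" where
  "setof w = {i. i < length w \<and> w ! i}"

lemma setof_inj: "length v = length w \<Longrightarrow> setof v = setof w \<Longrightarrow> v = w"
  by (rule nth_equalityI) (auto simp: setof_def set_eq_iff)

definition wordof :: "nat \<Rightarrow> nat set \<Rightarrow> bool list" where
  "wordof n A = map (\<lambda>i. i \<in> A) [0..<n]"

lemma setof_wordof: "setof (wordof n A) = A \<inter> {..<n}"
  by (auto simp: setof_def wordof_def)

lemma wordof_in_words: "wordof n A \<in> set (words n)"
  by (simp add: set_words wordof_def)

definition lfS :: "lfun \<Rightarrow> nat set \<Rightarrow> bool" where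
  "lfS f U \<longleftrightarrow> (fst f \<in> U) \<noteq> (snd f \<and> 0 \<in> U)"

definition violS :: "bclause \<Rightarrow> nat set \<Rightarrow> nat set \<Rightarrow> nat set \<Rightarrow> bool" where
  "violS c U V W \<longleftrightarrow> lfS (snd (ith c 0)) U \<and> lfS (snd (ith c 1)) V \<and> lfS (snd (ith c 2)) W"

text \<open>The vector of row parities as a function of three arbitrary sets. Each violation is a
  product of three linear functionals, so a parity of violations is trilinear.\<close>

definition TS :: "(tri \<Rightarrow> bclause list list) \<Rightarrow> tri \<Rightarrow> nat set \<Rightarrow> nat set \<Rightarrow> nat set \<Rightarrow> nat set" where
  "TS Rf e U V W = {r. r < length (Rf e) \<and> odd (length (filter (\<lambda>c. violS c U V W) (Rf e ! r)))}"

lemma lfS_add: "lfS f (U \<triangle> U') = (lfS f U \<noteq> lfS f U')"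
  by (auto simp: lfS_def mem_sdiff)

lemma odd_filter_xor:
  "(\<And>x. x \<in> set xs \<Longrightarrow> P x = (Q x \<noteq> Q' x)) \<Longrightarrow>
    odd (length (filter P xs)) = (odd (length (filter Q xs)) \<noteq> odd (length (filter Q' xs)))"
  by (induction xs) auto

lemma trilinear_TS: "trilinear (TS Rf e)"
proof -
  have *: "TS Rf e U V W = TS Rf e U' V' W' \<triangle> TS Rf e U'' V'' W''"
    if "\<And>c. violS c U V W = (violS c U' V' W' \<noteq> violS c U'' V'' W'')" for U V W U' V' W' U'' V'' W''
  proof -
    have "odd (length (filter (\<lambda>c. violS c U V W) xs)) =
      (odd (length (filter (\<lambda>c. violS c U' V' W') xs)) \<noteq> odd (length (filter (\<lambda>c. violS c U'' V'' W'') xs)))" for xs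
      by (rule odd_filter_xor) (rule that)
    then show ?thesis by (auto simp: TS_def mem_sdiff set_eq_iff)
  qed
  show ?thesis unfolding trilinear_def
    by (intro conjI allI; rule *; auto simp: violS_def lfS_add)
qed

lemma lf_setof: "fst f < length u \<Longrightarrow> lf f u = lfS f (setof u)"
  by (cases "length u = 0") (auto simp: lf_def lfS_def setof_def ith_nth)

definition cbound :: "nat \<Rightarrow> bclause \<Rightarrow> bool" where
  "cbound d c \<longleftrightarrow> length c = 3 \<and> (\<forall>x \<in> set c. fst (snd x) \<le> d)"

lemma viol_setof:
  assumes "cbound d c" "length u > d" "length v > d" "length w > d"
  shows "viol c (u, v, w) = violS c (setof u) (setof v) (setof w)"
proof -
  have "fst (snd (ith c j)) \<le> d" if "j < 3" for j
    using assms(1) that by (simp add: cbound_def ith_nth)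
  from this[of 0] this[of 1] this[of 2] show ?thesis
    using assms(2-4) by (simp add: viol_def violS_def lf_setof)
qed

definition triples :: "nat \<Rightarrow> triple list" where
  "triples d = List.product (words (Suc d)) (List.product (words (Suc d)) (words (Suc d)))"

text \<open>There are \<open>2 ^ (3 * Suc d)\<close> triples of words of length
  \<open>Suc d\<close>; one more row than this exponent leaves none of them. Words of this length
  also accommodate the \<open>Suc d\<close> coordinates of a block.\<close>

definition wlen :: "nat \<Rightarrow> nat" where
  "wlen d = 3 * Suc d + 1"

definition crows :: "nat \<Rightarrow> bclause list \<Rightarrow> bclause list list" where
  "crows d cs = rows (wlen d) cs (filter (\<lambda>x. list_ex (\<lambda>c. viol c x) cs) (triples d))"

lemma crows_sound:
  assumes cs: "\<And>c. c \<in> set cs \<Longrightarrow> cbound d c" and Rf: "Rf e = crows d cs"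
    and c: "c \<in> set cs" "violS c U V W"
  shows "TS Rf e U V W \<noteq> {}"
proof -
  let ?w = "wordof (Suc d)"
  let ?x = "(?w U, ?w V, ?w W)"
  \<comment> \<open>Clauses read coordinates up to \<open>d\<close> only, so arbitrary sets may be
    truncated to words of length \<open>Suc d\<close>.\<close>
  have v: "viol c' ?x = violS c' U V W" if "c' \<in> set cs" for c'
  proof -
    have j: "fst (snd (ith c' j)) \<le> d" if "j < 3" for j
      using cs[OF \<open>c' \<in> set cs\<close>] that by (simp add: cbound_def ith_nth)
    have "viol c' ?x = violS c' (setof (?w U)) (setof (?w V)) (setof (?w W))"
      by (rule viol_setof[OF cs[OF that]]) (auto simp: wordof_def)
    also have "\<dots> = violS c' U V W"
      using j[of 0] j[of 1] j[of 2] by (auto simp: violS_def lfS_def setof_wordof)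
    finally show ?thesis .
  qed
  have len: "length (filter (\<lambda>x. list_ex (\<lambda>c. viol c x) cs) (triples d)) < 2 ^ wlen d"
  proof -
    have "length (triples d) = 2 ^ (3 * Suc d)"
    proof -
      have "3 * Suc d = Suc d + (Suc d + Suc d)" by simp
      then show ?thesis unfolding triples_def by (simp only: power_add length_words length_product)
    qed
    moreover have "length (filter (\<lambda>x. list_ex (\<lambda>c. viol c x) cs) (triples d)) \<le> length (triples d)" by simp
    moreover have "(2::nat) ^ (3 * Suc d) < 2 ^ wlen d"
      unfolding wlen_def by (rule power_strict_increasing) simp_all
    ultimately show ?thesis by linarith
  qed
  have mem: "?x \<in> set (filter (\<lambda>x. list_ex (\<lambda>c. viol c x) cs) (triples d))"
    using c v[OF c(1)] wordof_in_words by (auto simp: triples_def list_ex_iff simp del: words.simps)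
  obtain r where r: "r \<in> set (Rf e)" "rowval r ?x"
    using rows_kill[OF _ len mem] unfolding Rf crows_def by auto
  then obtain j where j: "j < length (Rf e)" "Rf e ! j = r" by (auto simp: in_set_conv_nth)
  have "set r \<subseteq> set cs" using r(1) set_rows unfolding Rf crows_def by blast
  then have "filter (\<lambda>c. viol c ?x) r = filter (\<lambda>c. violS c U V W) r" using v by (intro filter_cong) auto
  then have "j \<in> TS Rf e U V W" using r(2) j by (simp add: TS_def rowval_def parity_odd)
  then show ?thesis by blast
qed

lemma crows_complete:
  assumes Rf: "Rf e = crows d cs" and "\<And>c. c \<in> set cs \<Longrightarrow> \<not> violS c U V W"
  shows "TS Rf e U V W = {}"
proof -
  have "odd (length (filter (\<lambda>c. violS c U V W) (Rf e ! r))) = False" if "r < length (Rf e)" for r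
  proof -
    have "set (Rf e ! r) \<subseteq> set cs" using nth_mem[OF that] set_rows unfolding Rf crows_def by blast
    then have "filter (\<lambda>c. violS c U V W) (Rf e ! r) = []" using assms(2) by (auto simp: filter_empty_conv)
    then show ?thesis by simp
  qed
  then show ?thesis by (auto simp: TS_def)
qed

subsection \<open>Accepted views\<close>

definition xorl :: "bool list \<Rightarrow> bool list \<Rightarrow> bool list" where
  "xorl a b = map (\<lambda>z. fst z \<noteq> snd z) (zip a b)"

definition Tl :: "bclause list list \<Rightarrow> triple \<Rightarrow> bool list" where
  "Tl rs x = map (\<lambda>row. rowval row x) rs"

definition Tsuml :: "nat \<Rightarrow> bclause list list list \<Rightarrow> nat list \<Rightarrow> triple \<Rightarrow> bool list" where
  "Tsuml n Ts be x = foldl xorl (replicate n False) (map (\<lambda>j. Tl (ith Ts j) x) be)"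

definition accept :: "nat \<Rightarrow> bclause list list list \<Rightarrow> nat list \<Rightarrow> bool \<Rightarrow> view \<Rightarrow> bool" where
  "accept n Ts be par v \<longleftrightarrow> xorl (ith v 0) (ith v 1) = ith v 2 \<and>
     xorl (ith v 0) (ith v 6) =
       Tsuml n Ts be (xorl (ith v 0) (ith v 3), xorl (ith v 0) (ith v 4), xorl (ith v 0) (ith v 5)) \<and>
     ith v 0 = ith v 7 \<and> (hd (xorl (ith v 0) (ith v 3)) \<longleftrightarrow> par)"

lemma length_xorl: "length a = n \<Longrightarrow> length b = n \<Longrightarrow> length (xorl a b) = n"
  by (simp add: xorl_def)

lemma setof_xorl: "length a = length b \<Longrightarrow> setof (xorl a b) = setof a \<triangle> setof b"
  by (auto simp: setof_def xorl_def mem_sdiff)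

text \<open>The bridge between the executable verifier on bit lists and the abstract one on sets.
  All words have the same length, hence they are determined by their sets.\<close>

lemma accept_acc:
  assumes v: "length v = 8" "\<And>w. w \<in> set v \<Longrightarrow> length w = n" and n: "n = wlen d"
    and Es: "distinct Es" and be: "distinct be" "\<And>j. j \<in> set be \<Longrightarrow> j < length Es" "tbe t = (!) Es ` set be"
    and Ts: "length Ts = length Es" "\<And>j. j < length Es \<Longrightarrow> Ts ! j = Rf (Es ! j)"
    and Rf: "\<And>e. length (Rf e) = n" "\<And>e r c. r \<in> set (Rf e) \<Longrightarrow> c \<in> set r \<Longrightarrow> cbound d c"
    and par: "par = odd (card (tal t))"
  shows "accept n Ts be par v \<longleftrightarrow> acc (TS Rf) t (map setof v)"
proof -
  have l: "length (v ! j) = n" if "j < 8" for j using v that by simp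
  have s: "map setof v ! j = setof (v ! j)" if "j < 8" for j using v(1) that by simp
  have x: "setof (xorl (v ! i) (v ! j)) = setof (v ! i) \<triangle> setof (v ! j)" if "i < 8" "j < 8" for i j
    by (rule setof_xorl) (use l that in simp)
  have eq: "a = b \<longleftrightarrow> setof a = setof b" if "length a = n" "length b = n" for a b
    using setof_inj that by metis
  have T1: "setof (Tl (Rf e) (a, b, c)) = TS Rf e (setof a) (setof b) (setof c)"
    if "length a = n" "length b = n" "length c = n" for e a b c
  proof -
    have "rowval r (a, b, c) = odd (length (filter (\<lambda>x. violS x (setof a) (setof b) (setof c)) r))" if "r \<in> set (Rf e)" for r
    proof -
      have "viol x (a, b, c) = violS x (setof a) (setof b) (setof c)" if "x \<in> set r" for x
        by (rule viol_setof[OF Rf(2)[OF \<open>r \<in> set (Rf e)\<close> that]]) (use \<open>length a = n\<close> \<open>length b = n\<close> \<open>length c = n\<close> n in \<open>auto simp: wlen_def\<close>)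
      then have "filter (\<lambda>x. viol x (a, b, c)) r = filter (\<lambda>x. violS x (setof a) (setof b) (setof c)) r"
        by (intro filter_cong) auto
      then show ?thesis by (simp add: rowval_def parity_odd)
    qed
    then show ?thesis by (auto simp: setof_def Tl_def TS_def)
  qed
  \<comment> \<open>Distinctness of \<open>bs\<close> is what equates the list sum with the sum over
    a set: repeated triples would cancel in the list.\<close>
  have T2: "length (Tsuml n Ts bs (a, b, c)) = n \<and> setof (Tsuml n Ts bs (a, b, c)) = Tsum (TS Rf) ((!) Es ` set bs) (setof a) (setof b) (setof c)"
    if "length a = n" "length b = n" "length c = n" "distinct bs" "\<And>j. j \<in> set bs \<Longrightarrow> j < length Es" for a b c bs
    using that(4,5)
  proof (induction bs rule: rev_induct)
    case Nil
    have "setof (replicate n False) = {}" by (auto simp: setof_def)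
    then show ?case by (simp add: Tsuml_def Tsum_def)
  next
    case (snoc j bs)
    have j: "j < length Es" "ith Ts j = Rf (Es ! j)" using snoc.prems(2)[of j] Ts by (auto simp: ith_nth)
    have IH: "length (Tsuml n Ts bs (a, b, c)) = n" "setof (Tsuml n Ts bs (a, b, c)) = Tsum (TS Rf) ((!) Es ` set bs) (setof a) (setof b) (setof c)"
      using snoc by auto
    have e: "Tsuml n Ts (bs @ [j]) (a, b, c) = xorl (Tsuml n Ts bs (a, b, c)) (Tl (Rf (Es ! j)) (a, b, c))"
      by (simp add: Tsuml_def j)
    have lT: "length (Tl (Rf (Es ! j)) (a, b, c)) = n" by (simp add: Tl_def Rf)
    have "Es ! j \<notin> (!) Es ` set bs" using Es snoc.prems j(1) by (auto simp: nth_eq_iff_index_eq)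
    then have "(!) Es ` set (bs @ [j]) = (!) Es ` set bs \<triangle> {Es ! j}" by (auto simp: sdiff_def)
    then have "Tsum (TS Rf) ((!) Es ` set (bs @ [j])) (setof a) (setof b) (setof c) =
       Tsum (TS Rf) ((!) Es ` set bs) (setof a) (setof b) (setof c) \<triangle> TS Rf (Es ! j) (setof a) (setof b) (setof c)"
      using Tsum_sdiff[of "(!) Es ` set bs" "{Es ! j}" "TS Rf"] by (simp add: Tsum_single)
    then show ?case unfolding e using IH lT T1 that by (simp add: setof_xorl length_xorl)
  qed
  have h: "hd (xorl (v ! 0) (v ! 3)) \<longleftrightarrow> 0 \<in> setof (v ! 0) \<triangle> setof (v ! 3)"
  proof -
    have "length (xorl (v ! 0) (v ! 3)) > 0" using l[of 0] l[of 3] n by (simp add: length_xorl wlen_def)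
    then show ?thesis using x[of 0 3] by (auto simp: setof_def hd_conv_nth)
  qed
  have lx: "length (xorl (v ! i) (v ! j)) = n" if "i < 8" "j < 8" for i j using length_xorl l that by blast
  note t2 = T2[OF lx[of 0 3] lx[of 0 4] lx[of 0 5] be(1,2)]
  have c1: "xorl (v ! 0) (v ! 1) = v ! 2 \<longleftrightarrow> setof (v ! 0) \<triangle> setof (v ! 1) = setof (v ! 2)"
    using eq[OF lx[of 0 1] l[of 2]] x[of 0 1] by simp
  have c2: "xorl (v ! 0) (v ! 6) = Tsuml n Ts be (xorl (v ! 0) (v ! 3), xorl (v ! 0) (v ! 4), xorl (v ! 0) (v ! 5)) \<longleftrightarrow>
    setof (v ! 0) \<triangle> setof (v ! 6) = Tsum (TS Rf) (tbe t) (setof (v ! 0) \<triangle> setof (v ! 3)) (setof (v ! 0) \<triangle> setof (v ! 4)) (setof (v ! 0) \<triangle> setof (v ! 5))"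
    using eq[OF lx[of 0 6], of "Tsuml n Ts be (xorl (v ! 0) (v ! 3), xorl (v ! 0) (v ! 4), xorl (v ! 0) (v ! 5))"] t2
      x[of 0 3] x[of 0 4] x[of 0 5] x[of 0 6] by (simp add: be(3))
  have c3: "v ! 0 = v ! 7 \<longleftrightarrow> setof (v ! 0) = setof (v ! 7)" using eq[OF l[of 0] l[of 7]] by simp
  show ?thesis
    unfolding accept_def acc_def using v(1) by (simp add: ith_nth s par h c1[simplified] c2[simplified] c3)
qed

subsection \<open>Blocks of variables\<close>

type_synonym pcnf = "(nat list \<times> bool) list list"
type_synonym vtab = "(nat list \<times> nat \<times> nat) list"

definition pvars :: "pcnf \<Rightarrow> nat list list" where
  "pvars \<phi> = remdups (map fst (concat \<phi>))"

text \<open>The product list enumerates quotient and remainder: variable number \<open>j\<close>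
  gets coordinate \<open>Suc (j div k)\<close> of block \<open>j mod k\<close>. Coordinate 0 stays
  free for the constant.\<close>

definition vtab :: "nat \<Rightarrow> nat list list \<Rightarrow> vtab" where
  "vtab k V = zip V (List.product (map Suc [0..<length V]) [0..<k])"

definition dim :: "vtab \<Rightarrow> nat" where
  "dim tab = foldl (\<lambda>m z. if m < fst (snd z) then fst (snd z) else m) 0 tab"

definition lpos :: "vtab \<Rightarrow> nat list \<times> bool \<Rightarrow> nat \<times> lfun" where
  "lpos tab l = (let z = hd (filter (\<lambda>z. fst z = fst l) tab) in (snd (snd z), (fst (snd z), snd l)))"

text \<open>The functional of coordinate 0 pads clauses to three literals: it is true on every legal word.\<close>

definition cl3 :: "vtab \<Rightarrow> (nat list \<times> bool) list \<Rightarrow> bclause" where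
  "cl3 tab C = take 3 (map (lpos tab) C @ replicate 3 (0, (0, False)))"

definition ctri :: "bclause \<Rightarrow> tri" where
  "ctri c = (fst (ith c 0), fst (ith c 1), fst (ith c 2))"

definition cls :: "vtab \<Rightarrow> pcnf \<Rightarrow> tri \<Rightarrow> bclause list" where
  "cls tab \<phi> e = filter (\<lambda>c. ctri c = e) (map (cl3 tab) \<phi>)"

definition psat :: "pcnf \<Rightarrow> bool" where
  "psat \<phi> \<longleftrightarrow> (\<exists>\<alpha> :: nat list \<Rightarrow> bool. \<forall>C \<in> set \<phi>. \<exists>l \<in> set C. \<alpha> (fst l) = snd l)"

definition vcoord :: "vtab \<Rightarrow> nat list \<Rightarrow> nat \<times> nat" where
  "vcoord tab v = snd (hd (filter (\<lambda>z. fst z = v) tab))"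

lemma lpos_vcoord: "lpos tab l = (snd (vcoord tab (fst l)), (fst (vcoord tab (fst l)), snd l))"
  by (simp add: lpos_def vcoord_def Let_def)

lemma vtab_nth:
  assumes "k > 0" "j < length V"
  shows "vtab k V ! j = (V ! j, (Suc (j div k), j mod k))"
proof -
  have 1: "j < length V * k" using assms
    by (metis le_less_trans less_le_trans mult.right_neutral mult_le_mono2 not_less_eq_eq One_nat_def linorder_not_less less_nat_zero_code)
  have "j div k < length V" using assms(2) by (meson div_le_dividend le_less_trans)
  moreover have "j mod k < k" using assms(1) by simp
  ultimately show ?thesis using assms 1 by (simp add: vtab_def product_nth)
qed

lemma length_vtab: "k > 0 \<Longrightarrow> length (vtab k V) = length V"
  by (cases k) (auto simp: vtab_def)

lemma vcoord_nth:
  assumes "k > 0" "distinct V" "j < length V"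
  shows "vcoord (vtab k V) (V ! j) = (Suc (j div k), j mod k)"
proof -
  let ?t = "vtab k V"
  have mem: "?t ! j \<in> set (filter (\<lambda>z. fst z = V ! j) ?t)"
    using nth_mem[of j ?t] assms length_vtab[OF assms(1), of V] by (simp add: vtab_nth)
  have "z = ?t ! j" if h: "z \<in> set (filter (\<lambda>z. fst z = V ! j) ?t)" for z
  proof -
    obtain i where i: "i < length V" "z = ?t ! i" "fst z = V ! j"
      using h length_vtab[OF assms(1), of V] by (auto simp: in_set_conv_nth)
    then have "i = j" using assms by (simp add: vtab_nth nth_eq_iff_index_eq)
    then show ?thesis using i by simp
  qed
  then have "hd (filter (\<lambda>z. fst z = V ! j) ?t) = ?t ! j" using mem by (metis list.set_sel(1) empty_iff list.set(1))
  then show ?thesis using assms by (simp add: vcoord_def vtab_nth)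
qed

lemma dim_ge_foldl: "m \<le> foldl (\<lambda>m (z::nat list \<times> nat \<times> nat). if m < fst (snd z) then fst (snd z) else m) m tab"
  by (induction tab arbitrary: m) (auto, meson less_imp_le le_trans)

lemma dim_ge: "z \<in> set tab \<Longrightarrow> fst (snd z) \<le> dim tab"
proof -
  have "z \<in> set tab \<Longrightarrow> fst (snd z) \<le> foldl (\<lambda>m (z::nat list \<times> nat \<times> nat). if m < fst (snd z) then fst (snd z) else m) m tab" for m
  proof (induction tab arbitrary: m)
    case (Cons a tab)
    show ?case
    proof (cases "z = a")
      case True
      then show ?thesis using dim_ge_foldl[of "if m < fst (snd a) then fst (snd a) else m" tab] by (auto split: if_splits)
    qed (use Cons in simp)
  qed simp
  then show "z \<in> set tab \<Longrightarrow> fst (snd z) \<le> dim tab" by (simp add: dim_def)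
qed

lemma dim_le: "(\<And>z. z \<in> set tab \<Longrightarrow> fst (snd z) \<le> b) \<Longrightarrow> dim tab \<le> b"
proof -
  have "(\<And>z. z \<in> set tab \<Longrightarrow> fst (snd z) \<le> b) \<Longrightarrow> m \<le> b \<Longrightarrow>
    foldl (\<lambda>m (z::nat list \<times> nat \<times> nat). if m < fst (snd z) then fst (snd z) else m) m tab \<le> b" for m
    by (induction tab arbitrary: m) auto
  then show "(\<And>z. z \<in> set tab \<Longrightarrow> fst (snd z) \<le> b) \<Longrightarrow> dim tab \<le> b" by (simp add: dim_def)
qed

lemma dim_vtab: "k > 0 \<Longrightarrow> dim (vtab k V) \<le> length V div k + 1"
proof (rule dim_le)
  fix z assume k: "k > 0" and "z \<in> set (vtab k V)"
  then obtain j where "j < length V" "z = vtab k V ! j" using length_vtab[OF k] by (metis in_set_conv_nth)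
  then show "fst (snd z) \<le> length V div k + 1" using k by (simp add: vtab_nth div_le_mono)
qed

locale blocked =
  fixes k :: nat and \<phi> :: pcnf
  assumes k: "k > 0" and c3: "\<And>C. C \<in> set \<phi> \<Longrightarrow> length C \<le> 3"
begin

abbreviation "tab \<equiv> vtab k (pvars \<phi>)"
abbreviation "vc \<equiv> vcoord tab"

lemma distinct_pvars: "distinct (pvars \<phi>)"
  by (simp add: pvars_def)

lemma vc_props:
  assumes "v \<in> set (pvars \<phi>)"
  shows "0 < fst (vc v)" "fst (vc v) \<le> dim tab" "snd (vc v) < k"
proof -
  obtain j where j: "j < length (pvars \<phi>)" "v = pvars \<phi> ! j" using assms by (metis in_set_conv_nth)
  have v: "vc v = (Suc (j div k), j mod k)" using vcoord_nth[OF k distinct_pvars j(1)] j(2) by simp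
  have "tab ! j \<in> set tab" using length_vtab[OF k] j(1) by simp
  from dim_ge[OF this] show "0 < fst (vc v)" "fst (vc v) \<le> dim tab" "snd (vc v) < k"
    using v k j by (auto simp: vtab_nth)
qed

lemma vc_inj:
  assumes "v \<in> set (pvars \<phi>)" "v' \<in> set (pvars \<phi>)" "vc v = vc v'"
  shows "v = v'"
proof -
  obtain j where j: "j < length (pvars \<phi>)" "v = pvars \<phi> ! j" using assms by (metis in_set_conv_nth)
  obtain j' where j': "j' < length (pvars \<phi>)" "v' = pvars \<phi> ! j'" using assms by (metis in_set_conv_nth)
  have "j div k = j' div k" "j mod k = j' mod k"
    using assms(3) vcoord_nth[OF k distinct_pvars j(1)] vcoord_nth[OF k distinct_pvars j'(1)] j(2) j'(2) by auto
  then have "j = j'" by (metis div_mult_mod_eq)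
  then show ?thesis using j j' by simp
qed

lemma var_in: "C \<in> set \<phi> \<Longrightarrow> l \<in> set C \<Longrightarrow> fst l \<in> set (pvars \<phi>)"
  by (auto simp: pvars_def)

lemma cl3_nth:
  assumes "C \<in> set \<phi>" "j < 3"
  shows "ith (cl3 tab C) j = (if j < length C then lpos tab (C ! j) else (0, (0, False)))"
  using assms c3[OF assms(1)] by (auto simp: cl3_def ith_nth nth_append)

lemma ctri_blocks: "C \<in> set \<phi> \<Longrightarrow> ctri (cl3 tab C) \<in> blocks3 k"
  using cl3_nth[of C 0] cl3_nth[of C 1] cl3_nth[of C 2] vc_props(3)[OF var_in[of C "C ! _"]] k
  by (auto simp: ctri_def blocks3_def lpos_vcoord)

lemma cbound_cl3: "C \<in> set \<phi> \<Longrightarrow> cbound (dim tab) (cl3 tab C)"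
proof -
  assume C: "C \<in> set \<phi>"
  have "fst (snd x) \<le> dim tab" if x: "x \<in> set (cl3 tab C)" for x
  proof -
    have "x \<in> set (map (lpos tab) C @ replicate 3 (0, (0, False)))" using x unfolding cl3_def by (rule in_set_takeD)
    then consider l where "l \<in> set C" "x = lpos tab l" | "x = (0, (0, False))" by (auto split: if_splits)
    then show ?thesis
    proof cases
      case 1 then show ?thesis using vc_props(2)[OF var_in[OF C 1(1)]] by (simp add: lpos_vcoord)
    qed simp
  qed
  then show ?thesis by (auto simp: cbound_def cl3_def)
qed

text \<open>A padding literal reads coordinate 0 of block 0, which is 1, so it does not influence
  whether the clause is violated.\<close>

lemma viol_cl3:
  assumes C: "C \<in> set \<phi>" and y: "\<And>a. a < k \<Longrightarrow> 0 \<in> y a" and e: "ctri (cl3 tab C) = (a, b, c)"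
  shows "violS (cl3 tab C) (y a) (y b) (y c) \<longleftrightarrow>
    (\<forall>l \<in> set C. (fst (vc (fst l)) \<in> y (snd (vc (fst l)))) \<noteq> snd l)"
proof -
  let ?P = "\<lambda>j. lfS (snd (ith (cl3 tab C) j)) (y (fst (ith (cl3 tab C) j)))"
  have P: "?P j \<longleftrightarrow> (j < length C \<longrightarrow> (fst (vc (fst (C ! j))) \<in> y (snd (vc (fst (C ! j))))) \<noteq> snd (C ! j))" if "j < 3" for j
  proof (cases "j < length C")
    case True
    have "snd (vc (fst (C ! j))) < k" using vc_props(3)[OF var_in[OF C]] True by simp
    then show ?thesis using True cl3_nth[OF C that] y by (auto simp: lpos_vcoord lfS_def)
  next
    case False
    then show ?thesis using cl3_nth[OF C that] y[OF k] by (simp add: lfS_def)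
  qed
  have "violS (cl3 tab C) (y a) (y b) (y c) \<longleftrightarrow> ?P 0 \<and> ?P 1 \<and> ?P 2"
    using e by (auto simp: violS_def ctri_def)
  also have "\<dots> \<longleftrightarrow> (\<forall>j < length C. (fst (vc (fst (C ! j))) \<in> y (snd (vc (fst (C ! j))))) \<noteq> snd (C ! j))"
  proof -
    have "(\<forall>j<length C. Q j) \<longleftrightarrow> (0 < length C \<longrightarrow> Q 0) \<and> (1 < length C \<longrightarrow> Q 1) \<and> (2 < length C \<longrightarrow> Q 2)" for Q
    proof -
      have "j = 0 \<or> j = 1 \<or> j = 2" if "j < length C" for j using that c3[OF C] by linarith
      then show ?thesis by blast
    qed
    then show ?thesis using P[of 0] P[of 1] P[of 2] by simp
  qed
  also have "\<dots> \<longleftrightarrow> (\<forall>l \<in> set C. (fst (vc (fst l)) \<in> y (snd (vc (fst l)))) \<noteq> snd l)"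
    by (simp add: all_set_conv_all_nth)
  finally show ?thesis .
qed

definition Rows :: "tri \<Rightarrow> bclause list list" where
  "Rows e = crows (dim tab) (cls tab \<phi> e)"

lemma psat_imp:
  assumes "psat \<phi>"
  shows "\<exists>y. (\<forall>a. 0 \<in> y a) \<and> (\<forall>a. y a \<subseteq> {..<wlen (dim tab)}) \<and>
    (\<forall>(a, b, c) \<in> blocks3 k. TS Rows (a, b, c) (y a) (y b) (y c) = {})"
proof -
  obtain \<alpha> :: "nat list \<Rightarrow> bool" where \<alpha>: "\<forall>C \<in> set \<phi>. \<exists>l \<in> set C. \<alpha> (fst l) = snd l"
    using assms by (auto simp: psat_def)
  \<comment> \<open>The true variables of block \<open>a\<close> by their coordinates, with the
    constant coordinate added.\<close>
  define y where "y a = insert 0 {fst (vc v) | v. v \<in> set (pvars \<phi>) \<and> snd (vc v) = a \<and> \<alpha> v}" for a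
  have y0: "0 \<in> y a" for a by (simp add: y_def)
  have "y a \<subseteq> {..<wlen (dim tab)}" for a
    using vc_props(2) by (fastforce simp: y_def wlen_def)
  moreover have "TS Rows (a, b, c) (y a) (y b) (y c) = {}" for a b c
  proof (rule crows_complete)
    show "Rows (a, b, c) = crows (dim tab) (cls tab \<phi> (a, b, c))" by (simp add: Rows_def)
    fix cc assume "cc \<in> set (cls tab \<phi> (a, b, c))"
    then obtain C where C: "C \<in> set \<phi>" "cc = cl3 tab C" "ctri (cl3 tab C) = (a, b, c)" by (auto simp: cls_def)
    obtain l where l: "l \<in> set C" "\<alpha> (fst l) = snd l" using \<alpha> C by blast
    have v: "fst l \<in> set (pvars \<phi>)" using var_in C l by blast
    have "fst (vc (fst l)) \<in> y (snd (vc (fst l))) \<longleftrightarrow> \<alpha> (fst l)"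
    proof
      assume "fst (vc (fst l)) \<in> y (snd (vc (fst l)))"
      then obtain v' where "v' \<in> set (pvars \<phi>)" "vc v' = vc (fst l)" "\<alpha> v'"
        using vc_props(1)[OF v] by (auto simp: y_def prod_eq_iff)
      then show "\<alpha> (fst l)" using vc_inj v by metis
    qed (use v in \<open>auto simp: y_def\<close>)
    moreover have "violS (cl3 tab C) (y a) (y b) (y c) \<longleftrightarrow>
        (\<forall>l \<in> set C. (fst (vc (fst l)) \<in> y (snd (vc (fst l)))) \<noteq> snd l)"
      by (rule viol_cl3[OF C(1) _ C(3)]) (rule y0)
    ultimately show "\<not> violS cc (y a) (y b) (y c)"
      unfolding C(2) using l by blast
  qed
  ultimately show ?thesis using y0 by (intro exI[of _ y]) simp
qed

text \<open>The words of the blocks are read as an assignment. A falsified clause would be a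
  violation at its own block triple, and some row of that triple would notice it.\<close>

lemma psat_if:
  assumes y: "\<forall>a<k. 0 \<in> y a" and T: "\<forall>(a, b, c) \<in> blocks3 k. TS Rows (a, b, c) (y a) (y b) (y c) = {}"
  shows "psat \<phi>"
  unfolding psat_def
proof (intro exI[of _ "\<lambda>v. fst (vc v) \<in> y (snd (vc v))"] ballI)
  fix C assume C: "C \<in> set \<phi>"
  obtain a b c where e: "ctri (cl3 tab C) = (a, b, c)" by (metis prod_cases3)
  have mem: "cl3 tab C \<in> set (cls tab \<phi> (a, b, c))" using C e by (auto simp: cls_def)
  have "TS Rows (a, b, c) (y a) (y b) (y c) = {}" using T ctri_blocks[OF C] e by auto
  moreover have "TS Rows (a, b, c) (y a) (y b) (y c) \<noteq> {}" if "violS (cl3 tab C) (y a) (y b) (y c)"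
    by (rule crows_sound[where cs="cls tab \<phi> (a, b, c)" and d="dim tab" and c="cl3 tab C"])
      (use cbound_cl3 mem that in \<open>auto simp: cls_def Rows_def\<close>)
  ultimately have "\<not> violS (cl3 tab C) (y a) (y b) (y c)" by blast
  moreover have "violS (cl3 tab C) (y a) (y b) (y c) \<longleftrightarrow>
      (\<forall>l \<in> set C. (fst (vc (fst l)) \<in> y (snd (vc (fst l)))) \<noteq> snd l)"
    by (rule viol_cl3[OF C _ e]) (use y in simp)
  ultimately show "\<exists>l \<in> set C. (fst (vc (fst l)) \<in> y (snd (vc (fst l)))) = snd l" by blast
qed

lemma Rows_props:
  "length (Rows e) = wlen (dim tab)" "r \<in> set (Rows e) \<Longrightarrow> c \<in> set r \<Longrightarrow> cbound (dim tab) c"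
proof -
  show "length (Rows e) = wlen (dim tab)" by (simp add: Rows_def crows_def length_rows)
  assume "r \<in> set (Rows e)" "c \<in> set r"
  then have "c \<in> set (cls tab \<phi> e)" unfolding Rows_def crows_def using set_rows by blast
  then show "cbound (dim tab) c" using cbound_cl3 by (auto simp: cls_def)
qed

end

subsection \<open>The base game\<close>

fun tuples :: "nat \<Rightarrow> 'a list \<Rightarrow> 'a list list" where
  "tuples 0 W = [[]]"
| "tuples (Suc m) W = concat (map (\<lambda>w. map (\<lambda>v. w # v) (tuples m W)) W)"

lemma set_tuples: "set (tuples m W) = {v. length v = m \<and> set v \<subseteq> set W}"
  by (induction m) (auto simp: length_Suc_conv image_iff)

lemma distinct_tuples: "distinct W \<Longrightarrow> distinct (tuples m W)"
  by (induction m) (auto intro!: distinct_concat_map simp: distinct_map inj_on_def)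

lemma distinct_words: "distinct (words n)"
  by (induction n) (auto simp: distinct_map inj_on_def)

text \<open>Choice is harmless here: everything that depends on \<open>k\<close> alone is later
  built into the machine as a constant.\<close>

definition tlist :: "nat \<Rightarrow> test list" where
  "tlist k = (SOME l. set l = tests k \<and> distinct l)"

definition tid :: "nat \<Rightarrow> test \<Rightarrow> nat" where
  "tid k = (SOME f. inj_on f (tests k))"

definition pid :: "nat \<Rightarrow> idx set \<Rightarrow> nat" where
  "pid k = (SOME f. inj_on f (Pow (idxs k)))"

definition Elist :: "nat \<Rightarrow> tri list" where
  "Elist k = List.product [0..<k] (List.product [0..<k] [0..<k])"

definition belist :: "nat \<Rightarrow> tri set \<Rightarrow> nat list" where
  "belist k E = filter (\<lambda>j. Elist k ! j \<in> E) [0..<length (Elist k)]"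

lemma tlist: "set (tlist k) = tests k" "distinct (tlist k)"
proof -
  have "\<exists>l. set l = tests k \<and> distinct l" using finite_distinct_list[OF finite_tests] by blast
  from someI_ex[OF this] show "set (tlist k) = tests k" "distinct (tlist k)" unfolding tlist_def by auto
qed

lemma tid: "inj_on (tid k) (tests k)"
proof -
  have "\<exists>f :: test \<Rightarrow> nat. inj_on f (tests k)" using finite_imp_inj_to_nat_seg[OF finite_tests[of k]] by blast
  then show ?thesis unfolding tid_def by (rule someI_ex)
qed

lemma pid: "inj_on (pid k) (Pow (idxs k))"
proof -
  have "finite (Pow (idxs k))" by (simp add: finite_idxs)
  then have "\<exists>f :: idx set \<Rightarrow> nat. inj_on f (Pow (idxs k))" using finite_imp_inj_to_nat_seg by blast
  then show ?thesis unfolding pid_def by (rule someI_ex)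
qed

lemma Elist: "set (Elist k) = blocks3 k" "distinct (Elist k)"
  by (auto simp: Elist_def blocks3_def distinct_product)

lemma belist: "distinct (belist k E)" "j \<in> set (belist k E) \<Longrightarrow> j < length (Elist k)"
  "E \<subseteq> blocks3 k \<Longrightarrow> (!) (Elist k) ` set (belist k E) = E"
proof -
  show "distinct (belist k E)" "j \<in> set (belist k E) \<Longrightarrow> j < length (Elist k)" by (auto simp: belist_def)
  assume E: "E \<subseteq> blocks3 k"
  show "(!) (Elist k) ` set (belist k E) = E"
  proof
    show "E \<subseteq> (!) (Elist k) ` set (belist k E)"
    proof
      fix e assume e: "e \<in> E"
      then have "e \<in> set (Elist k)" using E Elist(1) by blast
      then obtain j where "j < length (Elist k)" "Elist k ! j = e" by (metis in_set_conv_nth)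
      then show "e \<in> (!) (Elist k) ` set (belist k E)" using e by (auto simp: belist_def)
    qed
  qed (auto simp: belist_def)
qed

text \<open>Each player independently draws one of nine kinds of question: 0 asks for the whole
  view, \<open>c > 0\<close> for its position \<open>c - 1\<close>.\<close>

definition coins :: "nat \<Rightarrow> nat list list" where
  "coins p = tuples p [0..<9]"

type_synonym kom = "nat \<times> nat list \<times> nat list list \<times> nat list \<times> bool"

text \<open>Parity separates the two kinds. A question for a single position carries the position
  alone and hides both the test and its place in the test, so that the answers to such questions
  form a proof.\<close>

definition qnum :: "nat \<Rightarrow> test \<Rightarrow> nat \<Rightarrow> nat" where
  "qnum k t c = (if c = 0 then 2 * tid k t else 2 * pid k (positions t ! (c - 1)) + 1)"

definition selc :: "nat \<Rightarrow> nat list" where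
  "selc c = (if c = 0 then [0..<8] else [c - 1])"

definition runs :: "nat \<Rightarrow> nat \<Rightarrow> (test \<times> nat list) list" where
  "runs p k = List.product (tlist k) (coins p)"

definition koms :: "nat \<Rightarrow> nat \<Rightarrow> kom list" where
  "koms p k = map (\<lambda>j. let t = fst (runs p k ! j); cs = snd (runs p k ! j) in
     (j, map (qnum k t) cs, map selc cs, belist k (tbe t), odd (card (tal t)))) [0..<length (runs p k)]"

definition omegas :: "nat \<Rightarrow> bclause list list list \<Rightarrow> bool list list \<Rightarrow> kom list \<Rightarrow> omega list" where
  "omegas n Ts W ks = map (\<lambda>z. (fst z, fst (snd z), fst (snd (snd z)),
     filter (\<lambda>v. accept n Ts (fst (snd (snd (snd z)))) (snd (snd (snd (snd z)))) v) (tuples 8 W))) ks"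

lemma positions_sub: "t \<in> tests k \<Longrightarrow> x \<in> set (positions t) \<Longrightarrow> x \<subseteq> idxs k"
proof -
  assume t: "t \<in> tests k" and x: "x \<in> set (positions t)"
  from t have "tx t \<subseteq> idxs k" "ty t \<subseteq> idxs k" "YI ` tal t \<subseteq> idxs k" "YI ` tal' t \<subseteq> idxs k" "YI ` tal'' t \<subseteq> idxs k"
    "tensor (tbe t) (tal t) (tal' t) (tal'' t) \<subseteq> idxs k" "diag (tbe t) \<subseteq> idxs k"
    by (simp_all add: tests_def YI_sub tensor_sub diag_sub)
  moreover have "x \<in> {tx t, ty t, tx t \<triangle> ty t, tx t \<triangle> YI ` tal t, tx t \<triangle> YI ` tal' t,
     tx t \<triangle> YI ` tal'' t, tx t \<triangle> tensor (tbe t) (tal t) (tal' t) (tal'' t), tx t \<triangle> diag (tbe t)}"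
    using x by (simp add: positions_def)
  ultimately show "x \<subseteq> idxs k" by (elim insertE emptyE) (simp_all add: sdiff_subset)
qed

lemma length_positions: "length (positions t) = 8"
  by (simp add: positions_def)

lemma tests_nonempty: "tests k \<noteq> {}"
proof -
  have "\<lparr>tx = {}, ty = {}, tal = {}, tal' = {}, tal'' = {}, tbe = {}\<rparr> \<in> tests k" by (simp add: tests_def)
  then show ?thesis by blast
qed

text \<open>Every coin list arises from one with the prescribed entries by overwriting these two, in
  one of 81 ways.\<close>

lemma coins_count:
  assumes "i < p" "j < p" "i \<noteq> j" "a < 9" "b < 9"
  shows "card (set (coins p)) \<le> 81 * card {cs \<in> set (coins p). cs ! i = a \<and> cs ! j = b}"
proof -
  let ?C = "set (coins p)" and ?D = "{cs \<in> set (coins p). cs ! i = a \<and> cs ! j = b}"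
  let ?f = "\<lambda>(cs, x, y). (cs[i := x])[j := y] :: nat list"
  have C: "?C = {v. length v = p \<and> set v \<subseteq> {0..<9}}" by (simp add: coins_def set_tuples)
  have "?C \<subseteq> ?f ` (?D \<times> {..<9} \<times> {..<9})"
  proof
    fix cs assume cs: "cs \<in> ?C"
    let ?d = "(cs[i := a])[j := b]"
    have "set ?d \<subseteq> {0..<9}" using cs assms C
      by (intro set_update_subsetI) auto
    then have "?d \<in> ?D" using cs assms C by simp
    moreover have "cs ! i < 9" "cs ! j < 9" using cs assms C nth_mem by fastforce+
    moreover have "cs = ?f (?d, cs ! i, cs ! j)" using cs assms C by (intro nth_equalityI) (auto simp: nth_list_update)
    ultimately show "cs \<in> ?f ` (?D \<times> {..<9} \<times> {..<9})" by (intro image_eqI[of _ _ "(?d, cs ! i, cs ! j)"]) auto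
  qed
  then have "card ?C \<le> card (?f ` (?D \<times> {..<9} \<times> {..<9}))" by (intro card_mono) auto
  also have "\<dots> \<le> card (?D \<times> {..<9::nat} \<times> {..<9::nat})" by (intro card_image_le) auto
  finally show ?thesis by (simp add: card_cartesian_product)
qed

context blocked
begin

abbreviation "n \<equiv> wlen (dim tab)"
abbreviation "Ts \<equiv> map Rows (Elist k)"

definition "views t = filter (\<lambda>v. accept n Ts (belist k (tbe t)) (odd (card (tal t))) v) (tuples 8 (words n))"
definition "Om p = omegas n Ts (words n) (koms p k)"

lemma views_iff:
  assumes "t \<in> tests k" "v \<in> set (tuples 8 (words n))"
  shows "v \<in> set (views t) \<longleftrightarrow> acc (TS Rows) t (map setof v)"
proof -
  have "accept n Ts (belist k (tbe t)) (odd (card (tal t))) v \<longleftrightarrow> acc (TS Rows) t (map setof v)"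
  proof (rule accept_acc[where d="dim tab" and Es="Elist k"])
    show "tbe t = (!) (Elist k) ` set (belist k (tbe t))"
      using belist(3)[of "tbe t" k] assms(1) by (auto simp: tests_def)
  qed (use assms(2) belist Elist Rows_props in \<open>auto simp: set_tuples set_words subset_iff\<close>)
  then show ?thesis using assms(2) by (simp add: views_def)
qed

lemma Om_nth:
  assumes "j < length (runs p k)"
  shows "Om p ! j = (j, map (qnum k (fst (runs p k ! j))) (snd (runs p k ! j)),
     map selc (snd (runs p k ! j)), views (fst (runs p k ! j)))"
  using assms by (simp add: Om_def omegas_def koms_def views_def Let_def)

lemma length_Om: "length (Om p) = length (runs p k)"
  by (simp add: Om_def omegas_def koms_def)

lemma map_fst_Om: "map fst (Om p) = [0..<length (runs p k)]"
  by (rule nth_equalityI) (simp_all add: length_Om Om_nth)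

lemma ids: "distinct (map fst (Om p))"
  unfolding map_fst_Om by simp

lemma distinct_Om: "distinct (Om p)"
  using ids by (simp add: distinct_map)

lemma card_Om: "card (set (Om p)) = length (koms p k)"
  using distinct_card[OF distinct_Om] by (simp add: length_Om koms_def)

lemma distinct_omv: "w \<in> set (Om p) \<Longrightarrow> distinct (omv w)"
  by (auto simp: Om_def omegas_def omv_def distinct_tuples distinct_words)

lemma runs_props:
  assumes "j < length (runs p k)"
  shows "fst (runs p k ! j) \<in> tests k" "snd (runs p k ! j) \<in> set (coins p)" "length (snd (runs p k ! j)) = p"
proof -
  have "runs p k ! j \<in> set (runs p k)" using assms by simp
  then show "fst (runs p k ! j) \<in> tests k" "snd (runs p k ! j) \<in> set (coins p)" by (auto simp: runs_def tlist)
  then show "length (snd (runs p k ! j)) = p" by (simp add: coins_def set_tuples)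
qed

lemma Om_fields:
  assumes "j < length (runs p k)" "i < p"
  shows "omq i (Om p ! j) = qnum k (fst (runs p k ! j)) (snd (runs p k ! j) ! i)"
    "omv (Om p ! j) = views (fst (runs p k ! j))"
    "oma i (Om p ! j) v = map (ith v) (selc (snd (runs p k ! j) ! i))"
  using assms runs_props(3)[OF assms(1)] by (auto simp: Om_nth omq_def omv_def oma_def ith_nth)

text \<open>The single-position answers of player \<open>j\<close> are a proof \<open>F\<close>,
  which at least one test in 300 rejects. On such a test the whole view named by player
  \<open>i\<close> is not accepted or deviates from \<open>F\<close> at some position, and with
  probability at least \<open>1 / 81\<close> player \<open>i\<close> is asked for the view and
  player \<open>j\<close> for that position.\<close>

lemma base_bound:
  assumes "\<not> psat \<phi>" "i < p" "j < p" "i \<noteq> j"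
  shows "real (card {w \<in> set (Om p). \<exists>v \<in> set (omv w). oma i w v = s (omq i w) \<and> oma j w v = s' (omq j w)})
    \<le> (1 - 1 / 24300) * real (card (set (Om p)))"
proof -
  let ?P = "\<lambda>w. \<exists>v \<in> set (omv w). oma i w v = s (omq i w) \<and> oma j w v = s' (omq j w)"
  define Q where "Q x \<longleftrightarrow> (\<exists>v \<in> set (views (fst x)). map (ith v) (selc (snd x ! i)) = s (qnum k (fst x) (snd x ! i)) \<and>
     map (ith v) (selc (snd x ! j)) = s' (qnum k (fst x) (snd x ! j)))" for x :: "test \<times> nat list"
  let ?S = "set (runs p k)"
  have S: "?S = tests k \<times> set (coins p)" by (simp add: runs_def tlist)
  have dr: "distinct (runs p k)" unfolding runs_def by (intro distinct_product tlist) (simp add: coins_def distinct_tuples)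
  have cS: "card ?S = card (set (Om p))" using distinct_card[OF dr] distinct_card[OF distinct_Om] length_Om by metis
  \<comment> \<open>Coins and runs are listed in the same order, so the counts agree through the
    common index.\<close>
  have eq: "card {w \<in> set (Om p). ?P w} = card {x \<in> ?S. Q x}"
  proof -
    let ?J = "{j' \<in> {..<length (runs p k)}. Q (runs p k ! j')}"
    have im: "{x \<in> set xs. P x} = (!) xs ` {j \<in> {..<length xs}. P (xs ! j)}" for P and xs :: "'z list"
      by (auto simp: in_set_conv_nth)
    have PQ: "?P (Om p ! j') = Q (runs p k ! j')" if "j' < length (runs p k)" for j'
      unfolding Q_def Om_fields(2)[OF that assms(2)] Om_fields(1,3)[OF that assms(2)] Om_fields(1,3)[OF that assms(3)] by (rule refl)
    have "{w \<in> set (Om p). ?P w} = (!) (Om p) ` {j \<in> {..<length (Om p)}. ?P (Om p ! j)}" by (rule im)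
    moreover have "{j \<in> {..<length (Om p)}. ?P (Om p ! j)} = ?J" using PQ by (auto simp: length_Om)
    ultimately have "{w \<in> set (Om p). ?P w} = (!) (Om p) ` ?J" by simp
    moreover have "{x \<in> ?S. Q x} = (!) (runs p k) ` ?J" by (rule im)
    moreover have "inj_on ((!) (Om p)) ?J" using distinct_Om by (auto intro!: inj_onI simp: nth_eq_iff_index_eq length_Om)
    moreover have "inj_on ((!) (runs p k)) ?J" using dr by (auto intro!: inj_onI simp: nth_eq_iff_index_eq)
    ultimately show ?thesis by (simp add: card_image)
  qed
  \<comment> \<open>The answer to a question for one position is a list with a single word.\<close>
  define F where "F A = setof (hd (s' (2 * pid k A + 1)))" for A
  define Rj where "Rj = {t \<in> tests k. \<not> acc (TS Rows) t (map F (positions t))}"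
  have Rj: "card (tests k) \<le> 300 * card Rj"
  proof (rule ccontr)
    assume "\<not> ?thesis"
    then have "300 * card {t \<in> tests k. \<not> acc (TS Rows) t (map F (positions t))} < card (tests k)" by (simp add: Rj_def)
    from pcp_sound[OF trilinear_TS this] obtain y where y: "\<forall>a<k. 0 \<in> y a"
      "\<forall>(a, b, c)\<in>blocks3 k. TS Rows (a, b, c) (y a) (y b) (y c) = {}" by blast
    then show False using psat_if[OF y] assms(1) by blast
  qed
  \<comment> \<open>Otherwise the view named by player \<open>i\<close> would be accepted and agree
    with \<open>F\<close> in all eight positions, although the test rejects
    \<open>F\<close>.\<close>
  have bad: "\<exists>m<8. \<forall>cs \<in> set (coins p). cs ! i = 0 \<and> cs ! j = Suc m \<longrightarrow> \<not> Q (t, cs)" if t: "t \<in> Rj" for t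
  proof (rule ccontr)
    assume "\<not> ?thesis"
    then have ex: "\<exists>cs. cs ! i = 0 \<and> cs ! j = Suc m \<and> Q (t, cs)" if "m < 8" for m using that by blast
    have t': "t \<in> tests k" using t by (simp add: Rj_def)
    define a where "a = s (2 * tid k t)"
    have all: "a \<in> set (views t) \<and> length a = 8 \<and> setof (a ! m) = F (positions t ! m)" if m: "m < 8" for m
    proof -
      obtain cs v where cs: "cs ! i = 0" "cs ! j = Suc m" and v: "v \<in> set (views t)"
        "map (ith v) (selc 0) = a" "map (ith v) (selc (Suc m)) = s' (2 * pid k (positions t ! m) + 1)"
        using ex[OF m] by (auto simp: Q_def qnum_def a_def)
      have lv: "length v = 8" using v(1) by (auto simp: views_def set_tuples)
      have "map (ith v) [0..<8] = v" by (rule nth_equalityI) (simp_all add: lv ith_nth)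
      then have va: "v = a" using v(2) by (simp add: selc_def)
      have "s' (2 * pid k (positions t ! m) + 1) = [v ! m]" using v(3) lv m by (simp add: selc_def ith_nth)
      then show ?thesis using va v(1) lv by (simp add: F_def)
    qed
    have a: "a \<in> set (views t)" "length a = 8" using all[of 0] by auto
    have "map setof a = map F (positions t)"
      by (rule nth_equalityI) (use all a in \<open>simp_all add: length_positions\<close>)
    moreover have "acc (TS Rows) t (map setof a)"
      using views_iff[OF t', of a] a(1) by (auto simp: views_def)
    ultimately show False using t by (simp add: Rj_def)
  qed
  then obtain m where m: "\<And>t. t \<in> Rj \<Longrightarrow> m t < 8"
    "\<And>t cs. t \<in> Rj \<Longrightarrow> cs \<in> set (coins p) \<Longrightarrow> cs ! i = 0 \<Longrightarrow> cs ! j = Suc (m t) \<Longrightarrow> \<not> Q (t, cs)" by metis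
  let ?D = "\<lambda>t. {cs \<in> set (coins p). cs ! i = 0 \<and> cs ! j = Suc (m t)}"
  have finT: "finite Rj" unfolding Rj_def using finite_tests by simp
  have "card Rj * card (set (coins p)) = (\<Sum>t\<in>Rj. card (set (coins p)))" by simp
  also have "\<dots> \<le> (\<Sum>t\<in>Rj. 81 * card (?D t))"
    using m(1) assms by (intro sum_mono coins_count) auto
  also have "\<dots> = 81 * card (SIGMA t:Rj. ?D t)" using finT by (simp add: sum_distrib_left)
  also have "\<dots> \<le> 81 * card {x \<in> ?S. \<not> Q x}"
    using m(2) by (intro mult_le_mono2 card_mono) (auto simp: S Rj_def finite_tests)
  finally have 1: "card Rj * card (set (coins p)) \<le> 81 * card {x \<in> ?S. \<not> Q x}" .
  have "card ?S = card (tests k) * card (set (coins p))" by (simp add: S card_cartesian_product)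
  also have "\<dots> \<le> 300 * card Rj * card (set (coins p))" by (rule mult_le_mono1[OF Rj])
  also have "\<dots> \<le> 24300 * card {x \<in> ?S. \<not> Q x}" using 1 by simp
  finally have 2: "card ?S \<le> 24300 * card {x \<in> ?S. \<not> Q x}" .
  have "card ?S = card {x \<in> ?S. Q x} + card {x \<in> ?S. \<not> Q x}"
    by (subst card_Un_disjoint[symmetric]) (auto intro: arg_cong[where f=card])
  with 2 have "24300 * real (card {x \<in> ?S. Q x}) \<le> 24299 * real (card ?S)" by linarith
  then show ?thesis unfolding eq cS by (simp add: field_simps)
qed

text \<open>The views are read from one honest proof. Equal question numbers mean the same test or
  the same position, hence the same answer.\<close>

lemma base_complete:
  assumes "psat \<phi>"
  shows "\<exists>V. (\<forall>w \<in> set (Om p). V w \<in> set (omv w)) \<and>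
    (\<forall>i<p. \<forall>w \<in> set (Om p). \<forall>w' \<in> set (Om p). omq i w = omq i w' \<longrightarrow> oma i w (V w) = oma i w' (V w'))"
proof -
  obtain y where y: "\<And>a. 0 \<in> y a" "\<And>a. y a \<subseteq> {..<n}"
    "\<forall>(a, b, c) \<in> blocks3 k. TS Rows (a, b, c) (y a) (y b) (y c) = {}" using psat_imp[OF assms] by blast
  define h where "h A = wordof n (honest (TS Rows) y A)" for A
  have T: "TS Rows e U V W \<subseteq> {..<n}" for e U V W using Rows_props(1)[of e] by (auto simp: TS_def)
  have hs: "setof (h A) = honest (TS Rows) y A" for A
  proof -
    have "honest (TS Rows) y A \<subseteq> {..<n}" by (rule honest_bounded) (rule y(2), rule T)
    then show ?thesis by (auto simp: h_def setof_wordof)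
  qed
  define V where "V w = map h (positions (fst (runs p k ! fst w)))" for w :: omega
  have Vn: "V (Om p ! j) = map h (positions (fst (runs p k ! j)))" if "j < length (runs p k)" for j
    using that by (simp add: V_def Om_nth)
  show ?thesis
  proof (intro exI[of _ V] conjI ballI allI impI)
    fix w assume "w \<in> set (Om p)"
    then obtain j where j: "j < length (runs p k)" "w = Om p ! j" by (auto simp: in_set_conv_nth length_Om)
    let ?t = "fst (runs p k ! j)"
    have t: "?t \<in> tests k" by (rule runs_props(1)[OF j(1)])
    have mem: "V w \<in> set (tuples 8 (words n))"
      using Vn[OF j(1)] j(2) wordof_in_words by (auto simp: set_tuples length_positions h_def)
    have e: "map setof (V w) = map (honest (TS Rows) y) (positions ?t)" using Vn[OF j(1)] j(2) hs by simp
    have "acc (TS Rows) ?t (map setof (V w))"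
      unfolding e by (rule pcp_complete[OF trilinear_TS t]) (use y in auto)
    then have "V w \<in> set (views ?t)" using views_iff[OF t mem] by blast
    then show "V w \<in> set (omv w)" using j by (simp add: Om_nth omv_def)
  next
    fix i w w' assume i: "i < p" and w: "w \<in> set (Om p)" "w' \<in> set (Om p)" and q: "omq i w = omq i w'"
    obtain j where j: "j < length (runs p k)" "w = Om p ! j" using w by (auto simp: in_set_conv_nth length_Om)
    obtain j' where j': "j' < length (runs p k)" "w' = Om p ! j'" using w by (auto simp: in_set_conv_nth length_Om)
    let ?t = "fst (runs p k ! j)" and ?c = "snd (runs p k ! j) ! i"
    let ?t' = "fst (runs p k ! j')" and ?c' = "snd (runs p k ! j') ! i"
    have c9: "?c < 9" "?c' < 9"
      using runs_props(2)[OF j(1)] runs_props(2)[OF j'(1)] i by (auto simp: coins_def set_tuples subset_iff)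
    have t: "?t \<in> tests k" "?t' \<in> tests k" using runs_props(1) j j' by blast+
    have e: "qnum k ?t ?c = qnum k ?t' ?c'" using q j j' i by (simp add: Om_fields)
    have a: "oma i w (V w) = map (ith (map h (positions ?t))) (selc ?c)" "oma i w' (V w') = map (ith (map h (positions ?t'))) (selc ?c')"
      using j j' i by (simp_all add: Om_fields Vn)
    have par: "2 * x \<noteq> Suc (2 * z)" for x z :: nat by presburger
    show "oma i w (V w) = oma i w' (V w')"
    proof (cases "?c = 0")
      case True
      then have c': "?c' = 0" using e par by (auto simp: qnum_def split: if_splits)
      then have "tid k ?t = tid k ?t'" using e True by (simp add: qnum_def)
      then have "?t = ?t'" using tid t by (meson inj_onD)
      then show ?thesis using True c' a by simp
    next
      case False
      have c': "?c' \<noteq> 0"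
      proof
        assume "?c' = 0"
        then have "2 * tid k ?t' = Suc (2 * pid k (positions ?t ! (?c - 1)))" using e False by (simp add: qnum_def)
        then show False using par by blast
      qed
      then have pe: "pid k (positions ?t ! (?c - 1)) = pid k (positions ?t' ! (?c' - 1))" using e False by (simp add: qnum_def)
      have "?c - 1 < 8" "?c' - 1 < 8" using c9 False c' by auto
      then have "positions ?t ! (?c - 1) \<in> Pow (idxs k)" "positions ?t' ! (?c' - 1) \<in> Pow (idxs k)"
        using positions_sub[OF t(1)] positions_sub[OF t(2)] nth_mem length_positions by (metis PowI)+
      then have "positions ?t ! (?c - 1) = positions ?t' ! (?c' - 1)" using pid pe by (meson inj_onD)
      then show ?thesis using a False c' \<open>?c - 1 < 8\<close> \<open>?c' - 1 < 8\<close> by (simp add: selc_def ith_nth length_positions)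
    qed
  qed
qed

lemma psat_cut:
  assumes "psat \<phi>"
  shows "\<exists>X \<subseteq> bundle_labels (Om p) r. card X \<le> length (koms p k) ^ r \<and> (\<forall>i<p. cut X (spt (Om p) i r [[[]]]))"
proof -
  obtain V where V: "\<And>w. w \<in> set (Om p) \<Longrightarrow> V w \<in> set (omv w)"
    "\<And>i w w'. i < p \<Longrightarrow> w \<in> set (Om p) \<Longrightarrow> w' \<in> set (Om p) \<Longrightarrow> omq i w = omq i w' \<Longrightarrow> oma i w (V w) = oma i w' (V w')"
    using base_complete[OF assms, of p] by blast
  define X where "X = (\<lambda>ws. zip (map fst ws) (map V ws)) ` seqs (Om p) r"
  have "card X \<le> card (seqs (Om p) r)" unfolding X_def by (rule card_image_le[OF finite_seqs])
  moreover have "X \<subseteq> bundle_labels (Om p) r"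
  proof
    fix x assume "x \<in> X"
    then obtain ws where ws: "ws \<in> seqs (Om p) r" "x = zip (map fst ws) (map V ws)" unfolding X_def by blast
    have "list_all2 (\<lambda>w v. v \<in> set (omv w)) ws (map V ws)"
    proof (rule list_all2_all_nthI)
      fix j assume j: "j < length ws"
      then have "ws ! j \<in> set (Om p)" using ws(1) nth_mem[OF j] unfolding seqs_def by blast
      then show "map V ws ! j \<in> set (omv (ws ! j))" using V(1) j by simp
    qed simp
    then show "x \<in> bundle_labels (Om p) r" using ws unfolding bundle_labels_def by blast
  qed
  moreover have "cut X (spt (Om p) i r [[[]]])" if "i < p" for i
  proof (rule spt_complete[where V=V])
    show "oma i w (V w) = oma i w' (V w')" if "w \<in> set (Om p)" "w' \<in> set (Om p)" "omq i w = omq i w'" for w w'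
      using V(2)[OF \<open>i < p\<close> that] .
    fix opts :: "label list" assume "opts \<in> set [[[]]]"
    then show "\<exists>b \<in> set opts. \<forall>ws \<in> seqs (Om p) r. b @ zip (map fst ws) (map V ws) \<in> X"
      by (simp add: X_def)
  qed (rule V(1))
  ultimately show ?thesis unfolding card_seqs card_Om by blast
qed

lemma unsat_cut:
  assumes "\<not> psat \<phi>" "finite X" "\<And>i. i < p \<Longrightarrow> cut X (spt (Om p) i r [[[]]])"
  shows "real (card X) \<ge> (real p - real p ^ 2 * (1 - 1 / 24300) ^ r) * real (length (koms p k)) ^ r"
  unfolding card_Om[of p, symmetric]
  by (rule spt_sound[OF base_bound[OF assms(1)] _ ids assms(2,3)]) auto

lemma koms_pos: "length (koms p k) > 0"
proof -
  have "replicate p 0 \<in> set (coins p)" by (simp add: coins_def set_tuples set_replicate_conv_if)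
  moreover have "tlist k \<noteq> []" using tests_nonempty tlist(1) by (metis set_empty)
  moreover obtain t where "t \<in> set (tlist k)" using calculation(2) by (meson list.set_sel(1))
  ultimately have "(t, replicate p 0) \<in> set (runs p k)" by (simp add: runs_def set_product)
  then have "runs p k \<noteq> []" by auto
  then show ?thesis by (simp add: koms_def)
qed

text \<open>The game meets the requirement that each transcript labels exactly one edge of every
  player's network.\<close>

lemma network_Om:
  assumes "inj nm" "p \<ge> 2"
  shows "network p (\<lambda>i. spt (Om p) i r [[[]]]) nm (bundle_labels (Om p) r)"
proof
  fix i
  show "distinct (labels (spt (Om p) i r [[[]]]))"
    by (rule distinct_labels_spt[where m=0]) (use ids distinct_omv in auto)
  show "set (labels (spt (Om p) i r [[[]]])) = bundle_labels (Om p) r"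
    unfolding set_labels_spt by auto
qed (use assms in auto)

end

section \<open>Computing the reduction\<close>

lemma tc_comp3:
  assumes "fp (\<lambda>z. h (fst z) (fst (snd z)) (snd (snd z)))" "tc \<mu> f" "tc \<mu> g" "tc \<mu> k"
  shows "tc \<mu> (\<lambda>x. h (f x) (g x) (k x))"
  using fp_comp[OF assms(1) tc_pair[OF assms(2) tc_pair[OF assms(3,4)]]] by simp

lemma tc_comp4:
  assumes "fp (\<lambda>z. h (fst z) (fst (snd z)) (fst (snd (snd z))) (snd (snd (snd z))))" "tc \<mu> f" "tc \<mu> g" "tc \<mu> k" "tc \<mu> l"
  shows "tc \<mu> (\<lambda>x. h (f x) (g x) (k x) (l x))"
  using fp_comp[OF assms(1) tc_pair[OF assms(2) tc_pair[OF assms(3) tc_pair[OF assms(4,5)]]]] by simp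

lemma tc_comp5:
  assumes "fp (\<lambda>z. h (fst z) (fst (snd z)) (fst (snd (snd z))) (fst (snd (snd (snd z)))) (snd (snd (snd (snd z)))))"
    "tc \<mu> f" "tc \<mu> g" "tc \<mu> k" "tc \<mu> l" "tc \<mu> m"
  shows "tc \<mu> (\<lambda>x. h (f x) (g x) (k x) (l x) (m x))"
  using fp_comp[OF assms(1) tc_pair[OF assms(2) tc_pair[OF assms(3) tc_pair[OF assms(4) tc_pair[OF assms(5,6)]]]]] by simp

lemma fp_ith: "fp (\<lambda>z. ith (fst z) (snd z))"
  unfolding ith_def by (intro fp_intros)

lemmas tc_ith [fp_intros] = tc_comp2[OF fp_ith]

lemma rsize_word_sum: "rsize (map ((#) (b::bool)) W) \<le> rsize W + 4 * length W"
proof (induction W)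
  case (Cons w W) then show ?case using rsize_bool[of b] by simp
qed simp

lemma rsize_words: "rsize (words n) \<le> 2 ^ n * (4 * n + 3)"
proof (induction n)
  case (Suc n)
  have "rsize (words (Suc n)) \<le> rsize (map ((#) True) (words n)) + rsize (map ((#) False) (words n))"
    using rsize_append[of "map ((#) True) (words n)" "map ((#) False) (words n)"] by simp
  also have "\<dots> \<le> 2 * rsize (words n) + 8 * 2 ^ n"
    using rsize_word_sum[of True "words n"] rsize_word_sum[of False "words n"] unfolding length_words by linarith
  also have "\<dots> \<le> 2 * (2 ^ n * (4 * n + 3)) + 8 * 2 ^ n" using Suc by linarith
  also have "\<dots> = 2 ^ Suc n * (4 * Suc n + 3)" by (simp add: algebra_simps)
  finally show ?case .
qed simp

text \<open>The list doubles in each round, so its size is charged to a measure that is at least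
  \<open>2 ^ g x\<close> up to a polynomial.\<close>

lemma tc_words:
  assumes g: "tc \<mu> g" and Q: "pb Q" "\<And>x. 2 ^ g x \<le> Q (\<mu> x + rsize x)"
  shows "tc \<mu> (\<lambda>x. words (g x))"
proof -
  let ?h = "\<lambda>W. map ((#) True) W @ map ((#) False) W"
  have e: "foldl (\<lambda>W _. ?h W) [[]] (replicate n ()) = words n" for n
  proof (induction n)
    case (Suc n)
    have "foldl (\<lambda>W _. ?h W) [[]] (replicate (Suc n) ()) = ?h (foldl (\<lambda>W _. ?h W) [[]] (replicate n ()))"
      by (simp only: replicate_Suc replicate_append_same[symmetric] foldl_append foldl.simps)
    then show ?case using Suc by simp
  qed simp
  have "tc \<mu> (\<lambda>x. foldl (\<lambda>W _. ?h W) [[]] (replicate (g x) ()))"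
  proof (rule tc_foldl[where Q="\<lambda>n. Q n * (4 * Q n + 3)"])
    show "pb (\<lambda>n. Q n * (4 * Q n + 3))" by (intro pb_intros Q(1))
    show "rsize (foldl (\<lambda>W _. ?h W) [[]] (take k (replicate (g x) ()))) \<le> Q (\<mu> x + rsize x) * (4 * Q (\<mu> x + rsize x) + 3)" for x k
    proof -
      let ?n = "min k (g x)"
      have "2 ^ ?n \<le> (2::nat) ^ g x" by (rule power_increasing) auto
      then have a: "2 ^ ?n \<le> Q (\<mu> x + rsize x)" using Q(2)[of x] by linarith
      have "?n < 2 ^ ?n" by (rule less_exp)
      then have b: "4 * ?n + 3 \<le> 4 * Q (\<mu> x + rsize x) + 3" using a by linarith
      show ?thesis unfolding take_replicate e by (rule le_trans[OF rsize_words mult_le_mono[OF a b]])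
    qed
  qed (intro fp_intros g)+
  then show ?thesis unfolding e .
qed

lemma fp_wlen: "fp wlen"
proof -
  have "fp (\<lambda>d. Suc d + (Suc d + (Suc d + 1)))" by (intro fp_intros)
  then show ?thesis by (rule tc_cong) (simp add: wlen_def)
qed

lemmas tc_wlen [fp_intros] = fp_comp[OF fp_wlen]

lemma fp_viol: "fp (\<lambda>z. viol (fst z) (snd z))"
  unfolding viol_def lf_def by (intro fp_intros)

lemmas tc_viol [fp_intros] = tc_comp2[OF fp_viol]

lemma fp_parity: "fp parity"
proof -
  have "fp (\<lambda>x. foldl (\<lambda>a b. a \<noteq> b) False x)"
  proof (rule tc_foldl_add[where Q="\<lambda>n. 3"])
    show "rsize (a \<noteq> y) \<le> rsize a + 3" for a y :: bool using rsize_bool[of "a \<noteq> y"] by linarith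
  qed (intro fp_intros pb_intros)+
  then show ?thesis by (rule tc_cong) (simp add: parity_def)
qed

lemmas tc_parity [fp_intros] = fp_comp[OF fp_parity]

lemma fp_rowval: "fp (\<lambda>z. rowval (fst z) (snd z))"
  unfolding rowval_def by (intro fp_intros)

lemmas tc_rowval [fp_intros] = tc_comp2[OF fp_rowval]

lemma fp_decide: "fp (\<lambda>z. decide (fst z) (fst (snd z)) (fst (snd (snd z))) (snd (snd (snd z))))"
  unfolding decide_def Let_def by (intro fp_intros)

lemmas tc_decide [fp_intros] = tc_comp4[OF fp_decide]

lemma rsize_tl: "rsize (tl xs) \<le> rsize xs"
  by (cases xs) auto

lemma rsize_filter: "rsize (filter P xs) \<le> rsize xs"
  by (induction xs) auto

lemma rsize_decide: "rsize (decide S c cs row) \<le> rsize row + rsize c + 1"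
  by (simp add: decide_def Let_def rsize_snoc)

lemma rsize_pick: "rsize (pick S cs row) \<le> rsize row + rsize cs"
proof (induction cs arbitrary: row)
  case (Cons c cs)
  show ?case using Cons[of "decide S c cs row"] rsize_decide[of S c cs row] by simp
qed simp

lemma fp_pick: "fp (\<lambda>z. pick (fst z) (snd z) [])"
proof -
  \<comment> \<open>The fold carries the clauses still to come, because \<open>decide\<close> looks
    ahead at them.\<close>
  let ?h = "\<lambda>S a c. (tl (fst a), decide S c (tl (fst a)) (snd a))"
  have e: "snd (foldl (?h S) (cs, row) cs) = pick S cs row" for S cs row
    by (induction cs arbitrary: row) auto
  have "fp (\<lambda>z. foldl (?h (fst z)) (snd z, []) (snd z))"
  proof (rule tc_foldl_add[where Q="\<lambda>n. n + 1"])
    fix x :: "triple list \<times> bclause list" and a :: "bclause list \<times> bclause list" and c :: bclause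
    show "rsize (?h (fst x) a c) \<le> rsize a + (rsize x + rsize c + 1)"
      using rsize_tl[of "fst a"] rsize_decide[of "fst x" c "tl (fst a)" "snd a"] by (cases a) simp
  qed (intro fp_intros pb_intros)+
  then have "fp (\<lambda>z. snd (foldl (?h (fst z)) (snd z, []) (snd z)))" by (rule tc_snd)
  then show ?thesis unfolding e .
qed

lemmas tc_pick [fp_intros] = tc_comp2[OF fp_pick]

lemma fp_rows: "fp (\<lambda>z. rows (fst z) (fst (snd z)) (snd (snd z)))"
proof -
  let ?h = "\<lambda>cs a (y::unit). (fst a @ [pick (snd a) cs []], filter (\<lambda>x. \<not> rowval (pick (snd a) cs []) x) (snd a))"
  have e: "fst (foldl (?h cs) (rs, S) (replicate n ())) = rs @ rows n cs S" for cs rs S n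
    by (induction n arbitrary: rs S) (auto simp: Let_def)
  have "fp (\<lambda>z. foldl (?h (fst (snd z))) ([], snd (snd z)) (replicate (fst z) ()))"
  proof (rule tc_foldl_add[where Q="\<lambda>n. n + 2"])
    fix x :: "nat \<times> bclause list \<times> triple list" and a :: "bclause list list \<times> triple list" and y :: unit
    have "rsize (pick (snd a) (fst (snd x)) []) \<le> 1 + rsize (fst (snd x))" using rsize_pick[of "snd a" "fst (snd x)" "[]"] by simp
    then show "rsize (?h (fst (snd x)) a y) \<le> rsize a + (rsize x + rsize y + 2)"
      using rsize_filter[of "\<lambda>t. \<not> rowval (pick (snd a) (fst (snd x)) []) t" "snd a"]
      by (cases a, cases x) (simp add: rsize_snoc)
  qed (intro fp_intros pb_intros)+
  then have "fp (\<lambda>z. fst (foldl (?h (fst (snd z))) ([], snd (snd z)) (replicate (fst z) ())))" by (rule tc_fst)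
  then show ?thesis unfolding e by simp
qed

lemmas tc_rows [fp_intros] = tc_comp3[OF fp_rows]

lemma fp_xorl: "fp (\<lambda>z. xorl (fst z) (snd z))"
  unfolding xorl_def by (intro fp_intros)

lemmas tc_xorl [fp_intros] = tc_comp2[OF fp_xorl]

lemma rsize_bools: "rsize (bs :: bool list) \<le> 4 * length bs + 1"
proof (induction bs)
  case (Cons b bs) then show ?case using rsize_bool[of b] by simp
qed simp

lemma fp_Tsuml: "fp (\<lambda>z. Tsuml (fst z) (fst (snd z)) (fst (snd (snd z))) (snd (snd (snd z))))"
  unfolding Tsuml_def Tl_def
proof (rule tc_foldl_add[where Q="\<lambda>n. 4 * n + 1"])
  show "rsize (xorl a y) \<le> rsize a + (4 * (rsize x + rsize y) + 1)"
    for a y and x :: "nat \<times> bclause list list list \<times> nat list \<times> triple"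
    using rsize_bools[of "xorl a y"] length_le_rsize[of y] by (simp add: xorl_def min_def split: if_splits)
qed (intro fp_intros pb_intros)+

lemmas tc_Tsuml [fp_intros] = tc_comp4[OF fp_Tsuml]

lemma fp_accept: "fp (\<lambda>z. accept (fst z) (fst (snd z)) (fst (snd (snd z))) (fst (snd (snd (snd z)))) (snd (snd (snd (snd z)))))"
  unfolding accept_def by (intro fp_intros)

lemmas tc_accept [fp_intros] = tc_comp5[OF fp_accept]

text \<open>The length \<open>m\<close> is fixed outside the program, which therefore is a nest of
  \<open>m\<close> loops; the degree of the polynomial may depend on it.\<close>

lemma fp_tuples: "fp (tuples m :: 'a::rep list \<Rightarrow> _)"
proof (induction m)
  case (Suc m)
  note [fp_intros] = fp_comp[OF Suc]
  have "fp (\<lambda>W :: 'a list. concat (map (\<lambda>w. map (\<lambda>v. w # v) (tuples m W)) W))" by (intro fp_intros)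
  then show ?case by (rule tc_cong) simp
qed (simp add: tc_const)

lemmas tc_tuples [fp_intros] = fp_comp[OF fp_tuples]

lemma fp_omegas: "fp (\<lambda>z. omegas (fst z) (fst (snd z)) (fst (snd (snd z))) (snd (snd (snd z))))"
  unfolding omegas_def by (intro fp_intros)

lemmas tc_omegas [fp_intros] = tc_comp4[OF fp_omegas]

lemma fp_dim: "fp dim"
proof -
  have "fp (\<lambda>x :: vtab. foldl (\<lambda>m z. if m < fst (snd z) then fst (snd z) else m) 0 x)"
    by (rule tc_foldl_add[where Q="\<lambda>n. n"]) (intro fp_intros pb_intros | force)+
  then show ?thesis by (rule tc_cong) (simp add: dim_def)
qed

lemmas tc_dim [fp_intros] = fp_comp[OF fp_dim]

lemma fp_pvars: "fp pvars"
  unfolding pvars_def by (intro fp_intros)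

lemmas tc_pvars [fp_intros] = fp_comp[OF fp_pvars]

lemma fp_vtab: "fp (\<lambda>z. vtab (fst z) (snd z))"
  unfolding vtab_def by (intro fp_intros)

lemmas tc_vtab [fp_intros] = tc_comp2[OF fp_vtab]

lemma fp_lpos: "fp (\<lambda>z. lpos (fst z) (snd z))"
  unfolding lpos_def Let_def by (intro fp_intros)

lemmas tc_lpos [fp_intros] = tc_comp2[OF fp_lpos]

lemma fp_cl3: "fp (\<lambda>z. cl3 (fst z) (snd z))"
  unfolding cl3_def by (intro fp_intros)

lemmas tc_cl3 [fp_intros] = tc_comp2[OF fp_cl3]

lemma fp_cls: "fp (\<lambda>z. cls (fst z) (fst (snd z)) (snd (snd z)))"
  unfolding cls_def ctri_def by (intro fp_intros)

lemmas tc_cls [fp_intros] = tc_comp3[OF fp_cls]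

text \<open>The block length, the triples of blocks, the questions of the base game and the code of the budget.\<close>

type_synonym constants = "nat \<times> tri list \<times> kom list \<times> nat list"

text \<open>The word lists are arguments because they alone are exponentially long:
  \<open>W1\<close> for the triples that the rows have to catch, \<open>W2\<close> for the alphabet.
  Relative to them the computation is polynomial.\<close>

definition game :: "constants \<Rightarrow> pcnf \<Rightarrow> bool list list \<Rightarrow> bool list list \<Rightarrow> omega list" where
  "game \<kappa> \<phi> W1 W2 = (let tab = vtab (fst \<kappa>) (pvars \<phi>); n = wlen (dim tab) in
     omegas n (map (\<lambda>e. rows n (cls tab \<phi> e) (filter (\<lambda>x. list_ex (\<lambda>c. viol c x) (cls tab \<phi> e))
       (List.product W1 (List.product W1 W1)))) (fst (snd \<kappa>))) W2 (fst (snd (snd \<kappa>))))"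

lemma fp_game: "fp (\<lambda>z. game (fst z) (fst (snd z)) (fst (snd (snd z))) (snd (snd (snd z))))"
  unfolding game_def Let_def by (intro fp_intros)

lemmas tc_game [fp_intros] = tc_comp4[OF fp_game]

lemma fp_omq: "fp (\<lambda>z. omq (fst z) (snd z))"
  unfolding omq_def by (intro fp_intros)

lemmas tc_omq [fp_intros] = tc_comp2[OF fp_omq]

lemma fp_oma: "fp (\<lambda>z. oma (fst z) (fst (snd z)) (snd (snd z)))"
  unfolding oma_def by (intro fp_intros)

lemmas tc_oma [fp_intros] = tc_comp3[OF fp_oma]

lemma fp_questions: "fp (\<lambda>z. questions (fst z) (snd z))"
  unfolding questions_def by (intro fp_intros)

lemmas tc_questions [fp_intros] = tc_comp2[OF fp_questions]

lemma fp_answers: "fp (\<lambda>z. answers (fst z) (fst (snd z)) (snd (snd z)))"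
  unfolding answers_def omv_def by (intro fp_intros)

lemmas tc_answers [fp_intros] = tc_comp3[OF fp_answers]

lemma fp_extend: "fp (\<lambda>z. extend (fst z) (fst (snd z)) (fst (snd (snd z))) (snd (snd (snd z))))"
  unfolding extend_def omv_def by (intro fp_intros)

lemmas tc_extend [fp_intros] = tc_comp4[OF fp_extend]

lemma fp_ext: "fp (\<lambda>z. ext (fst z) (fst (snd z)) (fst (snd (snd z))) (fst (snd (snd (snd z)))) (snd (snd (snd (snd z)))))"
  unfolding ext_def by (intro fp_intros)

lemmas tc_ext [fp_intros] = tc_comp5[OF fp_ext]

section \<open>Printing the networks\<close>

lemma zip_upt_map: "zip [0..<length (map f xs)] (map f xs) = map (\<lambda>z. (fst z, f (snd z))) (zip [0..<length xs] xs)"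
  by (simp add: zip_map2 case_prod_unfold)

lemma sp_edges_Par_map:
  "sp_edges \<pi> u v (Par (map f xs)) =
     concat (map (\<lambda>z. sp_edges (\<pi> @ [Suc (fst z)]) u v (f (snd z))) (zip [0..<length xs] xs))"
  unfolding sp_edges.simps(2) zip_upt_map by (simp add: comp_def)

lemma sp_edges_Ser_map:
  "sp_edges \<pi> u v (Ser (map f xs)) = [((u, \<pi> @ [Suc 0]), []), ((\<pi> @ [Suc (length xs)], v), [])] @
     concat (map (\<lambda>z. sp_edges (\<pi> @ [Suc (fst z)]) (\<pi> @ [Suc (fst z)]) (\<pi> @ [Suc (Suc (fst z))]) (f (snd z)))
       (zip [0..<length xs] xs))"
  unfolding sp_edges.simps(3) zip_upt_map by (simp add: comp_def)

abbreviation net_edges :: "nat \<Rightarrow> vpath \<times> vpath \<times> vpath \<times> omega list \<times> nat \<times> label list list \<Rightarrow> ((vpath \<times> vpath) \<times> label list) list" where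
  "net_edges n z \<equiv> sp_edges (fst z) (fst (snd z)) (fst (snd (snd z)))
     (spt (fst (snd (snd (snd z)))) (fst (snd (snd (snd (snd z))))) n (snd (snd (snd (snd (snd z))))))"

text \<open>The network is never stored as a tree: unfolding \<open>spt\<close> under
  \<open>sp_edges\<close> gives the edge list by nested loops. The number of rounds is fixed, so
  this recursion takes place outside the program.\<close>

lemma fp_net_edges: "fp (\<lambda>z. net_edges n z)"
proof (induction n)
  case 0
  show ?case unfolding spt.simps sp_edges_Par_map sp_edges_Ser_map sp_edges.simps(1) by (intro fp_intros)
next
  case (Suc n)
  have *: "tc \<mu> (\<lambda>x. sp_edges (A x) (B x) (C x) (spt (D x) (I x) n (G x)))"
    if "tc \<mu> A" "tc \<mu> B" "tc \<mu> C" "tc \<mu> D" "tc \<mu> I" "tc \<mu> G" for \<mu> A B C D I and G :: "'z::rep \<Rightarrow> label list list"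
    using fp_comp[OF Suc, of \<mu> "\<lambda>x. (A x, B x, C x, D x, I x, G x)"] that by (simp add: fp_intros)
  show ?case unfolding spt.simps sp_edges_Par_map sp_edges_Ser_map by (intro fp_intros *)
qed

section \<open>Binary names of vertices\<close>

declare binary.simps [simp del]

lemma binary_digits: "s \<in> set (binary n) \<Longrightarrow> s = 1 \<or> s = 2"
proof (induction n rule: binary.induct)
  case (1 n)
  then show ?case using binary.simps[of n] by (auto split: if_splits)
qed

lemma binary_nonempty: "binary n \<noteq> []"
  using binary.simps[of n] by auto

lemma binary_value: "foldl (\<lambda>a s. 2 * a + (s - 1)) 0 (binary n) = n"
proof (induction n rule: binary.induct)
  case (1 n)
  then show ?case using binary.simps[of n] by (cases "n < 2") auto
qed

lemma inj_binary: "inj binary"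
  by (metis binary_value injI)

lemma binary_snoc: "n > 0 \<Longrightarrow> binary (2 * n + of_bool b) = binary n @ [if b then 2 else 1]"
  using binary.simps[of "2 * n + of_bool b"] by auto

lemma binary_foldl:
  "foldl (\<lambda>n b. 2 * n + of_bool b) 1 bs > (0::nat) \<and>
   binary (foldl (\<lambda>n b. 2 * n + of_bool b) 1 bs) = 2 # map (\<lambda>b. if b then 2 else 1) bs"
proof (induction bs rule: rev_induct)
  case Nil then show ?case using binary.simps[of 1] by (simp add: numeral_2_eq_2)
next
  case (snoc b bs)
  then show ?case using binary_snoc[of "foldl (\<lambda>n b. 2 * n + of_bool b) 1 bs" b] by simp
qed

text \<open>Each entry in unary with a terminating \<open>False\<close>, so that paths can be read
  back.\<close>

definition bits :: "vpath \<Rightarrow> bool list" where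
  "bits \<pi> = concat (map (\<lambda>a. replicate a True @ [False]) \<pi>)"

text \<open>A leading digit 1 protects the bits that follow. The binary notation of the name is then
  the bit string itself, and \<open>num\<close> can print it without arithmetic.\<close>

definition name :: "vpath \<Rightarrow> nat" where
  "name \<pi> = foldl (\<lambda>n b. 2 * n + of_bool b) 1 (bits \<pi>)"

lemma bits_inj: "bits \<pi> = bits \<rho> \<Longrightarrow> \<pi> = \<rho>"
proof (induction \<pi> arbitrary: \<rho>)
  case Nil then show ?case by (cases \<rho>) (auto simp: bits_def)
next
  case (Cons a \<pi>)
  have *: "replicate a True @ False # x = replicate b True @ False # y \<Longrightarrow> a = b \<and> x = y" for a b x y
  proof (induction a arbitrary: b)
    case 0 then show ?case by (cases b) auto
  next
    case (Suc a) then show ?case by (cases b) auto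
  qed
  obtain b \<rho>' where \<rho>: "\<rho> = b # \<rho>'" using Cons.prems by (cases \<rho>) (auto simp: bits_def)
  then have "replicate a True @ False # bits \<pi> = replicate b True @ False # bits \<rho>'"
    using Cons.prems by (simp add: bits_def)
  from *[OF this] Cons.IH show ?case by (simp add: \<rho>)
qed

lemma inj_name: "inj name"
proof (rule injI)
  fix \<pi> \<rho> assume "name \<pi> = name \<rho>"
  then have "binary (name \<pi>) = binary (name \<rho>)" by simp
  then have "map (\<lambda>b. if b then 2 else 1::nat) (bits \<pi>) = map (\<lambda>b. if b then 2 else 1) (bits \<rho>)"
    unfolding name_def using binary_foldl by simp
  moreover have "inj (\<lambda>b. if b then 2 else 1::nat)" by (rule injI) (auto split: if_splits)
  ultimately have "bits \<pi> = bits \<rho>" using inj_mapI by (metis injD)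
  then show "\<pi> = \<rho>" by (rule bits_inj)
qed

definition num :: "vpath \<Rightarrow> nat list" where
  "num \<pi> = 3 # 2 # map (\<lambda>b. if b then 2 else 1) (bits \<pi>) @ [4]"

definition node :: "nat list list \<Rightarrow> nat list" where
  "node xs = 3 # concat xs @ [4]"

lemma num: "num \<pi> = enc (Num (name \<pi>))"
  using binary_foldl[of "bits \<pi>"] by (simp add: num_def name_def)

lemma map_num: "map num vs = map enc (map (\<lambda>v. Num (name v)) vs)"
  by (simp add: num)

lemma node: "node (map enc ds) = enc (Node ds)"
  by (simp add: node_def)

section \<open>The instance as a string\<close>

text \<open>Codes of sets have no repetitions, and an undirected edge might come in either
  orientation.\<close>

definition edge_add :: "(vpath \<times> vpath) list \<Rightarrow> vpath \<times> vpath \<Rightarrow> (vpath \<times> vpath) list" where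
  "edge_add es e = (if e \<in> set es \<or> (snd e, fst e) \<in> set es then es else es @ [e])"

definition dedup :: "(vpath \<times> vpath) list \<Rightarrow> (vpath \<times> vpath) list" where
  "dedup es = foldl edge_add [] es"

definition estr :: "(vpath \<times> vpath) list \<Rightarrow> nat list" where
  "estr es = node (map (\<lambda>e. node [num (fst e), num (snd e)]) es)"

definition gstr :: "vpath list \<Rightarrow> (vpath \<times> vpath) list \<Rightarrow> nat list" where
  "gstr vs es = node [node (map num (remdups vs)), estr (dedup es)]"

definition sides :: "nat \<Rightarrow> nat \<Rightarrow> omega list \<Rightarrow> ((vpath \<times> vpath) \<times> label list) list list" where
  "sides p r W = map (\<lambda>i. net_edges r ([Suc (Suc i)], [0, Suc i], [1, Suc i], W, i, [[[]]])) [0..<p]"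

definition pverts :: "nat \<Rightarrow> ((vpath \<times> vpath) \<times> label list) list \<Rightarrow> vpath list" where
  "pverts i es = [[0, Suc i], [1, Suc i]] @ concat (map (\<lambda>e. [fst (fst e), snd (fst e)]) es)"

text \<open>\<open>B\<close> is the code of the budget. The labels are read off the first piece, as
  all pieces have the same ones; a bundle collects the edges with its label from all pieces.\<close>

definition inst_string :: "nat list \<Rightarrow> ((vpath \<times> vpath) \<times> label list) list list \<Rightarrow> nat list" where
  "inst_string B S = (let Z = zip [0..<length S] S in
     node [gstr ([[0], [1]] @ concat (map (\<lambda>z. pverts (fst z) (snd z)) Z))
         (concat (map (\<lambda>i. [([0], [0, Suc i]), ([1, Suc i], [1])]) [0..<length S]) @ map fst (concat S)),
       num [0], num [1], node (map (\<lambda>z. gstr (pverts (fst z) (snd z)) (map fst (snd z))) Z),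
       node (map (\<lambda>b. estr (dedup (map fst (filter (\<lambda>e. snd e = [b]) (concat S)))))
         (remdups (concat (map snd (hd S))))), B])"

lemma fp_num: "fp num"
  unfolding num_def bits_def by (intro fp_intros)

lemmas tc_num [fp_intros] = fp_comp[OF fp_num]

lemma fp_node: "fp node"
  unfolding node_def by (intro fp_intros)

lemmas tc_node [fp_intros] = fp_comp[OF fp_node]

lemma fp_dedup: "fp dedup"
proof -
  have "fp (\<lambda>es. foldl edge_add [] es)" unfolding edge_add_def
    by (rule tc_foldl_add[where Q="\<lambda>n. n + 1"]) (intro fp_intros pb_intros | simp add: rsize_snoc)+
  then show ?thesis by (rule tc_cong) (simp add: dedup_def)
qed

lemmas tc_dedup [fp_intros] = fp_comp[OF fp_dedup]

lemma fp_estr: "fp estr"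
  unfolding estr_def by (intro fp_intros)

lemmas tc_estr [fp_intros] = fp_comp[OF fp_estr]

lemma fp_gstr: "fp (\<lambda>z. gstr (fst z) (snd z))"
  unfolding gstr_def by (intro fp_intros)

lemmas tc_gstr [fp_intros] = tc_comp2[OF fp_gstr]

lemma fp_sides: "fp (sides p r)"
  unfolding sides_def by (intro fp_comp[OF fp_net_edges] fp_intros)

lemmas tc_sides [fp_intros] = fp_comp[OF fp_sides]

lemma fp_output: "fp (\<lambda>z. inst_string (fst z) (snd z))"
  unfolding inst_string_def Let_def pverts_def by (intro fp_intros)

lemmas tc_output [fp_intros] = tc_comp2[OF fp_output]

lemma dedup:
  fixes g :: "vpath \<Rightarrow> nat"
  assumes "inj g"
  defines "h \<equiv> \<lambda>e. {g (fst e), g (snd e)}"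
  shows "distinct (map h (dedup es)) \<and> set (map h (dedup es)) = h ` set es"
proof -
  have add: "map h (edge_add es e) = (if h e \<in> h ` set es then map h es else map h es @ [h e])" for es e
  proof -
    have "(e \<in> set es \<or> (snd e, fst e) \<in> set es) \<longleftrightarrow> h e \<in> h ` set es"
    proof
      assume "e \<in> set es \<or> (snd e, fst e) \<in> set es"
      then show "h e \<in> h ` set es"
      proof
        assume "(snd e, fst e) \<in> set es"
        moreover have "h e = h (snd e, fst e)" by (auto simp: h_def)
        ultimately show ?thesis by (rule rev_image_eqI)
      qed (rule imageI)
    next
      assume "h e \<in> h ` set es"
      then obtain e' where e': "e' \<in> set es" "h e = h e'" by blast
      then have "e = e' \<or> (snd e, fst e) = e'"
        using \<open>inj g\<close> by (cases e, cases e') (auto simp: h_def doubleton_eq_iff inj_eq)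
      then show "e \<in> set es \<or> (snd e, fst e) \<in> set es" using e'(1) by blast
    qed
    then show ?thesis by (simp add: edge_add_def)
  qed
  show ?thesis unfolding dedup_def
  proof (induction es rule: rev_induct)
    case (snoc e es)
    let ?m = "map h (foldl edge_add [] es)"
    show ?case
    proof (cases "h e \<in> h ` set (foldl edge_add [] es)")
      case True
      then show ?thesis using snoc add[of "foldl edge_add [] es" e] by (auto simp: image_iff)
    next
      case False
      then have e: "map h (edge_add (foldl edge_add [] es) e) = ?m @ [h e]" unfolding add by simp
      have "distinct (?m @ [h e]) \<and> set (?m @ [h e]) = h ` set (es @ [e])"
        using snoc False by simp
      then show ?thesis by (simp only: foldl_append foldl.simps e)
    qed
  qed simp
qed

lemma codes_edges:
  "\<exists>d. codes_set codes_edge ((\<lambda>e. {name (fst e), name (snd e)}) ` set es) d \<and> estr (dedup es) = enc d"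
proof -
  let ?h = "\<lambda>e. {name (fst e), name (snd e)}"
  let ?ds = "map (\<lambda>e. Node [Num (name (fst e)), Num (name (snd e))]) (dedup es)"
  have "codes_set codes_edge (?h ` set es) (Node ?ds)" unfolding codes_set_def
  proof (intro exI conjI)
    show "distinct (map ?h (dedup es))" "set (map ?h (dedup es)) = ?h ` set es" using dedup[OF inj_name] by blast+
    show "list_all2 codes_edge (map ?h (dedup es)) ?ds"
      by (auto simp: list_all2_map1 list_all2_map2 list_all2_same codes_edge_def)
  qed simp
  moreover have "estr (dedup es) = enc (Node ?ds)"
    by (simp add: estr_def node_def num comp_def)
  ultimately show ?thesis by blast
qed

lemma codes_gstr:
  assumes "verts G = name ` set vs" "edges G = (\<lambda>e. {name (fst e), name (snd e)}) ` set es"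
  shows "\<exists>d. codes_graph G d \<and> gstr vs es = enc d"
proof -
  let ?ds = "map (\<lambda>v. Num (name v)) (remdups vs)"
  have V: "codes_set codes_nat (verts G) (Node ?ds)" unfolding codes_set_def
  proof (intro exI conjI)
    show "distinct (map name (remdups vs))" using inj_name by (auto simp: distinct_map intro: inj_on_subset)
    show "set (map name (remdups vs)) = verts G" by (simp add: assms)
    show "list_all2 codes_nat (map name (remdups vs)) ?ds"
      by (simp add: list_all2_map1 list_all2_map2 list_all2_same codes_nat_def)
  qed simp
  obtain dE where dE: "codes_set codes_edge (edges G) dE" "estr (dedup es) = enc dE"
    unfolding assms using codes_edges by blast
  have "gstr vs es = enc (Node [Node ?ds, dE])" 
    by (simp only: gstr_def map_num node[symmetric] dE(2) list.map)
  then show ?thesis using V dE(1) unfolding codes_graph_def by blast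
qed

lemma list_all2_ex: "(\<And>x. x \<in> set xs \<Longrightarrow> \<exists>d. P x d \<and> f x = g d) \<Longrightarrow> \<exists>ds. list_all2 P xs ds \<and> map f xs = map g ds"
proof (induction xs)
  case (Cons x xs)
  obtain d where d: "P x d" "f x = g d" using Cons.prems[of x] by auto
  obtain ds where "list_all2 P xs ds" "map f xs = map g ds" using Cons by auto
  then have "list_all2 P (x # xs) (d # ds) \<and> map f (x # xs) = map g (d # ds)" using d by simp
  then show ?case by blast
qed simp

lemma fst_filter: "set (map fst (filter (\<lambda>e. snd e = l) xs)) = {e. (e, l) \<in> set xs}"
  by force

lemma edge_image:
  "(\<lambda>e. {g (fst e), g (snd e)}) ` {e. \<exists>i<p. (e, x) \<in> f i} = {{g a, g c} | i a c. i < (p::nat) \<and> ((a, c), x) \<in> (f i :: (_ \<times> 'x) set)}"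
proof (intro set_eqI iffI)
  fix z assume "z \<in> (\<lambda>e. {g (fst e), g (snd e)}) ` {e. \<exists>i<p. (e, x) \<in> f i}"
  then obtain e i where e: "z = {g (fst e), g (snd e)}" "i < p" "(e, x) \<in> f i" by blast
  then have "((fst e, snd e), x) \<in> f i" by simp
  with e show "z \<in> {{g a, g c} | i a c. i < p \<and> ((a, c), x) \<in> f i}" by blast
next
  fix z assume "z \<in> {{g a, g c} | i a c. i < p \<and> ((a, c), x) \<in> f i}"
  then obtain i a c where "z = {g a, g c}" "i < p" "((a, c), x) \<in> f i" by blast
  then show "z \<in> (\<lambda>e. {g (fst e), g (snd e)}) ` {e. \<exists>i<p. (e, x) \<in> f i}" by (intro image_eqI[of _ _ "(a, c)"]) auto
qed

text \<open>A set may be coded in any order, so the order in which the program happens to list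
  vertices, edges and bundles is as good as any other.\<close>

lemma split_code_output:
  assumes net: "network p (\<lambda>i. spt W i r [[[]]]) name L"
  shows "split_code (network.inst p (\<lambda>i. spt W i r [[[]]]) name L) K (inst_string (enc (Num K)) (sides p r W))"
proof -
  interpret network p "\<lambda>i. spt W i r [[[]]]" name L by (rule net)
  let ?h = "\<lambda>e. {name (fst e), name (snd e)}"
  let ?S = "sides p r W"
  have S: "?S = map side [0..<p]" by (simp add: sides_def side_def)
  have lS: "length ?S = p" by (simp add: S)
  have Z: "zip [0..<length ?S] ?S = map (\<lambda>i. (i, side i)) [0..<p]"
    by (rule nth_equalityI) (auto simp: S)
  have pv: "set (pverts i (side i)) = vset i" for i
    by (force simp: pverts_def vset_def)
  have pe: "?h ` set (map fst (side i)) = edges (piece i)" for i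
    by (force simp: piece_def edg_def)
  have cS: "set (concat ?S) = (\<Union>i<p. set (side i))" by (auto simp: S)
  let ?Vs = "[[0], [1]] @ concat (map (\<lambda>z. pverts (fst z) (snd z)) (zip [0..<length ?S] ?S))"
  let ?Es = "concat (map (\<lambda>i. [([0], [0, Suc i]), ([1, Suc i], [1])]) [0..<length ?S]) @ map fst (concat ?S)"
  have 1: "verts (the_graph inst) = name ` set ?Vs"
  proof -
    have "set ?Vs = {[0], [1]} \<union> (\<Union>i<p. vset i)" unfolding Z using pv by (simp add: atLeast0LessThan)
    then show ?thesis by (simp add: inst_def image_UN)
  qed
  have 2: "edges (the_graph inst) = ?h ` set ?Es"
  proof -
    have a: "?h ` set (map fst (concat ?S)) = (\<Union>i<p. edges (piece i))"
      unfolding pe[symmetric] set_map cS image_UN ..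
    have b: "?h ` set (concat (map (\<lambda>i. [([0], [0, Suc i]), ([1, Suc i], [1])]) [0..<length ?S])) = conn"
      unfolding lS by (simp add: conn_def edg_def image_UN atLeast0LessThan)
    show ?thesis unfolding set_append image_Un a b by (simp add: inst_def)
  qed
  obtain dG where dG: "codes_graph (the_graph inst) dG" "gstr ?Vs ?Es = enc dG" using codes_gstr[OF 1 2] by blast
  have "\<exists>ds. list_all2 (\<lambda>i. codes_graph (piece i)) [0..<p] ds \<and>
      map (\<lambda>i. gstr (pverts i (side i)) (map fst (side i))) [0..<p] = map enc ds"
  proof (rule list_all2_ex)
    fix i
    have v: "verts (piece i) = name ` set (pverts i (side i))" unfolding pv by (simp add: piece_def)
    show "\<exists>d. codes_graph (piece i) d \<and> gstr (pverts i (side i)) (map fst (side i)) = enc d"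
      by (rule codes_gstr[OF v pe[symmetric]])
  qed
  then obtain dH where dH: "list_all2 codes_graph (pieces inst) dH"
    "map (\<lambda>i. gstr (pverts i (side i)) (map fst (side i))) [0..<p] = map enc dH"
    by (auto simp: inst_def list_all2_map1)
  let ?B = "\<lambda>b. map fst (filter (\<lambda>e. snd e = [b]) (concat ?S))"
  have B: "?h ` set (?B b) = bnd b" for b
  proof -
    have "set (?B b) = {e. \<exists>i<p. (e, [b]) \<in> set (side i)}" unfolding fst_filter cS by blast
    then show ?thesis unfolding bnd_def edg_def
      by (simp only: edge_image[where g=name and f="\<lambda>i. set (side i)" and x="[b]" and p=p])
  qed
  let ?bs = "remdups (concat (map snd (hd ?S)))"
  have "hd ?S = side 0" using p2 by (simp add: S hd_map upt_conv_Cons)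
  then have bs: "set ?bs = L" using lab(2)[of 0] p2 by (simp add: side_def sp_edges_labels del: set_concat)
  have "\<exists>ds. list_all2 (\<lambda>b. codes_set codes_edge (bnd b)) ?bs ds \<and> map (\<lambda>b. estr (dedup (?B b))) ?bs = map enc ds"
  proof (rule list_all2_ex)
    fix b
    show "\<exists>d. codes_set codes_edge (bnd b) d \<and> estr (dedup (?B b)) = enc d" unfolding B[symmetric] by (rule codes_edges)
  qed
  then obtain dB where dB: "list_all2 (codes_set codes_edge) (map bnd ?bs) dB"
    "map (\<lambda>b. estr (dedup (?B b))) ?bs = map enc dB" by (auto simp: list_all2_map1)
  have "codes_set (codes_set codes_edge) (bundles inst) (Node dB)"
    unfolding codes_set_def[of "codes_set codes_edge" "bundles inst" "Node dB"]
  proof (intro exI conjI)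
    show "distinct (map bnd ?bs)" unfolding distinct_map bs by (simp add: bnd_inj)
    show "set (map bnd ?bs) = bundles inst" unfolding set_map bs by (simp add: inst_def)
  qed (rule dB(1), rule refl)
  moreover have "inst_string (enc (Num K)) ?S =
      enc (Node [dG, Num (source inst), Num (sink inst), Node dH, Node dB, Num K])"
  proof -
    have z: "map (\<lambda>z. gstr (pverts (fst z) (snd z)) (map fst (snd z))) (zip [0..<length ?S] ?S) = map enc dH"
      unfolding Z map_map comp_def fst_conv snd_conv dH(2) ..
    have "inst_string (enc (Num K)) ?S = node (map enc [dG, Num (source inst), Num (sink inst), Node dH, Node dB, Num K])"
      unfolding inst_string_def Let_def z dB(2) dG(2) by (simp add: num node inst_def del: enc.simps)
    then show ?thesis unfolding node .
  qed
  ultimately show ?thesis unfolding split_code_def using dG(1) dH(1) by blast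
qed

subsection \<open>Parsing formulas\<close>

text \<open>The state consists of the digits, the numbers, the literals and the clauses read so far. The final
  bracket completes a spurious empty clause.\<close>

type_synonym parser = "nat list \<times> nat list list \<times> (nat list \<times> bool) list \<times> pcnf"

text \<open>A closing bracket completes the innermost unfinished object, recognised by which buffers
  are nonempty; no bracket depth is needed. In a literal the second number is the sign, and
  \<open>[2]\<close> is the digit list of 1.\<close>

definition pstp :: "parser \<Rightarrow> nat \<Rightarrow> parser" where
  "pstp S s = (if s = 3 then S else if s = 4 then
     (if fst S \<noteq> [] then ([], fst (snd S) @ [fst S], snd (snd S))
      else if fst (snd S) \<noteq> [] then ([], [], fst (snd (snd S)) @ [(hd (fst (snd S)), hd (tl (fst (snd S))) = [2])], snd (snd (snd S)))
      else ([], [], [], snd (snd (snd S)) @ [fst (snd (snd S))]))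
    else (fst S @ [s], snd S))"

definition parse :: "nat list \<Rightarrow> pcnf" where
  "parse x = rev (tl (rev (snd (snd (snd (foldl pstp ([], [], [], []) x))))))"

text \<open>Variables stay digit lists: their numbers may be exponentially larger than the input,
  too large for unary notation.\<close>

definition pform :: "cnf \<Rightarrow> pcnf" where
  "pform \<phi> = map (map (\<lambda>l. (binary (fst l), snd l))) \<phi>"

lemma fp_parse: "fp parse"
proof -
  have "fp (\<lambda>x. foldl pstp ([], [], [], []) x)" unfolding pstp_def
  proof (rule tc_foldl_add[where Q="\<lambda>n. n + 20"])
    fix a :: parser and x :: "nat list" and y :: nat
    obtain ds ns c f where a: "a = (ds, ns, c, f)" by (metis prod.collapse)
    have h: "rsize (hd ns) \<le> rsize ns" if "ns \<noteq> []" using rsize_member[of "hd ns" ns] that by simp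
    have b: "rsize b \<le> 3" for b :: bool by (rule rsize_bool)
    have p: "rsize ds \<ge> 1" "rsize ns \<ge> 1" "rsize c \<ge> 1" by (rule rsize_pos)+
    show "rsize (if y = 3 then a else if y = 4 then
       (if fst a \<noteq> [] then ([], fst (snd a) @ [fst a], snd (snd a))
        else if fst (snd a) \<noteq> [] then ([], [], fst (snd (snd a)) @ [(hd (fst (snd a)), hd (tl (fst (snd a))) = [2])], snd (snd (snd a)))
        else ([], [], [], snd (snd (snd a)) @ [fst (snd (snd a))]))
      else (fst a @ [y], snd a)) \<le> rsize a + (rsize x + rsize y + 20)"
      using h p b[of "hd (tl ns) = [2]"] rsize_pos[of x] rsize_pos[of y] by (cases "ns = []") (simp_all add: a rsize_snoc)
  qed (intro fp_intros pb_intros tc_nonempty)+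
  then show ?thesis unfolding parse_def by (intro fp_intros)
qed

lemmas tc_parse [fp_intros] = fp_comp[OF fp_parse]

lemma parse_digits: "\<forall>s \<in> set ds. s = 1 \<or> s = 2 \<Longrightarrow> foldl pstp (d, T) ds = (d @ ds, T)"
  by (induction ds arbitrary: d) (auto simp: pstp_def)

lemma parse_num: "foldl pstp ([], ns, T) (enc (Num v)) = ([], ns @ [binary v], T)"
proof -
  have "foldl pstp ([], ns, T) (binary v) = (binary v, ns, T)"
    using parse_digits[of "binary v" "[]" "(ns, T)"] binary_digits by simp
  then show ?thesis using binary_nonempty by (simp add: pstp_def)
qed

lemma parse_lit:
  "foldl pstp ([], [], c, f) (enc (Node [Num v, Num (if b then 1 else 0)])) = ([], [], c @ [(binary v, b)], f)"
proof -
  have "binary (if b then 1 else 0) = [2] \<longleftrightarrow> b" using binary.simps[of 0] binary.simps[of 1] by auto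
  moreover have "foldl pstp ([], [], c, f) (enc (Node [Num v, Num (if b then 1 else 0)])) =
     foldl pstp (foldl pstp (foldl pstp ([], [], c, f) (enc (Num v))) (enc (Num (if b then 1 else 0)))) [4]"
    by (simp add: pstp_def[of _ 3])
  ultimately show ?thesis unfolding parse_num by (simp add: pstp_def)
qed

lemma parse_clause:
  "foldl pstp ([], [], [], f) (enc (Node (map (\<lambda>(v, b). Node [Num v, Num (if b then 1 else 0)]) C))) =
     ([], [], [], f @ [map (\<lambda>l. (binary (fst l), snd l)) C])"
proof -
  have "foldl pstp ([], [], c, f) (concat (map enc (map (\<lambda>(v, b). Node [Num v, Num (if b then 1 else 0)]) C))) =
     ([], [], c @ map (\<lambda>l. (binary (fst l), snd l)) C, f)" for c
  proof (induction C arbitrary: c)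
    case (Cons l C)
    obtain v b where l: "l = (v, b)" by (cases l)
    show ?case unfolding l using Cons[of "c @ [(binary v, b)]"] parse_lit[of c f v b]
      by (simp only: list.map concat.simps foldl_append case_prod_conv fst_conv snd_conv append_assoc append.simps)
  qed simp
  from this[of "[]"] show ?thesis by (simp add: pstp_def)
qed

lemma parse_enc: "parse (enc_cnf \<phi>) = pform \<phi>"
proof -
  let ?g = "\<lambda>C. Node (map (\<lambda>(v, b). Node [Num v, Num (if b then 1 else 0)]) C)"
  have "foldl pstp ([], [], [], f) (concat (map enc (map ?g \<phi>))) = ([], [], [], f @ pform \<phi>)" for f
  proof (induction \<phi> arbitrary: f)
    case (Cons C \<phi>)
    show ?case using Cons[of "f @ [map (\<lambda>l. (binary (fst l), snd l)) C]"] parse_clause[of f C]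
      by (simp only: list.map concat.simps foldl_append pform_def append_assoc append.simps)
  qed (simp add: pform_def)
  from this[of "[]"] have "foldl pstp ([], [], [], []) (enc_cnf \<phi>) = ([], [], [], pform \<phi> @ [[]])"
    by (simp add: enc_cnf_def pstp_def)
  then show ?thesis by (simp add: parse_def)
qed

lemma psat_pform: "psat (pform \<phi>) \<longleftrightarrow> satisfiable \<phi>"
proof
  assume "psat (pform \<phi>)"
  then obtain \<alpha> where \<alpha>: "\<forall>C \<in> set (pform \<phi>). \<exists>l \<in> set C. \<alpha> (fst l) = snd l" unfolding psat_def by blast
  have "\<forall>C \<in> set \<phi>. \<exists>(v, b) \<in> set C. \<alpha> (binary v) = b"
  proof
    fix C assume "C \<in> set \<phi>"
    then obtain l where "l \<in> set C" "\<alpha> (binary (fst l)) = snd l" using \<alpha> by (auto simp: pform_def)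
    then show "\<exists>(v, b) \<in> set C. \<alpha> (binary v) = b" by (intro bexI[of _ l]) auto
  qed
  then show "satisfiable \<phi>" unfolding satisfiable_def by (intro exI[of _ "\<lambda>v. \<alpha> (binary v)"])
next
  assume "satisfiable \<phi>"
  then obtain \<alpha> where \<alpha>: "\<forall>C \<in> set \<phi>. \<exists>(v, b) \<in> set C. \<alpha> v = b" unfolding satisfiable_def by blast
  have "\<forall>C \<in> set (pform \<phi>). \<exists>l \<in> set C. \<alpha> (inv binary (fst l)) = snd l"
    using \<alpha> by (force simp: pform_def inv_f_f[OF inj_binary])
  then show "psat (pform \<phi>)" unfolding psat_def by (intro exI[of _ "\<lambda>v. \<alpha> (inv binary v)"])
qed

lemma pvars_pform: "length (pvars (pform \<phi>)) = card (vars \<phi>)"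
proof -
  have "set (map fst (concat (pform \<phi>))) = binary ` vars \<phi>" by (force simp: pform_def vars_def)
  then have "length (pvars (pform \<phi>)) = card (binary ` vars \<phi>)" unfolding pvars_def length_remdups_card_conv by simp
  also have "\<dots> = card (vars \<phi>)" by (rule card_image) (use inj_binary in \<open>auto intro: inj_on_subset\<close>)
  finally show ?thesis .
qed

subsection \<open>The reduction\<close>

text \<open>The data that depend on \<open>p\<close>, \<open>r\<close> and \<open>k\<close> only,
  among them objects defined by choice. The budget appears as a finished string since it is merely
  copied to the output.\<close>

definition consts_of :: "nat \<Rightarrow> nat \<Rightarrow> nat \<Rightarrow> constants" where
  "consts_of p r k = (k, Elist k, koms p k, enc (Num (length (koms p k) ^ r)))"

definition pdim :: "constants \<Rightarrow> nat list \<Rightarrow> nat" where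
  "pdim \<kappa> x = dim (vtab (fst \<kappa>) (pvars (parse x)))"

definition reduce :: "nat \<Rightarrow> nat \<Rightarrow> constants \<Rightarrow> nat list \<Rightarrow> nat list" where
  "reduce p r \<kappa> x = inst_string (snd (snd (snd \<kappa>)))
     (sides p r (game \<kappa> (parse x) (words (Suc (pdim \<kappa> x))) (words (wlen (pdim \<kappa> x)))))"

lemma fp_pdim: "fp (\<lambda>z. pdim (fst z) (snd z))"
  unfolding pdim_def by (intro fp_intros)

lemmas tc_pdim [fp_intros] = tc_comp2[OF fp_pdim]

text \<open>The constants are part of the argument rather than fixed, so one polynomial serves all
  \<open>k\<close>. Both word lists are bounded in terms of the measure
  \<open>2 ^ wlen\<close>.\<close>

lemma tc_reduce: "tc (\<lambda>z. 2 ^ wlen (pdim (fst z) (snd z))) (\<lambda>z. reduce p r (fst z) (snd z))"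
proof -
  let ?\<mu> = "\<lambda>z. 2 ^ wlen (pdim (fst z) (snd z))"
  have 1: "tc ?\<mu> (\<lambda>z. words (Suc (pdim (fst z) (snd z))))"
  proof (rule tc_words[where Q="\<lambda>n. n"])
    show "2 ^ Suc (pdim (fst z) (snd z)) \<le> 2 ^ wlen (pdim (fst z) (snd z)) + rsize z" for z :: "constants \<times> nat list"
      by (rule trans_le_add1) (rule power_increasing; simp add: wlen_def)
  qed (intro fp_intros pb_intros)+
  have 2: "tc ?\<mu> (\<lambda>z. words (wlen (pdim (fst z) (snd z))))"
    by (rule tc_words[where Q="\<lambda>n. n"]) (intro fp_intros pb_intros le_add1)+
  show ?thesis unfolding reduce_def by (intro fp_intros 1 2)
qed

lemma pdim_bound: "k > 0 \<Longrightarrow> pdim (consts_of p r k) (enc_cnf \<phi>) \<le> card (vars \<phi>) div k + 1"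
  unfolding pdim_def consts_of_def parse_enc fst_conv using dim_vtab[of k "pvars (pform \<phi>)"] by (simp only: pvars_pform)

text \<open>The budget is the number of coin sequences: consistent views of a satisfying assignment
  cut at that cost, while otherwise any cut costs more than \<open>c\<close> times as much.\<close>

lemma reduce_correct:
  fixes p r k :: nat
  assumes "is_3cnf \<phi>" "k > 0" "p \<ge> 2"
  defines "K \<equiv> length (koms p k) ^ r"
  shows "\<exists>I. is_split_instance p I \<and> split_code I K (reduce p r (consts_of p r k) (enc_cnf \<phi>)) \<and>
    (satisfiable \<phi> \<longrightarrow> split_yes I (real K)) \<and>
    (\<not> satisfiable \<phi> \<longrightarrow> (\<forall>c. c < real p - real p ^ 2 * (1 - 1 / 24300) ^ r \<longrightarrow> \<not> split_yes I (c * real K)))"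
proof -
  interpret blocked k "pform \<phi>"
  proof
    fix C assume "C \<in> set (pform \<phi>)"
    then show "length C \<le> 3" using assms(1) by (auto simp: pform_def is_3cnf_def)
  qed fact
  have K: "K > 0" unfolding K_def using koms_pos[of p] by simp
  let ?L = "bundle_labels (Om p) r"
  have net: "network p (\<lambda>i. spt (Om p) i r [[[]]]) name ?L" by (rule network_Om[OF inj_name assms(3)])
  let ?I = "network.inst p (\<lambda>i. spt (Om p) i r [[[]]]) name ?L"
  have d: "pdim (consts_of p r k) (enc_cnf \<phi>) = dim tab" by (simp add: pdim_def consts_of_def parse_enc)
  have "game (consts_of p r k) (pform \<phi>) (words (Suc (dim tab))) (words (wlen (dim tab))) = Om p"
    by (simp add: game_def consts_of_def Om_def Rows_def[abs_def] crows_def triples_def Let_def)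
  then have red: "reduce p r (consts_of p r k) (enc_cnf \<phi>) = inst_string (enc (Num K)) (sides p r (Om p))"
    unfolding reduce_def d parse_enc by (simp add: consts_of_def K_def)
  note yes = network.split_yes_inst[OF net]
  show ?thesis
  proof (intro exI[of _ ?I] conjI impI allI)
    show "is_split_instance p ?I" by (rule network.is_split_instance_inst[OF net])
    show "split_code ?I K (reduce p r (consts_of p r k) (enc_cnf \<phi>))"
      unfolding red by (rule split_code_output[OF net])
    show "split_yes ?I (real K)" if h: "satisfiable \<phi>"
    proof -
      have "psat (pform \<phi>)" using h psat_pform by blast
      from psat_cut[OF this, of p r] obtain X where "X \<subseteq> ?L" "card X \<le> K" "\<forall>i<p. cut X (spt (Om p) i r [[[]]])"
        unfolding K_def by blast
      then show ?thesis unfolding yes by (intro exI[of _ X]) simp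
    qed
    show "\<not> split_yes ?I (c * real K)"
      if h: "\<not> satisfiable \<phi>" and c: "c < real p - real p ^ 2 * (1 - 1 / 24300) ^ r" for c
    proof
      assume "split_yes ?I (c * real K)"
      then obtain X where X: "X \<subseteq> ?L" "real (card X) \<le> c * real K" "\<forall>i<p. cut X (spt (Om p) i r [[[]]])"
        unfolding yes by blast
      have "finite X" using X(1) network.finite_L[OF net] finite_subset by blast
      moreover have "\<not> psat (pform \<phi>)" using h psat_pform by blast
      ultimately have "real (card X) \<ge> (real p - real p ^ 2 * (1 - 1 / 24300) ^ r) * real K"
        using unsat_cut[of X p r] X(3) unfolding K_def by simp
      moreover have "c * real K < (real p - real p ^ 2 * (1 - 1 / 24300) ^ r) * real K"
        using c K by (intro mult_strict_right_mono) auto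
      ultimately show False using X(2) by linarith
    qed
  qed
qed

lemma enc_symbols: "set (enc d) \<subseteq> {1, 2, 3, 4}"
proof (induction d)
  case (Num n) then show ?case using binary_digits[of _ n] by auto
next
  case (Node ds) then show ?case by fastforce
qed

lemma split_code_symbols: "split_code I k x \<Longrightarrow> set x \<subseteq> {1, 2, 3, 4} \<and> x \<noteq> []"
  using enc_symbols by (auto simp: split_code_def simp del: enc.simps) (auto simp: enc.simps)

declare One_nat_def [simp del]

section \<open>Running a machine after a program\<close>

lemma input_tape_zt: "input_tape x = zt [] x"
  by (auto simp: input_tape_def zt_def fun_eq_iff)

abbreviation "syms \<equiv> {1, 2, 3, 4::nat}"

definition case_sym :: "(nat \<Rightarrow> prog) \<Rightarrow> prog" where
  "case_sym f = If 0 {1} (f 1) (If 0 {2} (f 2) (If 0 {3} (f 3) (f 4)))"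

lemma ex_case_sym:
  assumes "rd ts 0 = a" "a \<in> syms" "ex (f a) ts n ts'"
  shows "ex (case_sym f) ts (n + 3) ts'"
proof -
  consider "a = 1" | "a = 2" | "a = 3" | "a = 4" using assms(2) by blast
  then show ?thesis
  proof cases
    case 1
    show ?thesis unfolding case_sym_def by (rule ex_IfT) (use assms 1 in auto)
  next
    case 2
    show ?thesis unfolding case_sym_def by (rule ex_IfF[OF _ ex_IfT]) (use assms 2 in auto)
  next
    case 3
    show ?thesis unfolding case_sym_def by (rule ex_IfF[OF _ ex_IfF[OF _ ex_IfT]]) (use assms 3 in auto)
  next
    case 4
    show ?thesis unfolding case_sym_def by (rule ex_IfF[OF _ ex_IfF[OF _ ex_IfF]]) (use assms 4 in auto)
  qed
qed

text \<open>Writes a fixed number in unary; a symbol read from the input is known to the control, so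
  this needs no counter on a tape.\<close>

primrec put_nat :: "nat \<Rightarrow> prog" where
  "put_nat 0 = Put 1 1 Right"
| "put_nat (Suc s) = (Put 1 2 Right ;; Put 1 1 Right ;; put_nat s)"

lemma ex_put_nat: "ts 1 = zt l [] \<Longrightarrow> ex (put_nat s) ts (2 * s + 1) (ts(1 := zt (rev (code (rep s)) @ l) []))"
proof (induction s arbitrary: ts l)
  case 0
  have "ex (Put 1 1 Right) ts 1 (ts(1 := zt (1 # l) []))" by (rule ex_Put) (simp add: 0)
  then show ?case unfolding put_nat.simps by (rule ex_eq) (auto simp: fun_eq_iff)
next
  case (Suc s)
  have 1: "ex (Put 1 2 Right) ts 1 (ts(1 := zt (2 # l) []))" by (rule ex_Put) (simp add: Suc.prems)
  have 2: "ex (Put 1 1 Right) (ts(1 := zt (2 # l) [])) 1 (ts(1 := zt (1 # 2 # l) []))" by (rule ex_Put) simp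
  have 3: "ex (put_nat s) (ts(1 := zt (1 # 2 # l) [])) (2 * s + 1) (ts(1 := zt (rev (code (rep (Suc s))) @ l) []))"
    by (rule ex_eq[OF Suc.IH]) auto
  show ?case unfolding put_nat.simps by (rule ex_Seq[OF 1 ex_Seq[OF 2 3 order_refl]]) simp
qed

definition read_in :: prog where
  "read_in = While 0 syms (case_sym (\<lambda>a. Put 1 2 Right ;; put_nat a) ;; Mov 0 Right)"

lemma ex_read_in:
  "set x \<subseteq> syms \<Longrightarrow> ts 0 = zt k x \<Longrightarrow> ts 1 = zt l [] \<Longrightarrow>
    ex read_in ts (20 * length x + 1)
      (ts(0 := zt (rev x @ k) [], 1 := zt (rev (concat (map (\<lambda>a. 2 # code (rep a)) x)) @ l) []))"
proof (induction x arbitrary: ts k l)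
  case Nil
  have "ex read_in ts 1 ts" unfolding read_in_def by (rule ex.WhileF) (simp add: Nil)
  then show ?case by (rule ex_eq) (use Nil in auto)
next
  case (Cons a x)
  let ?t1 = "ts(1 := zt (2 # l) [])" and ?t2 = "ts(1 := zt (rev (2 # code (rep a)) @ l) [])"
  let ?t3 = "ts(0 := zt (a # k) x, 1 := zt (rev (2 # code (rep a)) @ l) [])"
  have a: "a \<in> syms" "rd ts 0 = a" "a \<le> 4" using Cons.prems by auto
  have 1: "ex (Put 1 2 Right) ts 1 ?t1" by (rule ex_Put) (simp add: Cons.prems)
  have 2: "ex (put_nat a) ?t1 (2 * a + 1) ?t2" by (rule ex_eq[OF ex_put_nat]) auto
  have 3: "ex (Put 1 2 Right ;; put_nat a) ts (2 * a + 2) ?t2" by (rule ex_Seq[OF 1 2]) simp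
  have 4: "ex (case_sym (\<lambda>a. Put 1 2 Right ;; put_nat a)) ts (2 * a + 2 + 3) ?t2"
    by (rule ex_case_sym[where a=a and ts=ts and f="\<lambda>a. Put 1 2 Right ;; put_nat a", OF a(2,1) 3])
  have 5: "ex (Mov 0 Right) ?t2 1 ?t3" by (rule ex_Mov) (simp add: Cons.prems fun_upd_twist)
  have 6: "ex read_in ?t3 (20 * length x + 1)
      (ts(0 := zt (rev (a # x) @ k) [], 1 := zt (rev (concat (map (\<lambda>a. 2 # code (rep a)) (a # x))) @ l) []))"
    by (rule ex_eq[OF Cons.IH]) (use Cons.prems in auto)
  show ?case
    unfolding read_in_def
    by (rule ex_WhileT[OF _ ex_Seq[OF 4 5 order_refl] 6[unfolded read_in_def]]) (use a in auto)
qed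

lemma code_rep_list: "code (rep xs) = concat (map (\<lambda>a. 2 # code (rep a)) xs) @ [1]"
  by (induction xs) auto

lemma tsize_rep_symbols: "set x \<subseteq> syms \<Longrightarrow> rsize x \<le> 10 * length x + 1"
  by (induction x) (auto simp: rsize_nat)

definition "clear_in = While 0 syms (Put 0 0 Left)"

lemma ex_clear_in:
  "set w \<subseteq> syms \<Longrightarrow> a \<in> syms \<Longrightarrow> ts 0 = zt w [a] \<Longrightarrow>
    ex clear_in ts (2 * length w + 3) (ts(0 := (\<lambda>_. 0, -1)))"
proof (induction w arbitrary: a ts)
  case Nil
  \<comment> \<open>\<open>zt\<close> cannot express a head left of cell 0, so this tape is given
    explicitly.\<close>
  have t: "write_tape (zt [] [a]) (0, Left) = (\<lambda>_. 0, -1)" by (auto simp: zt_def fun_eq_iff)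
  have 1: "ex (Put 0 0 Left) ts 1 (ts(0 := (\<lambda>_. 0, -1)))" by (rule ex_Put) (simp only: Nil t)
  have 2: "ex (While 0 syms (Put 0 0 Left)) (ts(0 := (\<lambda>_. 0, -1))) 1 (ts(0 := (\<lambda>_. 0, -1)))"
    by (rule ex.WhileF) simp
  show ?case unfolding clear_in_def by (rule ex_WhileT[OF _ 1 2]) (use Nil in auto)
next
  case (Cons b w)
  have 1: "ex (Put 0 0 Left) ts 1 (ts(0 := zt w [b]))" by (rule ex_Put) (simp add: Cons.prems)
  have 2: "ex clear_in (ts(0 := zt w [b])) (2 * length w + 3) (ts(0 := (\<lambda>_. 0, -1)))"
    by (rule ex_eq[OF Cons.IH]) (use Cons.prems in auto)
  show ?case unfolding clear_in_def by (rule ex_WhileT[OF _ 1 2[unfolded clear_in_def]]) (use Cons.prems in auto)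
qed

definition "back_out = (While 0 syms (Mov 0 Left) ;; Mov 0 Right)"

lemma ex_back_out_loop:
  "set w \<subseteq> syms \<Longrightarrow> a \<in> syms \<Longrightarrow> ts 0 = zt w (a # r) \<Longrightarrow>
    ex (While 0 syms (Mov 0 Left)) ts (2 * length w + 3) (ts(0 := (fst (zt [] (rev w @ a # r)), -1)))"
proof (induction w arbitrary: a r ts)
  case Nil
  have t: "write_tape (zt [] (a # r)) (read_tape (zt [] (a # r)), Left) = (fst (zt [] (a # r)), -1)" by (auto simp: zt_def fun_eq_iff)
  have 1: "ex (Mov 0 Left) ts 1 (ts(0 := (fst (zt [] (a # r)), -1)))" by (rule ex_Mov) (simp only: Nil t)
  have 2: "ex (While 0 syms (Mov 0 Left)) (ts(0 := (fst (zt [] (a # r)), -1))) 1 (ts(0 := (fst (zt [] (a # r)), -1)))"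
    by (rule ex.WhileF) (simp add: zt_def)
  show ?case by (rule ex_WhileT[OF _ 1 2[THEN ex_eq]]) (use Nil in auto)
next
  case (Cons b w)
  have 1: "ex (Mov 0 Left) ts 1 (ts(0 := zt w (b # a # r)))" by (rule ex_Mov) (simp only: Cons.prems mov_left)
  have 2: "ex (While 0 syms (Mov 0 Left)) (ts(0 := zt w (b # a # r))) (2 * length w + 3) (ts(0 := (fst (zt [] (rev (b # w) @ a # r)), -1)))"
    by (rule ex_eq[OF Cons.IH]) (use Cons.prems in auto)
  show ?case by (rule ex_WhileT[OF _ 1 2]) (use Cons.prems in auto)
qed

lemma ex_back_out:
  assumes "set w \<subseteq> syms" "a \<in> syms" "ts 0 = zt w [a]"
  shows "ex back_out ts (2 * length w + 4) (ts(0 := input_tape (rev w @ [a])))"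
  unfolding back_out_def
proof (rule ex_Seq[OF ex_back_out_loop[where r="[]" and w=w and a=a and ts=ts, OF assms]])
  have t: "write_tape (fst (zt [] y), -1) (read_tape (fst (zt [] y), -1), Right) = zt [] y" for y
    by (auto simp: zt_def fun_eq_iff)
  show "ex (Mov 0 Right) (ts(0 := (fst (zt [] (rev w @ [a])), -1))) 1 (ts(0 := input_tape (rev w @ [a])))"
    by (rule ex_Mov) (simp only: fun_upd_same fun_upd_upd t input_tape_zt)
qed simp

text \<open>Converts a unary number back to a tape symbol. The count \<open>k\<close> is kept in the
  control, which is possible because at most \<open>n\<close> further units can follow.\<close>

primrec put_sym :: "nat \<Rightarrow> nat \<Rightarrow> prog" where
  "put_sym k 0 = (Put 0 k Right ;; Mov 1 Right)"
| "put_sym k (Suc n) = If 1 {2} (Mov 1 Right ;; Mov 1 Right ;; put_sym (Suc k) n) (Put 0 k Right ;; Mov 1 Right)"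

lemma ex_put_sym:
  "s \<le> n \<Longrightarrow> ts 1 = zt l (code (rep s) @ w) \<Longrightarrow> ts 0 = zt q [] \<Longrightarrow>
    \<exists>l'. ex (put_sym k n) ts (3 * s + 3) (ts(0 := zt ((k + s) # q) [], 1 := zt l' w))"
proof (induction n arbitrary: s k ts l)
  case 0
  have 1: "ex (Put 0 k Right) ts 1 (ts(0 := zt (k # q) []))" by (rule ex_Put) (simp add: 0)
  have 2: "ex (Mov 1 Right) (ts(0 := zt (k # q) [])) 1 (ts(0 := zt (k # q) [], 1 := zt (1 # l) w))"
    by (rule ex_Mov) (use 0 in simp)
  have "ex (put_sym k 0) ts (3 * s + 3) (ts(0 := zt ((k + s) # q) [], 1 := zt (1 # l) w))"
    using 0(1) by (simp only: put_sym.simps) (rule ex_eq[OF ex_Seq[OF 1 2 order_refl]], simp_all)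
  then show ?case by blast
next
  case (Suc n)
  show ?case
  proof (cases s)
    case 0
    have 1: "ex (Put 0 k Right) ts 1 (ts(0 := zt (k # q) []))" by (rule ex_Put) (simp add: Suc.prems)
    have 2: "ex (Mov 1 Right) (ts(0 := zt (k # q) [])) 1 (ts(0 := zt (k # q) [], 1 := zt (1 # l) w))"
      by (rule ex_Mov) (use Suc.prems 0 in simp)
    have "ex (put_sym k (Suc n)) ts (3 * s + 3) (ts(0 := zt ((k + s) # q) [], 1 := zt (1 # l) w))"
      unfolding put_sym.simps 0 add_0_right by (rule ex_IfF[OF _ ex_Seq[OF 1 2 order_refl]]) (use Suc.prems 0 in auto)
    then show ?thesis by blast
  next
    case (Suc s')
    have t: "ts 1 = zt l (2 # 1 # code (rep s') @ w)" using Suc.prems Suc by simp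
    have 1: "ex (Mov 1 Right) ts 1 (ts(1 := zt (2 # l) (1 # code (rep s') @ w)))" by (rule ex_Mov) (simp add: t)
    have 2: "ex (Mov 1 Right) (ts(1 := zt (2 # l) (1 # code (rep s') @ w))) 1 (ts(1 := zt (1 # 2 # l) (code (rep s') @ w)))"
      by (rule ex_Mov) simp
    have "\<exists>l'. ex (put_sym (Suc k) n) (ts(1 := zt (1 # 2 # l) (code (rep s') @ w))) (3 * s' + 3)
      ((ts(1 := zt (1 # 2 # l) (code (rep s') @ w)))(0 := zt ((Suc k + s') # q) [], 1 := zt l' w))"
      by (rule Suc.IH[where l="1 # 2 # l"]) (use Suc.prems Suc in auto)
    then obtain l' where 3: "ex (put_sym (Suc k) n) (ts(1 := zt (1 # 2 # l) (code (rep s') @ w))) (3 * s' + 3)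
      ((ts(1 := zt (1 # 2 # l) (code (rep s') @ w)))(0 := zt ((Suc k + s') # q) [], 1 := zt l' w))" by blast
    have 4: "ex (put_sym (Suc k) n) (ts(1 := zt (1 # 2 # l) (code (rep s') @ w))) (3 * s' + 3)
      (ts(0 := zt ((k + s) # q) [], 1 := zt l' w))" by (rule ex_eq[OF 3]) (auto simp: Suc fun_upd_twist)
    have "ex (put_sym k (Suc n)) ts (3 * s + 3) (ts(0 := zt ((k + s) # q) [], 1 := zt l' w))"
      unfolding put_sym.simps
      by (rule ex_IfT[OF _ ex_Seq[OF 1 ex_Seq[OF 2 4 order_refl] order_refl]]) (use t Suc in auto)
    then show ?thesis by blast
  qed
qed

definition "write_out = While 1 {2} (Mov 1 Right ;; put_sym 0 4)"

lemma ex_write_out: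
  "set y \<subseteq> syms \<Longrightarrow> ts 1 = zt l (code (rep y)) \<Longrightarrow> ts 0 = zt q [] \<Longrightarrow>
    \<exists>t. ex write_out ts (20 * length y + 1) (ts(0 := zt (rev y @ q) [], 1 := t))"
proof (induction y arbitrary: ts l q)
  case Nil
  have "ex write_out ts 1 ts" unfolding write_out_def by (rule ex.WhileF) (simp add: Nil)
  then have "ex write_out ts 1 (ts(0 := zt q [], 1 := ts 1))" by (rule ex_eq) (use Nil in auto)
  then have "ex write_out ts (20 * length ([] :: nat list) + 1) (ts(0 := zt (rev [] @ q) [], 1 := ts 1))" by simp_all
  then show ?case by blast
next
  case (Cons s y)
  have s: "s \<le> 4" using Cons.prems by auto
  have t: "ts 1 = zt l (2 # code (rep s) @ code (rep y))" using Cons.prems by simp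
  have 1: "ex (Mov 1 Right) ts 1 (ts(1 := zt (2 # l) (code (rep s) @ code (rep y))))" by (rule ex_Mov) (simp add: t)
  have "\<exists>l'. ex (put_sym 0 4) (ts(1 := zt (2 # l) (code (rep s) @ code (rep y)))) (3 * s + 3)
    ((ts(1 := zt (2 # l) (code (rep s) @ code (rep y))))(0 := zt ((0 + s) # q) [], 1 := zt l' (code (rep y))))"
    by (rule ex_put_sym[OF s]) (use Cons.prems in auto)
  then obtain l' where 2: "ex (put_sym 0 4) (ts(1 := zt (2 # l) (code (rep s) @ code (rep y)))) (3 * s + 3)
    ((ts(1 := zt (2 # l) (code (rep s) @ code (rep y))))(0 := zt ((0 + s) # q) [], 1 := zt l' (code (rep y))))" by blast
  let ?t = "ts(0 := zt (s # q) [], 1 := zt l' (code (rep y)))"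
  have 3: "ex (put_sym 0 4) (ts(1 := zt (2 # l) (code (rep s) @ code (rep y)))) (3 * s + 3) ?t"
    by (rule ex_eq[OF 2]) (auto simp: fun_upd_twist)
  have "\<exists>t. ex write_out ?t (20 * length y + 1) (?t(0 := zt (rev y @ s # q) [], 1 := t))"
    by (rule Cons.IH[where l=l']) (use Cons.prems in auto)
  then obtain u where 4: "ex write_out ?t (20 * length y + 1) (?t(0 := zt (rev y @ s # q) [], 1 := u))" by blast
  have 5: "ex write_out ?t (20 * length y + 1) (ts(0 := zt (rev (s # y) @ q) [], 1 := u))"
    by (rule ex_eq[OF 4]) (auto simp: fun_upd_twist)
  have "ex write_out ts (20 * length (s # y) + 1) (ts(0 := zt (rev (s # y) @ q) [], 1 := u))"
    unfolding write_out_def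
    by (rule ex_WhileT[OF _ ex_Seq[OF 1 3 order_refl] 5[unfolded write_out_def]]) (use t s in auto)
  then show ?case by blast
qed

primrec inits :: "nat \<Rightarrow> prog" where
  "inits 0 = Mov 0 Stay"
| "inits (Suc n) = (inits n ;; Put (Suc (Suc n)) 3 Right ;; Put (Suc (Suc n)) 1 Stay)"

lemma R_Lf: "R Lf = zt [3] [1]"
  by (simp add: R_def)

lemma ex_inits:
  assumes "\<And>i. i > 0 \<Longrightarrow> ts i = zt [] []"
  shows "ex (inits n) ts (2 * n + 1) (\<lambda>i. if 2 \<le> i \<and> i < n + 2 then R Lf else ts i)"
proof (induction n)
  case 0
  have "ts 0 = write_tape (ts 0) (rd ts 0, Stay)" by (cases "ts 0") simp
  then have "ex (Mov 0 Stay) ts 1 ts" using ex_Mov[of ts ts 0 Stay] by (metis fun_upd_triv)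
  then show ?case unfolding inits.simps by (rule ex_eq) (auto simp: fun_eq_iff)
next
  case (Suc n)
  let ?f = "\<lambda>n i. if 2 \<le> i \<and> i < n + 2 then R Lf else ts i" and ?i = "Suc (Suc n)"
  have 1: "ex (Put ?i 3 Right) (?f n) 1 ((?f n)(?i := zt [3] []))" by (rule ex_Put) (simp add: assms)
  have 2: "ex (Put ?i 1 Stay) ((?f n)(?i := zt [3] [])) 1 (?f (Suc n))"
    by (rule ex_Put) (auto simp: R_Lf fun_eq_iff)
  show ?case unfolding inits.simps by (rule ex_Seq[OF Suc ex_Seq[OF 1 2 order_refl]]) simp
qed

text \<open>Tape 0 carries the plain input and output, the tapes from 1 on are registers.
  \<open>inits\<close> prepares the empty ones; register 1 is instead filled with the list of input
  symbols.\<close>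

definition on_tape :: "nat \<Rightarrow> prog \<Rightarrow> prog" where
  "on_tape m P = (inits m ;; Put 1 3 Right ;; read_in ;; Put 1 1 Right ;; rewind 1 ;; Mov 0 Left ;; clear_in ;; Mov 0 Right ;;
     P ;; write_out ;; Mov 0 Left ;; back_out)"

lemma wf_on_tape:
  assumes "wf_prog (m + 2) 4 P"
  shows "wf_prog (m + 2) 5 (on_tape m P)"
proof -
  have "wf_prog (m + 2) 5 (inits j)" if "j \<le> m" for j using that by (induction j) auto
  moreover have "wf_prog (m + 2) 5 (put_nat s)" for s by (induction s) auto
  moreover have "k + j \<le> 4 \<Longrightarrow> wf_prog (m + 2) 5 (put_sym k j)" for k j by (induction j arbitrary: k) auto
  ultimately show ?thesis using wf_prog_mono[OF assms, of "m + 2" 5]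
    by (simp add: on_tape_def read_in_def case_sym_def clear_in_def write_out_def back_out_def rewind_def)
qed

lemma ex_on_tape:
  assumes x: "set x \<subseteq> syms" "x \<noteq> []" and y: "set y \<subseteq> syms" "y \<noteq> []"
    and P: "computes P 1 (m + 1) (rep x) (rep y) n"
  shows "\<exists>ts'. ts' 0 = input_tape y \<and>
    ex (on_tape m P) (\<lambda>i. if i = 0 then input_tape x else input_tape []) (n + 100 * (m + length x + length y) + 100) ts'"
proof -
  let ?ts = "\<lambda>i::nat. if i = 0 then input_tape x else input_tape []"
  let ?f = "\<lambda>i. if 2 \<le> i \<and> i < m + 2 then R Lf else ?ts i"
  have 1: "ex (inits m) ?ts (2 * m + 1) ?f" by (rule ex_inits) (simp add: input_tape_zt)
  have 2: "ex (Put 1 3 Right) ?f 1 (?f(1 := zt [3] []))" by (rule ex_Put) (simp add: input_tape_zt)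
  let ?c = "concat (map (\<lambda>a. 2 # code (rep a)) x)"
  let ?f3 = "?f(0 := zt (rev x) [], 1 := zt (rev ?c @ [3]) [])"
  have 3: "ex read_in (?f(1 := zt [3] [])) (20 * length x + 1) ?f3"
    by (rule ex_eq[OF ex_read_in[where k="[]" and l="[3]", OF x(1)]]) (auto simp: input_tape_zt fun_eq_iff)
  let ?f4 = "?f(0 := zt (rev x) [], 1 := zt ((1 # rev ?c) @ [3]) [])"
  have 4: "ex (Put 1 1 Right) ?f3 1 ?f4" by (rule ex_Put) simp
  let ?f5 = "?f(0 := zt (rev x) [], 1 := R (rep x))"
  have c: "set (1 # rev ?c) \<subseteq> {0, 1, 2}" using code_set by (auto simp: subset_iff)
  have lc: "length (1 # rev ?c) \<le> 10 * length x + 1"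
    using tsize_rep_symbols[OF x(1)] by (simp add: code_rep_list)
  have 5: "ex (rewind 1) ?f4 (2 * (10 * length x + 1) + 4) ?f5"
    by (rule ex_eq[OF ex_rewind[OF c, of "[]"]]) (use lc in \<open>auto simp: R_def code_rep_list fun_eq_iff\<close>)
  obtain a w where xa: "x = w @ [a]" using x(2) by (metis rev_exhaust)
  let ?f6 = "?f(0 := zt (rev w) [a], 1 := R (rep x))"
  have 6: "ex (Mov 0 Left) ?f5 1 ?f6" by (rule ex_Mov) (simp add: xa fun_upd_twist)
  let ?f7 = "?f(0 := (\<lambda>_. 0, -1), 1 := R (rep x))"
  have 7: "ex clear_in ?f6 (2 * length w + 3) ?f7"
    by (rule ex_eq[OF ex_clear_in[where w="rev w" and a=a]]) (use x xa in \<open>auto simp: fun_eq_iff\<close>)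
  let ?f8 = "?f(0 := zt [] [], 1 := R (rep x))"
  have 8: "ex (Mov 0 Right) ?f7 1 ?f8" by (rule ex_Mov) (auto simp: fun_eq_iff zt_def)
  let ?f9 = "?f(0 := zt [] [], 1 := R (rep y))"
  have 9: "ex P ?f8 n ?f9" by (rule computesD[OF P]) (auto simp: fun_eq_iff)
  have "\<exists>t. ex write_out ?f9 (20 * length y + 1) (?f9(0 := zt (rev y @ []) [], 1 := t))"
    by (rule ex_write_out[where l="[3]", OF y(1)]) (auto simp: R_def)
  then obtain t where 10: "ex write_out ?f9 (20 * length y + 1) (?f9(0 := zt (rev y @ []) [], 1 := t))" by blast
  obtain b v where yb: "y = v @ [b]" using y(2) by (metis rev_exhaust)
  let ?g = "?f9(0 := zt (rev v) [b], 1 := t)"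
  have 11: "ex (Mov 0 Left) (?f9(0 := zt (rev y @ []) [], 1 := t)) 1 ?g"
    by (rule ex_Mov) (simp add: yb fun_upd_twist)
  have 12: "ex back_out ?g (2 * length v + 4) (?g(0 := input_tape y))"
    using ex_back_out[where w="rev v" and a=b and ts="?g"] y yb by simp
  have l: "length w \<le> length x" "length v \<le> length y" by (simp_all add: xa yb)
  note s10 = ex_Seq[OF 10 ex_Seq[OF 11 12 order_refl] order_refl]
  note s6 = ex_Seq[OF 6 ex_Seq[OF 7 ex_Seq[OF 8 ex_Seq[OF 9 s10 order_refl] order_refl] order_refl] order_refl]
  note s1 = ex_Seq[OF 1 ex_Seq[OF 2 ex_Seq[OF 3 ex_Seq[OF 4 ex_Seq[OF 5 s6 order_refl] order_refl] order_refl] order_refl] order_refl]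
  have "ex (on_tape m P) ?ts (n + 100 * (m + length x + length y) + 100) (?g(0 := input_tape y))"
    unfolding on_tape_def by (rule ex_eq[OF s1]) (use l in auto)
  then show ?thesis by (intro exI[of _ "?g(0 := input_tape y)"]) simp
qed

section \<open>Concatenation of a program and a machine\<close>

lemma length_ptrans: "length (snd (ptrans c q as)) = length as"
  by (induction c arbitrary: q) auto

text \<open>The halting states keep their numbers, so the verdict of the machine is that of the
  combination. All others, the initial state included, are shifted beyond the program.\<close>

definition enter :: "prog \<Rightarrow> nat \<Rightarrow> nat" where
  "enter c s = (if s = 1 \<or> s = 2 then s else s + (3 + psize c))"

text \<open>The program uses the first \<open>N\<close> tapes; the machine takes over the first of them and gets fresh tapes
  for the others.\<close>

definition prog_then :: "prog \<Rightarrow> nat \<Rightarrow> tm \<Rightarrow> tm" where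
  "prog_then c N M = \<lparr>n_tapes = N + (n_tapes M - 1), n_symbols = n_symbols M, n_states = 3 + psize c + n_states M,
     trans_fun = \<lambda>q as.
       if q < 3 then (3, stay as)
       else if q < 3 + psize c then
         (fst (ptrans c (q - 3) (take N as)) + 3, snd (ptrans c (q - 3) (take N as)) @ stay (drop N as))
       else (case trans_fun M (q - (3 + psize c)) (hd as # drop N as) of
         (s, ws) \<Rightarrow> (enter c s, hd ws # stay (tl (take N as)) @ tl ws))\<rparr>"

lemma wf_tmD:
  assumes "wf_tm M" "q < n_states M" "length as = n_tapes M" "\<forall>a \<in> set as. a < n_symbols M" "trans_fun M q as = (q', ws)"
  shows "q' < n_states M" "length ws = n_tapes M" "\<forall>(a, m) \<in> set ws. a < n_symbols M"
proof -
  have "case trans_fun M q as of (q', ws) \<Rightarrow>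
      q' < n_states M \<and> length ws = n_tapes M \<and> (\<forall>(a, m) \<in> set ws. a < n_symbols M)"
    by (rule assms(1)[unfolded wf_tm_def, THEN conjunct2, THEN conjunct2, THEN conjunct2, THEN spec, THEN mp, OF assms(2),
        THEN spec, THEN mp, OF conjI[OF assms(3,4)]])
  then show "q' < n_states M" "length ws = n_tapes M" "\<forall>(a, m) \<in> set ws. a < n_symbols M"
    unfolding assms(5) by auto
qed

lemma wf_prog_then:
  assumes M: "wf_tm M" and N: "N \<ge> 1" and c: "wf_prog N 5 c"
  shows "wf_tm (prog_then c N M)"
proof -
  let ?S = "n_symbols M" and ?k = "n_tapes M"
  have M1: "?k \<ge> 1" "?S \<ge> 5" "n_states M \<ge> 3" using M by (auto simp: wf_tm_def)
  have c': "wf_prog N ?S c" using wf_prog_mono[OF c _ M1(2)] by simp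
  have main: "q' < 3 + psize c + n_states M \<and> length ws = N + (?k - 1) \<and> (\<forall>(a, m) \<in> set ws. a < ?S)"
    if q: "q < 3 + psize c + n_states M" and las: "length as = N + (?k - 1)" and sas: "\<forall>a \<in> set as. a < ?S"
      and e: "trans_fun (prog_then c N M) q as = (q', ws)" for q as q' ws
  proof -
    have st: "\<forall>(a, m) \<in> set (stay bs). a < ?S" if "set bs \<subseteq> set as" for bs using that sas by auto
    consider "q < 3" | "3 \<le> q" "q < 3 + psize c" | "3 + psize c \<le> q" by linarith
    then show ?thesis
    proof cases
      case 1
      then have "q' = 3" "ws = stay as" using e by (auto simp: prog_then_def)
      then show ?thesis using M1 las st[of as] by auto
    next
      case 2
      let ?r = "ptrans c (q - 3) (take N as)"
      have "q' = fst ?r + 3" "ws = snd ?r @ stay (drop N as)" using e 2 by (auto simp: prog_then_def)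
      moreover have "fst ?r \<le> psize c \<and> length (snd ?r) = N \<and> (\<forall>(a, m) \<in> set (snd ?r). a < ?S)"
      proof (rule ptrans_wf[OF c'])
        show "q - 3 < psize c" using 2 by simp
        show "length (take N as) = N" using las by simp
        show "\<forall>a \<in> set (take N as). a < ?S" using sas by (auto dest: in_set_takeD)
      qed simp
      ultimately show ?thesis using M1 las st[of "drop N as"] set_drop_subset[of N as] by (auto simp: ball_Un)
    next
      case 3
      let ?as = "hd as # drop N as"
      have ne: "as \<noteq> []" using las N by auto
      obtain s vs where s: "trans_fun M (q - (3 + psize c)) ?as = (s, vs)" by (metis surj_pair)
      have "length ?as = ?k" using las M1 by simp
      moreover have "\<forall>a \<in> set ?as. a < ?S" using sas ne set_drop_subset[of N as] by auto
      moreover have "q - (3 + psize c) < n_states M" using q 3 by simp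
      ultimately have v: "s < n_states M" "length vs = ?k" "\<forall>(a, m) \<in> set vs. a < ?S"
        using wf_tmD[OF M _ _ _ s] by blast+
      obtain w vs' where vs: "vs = w # vs'" using v(2) M1(1) by (cases vs) auto
      have "q' = enter c s" "ws = hd vs # stay (tl (take N as)) @ tl vs" using e 3 s by (auto simp: prog_then_def)
      moreover have "set (tl (take N as)) \<subseteq> set as"
        using set_take_subset[of N as] by (cases "take N as") auto
      ultimately show ?thesis using v las N M1 vs st[of "tl (take N as)"] by (auto simp: enter_def ball_Un)
    qed
  qed
  have "case trans_fun (prog_then c N M) q as of (q', ws) \<Rightarrow>
       q' < 3 + psize c + n_states M \<and> length ws = N + (?k - 1) \<and> (\<forall>(a, m) \<in> set ws. a < ?S)"
    if "q < 3 + psize c + n_states M" "length as = N + (?k - 1)" "\<forall>a \<in> set as. a < ?S" for q as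
  proof -
    obtain q' ws where e: "trans_fun (prog_then c N M) q as = (q', ws)" by (metis surj_pair)
    show ?thesis unfolding e prod.case by (rule main[OF that e])
  qed
  moreover have "n_tapes (prog_then c N M) = N + (?k - 1)" "n_symbols (prog_then c N M) = ?S"
    "n_states (prog_then c N M) = 3 + psize c + n_states M" by (simp_all add: prog_then_def)
  ultimately show ?thesis using M1 N unfolding wf_tm_def by simp
qed

lemma write_stay: "map2 write_tape ts (stay (map read_tape ts)) = ts"
proof (induction ts)
  case (Cons t ts) then show ?case by (cases t) simp
qed simp

lemma write_stay': "map2 write_tape ts (map ((\<lambda>a. (a, Stay)) \<circ> read_tape) ts) = ts"
  using write_stay[of ts] by simp

lemma sim_prog:
  assumes "path c n X Y" "length (snd X) = N"
  shows "(tm_step (prog_then c N M) ^^ n) (fst X + 3, snd X @ us) = (fst Y + 3, snd Y @ us)"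
  using assms
proof (induction rule: path.induct)
  case (path0 x) then show ?case by simp
next
  case (pathS q n ts x)
  let ?as = "map read_tape ts"
  have l: "length ts = N" using pathS.prems by simp
  obtain q' ws where r: "ptrans c q ?as = (q', ws)" by (metis surj_pair)
  have lw: "length ws = N" using length_ptrans[of c q ?as] r l by simp
  have ps: "pstep c (q, ts) = (q', map2 write_tape ts ws)" by (simp add: pstep_def r)
  have "tm_step (prog_then c N M) (q + 3, ts @ us) = (q' + 3, map2 write_tape ts ws @ us)"
    using pathS.hyps(1) l lw by (simp add: prog_then_def r write_stay')
  then show ?case using pathS.IH lw l unfolding ps funpow_Suc_right comp_def by simp
qed

text \<open>A well-formed machine is constrained on legal symbols only. Along legal configurations
  it writes on exactly its own tapes, which is what keeps the two runs aligned.\<close>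

definition legal :: "tm \<Rightarrow> config \<Rightarrow> bool" where
  "legal M C \<longleftrightarrow> fst C < n_states M \<and> length (snd C) = n_tapes M \<and> (\<forall>t \<in> set (snd C). \<forall>i. fst t i < n_symbols M)"

lemma legal_trans:
  assumes "wf_tm M" "legal M (q, ts)" "trans_fun M q (map read_tape ts) = (q', ws)"
  shows "q' < n_states M" "length ws = n_tapes M" "\<forall>(a, m) \<in> set ws. a < n_symbols M"
proof -
  have "\<forall>a \<in> set (map read_tape ts). a < n_symbols M"
  proof
    fix a assume "a \<in> set (map read_tape ts)"
    then obtain t where t: "t \<in> set ts" "a = read_tape t" by auto
    obtain f h where f: "t = (f, h)" by (metis surj_pair)
    have "fst t h < n_symbols M" using assms(2) t(1) unfolding legal_def snd_conv by blast
    then show "a < n_symbols M" by (simp add: t(2) f)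
  qed
  moreover have "length (map read_tape ts) = n_tapes M" "q < n_states M" using assms(2) by (auto simp: legal_def)
  ultimately show "q' < n_states M" "length ws = n_tapes M" "\<forall>(a, m) \<in> set ws. a < n_symbols M"
    using wf_tmD[OF assms(1) _ _ _ assms(3)] by blast+
qed

lemma legal_step:
  assumes "wf_tm M" "legal M C"
  shows "legal M (tm_step M C)"
proof -
  obtain q ts where C: "C = (q, ts)" by (metis surj_pair)
  obtain q' ws where r: "trans_fun M q (map read_tape ts) = (q', ws)" by (metis surj_pair)
  note w = legal_trans[OF assms(1) assms(2)[unfolded C] r]
  have l: "length ts = n_tapes M" "\<And>t i. t \<in> set ts \<Longrightarrow> fst t i < n_symbols M" using assms(2) by (auto simp: legal_def C)
  have "fst t i < n_symbols M" if t: "t \<in> set (map2 write_tape ts ws)" for t i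
  proof -
    obtain z where z: "z \<in> set (zip ts ws)" "t = write_tape (fst z) (snd z)"
      using t unfolding set_map case_prod_unfold by blast
    obtain u a m where z': "z = (u, (a, m))" by (metis surj_pair)
    have u: "u \<in> set ts" "(a, m) \<in> set ws" "t = write_tape u (a, m)"
      using z unfolding z' by (auto dest: set_zip_leftD set_zip_rightD simp del: write_tape.simps)
    obtain f h where f: "u = (f, h)" by (metis surj_pair)
    have "f i < n_symbols M" using l(2)[OF u(1), of i] f by simp
    moreover have "a < n_symbols M" using w(3) u(2) by auto
    ultimately show ?thesis using u(3) f by simp
  qed
  then have "legal M (q', map2 write_tape ts ws)" using w l(1) by (simp add: legal_def)
  then show ?thesis using assms(2) by (simp add: C r)
qed

text \<open>Whatever the program left on the tapes \<open>gs\<close> stays there untouched; the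
  machine sees the first tape and its fresh ones.\<close>

lemma sim_machine:
  assumes M: "wf_tm M" and N: "length gs + 1 = N"
  shows "legal M (s, t # us) \<Longrightarrow> \<exists>s' t' us'. (tm_step M ^^ n) (s, t # us) = (s', t' # us') \<and>
    (tm_step (prog_then c N M) ^^ n) (enter c s, t # gs @ us) = (enter c s', t' # gs @ us')"
proof (induction n arbitrary: s t us)
  case 0 show ?case by auto
next
  case (Suc n)
  have "\<exists>s' t' us'. tm_step M (s, t # us) = (s', t' # us') \<and>
    tm_step (prog_then c N M) (enter c s, t # gs @ us) = (enter c s', t' # gs @ us')"
  proof (cases "s = 1 \<or> s = 2")
    case True
    then show ?thesis by (auto simp: enter_def)
  next
    case False
    obtain s' ws where r: "trans_fun M s (map read_tape (t # us)) = (s', ws)" by (metis surj_pair)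
    have lw: "length ws = n_tapes M" by (rule legal_trans(2)[OF M Suc.prems r])
    moreover have "length (t # us) = n_tapes M" using Suc.prems unfolding legal_def snd_conv by blast
    ultimately obtain w ws' where w: "ws = w # ws'" by (cases ws) auto
    have r': "trans_fun M s (read_tape t # map read_tape us) = (s', w # ws')" using r w by simp
    have lg: "N = Suc (length gs)" using N by simp
    have "tm_step M (s, t # us) = (s', write_tape t w # map2 write_tape us ws')" using False r' by simp
    moreover have "tm_step (prog_then c N M) (enter c s, t # gs @ us) =
        (enter c s', write_tape t w # gs @ map2 write_tape us ws')"
      using False r' by (simp add: prog_then_def enter_def lg write_stay')
    ultimately show ?thesis by blast
  qed
  then obtain s1 t1 us1 where 1: "tm_step M (s, t # us) = (s1, t1 # us1)"
    "tm_step (prog_then c N M) (enter c s, t # gs @ us) = (enter c s1, t1 # gs @ us1)" by blast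
  have "legal M (s1, t1 # us1)" using legal_step[OF M Suc.prems] unfolding 1 .
  from Suc.IH[OF this] show ?case unfolding funpow_Suc_right comp_def 1 .
qed

text \<open>The delay \<open>k\<close> is that of the program, so \<open>j\<close> steps of the
  machine are matched for every \<open>j\<close>, halting or not. Acceptance and rejection are both
  transferred by this one equation.\<close>

lemma prog_then_run:
  assumes M: "wf_tm M" and N: "N \<ge> 1" and c: "wf_prog N 5 c"
    and run: "ex c (\<lambda>i. if i = 0 then input_tape x else input_tape []) n ts'" "ts' 0 = input_tape y"
    and y: "\<forall>a \<in> set y. a < 5"
  shows "\<exists>k \<le> n + 1. fst ((tm_step (prog_then c N M) ^^ (j + k)) (init_config (prog_then c N M) x)) =
    enter c (fst ((tm_step M ^^ j) (init_config M y)))"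
proof -
  let ?M = "prog_then c N M" and ?us = "replicate (n_tapes M - 1) (input_tape [])"
  let ?f = "\<lambda>i. if i = 0 then input_tape x else input_tape []"
  have k1: "n_tapes M \<ge> 1" "n_symbols M \<ge> 5" "n_states M \<ge> 3" using M by (auto simp: wf_tm_def)
  obtain k where k: "k \<le> n" "path c k (0, tapes N ?f) (psize c, tapes N ts')" using ex_path[OF run(1) c] by blast
  have split: "[0..<N] = 0 # [1..<N]" using N by (simp add: upt_conv_Cons One_nat_def)
  have e: "tapes N ?f = input_tape x # replicate (N - 1) (input_tape [])"
    unfolding split list.map by (rule arg_cong2[where f="(#)"], simp, rule nth_equalityI) auto
  have i: "init_config ?M x = (0, tapes N ?f @ ?us)"
    unfolding e using N k1 by (simp add: init_config_def prog_then_def replicate_add[symmetric])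
  \<comment> \<open>One idle step leaves the reserved states: without the shift by 3, control states
    1 and 2 of the program would count as halting.\<close>
  have s1: "tm_step ?M (0, tapes N ?f @ ?us) = (3, tapes N ?f @ ?us)"
  proof -
    have "trans_fun ?M 0 as = (3, stay as)" for as by (simp add: prog_then_def)
    then show ?thesis by (simp only: tm_step.simps prod.case write_stay zero_neq_one zero_neq_numeral simp_thms if_False)
  qed
  have s2: "(tm_step ?M ^^ k) (3, tapes N ?f @ ?us) = (psize c + 3, tapes N ts' @ ?us)"
    using sim_prog[OF k(2), of N M ?us] by simp
  let ?gs = "map ts' [1..<N]"
  have t: "tapes N ts' = input_tape y # ?gs" unfolding split by (simp add: run(2))
  have en: "psize c + 3 = enter c 0" by (simp add: enter_def)
  have lg: "legal M (0, input_tape y # ?us)"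
    using k1 y by (auto simp: legal_def input_tape_def intro: order.strict_trans2)
  have "length ?gs + 1 = N" using N by simp
  from sim_machine[OF M this lg, of j c] obtain s' t' us' where
    sm: "(tm_step M ^^ j) (0, input_tape y # ?us) = (s', t' # us')"
      "(tm_step ?M ^^ j) (enter c 0, input_tape y # ?gs @ ?us) = (enter c s', t' # ?gs @ us')" by blast
  have "(tm_step ?M ^^ (j + Suc k)) (init_config ?M x) = (enter c s', t' # ?gs @ us')"
    unfolding funpow_add comp_def funpow_Suc_right i s1 s2 en t using sm(2) by simp
  moreover have "fst ((tm_step M ^^ j) (init_config M y)) = s'" using sm(1) by (simp add: init_config_def)
  ultimately show ?thesis using k(1) by (intro exI[of _ "Suc k"]) simp
qed

lemma prog_then_accepts:
  assumes "wf_tm M" "N \<ge> 1" "wf_prog N 5 c"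
    "ex c (\<lambda>i. if i = 0 then input_tape x else input_tape []) n ts'" "ts' 0 = input_tape y" "\<forall>a \<in> set y. a < 5"
    "T + real n + 1 \<le> T'"
  shows "accepts_within M y T \<Longrightarrow> accepts_within (prog_then c N M) x T'"
    "rejects_within M y T \<Longrightarrow> rejects_within (prog_then c N M) x T'"
proof -
  note run = prog_then_run[OF assms(1-6)]
  have en: "enter c 1 = 1" "enter c 2 = 2" by (auto simp: enter_def)
  show "accepts_within (prog_then c N M) x T'" if h: "accepts_within M y T"
  proof -
    obtain j where j: "real j \<le> T" "fst ((tm_step M ^^ j) (init_config M y)) = 1" using h unfolding accepts_within_def by blast
    obtain k where k: "k \<le> n + 1" "fst ((tm_step (prog_then c N M) ^^ (j + k)) (init_config (prog_then c N M) x)) = 1"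
      using run[of j] unfolding j(2) en by blast
    show ?thesis unfolding accepts_within_def
      by (rule exI[of _ "j + k"]) (use j(1) k assms(7) in simp)
  qed
  show "rejects_within (prog_then c N M) x T'" if h: "rejects_within M y T"
  proof -
    obtain j where j: "real j \<le> T" "fst ((tm_step M ^^ j) (init_config M y)) = 2" using h unfolding rejects_within_def by blast
    obtain k where k: "k \<le> n + 1" "fst ((tm_step (prog_then c N M) ^^ (j + k)) (init_config (prog_then c N M) x)) = 2"
      using run[of j] unfolding j(2) en by blast
    show ?thesis unfolding rejects_within_def
      by (rule exI[of _ "j + k"]) (use j(1) k assms(7) in simp)
  qed
qed

declare One_nat_def [simp]

text \<open>The exponent of the part that is exponential in the number of variables does not depend on \<open>k\<close>.\<close>

lemma reduction_program:
  "\<exists>D. \<forall>k. \<exists>N c C d. N \<ge> 1 \<and> wf_prog N 5 c \<and> (\<forall>x. set x \<subseteq> syms \<longrightarrow> x \<noteq> [] \<longrightarrow>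
     (let \<kappa> = consts_of p r k; y = reduce p r \<kappa> x; b = C * ((2 ^ wlen (pdim \<kappa> x)) ^ D * length x ^ d) in
       set y \<subseteq> syms \<longrightarrow> y \<noteq> [] \<longrightarrow> length y \<le> b \<and>
       (\<exists>ts'. ts' 0 = input_tape y \<and> ex c (\<lambda>i. if i = 0 then input_tape x else input_tape []) b ts')))"
proof -
  let ?\<mu> = "\<lambda>z. 2 ^ wlen (pdim (fst z) (snd z))"
  obtain m B where B: "pb B" "\<And>z. rsize (reduce p r (fst z) (snd z)) \<le> B (?\<mu> z + rsize z)"
    and P: "\<And>b. \<exists>P. wf_prog (b + m) 4 P \<and>
      (\<forall>z. computes P b m (rep z) (rep (reduce p r (fst z) (snd z))) (B (?\<mu> z + rsize z)))"
    using tc_reduce[of p r] unfolding tc_def by blast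
  \<comment> \<open>The exponent comes from a function that takes the constants as input, so it is
    fixed before \<open>k\<close> is.\<close>
  obtain D where D: "\<And>n. B n \<le> (n + 2) ^ D" using B(1) unfolding pb_def by blast
  obtain P2 where P2: "wf_prog (1 + m) 4 P2"
    "\<And>z. computes P2 1 m (rep z) (rep (reduce p r (fst z) (snd z))) (B (?\<mu> z + rsize z))"
    using P[of 1] by blast
  show ?thesis
  proof (rule exI[of _ D], rule allI)
    fix k
    define \<kappa> where "\<kappa> = consts_of p r k"
    \<comment> \<open>Writing down the constants takes time that depends on \<open>k\<close>, but
      this affects only \<open>C\<close> and the degree in the input length.\<close>
    have "fp (\<lambda>x :: nat list. (\<kappa>, x))" by (intro fp_intros)
    then obtain m' B' where B': "pb B'"
      and P': "\<And>b. \<exists>P. wf_prog (b + m') 4 P \<and> (\<forall>x :: nat list. computes P b m' (rep x) (rep (\<kappa>, x)) (B' (0 + rsize x)))"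
      unfolding tc_def by blast
    obtain d' where d': "\<And>n. B' n \<le> (n + 2) ^ d'" using B' unfolding pb_def by blast
    obtain P1 where P1: "wf_prog (1 + m') 4 P1"
      "\<And>x :: nat list. computes P1 1 m' (rep x) (rep (\<kappa>, x)) (B' (0 + rsize x))"
      using P'[of 1] by blast
    define M where "M = m + m'"
    \<comment> \<open>From \<open>rsize x \<le> 11 * L\<close> the argument of the bound is at most
      \<open>\<mu> + 11 * L + rsize \<kappa> + 3\<close>; each summand is a multiple of
      \<open>\<mu> * L\<close>, and \<open>1 + 11 + 3 = 15\<close>.\<close>
    define a where "a = rsize \<kappa> + 15"
    \<comment> \<open>The coefficient 101 pays once for the computation and 100 times for the
      output, whose length obeys the same bound.\<close>
    define C where "C = 13 ^ d' + 101 * a ^ D + 100 * M + 200"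
    let ?c = "on_tape M (P1 ;; P2)"
    have wf: "wf_prog (M + 2) 4 (P1 ;; P2)"
      using wf_prog_mono[OF P1(1), of "M + 2" 4] wf_prog_mono[OF P2(1), of "M + 2" 4] by (simp add: M_def)
    have main: "length y \<le> C * (\<mu> ^ D * length x ^ (d' + D + 1)) \<and>
       (\<exists>ts'. ts' 0 = input_tape y \<and>
         ex ?c (\<lambda>i. if i = 0 then input_tape x else input_tape []) (C * (\<mu> ^ D * length x ^ (d' + D + 1))) ts')"
      if x: "set x \<subseteq> syms" "x \<noteq> []" and y: "y = reduce p r \<kappa> x" "set y \<subseteq> syms" "y \<noteq> []"
        and \<mu>: "\<mu> = 2 ^ wlen (pdim \<kappa> x)" for x y \<mu>
    proof -
      define L where "L = length x"
      define U where "U = \<mu> ^ D * L ^ (d' + D + 1)"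
      have L: "L \<ge> 1" using x(2) by (cases x) (auto simp: L_def)
      have \<mu>1: "\<mu> \<ge> 1" by (simp add: \<mu>)
      let ?w = "\<mu> + rsize (\<kappa>, x)"
      have s: "rsize x \<le> 11 * L" using tsize_rep_symbols[OF x(1)] L unfolding L_def by linarith
      have "B' (rsize x) \<le> (rsize x + 2) ^ d'" by (rule d')
      also have "\<dots> \<le> (13 * L) ^ d'" using s L by (intro power_mono) linarith+
      finally have b1: "B' (rsize x) \<le> 13 ^ d' * L ^ d'" by (simp add: power_mult_distrib)
      have \<mu>L: "\<mu> \<le> \<mu> * L" "L \<le> \<mu> * L" "1 \<le> \<mu> * L" using L \<mu>1 mult_le_mono[OF \<mu>1 L] by simp_all
      have "?w + 2 \<le> \<mu> + rsize \<kappa> + 11 * L + 3" using s by simp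
      also have "\<dots> \<le> a * (\<mu> * L)"
      proof -
        have "rsize \<kappa> + 3 \<le> (rsize \<kappa> + 3) * (\<mu> * L)" using mult_le_mono2[OF \<mu>L(3), of "rsize \<kappa> + 3"] by (simp only: mult_1_right)
        moreover have "a * (\<mu> * L) = \<mu> * L + 11 * (\<mu> * L) + (rsize \<kappa> + 3) * (\<mu> * L)" by (simp add: a_def algebra_simps)
        ultimately show ?thesis using \<mu>L by linarith
      qed
      finally have "(?w + 2) ^ D \<le> (a * (\<mu> * L)) ^ D" by (rule power_mono) simp
      then have b2: "B ?w \<le> a ^ D * (\<mu> ^ D * L ^ D)" using D[of ?w] by (simp add: power_mult_distrib)
      have \<mu>D: "\<mu> ^ D \<ge> 1" and Lp: "L ^ e \<ge> 1" for e using L \<mu>1 by simp_all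
      have U1: "L ^ d' \<le> U"
      proof -
        have "L ^ d' \<le> L ^ (d' + D + 1)" using L by (intro power_increasing) auto
        also have "\<dots> \<le> U" unfolding U_def using \<mu>D by simp
        finally show ?thesis .
      qed
      have U2: "\<mu> ^ D * L ^ D \<le> U" unfolding U_def using L by (intro mult_le_mono2 power_increasing) auto
      have U3: "L \<le> U"
      proof -
        have "L ^ 1 \<le> L ^ (d' + D + 1)" using L by (intro power_increasing) auto
        also have "\<dots> \<le> U" unfolding U_def using \<mu>D by simp
        finally show ?thesis by simp
      qed
      have U4: "1 \<le> U" using U3 L by linarith
      have ly: "length y \<le> B ?w"
        using length_le_rsize[of y] B(2)[of "(\<kappa>, x)"] unfolding y(1) fst_conv snd_conv \<mu> by linarith
      have "computes (P1 ;; P2) 1 (M + 1) (rep x) (rep y) (B' (rsize x) + B ?w)"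
        unfolding computes_def
      proof (intro allI impI)
        fix ts assume ts: "ts 1 = R (rep x) \<and> (\<forall>i. 1 < i \<and> i < 1 + (M + 1) \<longrightarrow> ts i = R Lf)"
        have 1: "ex P1 ts (B' (0 + rsize x)) (ts(1 := R (rep (\<kappa>, x))))"
          by (rule computesD[OF P1(2)]) (use ts in \<open>auto simp: M_def\<close>)
        have 2: "ex P2 (ts(1 := R (rep (\<kappa>, x)))) (B (?\<mu> (\<kappa>, x) + rsize (\<kappa>, x))) (ts(1 := R (rep (reduce p r (fst (\<kappa>, x)) (snd (\<kappa>, x))))))"
          by (rule computesD[OF P2(2)]) (use ts in \<open>auto simp: M_def\<close>)
        show "ex (P1 ;; P2) ts (B' (rsize x) + B ?w) (ts(1 := R (rep y)))"
          unfolding y(1) by (rule ex_Seq[OF 1 2[unfolded fst_conv snd_conv]]) (simp add: \<mu>)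
      qed
      from ex_on_tape[OF x y(2,3) this] obtain ts' where ts': "ts' 0 = input_tape y"
        "ex ?c (\<lambda>i. if i = 0 then input_tape x else input_tape [])
           (B' (rsize x) + B ?w + 100 * (M + length x + length y) + 100) ts'" by blast
      have c1: "B' (rsize x) \<le> 13 ^ d' * U" using b1 mult_le_mono2[OF U1, of "13 ^ d'"] by linarith
      have c2: "B ?w \<le> a ^ D * U" using b2 mult_le_mono2[OF U2, of "a ^ D"] by linarith
      have c3: "100 * M \<le> 100 * M * U" using U4 by simp
      have CU: "C * U = 13 ^ d' * U + 101 * (a ^ D * U) + 100 * M * U + 200 * U" by (simp add: C_def algebra_simps)
      have "B' (rsize x) + B ?w + 100 * (M + length x + length y) + 100 \<le> C * U"
        using c1 c2 c3 U3 U4 ly unfolding CU L_def[symmetric] distrib_left by linarith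
      moreover have "length y \<le> C * U" using ly c2 unfolding CU by linarith
      ultimately show ?thesis using ts' ex.weaken unfolding U_def L_def by blast
    qed
    show "\<exists>N c C d. N \<ge> 1 \<and> wf_prog N 5 c \<and> (\<forall>x. set x \<subseteq> syms \<longrightarrow> x \<noteq> [] \<longrightarrow>
     (let \<kappa> = consts_of p r k; y = reduce p r \<kappa> x; b = C * ((2 ^ wlen (pdim \<kappa> x)) ^ D * length x ^ d) in
       set y \<subseteq> syms \<longrightarrow> y \<noteq> [] \<longrightarrow> length y \<le> b \<and>
       (\<exists>ts'. ts' 0 = input_tape y \<and> ex c (\<lambda>i. if i = 0 then input_tape x else input_tape []) b ts')))"
    proof (rule exI[of _ "M + 2"], rule exI[of _ ?c], rule exI[of _ C], rule exI[of _ "d' + D + 1"], intro conjI allI impI)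
      show "M + 2 \<ge> 1" by simp
      show "wf_prog (M + 2) 5 ?c" by (rule wf_on_tape[OF wf])
      fix x assume "set x \<subseteq> syms" "x \<noteq> []"
      from main[OF this refl _ _ refl]
      show "let \<kappa> = consts_of p r k; y = reduce p r \<kappa> x; b = C * ((2 ^ wlen (pdim \<kappa> x)) ^ D * length x ^ (d' + D + 1)) in
       set y \<subseteq> syms \<longrightarrow> y \<noteq> [] \<longrightarrow> length y \<le> b \<and>
       (\<exists>ts'. ts' 0 = input_tape y \<and> ex ?c (\<lambda>i. if i = 0 then input_tape x else input_tape []) b ts')"
        unfolding Let_def \<kappa>_def[symmetric] by blast
    qed
  qed
qed

text \<open>Here \<open>wlen q \<le> 3 * (n div k) + 7\<close>. The 7 becomes a constant factor, and
  the rest an exponent of at most \<open>3 * E * n / k\<close>, which the second hypothesis turns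
  into \<open>\<delta> * n\<close>.\<close>

lemma exponential_bound:
  assumes "k > 0" "3 * real E \<le> \<delta> * real k" "q \<le> n div k + 1"
  shows "real ((2 ^ wlen q) ^ E) \<le> 2 ^ (7 * E) * 2 powr (\<delta> * real n)"
proof -
  have "wlen q * E \<le> 7 * E + 3 * E * (n div k)"
  proof -
    have "wlen q \<le> 7 + 3 * (n div k)" using assms(3) by (simp add: wlen_def)
    then have "wlen q * E \<le> (7 + 3 * (n div k)) * E" by (rule mult_le_mono1)
    then show ?thesis by (simp add: algebra_simps)
  qed
  then have "(2 ^ wlen q) ^ E \<le> (2::nat) ^ (7 * E + 3 * E * (n div k))"
    unfolding power_mult[symmetric] by (intro power_increasing) auto
  then have "real ((2 ^ wlen q) ^ E) \<le> 2 ^ (7 * E) * 2 ^ (3 * E * (n div k))"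
    by (metis numeral_power_eq_of_nat_cancel_iff of_nat_le_iff power_add of_nat_numeral of_nat_power)
  also have "(2::real) ^ (3 * E * (n div k)) = 2 powr real (3 * E * (n div k))" by (rule powr_realpow[symmetric]) simp
  also have "\<dots> \<le> 2 powr (\<delta> * real n)"
  proof (intro powr_mono)
    have "real (3 * E * (n div k)) = 3 * real E * real (n div k)" by simp
    also have "\<dots> \<le> \<delta> * real k * real (n div k)" by (intro mult_right_mono assms(2)) simp
    also have "\<dots> = \<delta> * real (k * (n div k))" by simp
    also have "\<dots> \<le> \<delta> * real n"
    proof (rule mult_left_mono)
      have "0 \<le> \<delta> * real k" using assms(2) by (meson mult_nonneg_nonneg of_nat_0_le_iff order_trans zero_le_numeral)
      then show "\<delta> \<ge> 0" using assms(1) by (simp add: zero_le_mult_iff)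
    qed (use times_div_less_eq_dividend[of k n] of_nat_le_iff in blast)
    finally show "real (3 * E * (n div k)) \<le> \<delta> * real n" .
  qed simp
  finally show ?thesis by simp
qed

text \<open>The approximation algorithm runs on an instance whose parameter is fixed with
  \<open>k\<close>, so its running time is a constant times a power of the length of the instance. A
  large \<open>k\<close> outweighs this power too, because its degree \<open>d\<close> is known
  before \<open>k\<close> is chosen.\<close>

lemma three_sat_from_approximation:
  assumes p: "p \<ge> 2" and \<epsilon>: "\<epsilon> > 0" and approx: "split_min_cut_fpt_approximable p (real p - \<epsilon>)" and \<delta>: "\<delta> > 0"
  shows "three_sat_solvable \<delta>"
proof -
  obtain M f d where M: "wf_tm M"
    and correct: "\<And>I K x. is_split_instance p I \<Longrightarrow> split_code I K x \<Longrightarrow>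
      (let T = real (f K) * real (length x) ^ d in
        (accepts_within M x T \<or> rejects_within M x T) \<and> (split_yes I (real K) \<longrightarrow> accepts_within M x T) \<and>
        (\<not> split_yes I ((real p - \<epsilon>) * real K) \<longrightarrow> rejects_within M x T))"
    using approx unfolding split_min_cut_fpt_approximable_def fpt_approximable_def by blast
  have "0 < \<epsilon> / real p ^ 2" using p \<epsilon> by simp
  \<comment> \<open>Enough rounds to push the loss \<open>p ^ 2 * (1 - 1 / 24300) ^ r\<close> below
    \<open>\<epsilon>\<close>.\<close>
  then obtain r where "(1 - 1 / 24300 :: real) ^ r < \<epsilon> / real p ^ 2" using real_arch_pow_inv[of "\<epsilon> / real p ^ 2" "1 - 1 / 24300"] by auto
  then have r: "real p - \<epsilon> < real p - real p ^ 2 * (1 - 1 / 24300) ^ r" using p by (simp add: field_simps)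
  obtain D where D: "\<And>k. \<exists>N c C d. N \<ge> 1 \<and> wf_prog N 5 c \<and> (\<forall>x. set x \<subseteq> syms \<longrightarrow> x \<noteq> [] \<longrightarrow>
     (let \<kappa> = consts_of p r k; y = reduce p r \<kappa> x; b = C * ((2 ^ wlen (pdim \<kappa> x)) ^ D * length x ^ d) in
       set y \<subseteq> syms \<longrightarrow> y \<noteq> [] \<longrightarrow> length y \<le> b \<and>
       (\<exists>ts'. ts' 0 = input_tape y \<and> ex c (\<lambda>i. if i = 0 then input_tape x else input_tape []) b ts')))"
    using reduction_program[of p r] by blast
  \<comment> \<open>The algorithm raises the length of the instance, at most \<open>C * U\<close>,
    to the power \<open>d\<close>, and the reduction itself takes time \<open>C * U\<close>;
    \<open>U ^ (d + 1)\<close> dominates both.\<close>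
  define E where "E = D * (d + 1)"
  \<comment> \<open>The least size needed for the exponent, rounded up; adding 1 keeps it positive
    when \<open>E = 0\<close>.\<close>
  define k where "k = nat \<lceil>3 * real E / \<delta>\<rceil> + 1"
  have k: "k > 0" "3 * real E \<le> \<delta> * real k"
  proof -
    have "3 * real E / \<delta> \<le> real k" unfolding k_def by linarith
    then show "3 * real E \<le> \<delta> * real k" using \<delta> by (simp add: field_simps)
  qed (simp add: k_def)
  define \<kappa> where "\<kappa> = consts_of p r k"
  define K where "K = length (koms p k) ^ r"
  obtain N c C d' where N: "N \<ge> 1" "wf_prog N 5 c"
    and prog: "\<And>x. set x \<subseteq> syms \<Longrightarrow> x \<noteq> [] \<Longrightarrow>
     (let y = reduce p r \<kappa> x; b = C * ((2 ^ wlen (pdim \<kappa> x)) ^ D * length x ^ d') in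
       set y \<subseteq> syms \<longrightarrow> y \<noteq> [] \<longrightarrow> length y \<le> b \<and>
       (\<exists>ts'. ts' 0 = input_tape y \<and> ex c (\<lambda>i. if i = 0 then input_tape x else input_tape []) b ts'))"
    using D[of k] unfolding \<kappa>_def[symmetric] Let_def by blast
  \<comment> \<open>The summands account for the reduction, the step that starts the program, and
    the algorithm. \<open>f K\<close> is a constant at this point, since \<open>K\<close> does not
    depend on the formula.\<close>
  define C' where "C' = C + 1 + f K * C ^ d"
  let ?M = "prog_then c N M"
  show ?thesis unfolding three_sat_solvable_def
  proof (intro exI conjI allI impI)
    show "wf_tm ?M" by (rule wf_prog_then[OF M N])
    fix \<phi> assume \<phi>: "is_3cnf \<phi>"
    define x where "x = enc_cnf \<phi>"
    define y where "y = reduce p r \<kappa> x"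
    define L where "L = length x"
    define \<mu> where "\<mu> = (2::nat) ^ wlen (pdim \<kappa> x)"
    define U where "U = \<mu> ^ D * L ^ d'"
    define T where "T = real C' * 2 ^ (7 * E) * 2 powr (\<delta> * real (card (vars \<phi>))) * real L ^ (d' * (d + 1))"
    have x: "set x \<subseteq> syms" "x \<noteq> []" unfolding x_def enc_cnf_def using enc_symbols by (blast, simp)
    obtain I where I: "is_split_instance p I" "split_code I K y"
      "satisfiable \<phi> \<Longrightarrow> split_yes I (real K)" "\<not> satisfiable \<phi> \<Longrightarrow> \<not> split_yes I ((real p - \<epsilon>) * real K)"
      using reduce_correct[OF \<phi> k(1) p, of r] r unfolding K_def y_def x_def \<kappa>_def by blast
    have y: "set y \<subseteq> syms" "y \<noteq> []" using split_code_symbols[OF I(2)] by auto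
    obtain ts' where ly: "length y \<le> C * U" and ts': "ts' 0 = input_tape y"
      "ex c (\<lambda>i. if i = 0 then input_tape x else input_tape []) (C * U) ts'"
      using prog[OF x] y unfolding Let_def y_def[symmetric] \<mu>_def[symmetric] L_def[symmetric] U_def[symmetric] by blast
    define T0 where "T0 = real (f K) * real (length y) ^ d"
    have U: "U \<ge> 1"
    proof -
      have "L \<ge> 1" using x(2) by (cases x) (auto simp: L_def)
      then have "1 * 1 \<le> U" unfolding U_def by (intro mult_le_mono one_le_power) (simp_all add: \<mu>_def)
      then show ?thesis by simp
    qed
    have "f K * length y ^ d \<le> f K * C ^ d * U ^ d"
      using power_mono[OF ly, of d] by (simp add: power_mult_distrib mult.assoc)
    also have "\<dots> \<le> f K * C ^ d * U ^ (d + 1)" using U by (intro mult_le_mono2 power_increasing) auto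
    finally have t1: "f K * length y ^ d \<le> f K * C ^ d * U ^ (d + 1)" .
    have u: "U \<le> U ^ (d + 1)" "1 \<le> U ^ (d + 1)" using U self_le_power[of U "d + 1"] by simp_all
    have t2: "C * U \<le> C * U ^ (d + 1)" using u(1) by simp
    have "f K * length y ^ d + C * U + 1 \<le> C' * U ^ (d + 1)"
      using t1 t2 u unfolding C'_def distrib_right mult_1_left by linarith
    then have "real (f K * length y ^ d + C * U + 1) \<le> real (C' * U ^ (d + 1))" by (rule of_nat_mono)
    then have t3: "T0 + real (C * U) + 1 \<le> real C' * real (U ^ (d + 1))" by (simp add: T0_def)
    have Ue: "U ^ (d + 1) = \<mu> ^ E * L ^ (d' * (d + 1))"
      unfolding U_def E_def power_mult_distrib power_mult[symmetric] ..
    have "real (\<mu> ^ E) \<le> 2 ^ (7 * E) * 2 powr (\<delta> * real (card (vars \<phi>)))"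
      unfolding \<mu>_def by (rule exponential_bound[OF k]) (unfold \<kappa>_def x_def, rule pdim_bound[OF k(1)])
    then have "real C' * (real (\<mu> ^ E) * real L ^ (d' * (d + 1))) \<le>
        real C' * (2 ^ (7 * E) * 2 powr (\<delta> * real (card (vars \<phi>))) * real L ^ (d' * (d + 1)))"
      by (intro mult_left_mono mult_right_mono) simp_all
    then have "real C' * real (U ^ (d + 1)) \<le> T" unfolding Ue T_def by (simp add: mult.assoc)
    with t3 have TT: "T0 + real (C * U) + 1 \<le> T" by linarith
    have y5: "\<forall>a \<in> set y. a < 5" using y(1) by auto
    note run = prog_then_accepts[OF M N ts'(2,1) y5 TT]
    have acc: "satisfiable \<phi> \<Longrightarrow> accepts_within M y T0" "\<not> satisfiable \<phi> \<Longrightarrow> rejects_within M y T0"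
      using correct[OF I(1,2)] I(3,4) unfolding Let_def T0_def by blast+
    show "let T = real C' * 2 ^ (7 * E) * 2 powr (\<delta> * real (card (vars \<phi>))) * real (length (enc_cnf \<phi>)) ^ (d' * (d + 1)) in
        (satisfiable \<phi> \<longrightarrow> accepts_within ?M (enc_cnf \<phi>) T) \<and> (\<not> satisfiable \<phi> \<longrightarrow> rejects_within ?M (enc_cnf \<phi>) T)"
      unfolding Let_def x_def[symmetric] L_def[symmetric] T_def[symmetric] using acc run by blast
  qed
qed

theorem theorem5:
  fixes p :: nat
  assumes "p \<ge> 2"
    and "ETH"
  shows "\<forall>\<epsilon>::real. \<epsilon> > 0 \<longrightarrow> \<not> split_min_cut_fpt_approximable p (real p - \<epsilon>)"
  using assms three_sat_from_approximation unfolding ETH_def by blast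

end
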